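(* Let $f$ be a checkerboard IS-net. Then the following properties hold: (i) All net-cubes of the IS-net are circumscribed. (ii) The net-cubes $\boxdot^c_{i,j,k}$ and $\boxdot^{c+4s+2}_{i-2s-1,\,j-2s-1,\,k-2s-1}$ are perspective. (iii) For sufficiently large IS-nets (all sides of the cuboid are at least of length $4$) all net-cubes are projective images of the standard cube. (They are called projective cubes.) (iv) The lines $\ell_{j,k}$, where $j+k=\mathrm{const}$, lie on a one-sheeted hyperboloid. The same holds for the lines $\ell_{j,k}$ with $j-k=\mathrm{const}$, and for the corresponding lines $m_{i,k}$ and $n_{i,j}$. (v) Let $o_{i,j,k}$ be the centers of the spheres inscribed in $\boxdot_{i,j,k}$. The points $o_{i,j,k}$ with all $i,j,k$ even build a grid projectively equivalent to an orthogonal grid (which is built by the intersection points of planes parallel to the coordinate planes). The same claim holds for the points $o_{i,j,k}$ with all $i,j,k$ odd.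
   Context: Let $\mathbb{P}\subset\mathbb{Z}^3$ be a cuboid of full dimension; for $f:\mathbb{P}\to\mathbb{R}^3$ write $f_{i,j,k}=f(i,j,k)$. All properties are understood for indices for which the objects involved are defined. Let $\boxdot^c_{i,j,k}$ denote the cube with the vertices $f_{i,j,k}$, $f_{i+c,j,k}$, $f_{i,j+c,k}$, $f_{i,j,k+c}$, $f_{i+c,j+c,k}$, $f_{i,j+c,k+c}$, $f_{i+c,j,k+c}$, $f_{i+c,j+c,k+c}$. It is called a net-cube if $i,j,k$ are all even or all odd and $c$ is odd. Unit net-cubes are the net-cubes $\boxdot_{i,j,k}=\boxdot^1_{i,j,k}$ of unit size. A cubical polytope is a polyhedron with quadrilateral faces combinatorially equivalent to the three-dimensional cube; it is circumscribed if it possesses an inscribed sphere (touching all its faces). A checkerboard IS-net (inscribed spherical net) is a map $f:\mathbb{P}\to\mathbb{R}^3$ such that: (1) for any integers $i,j$ the points $\{f_{i,j,k}\}_k$ lie on a straight line preserving the order, i.e. $f_{i,j,k}$ lies between $f_{i,j,k-1}$ and $f_{i,j,k+1}$; the same holds for the points $\{f_{i,j,k}\}_i$ and $\{f_{i,j,k}\}_j$; (2) the unit net-cubes $\boxdot_{i,j,k}$ are circumscribed cubical polytopes. The line of the net containing the vertices $\{f_{i,j,k}\mid \forall i\}$ is denoted $\ell_{j,k}$; similarly $m_{i,k}\supset\{f_{i,j,k}\mid\forall j\}$ and $n_{i,j}\supset\{f_{i,j,k}\mid\forall k\}$. Two net-cubes are perspective if the lines joining their corresponding vertices pass through one common point.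 In (ii) $s$ is an integer.
   Formalization: (iv) is claimed only for j+k odd and j-k even; the quadric may degenerate unless lines of equal parity are skew and no three are parallel to one plane. (iv) and (v) need all sides at least 4, as in (iii); so does (ii) when c+4s+2=-c (one cube relabelled). *)

theory Defs
  imports "HOL-Analysis.Analysis"
begin

text \<open>
  A lattice map on the cuboid \<open>I \<times> J \<times> K\<close> is a total function \<open>f i j k\<close> of which only the values at
  \<open>i \<in> I\<close>, \<open>j \<in> J\<close>, \<open>k \<in> K\<close> are ever used.
\<close>
type_synonym lattice_map = "int \<Rightarrow> int \<Rightarrow> int \<Rightarrow> real^3"

text \<open>
  A labelled eight-tuple of points: \<open>V a b d\<close> is the point put at the corner
  \<open>(of_bool a, of_bool b, of_bool d)\<close> of the standard cube \<open>[0,1]\<^sup>3\<close>.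
\<close>
type_synonym cube_points = "bool \<Rightarrow> bool \<Rightarrow> bool \<Rightarrow> real^3"

definition std_corner :: cube_points where
  "std_corner a b d = vector [of_bool a, of_bool b, of_bool d]"

definition cube_hull :: "cube_points \<Rightarrow> (real^3) set" where
  "cube_hull V = convex hull {V a b d | a b d. True}"


subsection \<open>Circumscribed cubical polytopes\<close>

text \<open>
  Combinatorial equivalence with the cube is an isomorphism of face lattices. It has to respect the
  labels, so that the edges and faces of the polytope are the ones prescribed by the lattice.
\<close>
definition cubical_polytope :: "cube_points \<Rightarrow> bool" where
  "cubical_polytope V \<longleftrightarrow>
     (\<exists>\<phi>. bij_betw \<phi> {F. F face_of (cbox 0 1 :: (real^3) set)} {F. F face_of cube_hull V} \<and>
          (\<forall>F G. F face_of (cbox 0 1 :: (real^3) set) \<longrightarrow> G face_of (cbox 0 1 :: (real^3) set) \<longrightarrow>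
             (F \<subseteq> G \<longleftrightarrow> \<phi> F \<subseteq> \<phi> G)) \<and>
          (\<forall>a b d. \<phi> {std_corner a b d} = {V a b d}))"

definition inscribed_sphere :: "(real^3) set \<Rightarrow> real^3 \<Rightarrow> real \<Rightarrow> bool" where
  "inscribed_sphere P z r \<longleftrightarrow>
     r > 0 \<and> cball z r \<subseteq> P \<and> (\<forall>F. F facet_of P \<longrightarrow> sphere z r \<inter> F \<noteq> {})"

definition circumscribed :: "cube_points \<Rightarrow> bool" where
  "circumscribed V \<longleftrightarrow> cubical_polytope V \<and> (\<exists>z r. inscribed_sphere (cube_hull V) z r)"


subsection \<open>Net-cubes and checkerboard IS-nets\<close>

definition net_cube :: "lattice_map \<Rightarrow> int \<Rightarrow> int \<Rightarrow> int \<Rightarrow> int \<Rightarrow> cube_points" where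
  "net_cube f c i j k =
     (\<lambda>a b d. f (i + c * of_bool a) (j + c * of_bool b) (k + c * of_bool d))"

text \<open>
  The size \<open>c\<close> may be negative; this is the same cube with its corners labelled from the opposite
  end.
\<close>
definition is_net_cube :: "int set \<Rightarrow> int set \<Rightarrow> int set \<Rightarrow> int \<Rightarrow> int \<Rightarrow> int \<Rightarrow> int \<Rightarrow> bool" where
  "is_net_cube I J K c i j k \<longleftrightarrow>
     odd c \<and> ((even i \<and> even j \<and> even k) \<or> (odd i \<and> odd j \<and> odd k)) \<and>
     {i, i + c} \<subseteq> I \<and> {j, j + c} \<subseteq> J \<and> {k, k + c} \<subseteq> K"

definition on_line_in_order :: "int set \<Rightarrow> (int \<Rightarrow> real^3) \<Rightarrow> bool" where
  "on_line_in_order K g \<longleftrightarrow>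
     collinear (g ` K) \<and>
     (\<forall>k. k - 1 \<in> K \<and> k \<in> K \<and> k + 1 \<in> K \<longrightarrow> g k \<in> open_segment (g (k - 1)) (g (k + 1)))"

definition checkerboard_IS_net :: "int set \<Rightarrow> int set \<Rightarrow> int set \<Rightarrow> lattice_map \<Rightarrow> bool" where
  "checkerboard_IS_net I J K f \<longleftrightarrow>
     (\<forall>i\<in>I. \<forall>j\<in>J. on_line_in_order K (\<lambda>k. f i j k)) \<and>
     (\<forall>j\<in>J. \<forall>k\<in>K. on_line_in_order I (\<lambda>i. f i j k)) \<and>
     (\<forall>i\<in>I. \<forall>k\<in>K. on_line_in_order J (\<lambda>j. f i j k)) \<and>
     (\<forall>i j k. is_net_cube I J K 1 i j k \<longrightarrow> circumscribed (net_cube f 1 i j k))"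

definition line_l :: "int set \<Rightarrow> lattice_map \<Rightarrow> int \<Rightarrow> int \<Rightarrow> (real^3) set" where
  "line_l I f j k = affine hull ((\<lambda>i. f i j k) ` I)"

definition line_m :: "int set \<Rightarrow> lattice_map \<Rightarrow> int \<Rightarrow> int \<Rightarrow> (real^3) set" where
  "line_m J f i k = affine hull ((\<lambda>j. f i j k) ` J)"

definition line_n :: "int set \<Rightarrow> lattice_map \<Rightarrow> int \<Rightarrow> int \<Rightarrow> (real^3) set" where
  "line_n K f i j = affine hull ((\<lambda>k. f i j k) ` K)"

definition perspective :: "cube_points \<Rightarrow> cube_points \<Rightarrow> bool" where
  "perspective V W \<longleftrightarrow>
     (\<exists>z. \<forall>a b d. V a b d \<noteq> W a b d \<and> z \<in> affine hull {V a b d, W a b d})"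


subsection \<open>Projective transformations\<close>

text \<open>
  A projective transformation of three-space is a linear automorphism \<open>T\<close> of the homogeneous
  coordinates \<open>(x, w)\<close>, the pair \<open>(x, 1)\<close> standing for the point \<open>x\<close>. The image of \<open>x\<close> is finite iff
  \<open>snd (T (x, 1)) \<noteq> 0\<close>.
\<close>
definition proj_finite_at :: "((real^3) \<times> real \<Rightarrow> (real^3) \<times> real) \<Rightarrow> real^3 \<Rightarrow> bool" where
  "proj_finite_at T x \<longleftrightarrow> snd (T (x, 1)) \<noteq> 0"

definition proj_map :: "((real^3) \<times> real \<Rightarrow> (real^3) \<times> real) \<Rightarrow> real^3 \<Rightarrow> real^3" where
  "proj_map T x = (1 / snd (T (x, 1))) *\<^sub>R fst (T (x, 1))"

definition projective_cube :: "cube_points \<Rightarrow> bool" where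
  "projective_cube V \<longleftrightarrow>
     (\<exists>T. linear T \<and> bij T \<and>
          (\<forall>x \<in> cbox 0 1. proj_finite_at T x) \<and>
          proj_map T ` cbox 0 1 = cube_hull V \<and>
          (\<forall>a b d. proj_map T (std_corner a b d) = V a b d))"

definition proj_orthogonal_grid ::
  "int set \<Rightarrow> int set \<Rightarrow> int set \<Rightarrow> lattice_map \<Rightarrow> bool" where
  "proj_orthogonal_grid X Y Z p \<longleftrightarrow>
     (\<exists>T x y z. linear T \<and> bij T \<and> inj_on x X \<and> inj_on y Y \<and> inj_on z Z \<and>
        (\<forall>i\<in>X. \<forall>j\<in>Y. \<forall>k\<in>Z.
           proj_finite_at T (vector [x i, y j, z k]) \<and>
           p i j k = proj_map T (vector [x i, y j, z k])))"


subsection \<open>One-sheeted hyperboloids\<close>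

definition one_sheeted_hyperboloid :: "(real^3) set \<Rightarrow> bool" where
  "one_sheeted_hyperboloid H \<longleftrightarrow>
     (\<exists>(A :: real^3^3) c. invertible A \<and>
        H = (\<lambda>x. A *v x + c) ` {x. (x$1)\<^sup>2 + (x$2)\<^sup>2 - (x$3)\<^sup>2 = 1})"

text \<open>
  The quadratic polynomials \<open>\<alpha>\<^sup>2 + \<beta>\<^sup>2 - \<gamma>\<^sup>2 - \<delta>\<^sup>2\<close> with affine \<open>\<alpha>, \<beta>, \<gamma>, \<delta>\<close>
  are the limits of the equations of one-sheeted hyperboloids (at most two positive and at most two
  negative squares in homogeneous coordinates). Besides the one-sheeted hyperboloids they describe
  their degenerations: hyperbolic paraboloids, cones, cylinders, pairs of planes and so on. The
  regular grid is an IS-net for which only such a degeneration (a plane) carries the lines.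
\<close>
definition possibly_degenerate_hyperboloid :: "(real^3) set \<Rightarrow> bool" where
  "possibly_degenerate_hyperboloid H \<longleftrightarrow>
     (\<exists>(u1 :: real^3) u2 u3 u4 s1 s2 s3 s4.
        let q = (\<lambda>x. (u1 \<bullet> x + s1)\<^sup>2 + (u2 \<bullet> x + s2)\<^sup>2 - (u3 \<bullet> x + s3)\<^sup>2 - (u4 \<bullet> x + s4)\<^sup>2)
        in (\<exists>x. q x \<noteq> 0) \<and> H = {x. q x = 0})"

definition parallel_to_common_plane :: "(real^3) set set \<Rightarrow> bool" where
  "parallel_to_common_plane \<L> \<longleftrightarrow>
     (\<exists>w. w \<noteq> 0 \<and> (\<forall>L\<in>\<L>. \<forall>x\<in>L. \<forall>y\<in>L. w \<bullet> (x - y) = 0))"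

text \<open>
  Consecutive lines of a diagonal family \<open>L j\<close>, \<open>j \<in> S\<close>, belong to opposite rulings, so lines with
  indices of the same parity are those of one ruling of the hyperboloid. General position demands
  of them what holds in one ruling of every one-sheeted hyperboloid.
\<close>
definition rulings_in_general_position :: "int set \<Rightarrow> (int \<Rightarrow> (real^3) set) \<Rightarrow> bool" where
  "rulings_in_general_position S L \<longleftrightarrow>
     (\<forall>j\<in>S. \<forall>j'\<in>S. j \<noteq> j' \<and> even (j - j') \<longrightarrow> \<not> coplanar (L j \<union> L j')) \<and>
     (\<forall>j\<in>S. \<forall>j'\<in>S. \<forall>j''\<in>S.
        j \<noteq> j' \<and> j \<noteq> j'' \<and> j' \<noteq> j'' \<and> even (j - j') \<and> even (j - j'') \<longrightarrow>
        \<not> parallel_to_common_plane {L j, L j', L j''})"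

definition lie_on_hyperboloid :: "int set \<Rightarrow> (int \<Rightarrow> (real^3) set) \<Rightarrow> bool" where
  "lie_on_hyperboloid S L \<longleftrightarrow>
     (\<exists>H. possibly_degenerate_hyperboloid H \<and>
          (rulings_in_general_position S L \<longrightarrow> one_sheeted_hyperboloid H) \<and>
          (\<forall>j\<in>S. L j \<subseteq> H))"

text \<open>
  The families \<open>j + k = s\<close> and \<open>j - k = t\<close> of a two-parameter family of lines \<open>L j k\<close>. The parities
  select the diagonals of the circumscribed quadrilaterals of the checkerboard: \<open>s\<close> odd, \<open>t\<close> even.
  The lines of the complementary families lie on no common quadric in general.
\<close>
definition diagonals_on_hyperboloids ::
  "int set \<Rightarrow> int set \<Rightarrow> (int \<Rightarrow> int \<Rightarrow> (real^3) set) \<Rightarrow> bool" where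
  "diagonals_on_hyperboloids J K L \<longleftrightarrow>
     (\<forall>s. odd s \<longrightarrow> lie_on_hyperboloid {j \<in> J. s - j \<in> K} (\<lambda>j. L j (s - j))) \<and>
     (\<forall>t. even t \<longrightarrow> lie_on_hyperboloid {j \<in> J. j - t \<in> K} (\<lambda>j. L j (j - t)))"

end

theory Submission
  imports Defs
begin

text \<open>
  The idea is to work in Laguerre geometry, where an oriented plane is a null vector of a Lorentz form on
  \<open>\<real>\<^sup>3 \<times> \<real> \<times> \<real>\<close> and contact with an oriented sphere is a linear condition. The points with a fixed first
  index lie on a plane \<open>p i\<close>, similarly \<open>q j\<close> and \<open>r k\<close>, and the inscribed spheres orient these planes
  consistently. Four planes touching the same two spheres are linearly dependent, so the opposite faces of
  all cells of one parity span pencils with a common vector \<open>v\<close>, a positive combination of \<open>p i, p (i + 1)\<close>, of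
  \<open>q j, q (j + 1)\<close> and of \<open>r k, r (k + 1)\<close>.

  The Lorentz reflection in such a vector exchanges opposite planes. Seen on the planes tangent to a fixed
  sphere it is a projective map of space that fixes the lines through a point; it carries a circumscribed
  net-cube to the next concentric one, which gives (i) and (ii). Reflecting \<open>v\<close> yields common vectors
  for planes at any odd distance; the plane of this vector, sent to infinity, makes the net-cube a parallelepiped,
  which is (iii). Modulo \<open>v\<close> the planes of one direction form a two-dimensional family, and the
  corresponding homogeneous coordinates of the centres give (v). Consecutive lines of a diagonal family are
  interchanged by the two reflections belonging to the even and the odd cells; a quadratic form invariant under both
  reflections vanishes on all of them, which is (iv).
\<close>

subsection \<open>Projective maps and cubical polytopes\<close>

text \<open>A Lorentz reflection acts on five coordinates, while a plane of space has four. For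
  planes touching a fixed sphere of nonzero signed radius the radius coordinate is a linear function
  of the other four. On these planes the reflection is therefore linear in four coordinates and
  dualizes to a map of points, which differs from the identity by a rank-one term; the image of that
  term is the centre fixed by the map.

  The obstacle is the consistent orientation. A cell knows its own outward normals only; that the
  cells on one side of a level agree must be drawn from the order of the points on the lines. At an
  outermost level there are no cells on the far side to compare with, and a crossing argument takes
  their place.

  Side length 4 is what guarantees, for both parities, two cells displaced in all three directions.
  With side length 3 one parity may have a single cell in some direction. This is why the pairing of
  a cube with its own opposite labelling in (ii) is claimed for large nets, while the other pairs in
  small nets are so close that two adjacent cells provide their common vector.\<close>

lemma proj_map_eqI:
  assumes "T (x, 1) = t *\<^sub>R (y, 1)" "t \<noteq> 0"
  shows "proj_map T x = y"
  using assms by (simp add: proj_map_def)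

lemma homog_proj_map:
  assumes "snd (T (x, 1)) \<noteq> 0"
  shows "T (x, 1) = snd (T (x, 1)) *\<^sub>R (proj_map T x, 1)"
  using assms by (simp add: proj_map_def prod_eq_iff)

lemma linear_homog_comb:
  fixes T :: "'a::real_vector \<times> real \<Rightarrow> 'b::real_vector"
  assumes "linear T" "u + v = 1"
  shows "T (u *\<^sub>R x + v *\<^sub>R y, 1) = u *\<^sub>R T (x, 1) + v *\<^sub>R T (y, 1)"
proof -
  have "(u *\<^sub>R x + v *\<^sub>R y, 1) = u *\<^sub>R (x, 1) + v *\<^sub>R (y, 1::real)"
    using assms(2) by simp
  then show ?thesis
    by (simp only: linear_add[OF assms(1)] linear_cmul[OF assms(1)])
qed

text \<open>Positive denominators change the weights of a convex combination but not their signs.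
  Preservation of segments, hulls and faces rests on this.\<close>

lemma proj_map_comb:
  assumes T: "linear T" and x: "snd (T (x, 1)) > 0" and y: "snd (T (y, 1)) > 0"
    and u: "0 \<le> u" "0 \<le> v" "u + v = 1"
  defines "d \<equiv> u * snd (T (x, 1)) + v * snd (T (y, 1))"
  shows "d > 0" "snd (T (u *\<^sub>R x + v *\<^sub>R y, 1)) = d"
    "proj_map T (u *\<^sub>R x + v *\<^sub>R y)
      = (u * snd (T (x, 1)) / d) *\<^sub>R proj_map T x + (v * snd (T (y, 1)) / d) *\<^sub>R proj_map T y"
proof -
  show d: "d > 0"
  proof (cases "u = 0")
    case True
    then show ?thesis using u y by (simp add: d_def)
  next
    case False
    then have "u * snd (T (x, 1)) > 0" using u x by simp
    moreover have "v * snd (T (y, 1)) \<ge> 0" using u y by simp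
    ultimately show ?thesis by (simp add: d_def)
  qed
  note c = linear_homog_comb[OF T u(3), of x y]
  show sd: "snd (T (u *\<^sub>R x + v *\<^sub>R y, 1)) = d"
    by (simp add: c d_def)
  have "fst (T (x,1)) = snd (T (x,1)) *\<^sub>R proj_map T x" "fst (T (y,1)) = snd (T (y,1)) *\<^sub>R proj_map T y"
    using x y by (simp_all add: proj_map_def)
  then have "fst (T (u *\<^sub>R x + v *\<^sub>R y, 1))
     = (u * snd (T (x, 1))) *\<^sub>R proj_map T x + (v * snd (T (y, 1))) *\<^sub>R proj_map T y"
    by (simp add: c)
  then show "proj_map T (u *\<^sub>R x + v *\<^sub>R y)
      = (u * snd (T (x, 1)) / d) *\<^sub>R proj_map T x + (v * snd (T (y, 1)) / d) *\<^sub>R proj_map T y"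
    by (simp add: proj_map_def[of T "u *\<^sub>R x + v *\<^sub>R y"] sd scaleR_add_right)
qed

lemma inj_on_proj_map:
  assumes "linear T" "inj T"
  shows "inj_on (proj_map T) {x. snd (T (x, 1)) > 0}"
proof (rule inj_onI)
  fix x y assume a: "x \<in> {x. snd (T (x, 1)) > 0}" "y \<in> {x. snd (T (x, 1)) > 0}"
    and e: "proj_map T x = proj_map T y"
  define a where "a = snd (T (x, 1))"
  define b where "b = snd (T (y, 1))"
  have p: "a > 0" "b > 0" using \<open>x \<in> _\<close> \<open>y \<in> _\<close> by (auto simp: a_def b_def)
  have "T (x, 1) = a *\<^sub>R (proj_map T x, 1)" "T (y, 1) = b *\<^sub>R (proj_map T x, 1)"
    using homog_proj_map[of T x] homog_proj_map[of T y] p e by (simp_all add: a_def b_def)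
  then have "b *\<^sub>R T (x, 1) = a *\<^sub>R T (y, 1)" by simp
  then have "T (b *\<^sub>R (x, 1)) = T (a *\<^sub>R (y, 1))"
    by (simp only: linear_cmul[OF assms(1)])
  then have e: "b *\<^sub>R (x, 1::real) = a *\<^sub>R (y, 1)" by (rule injD[OF assms(2)])
  have "b = a" "b *\<^sub>R x = a *\<^sub>R y" using arg_cong[OF e, of snd] arg_cong[OF e, of fst] by simp_all
  then show "x = y" using p by (metis less_irrefl scaleR_cancel_left)
qed

lemma proj_map_open_segment:
  assumes T: "linear T" "inj T" and x: "snd (T (x, 1)) > 0" and y: "snd (T (y, 1)) > 0"
  shows "proj_map T ` open_segment x y = open_segment (proj_map T x) (proj_map T y)"
proof -
  define a where "a = snd (T (x, 1))"
  define b where "b = snd (T (y, 1))"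
  have p: "a > 0" "b > 0" using x y by (auto simp: a_def b_def)
  have ne: "proj_map T x = proj_map T y \<longleftrightarrow> x = y"
    using inj_on_proj_map[OF T] x y by (auto dest: inj_onD)
  have step: "proj_map T ((1 - u) *\<^sub>R x + u *\<^sub>R y)
      = (1 - u * b / ((1 - u) * a + u * b)) *\<^sub>R proj_map T x + (u * b / ((1 - u) * a + u * b)) *\<^sub>R proj_map T y"
    if "0 < u" "u < 1" for u
  proof -
    have d: "(1 - u) * a + u * b > 0" using that p by (simp add: add_pos_pos)
    have "1 - u * b / ((1 - u) * a + u * b) = (1 - u) * a / ((1 - u) * a + u * b)"
      using d by (simp add: field_simps)
    then show ?thesis
      using proj_map_comb(3)[OF T(1) x y, of "1 - u" u] that by (simp add: a_def b_def)
  qed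
  show ?thesis
  proof (intro subset_antisym subsetI)
    fix w assume "w \<in> proj_map T ` open_segment x y"
    then obtain u where u: "x \<noteq> y" "0 < u" "u < 1" "w = proj_map T ((1 - u) *\<^sub>R x + u *\<^sub>R y)"
      by (auto simp: in_segment)
    have d: "(1 - u) * a + u * b > 0" "(1 - u) * a > 0" "u * b > 0"
      using u p by (simp_all add: add_pos_pos)
    then have "0 < u * b / ((1 - u) * a + u * b)" "u * b / ((1 - u) * a + u * b) < 1"
      by simp_all
    then show "w \<in> open_segment (proj_map T x) (proj_map T y)"
      using u step[OF u(2,3)] ne by (auto simp: in_segment)
  next
    fix w assume "w \<in> open_segment (proj_map T x) (proj_map T y)"
    then obtain t where t: "proj_map T x \<noteq> proj_map T y" "0 < t" "t < 1"
      "w = (1 - t) *\<^sub>R proj_map T x + t *\<^sub>R proj_map T y"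
      by (auto simp: in_segment)
    define D where "D = (1 - t) * b + t * a"
    have D: "D > 0" "(1 - t) * b > 0" "t * a > 0" using t p by (simp_all add: D_def add_pos_pos)
    \<comment> \<open>Inverse of the reparametrization
      \<open>u \<mapsto> u * b / ((1 - u) * a + u * b)\<close> found in \<open>step\<close>.\<close>
    define u where "u = t * a / D"
    have u: "0 < u" "u < 1" using D by (simp_all add: u_def D_def)
    have "1 - u = (1 - t) * b / D" using D by (simp add: u_def D_def field_simps)
    then have "(1 - u) * a + u * b = ((1 - t) * b * a + t * a * b) / D"
      by (simp add: u_def add_divide_distrib)
    also have "(1 - t) * b * a + t * a * b = a * b" by algebra
    finally have e: "(1 - u) * a + u * b = a * b / D" .
    have "u * b / ((1 - u) * a + u * b) = t"
      unfolding e using p D by (simp add: u_def)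
    then have "w = proj_map T ((1 - u) *\<^sub>R x + u *\<^sub>R y)" using step[OF u] t(4) by simp
    then show "w \<in> proj_map T ` open_segment x y"
      using u t(1) ne by (intro image_eqI[of _ _ "(1 - u) *\<^sub>R x + u *\<^sub>R y"]) (auto simp: in_segment)
  qed
qed

lemma convex_snd_homog_pos:
  fixes T :: "(real^3) \<times> real \<Rightarrow> (real^3) \<times> real"
  assumes "linear T"
  shows "convex {x. snd (T (x, 1)) > 0}"
  unfolding convex_def using proj_map_comb(1,2)[where T=T] assms by auto

lemma convex_proj_map_image:
  assumes T: "linear T" "inj T" and S: "convex S" "S \<subseteq> {x. snd (T (x, 1)) > 0}"
  shows "convex (proj_map T ` S)"
  unfolding convex_contains_open_segment
proof (intro ballI)
  fix p q assume "p \<in> proj_map T ` S" "q \<in> proj_map T ` S"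
  then obtain x y where xy: "x \<in> S" "y \<in> S" "p = proj_map T x" "q = proj_map T y" by auto
  have "open_segment p q = proj_map T ` open_segment x y"
    using proj_map_open_segment[OF T, of x y] xy S by auto
  also have "\<dots> \<subseteq> proj_map T ` S"
    using S(1) xy(1,2) by (intro image_mono) (simp add: convex_contains_open_segment)
  finally show "open_segment p q \<subseteq> proj_map T ` S" .
qed

lemma snd_homog_pos_hull:
  fixes T :: "(real^3) \<times> real \<Rightarrow> (real^3) \<times> real"
  assumes "linear T" "\<And>x. x \<in> A \<Longrightarrow> snd (T (x, 1)) > 0"
  shows "convex hull A \<subseteq> {x. snd (T (x, 1)) > 0}"
  using assms convex_snd_homog_pos by (intro hull_minimal) auto

text \<open>The points whose images lie in the hull of the images form a convex set containing
  \<open>A\<close>; the other inclusion is convexity of the image.\<close>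

lemma proj_map_convex_hull:
  assumes T: "linear T" "inj T" and A: "\<And>x. x \<in> A \<Longrightarrow> snd (T (x, 1)) > 0"
  shows "proj_map T ` (convex hull A) = convex hull (proj_map T ` A)"
proof
  note pos = snd_homog_pos_hull[OF T(1) A]
  define B where "B = {x. snd (T (x, 1)) > 0 \<and> proj_map T x \<in> convex hull (proj_map T ` A)}"
  have "convex B"
    unfolding convex_contains_open_segment
  proof (intro ballI subsetI)
    fix x y w assume xy: "x \<in> B" "y \<in> B" and w: "w \<in> open_segment x y"
    have "open_segment x y \<subseteq> {x. snd (T (x, 1)) > 0}"
      using convex_snd_homog_pos[OF T(1)] xy by (simp add: convex_contains_open_segment B_def)
    moreover have "proj_map T w \<in> open_segment (proj_map T x) (proj_map T y)"
      using proj_map_open_segment[OF T, of x y] xy w by (auto simp: B_def)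
    moreover have "open_segment (proj_map T x) (proj_map T y) \<subseteq> convex hull (proj_map T ` A)"
      using convex_convex_hull[of "proj_map T ` A"] xy by (simp only: convex_contains_open_segment B_def) blast
    ultimately show "w \<in> B" using w by (auto simp: B_def)
  qed
  moreover have "A \<subseteq> B" using A by (auto simp: B_def hull_inc)
  ultimately have "convex hull A \<subseteq> B" by (simp add: hull_minimal)
  then show "proj_map T ` (convex hull A) \<subseteq> convex hull (proj_map T ` A)" by (auto simp: B_def)
  show "convex hull (proj_map T ` A) \<subseteq> proj_map T ` (convex hull A)"
    by (intro hull_minimal image_mono hull_subset convex_proj_map_image[OF T] convex_convex_hull pos) auto
qed

text \<open>Faces are defined through open segments, and the map carries open segments onto open
  segments in both directions.\<close>

lemma proj_map_face_of:
  assumes T: "linear T" "inj T" and S: "convex S" "S \<subseteq> {x. snd (T (x, 1)) > 0}" and F: "F \<subseteq> S"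
  shows "proj_map T ` F face_of proj_map T ` S \<longleftrightarrow> F face_of S"
proof -
  note inj = inj_on_subset[OF inj_on_proj_map[OF T] S(2)]
  have seg: "proj_map T ` open_segment x y = open_segment (proj_map T x) (proj_map T y)"
    if "x \<in> S" "y \<in> S" for x y using proj_map_open_segment[OF T] S that by auto
  have segS: "open_segment x y \<subseteq> S" if "x \<in> S" "y \<in> S" for x y
    using S(1) that by (simp add: convex_contains_open_segment)
  have mem: "proj_map T x \<in> proj_map T ` A \<longleftrightarrow> x \<in> A" if "x \<in> S" "A \<subseteq> S" for x A
    using inj that by (meson inj_on_image_mem_iff)
  show ?thesis
  proof
    assume L: "proj_map T ` F face_of proj_map T ` S"
    show "F face_of S" unfolding face_of_def
    proof (intro conjI ballI impI)
      show "F \<subseteq> S" by fact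
      show "convex F" unfolding convex_contains_open_segment
      proof (intro ballI subsetI)
        fix x y w assume xy: "x \<in> F" "y \<in> F" and w: "w \<in> open_segment x y"
        then have "proj_map T w \<in> open_segment (proj_map T x) (proj_map T y)"
          using seg F by blast
        moreover have "convex (proj_map T ` F)" using L by (rule face_of_imp_convex)
        ultimately have "proj_map T w \<in> proj_map T ` F"
          using xy by (meson convex_contains_open_segment imageI subsetD)
        then show "w \<in> F" using mem segS xy w F by blast
      qed
      fix a b x assume "a \<in> S" "b \<in> S" "x \<in> F" "x \<in> open_segment a b"
      then have "proj_map T x \<in> open_segment (proj_map T a) (proj_map T b)" using seg by blast
      then have "proj_map T a \<in> proj_map T ` F \<and> proj_map T b \<in> proj_map T ` F"
        using L \<open>a \<in> S\<close> \<open>b \<in> S\<close> \<open>x \<in> F\<close> unfolding face_of_def by blast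
      then show "a \<in> F" "b \<in> F" using mem F \<open>a \<in> S\<close> \<open>b \<in> S\<close> by blast+
    qed
  next
    assume R: "F face_of S"
    have FT: "F \<subseteq> {x. snd (T (x, 1)) > 0}" using F S by blast
    show "proj_map T ` F face_of proj_map T ` S" unfolding face_of_def
    proof (intro conjI ballI impI)
      show "proj_map T ` F \<subseteq> proj_map T ` S" using F by blast
      show "convex (proj_map T ` F)"
        using convex_proj_map_image[OF T _ FT] R face_of_imp_convex by blast
      fix a b x assume a: "a \<in> proj_map T ` S" "b \<in> proj_map T ` S" "x \<in> proj_map T ` F"
        "x \<in> open_segment a b"
      obtain a' b' where ab: "a' \<in> S" "b' \<in> S" "a = proj_map T a'" "b = proj_map T b'" using a by blast
      then obtain x' where x': "x' \<in> open_segment a' b'" "x = proj_map T x'"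
        using seg a(4) by blast
      then have "x' \<in> F" using mem[of x' F] segS ab a(3) F by blast
      then have "a' \<in> F \<and> b' \<in> F" using R ab x' unfolding face_of_def by blast
      then show "a \<in> proj_map T ` F" "b \<in> proj_map T ` F" using ab by blast+
    qed
  qed
qed

lemma cube_hull_proj_map:
  assumes T: "linear T" "inj T" and V: "\<And>a b d. snd (T (V a b d, 1)) > 0"
  shows "proj_map T ` cube_hull V = cube_hull (\<lambda>a b d. proj_map T (V a b d))"
proof -
  have "proj_map T ` {V a b d | a b d. True} = {proj_map T (V a b d) | a b d. True}" by auto
  moreover have "\<And>x. x \<in> {V a b d | a b d. True} \<Longrightarrow> snd (T (x, 1)) > 0" using V by auto
  ultimately show ?thesis using proj_map_convex_hull[OF T, of "{V a b d | a b d. True}"]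
    by (simp add: cube_hull_def)
qed

lemma cube_hull_homog_pos:
  fixes T :: "(real^3) \<times> real \<Rightarrow> (real^3) \<times> real"
  assumes T: "linear T" and V: "\<And>a b d. snd (T (V a b d, 1)) > 0"
  shows "cube_hull V \<subseteq> {x. snd (T (x, 1)) > 0}"
  unfolding cube_hull_def using V by (intro snd_homog_pos_hull[OF T]) auto

lemma proj_map_faces_bij:
  assumes T: "linear T" "inj T" and S: "convex S" "S \<subseteq> {x. snd (T (x, 1)) > 0}"
  shows "bij_betw ((`) (proj_map T)) {F. F face_of S} {F. F face_of proj_map T ` S}"
proof -
  note inj = inj_on_subset[OF inj_on_proj_map[OF T] S(2)]
  show ?thesis
  proof (rule bij_betw_imageI)
    show "inj_on ((`) (proj_map T)) {F. F face_of S}"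
      by (rule inj_onI) (metis inj inj_on_image_eq_iff face_of_imp_subset mem_Collect_eq)
    show "(`) (proj_map T) ` {F. F face_of S} = {F. F face_of proj_map T ` S}"
    proof (intro subset_antisym subsetI)
      fix G assume "G \<in> (`) (proj_map T) ` {F. F face_of S}"
      then show "G \<in> {F. F face_of proj_map T ` S}"
        using proj_map_face_of[OF T S] face_of_imp_subset by blast
    next
      fix G assume "G \<in> {F. F face_of proj_map T ` S}"
      then have G: "G face_of proj_map T ` S" by simp
      define F where "F = {x \<in> S. proj_map T x \<in> G}"
      have "G = proj_map T ` F" "F \<subseteq> S"
        using face_of_imp_subset[OF G] by (auto simp: F_def)
      then show "G \<in> (`) (proj_map T) ` {F. F face_of S}"
        using proj_map_face_of[OF T S \<open>F \<subseteq> S\<close>] G by blast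
    qed
  qed
qed

lemma cubical_polytope_proj_map:
  assumes T: "linear T" "inj T" and V: "\<And>a b d. snd (T (V a b d, 1)) > 0"
    and c: "cubical_polytope V"
  shows "cubical_polytope (\<lambda>a b d. proj_map T (V a b d))"
proof -
  let ?g = "proj_map T"
  let ?C = "{F. F face_of (cbox 0 1 :: (real^3) set)}"
  have S: "convex (cube_hull V)" by (simp add: cube_hull_def)
  note S' = cube_hull_homog_pos[OF T(1) V]
  note inj = inj_on_subset[OF inj_on_proj_map[OF T] S']
  obtain \<phi> where phi: "bij_betw \<phi> ?C {F. F face_of cube_hull V}"
    "\<And>F G. F \<in> ?C \<Longrightarrow> G \<in> ?C \<Longrightarrow> F \<subseteq> G \<longleftrightarrow> \<phi> F \<subseteq> \<phi> G"
    "\<And>a b d. \<phi> {std_corner a b d} = {V a b d}"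
    using c unfolding cubical_polytope_def by blast
  have sub: "\<phi> F \<subseteq> cube_hull V" if "F \<in> ?C" for F
    using bij_betwE[OF phi(1)] that face_of_imp_subset by blast
  have "bij_betw ((`) ?g \<circ> \<phi>) ?C {F. F face_of cube_hull (\<lambda>a b d. ?g (V a b d))}"
    using bij_betw_trans[OF phi(1) proj_map_faces_bij[OF T S S']] cube_hull_proj_map[where V=V, OF T V]
    by simp
  moreover have "\<forall>F G. F face_of (cbox 0 1 :: (real^3) set) \<longrightarrow> G face_of (cbox 0 1 :: (real^3) set)
      \<longrightarrow> (F \<subseteq> G \<longleftrightarrow> ((`) ?g \<circ> \<phi>) F \<subseteq> ((`) ?g \<circ> \<phi>) G)"
  proof (intro allI impI)
    fix F G assume "F face_of (cbox 0 1 :: (real^3) set)" "G face_of (cbox 0 1 :: (real^3) set)"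
    then have FG: "F \<in> ?C" "G \<in> ?C" by simp_all
    have "?g ` \<phi> F \<subseteq> ?g ` \<phi> G \<longleftrightarrow> \<phi> F \<subseteq> \<phi> G"
      by (rule inj_on_image_subset_iff[OF inj sub[OF FG(1)] sub[OF FG(2)]])
    then show "F \<subseteq> G \<longleftrightarrow> ((`) ?g \<circ> \<phi>) F \<subseteq> ((`) ?g \<circ> \<phi>) G"
      using phi(2)[OF FG] by simp
  qed
  moreover have "\<forall>a b d. ((`) ?g \<circ> \<phi>) {std_corner a b d} = {?g (V a b d)}" using phi(3) by simp
  ultimately show ?thesis
    unfolding cubical_polytope_def by blast
qed

section \<open>Facets as maximal proper faces\<close>

lemma facet_maximal:
  fixes S :: "'a::euclidean_space set"
  assumes S: "polytope S" and F: "F facet_of S" and G: "G face_of S" "F \<subseteq> G" "G \<noteq> S"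
  shows "G = F"
proof (rule ccontr)
  assume ne: "G \<noteq> F"
  have cG: "convex G" using G face_of_imp_convex by blast
  have "F face_of G" using F G face_of_subset face_of_imp_subset facet_of_imp_face_of by metis
  then have "aff_dim F < aff_dim G" using face_of_aff_dim_lt cG ne by metis
  moreover have "aff_dim G < aff_dim S"
    using face_of_aff_dim_lt G polytope_imp_convex[OF S] by metis
  ultimately show False using F by (simp add: facet_of_def)
qed

text \<open>An isomorphism of face lattices knows nothing of dimensions, so facets are recognized by
  maximality.\<close>

lemma facet_of_maximal_face:
  fixes S :: "'a::euclidean_space set"
  assumes S: "polytope S" and F: "F face_of S" "F \<noteq> {}" "F \<noteq> S"
    and max: "\<And>G. G face_of S \<Longrightarrow> F \<subseteq> G \<Longrightarrow> G = F \<or> G = S"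
  shows "F facet_of S"
proof -
  obtain G where G: "G facet_of S" "F \<subseteq> G"
    using face_of_polyhedron_subset_facet[OF polytope_imp_polyhedron[OF S] F] by blast
  then have "G \<noteq> S" by (auto simp: facet_of_irrefl)
  then show ?thesis using max[OF facet_of_imp_face_of[OF G(1)] G(2)] G by auto
qed

lemma polytope_cube_hull: "polytope (cube_hull V)"
proof -
  have "finite {V a b d | a b d. True}"
    by (rule finite_subset[of _ "range (\<lambda>(a, b, d). V a b d)"]) (auto simp: image_iff, blast)
  then show ?thesis unfolding cube_hull_def polytope_def by blast
qed

text \<open>\<open>Q\<close> says that \<open>T\<close> carries the homogeneous quadratic form of
  the sphere \<open>(z, r)\<close> to that of \<open>(z', r')\<close>. Ball and sphere are sign
  conditions on these forms, so both are transported, together with the contact points in the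
  facets.\<close>

lemma circumscribed_proj_map:
  assumes T: "linear T" "bij T" and V: "\<And>a b d. snd (T (V a b d, 1)) > 0"
    and c: "cubical_polytope V" and s: "inscribed_sphere (cube_hull V) z r" and r': "r' > 0"
    and Q: "\<And>x t. (norm (fst (T (x, t)) - snd (T (x, t)) *\<^sub>R z'))\<^sup>2 - r'\<^sup>2 * (snd (T (x, t)))\<^sup>2
                 = (norm (x - t *\<^sub>R z))\<^sup>2 - r\<^sup>2 * t\<^sup>2"
  shows "circumscribed (\<lambda>a b d. proj_map T (V a b d))"
proof -
  let ?g = "proj_map T"
  let ?W = "\<lambda>a b d. ?g (V a b d)"
  have inj: "inj T" using T(2) by (rule bij_is_inj)
  have S: "convex (cube_hull V)" by (simp add: cube_hull_def)
  note S' = cube_hull_homog_pos[where V=V, OF T(1) V]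
  note hull = cube_hull_proj_map[where V=V, OF T(1) inj V]
  have Q1: "(norm (?g x - z'))\<^sup>2 - r'\<^sup>2 = ((norm (x - z))\<^sup>2 - r\<^sup>2) / (snd (T (x, 1)))\<^sup>2"
    if "snd (T (x, 1)) \<noteq> 0" for x
  proof -
    let ?t = "snd (T (x, 1))"
    have "fst (T (x, 1)) - ?t *\<^sub>R z' = ?t *\<^sub>R (?g x - z')"
      using that by (simp add: proj_map_def scaleR_diff_right)
    then have "(norm (fst (T (x, 1)) - ?t *\<^sub>R z'))\<^sup>2 = ?t\<^sup>2 * (norm (?g x - z'))\<^sup>2"
      by (simp add: power_mult_distrib)
    then have "?t\<^sup>2 * ((norm (?g x - z'))\<^sup>2 - r'\<^sup>2) = (norm (x - z))\<^sup>2 - r\<^sup>2"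
      using Q[of x 1] by (simp add: algebra_simps)
    then show ?thesis using that by (simp add: field_simps)
  qed
  have r: "r > 0" and sub: "cball z r \<subseteq> cube_hull V"
    and tang: "\<And>F. F facet_of cube_hull V \<Longrightarrow> sphere z r \<inter> F \<noteq> {}"
    using s by (auto simp: inscribed_sphere_def)
  have "cball z' r' \<subseteq> cube_hull ?W"
  proof
    fix y assume y: "y \<in> cball z' r'"
    obtain x t where xt: "T (x, t) = (y, 1)" using T(2) by (metis bij_pointE surj_pair)
    have "norm (y - z') \<le> r'" using y by (simp add: dist_norm norm_minus_commute)
    then have "(norm (y - z'))\<^sup>2 \<le> r'\<^sup>2" by (simp add: power_mono)
    then have le: "(norm (x - t *\<^sub>R z))\<^sup>2 \<le> r\<^sup>2 * t\<^sup>2" using Q[of x t] xt by simp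
    \<comment> \<open>No point at infinity is carried into the ball, since at \<open>(x, 0)\<close>
      the form is the positive definite \<open>(norm x)\<^sup>2\<close>.\<close>
    have t: "t \<noteq> 0"
    proof
      assume "t = 0"
      then have "x = 0" using le by simp
      then show False using xt \<open>t = 0\<close> linear_0[OF T(1)] by (simp add: zero_prod_def)
    qed
    define w where "w = (1 / t) *\<^sub>R x"
    have "(w, 1) = (1 / t) *\<^sub>R (x, t)" using t by (simp add: w_def)
    then have "T (w, 1) = (1 / t) *\<^sub>R T (x, t)" by (simp only: linear_cmul[OF T(1)])
    then have Tw: "T (w, 1) = (1 / t) *\<^sub>R (y, 1)" by (simp only: xt)
    have "?g w = y" using proj_map_eqI[where T=T, OF Tw] t by simp
    have "(norm (w - z))\<^sup>2 \<le> r\<^sup>2"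
    proof -
      have "x - t *\<^sub>R z = t *\<^sub>R (w - z)" using t by (simp add: w_def scaleR_diff_right)
      then have "(norm (x - t *\<^sub>R z))\<^sup>2 = t\<^sup>2 * (norm (w - z))\<^sup>2" by (simp add: power_mult_distrib)
      then show ?thesis using le t by (simp add: mult.commute)
    qed
    then have "norm (w - z) \<le> r" by (rule power2_le_imp_le) (use r in simp)
    then have "w \<in> cube_hull V" using sub by (auto simp: dist_norm norm_minus_commute)
    then show "y \<in> cube_hull ?W" using hull \<open>?g w = y\<close> by blast
  qed
  moreover have "sphere z' r' \<inter> F' \<noteq> {}" if F': "F' facet_of cube_hull ?W" for F'
  proof -
    note bij = proj_map_faces_bij[OF T(1) inj S S', unfolded hull]
    have "F' \<in> {F. F face_of cube_hull ?W}" using F' facet_of_imp_face_of by blast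
    then have "F' \<in> (`) ?g ` {F. F face_of cube_hull V}" using bij by (simp add: bij_betw_def)
    then obtain F where F: "F face_of cube_hull V" "F' = ?g ` F" by blast
    have ne: "F \<noteq> {}" "F \<noteq> cube_hull V"
      using F' F hull by (auto simp: facet_of_def)
    \<comment> \<open>A facet above the preimage \<open>F\<close> is enough: its image is a proper
      face above the facet \<open>F'\<close>, hence equal to \<open>F'\<close>.\<close>
    obtain G where G: "G facet_of cube_hull V" "F \<subseteq> G"
      using face_of_polyhedron_subset_facet[OF polytope_imp_polyhedron[OF polytope_cube_hull] F(1) ne] by blast
    have Gf: "G face_of cube_hull V" using G facet_of_imp_face_of by blast
    have "?g ` G face_of cube_hull ?W"
      using bij_betwE[OF bij] Gf by blast
    moreover have "?g ` G \<noteq> cube_hull ?W"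
    proof
      assume "?g ` G = cube_hull ?W"
      then have "?g ` G = ?g ` cube_hull V" using hull by simp
      then have "G = cube_hull V"
        using inj_on_image_eq_iff[OF inj_on_subset[OF inj_on_proj_map[OF T(1) inj] S']]
          face_of_imp_subset[OF Gf] by blast
      then show False using G(1) by (simp add: facet_of_irrefl)
    qed
    ultimately have "?g ` G = F'"
      using facet_maximal[OF polytope_cube_hull F'] G(2) F(2) by blast
    moreover obtain x where x: "x \<in> sphere z r" "x \<in> G" using tang[OF G(1)] by blast
    have "snd (T (x, 1)) > 0" using x S' face_of_imp_subset[OF Gf] by blast
    then have "(norm (?g x - z'))\<^sup>2 = r'\<^sup>2"
      using Q1[of x] x(1) by (simp add: dist_norm norm_minus_commute)
    then have "?g x \<in> sphere z' r'" using r' by (simp add: dist_norm norm_minus_commute)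
    ultimately show ?thesis using x(2) by blast
  qed
  ultimately have "inscribed_sphere (cube_hull ?W) z' r'" using r' unfolding inscribed_sphere_def by simp
  moreover have "cubical_polytope ?W" by (rule cubical_polytope_proj_map[where V=V, OF T(1) inj V c])
  ultimately show ?thesis unfolding circumscribed_def by (meson)
qed

subsection \<open>Facets of circumscribed cubes and oriented planes\<close>

lemma std_corner_nth [simp]:
  "std_corner a b d $ 1 = of_bool a" "std_corner a b d $ 2 = of_bool b" "std_corner a b d $ 3 = of_bool d"
  by (simp_all add: std_corner_def)

lemma cube_hull_std_corner: "cube_hull std_corner = cbox 0 1"
proof -
  have "{x :: real^3. \<forall>i. x $ i = 0 \<or> x $ i = 1} = {std_corner a b d | a b d. True}"
  proof (intro subset_antisym subsetI)
    fix x :: "real^3" assume "x \<in> {x. \<forall>i. x $ i = 0 \<or> x $ i = 1}"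
    then have "x = std_corner (x $ 1 = 1) (x $ 2 = 1) (x $ 3 = 1)"
      by (auto simp: vec_eq_iff forall_3)
    then show "x \<in> {std_corner a b d | a b d. True}" by blast
  qed (auto simp: forall_3)
  moreover have "{x :: real^3. \<forall>i\<in>Basis. x \<bullet> i = 0 \<or> x \<bullet> i = 1} = {x. \<forall>i. x $ i = 0 \<or> x $ i = 1}"
    by (simp add: Basis_vec_def inner_axis)
  ultimately show ?thesis
    using unit_interval_convex_hull[where 'a="real^3"] by (simp add: cube_hull_def Cart_1)
qed

lemma unit_cube_side_face:
  "{x \<in> cbox 0 1. x $ c = of_bool e} face_of (cbox 0 1 :: (real^3) set)"
proof -
  have e: "{x \<in> cbox 0 1. x $ c = of_bool e} = cbox 0 1 \<inter> {x :: real^3. axis c 1 \<bullet> x = of_bool e}"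
    by (auto simp: inner_axis')
  show ?thesis
  proof (cases e)
    case True
    then show ?thesis unfolding e
      by (intro face_of_Int_supporting_hyperplane_le) (auto simp: inner_axis' mem_box_cart)
  next
    case False
    then show ?thesis unfolding e
      by (intro face_of_Int_supporting_hyperplane_ge) (auto simp: inner_axis' mem_box_cart)
  qed
qed

lemma unit_cube_corner_face: "{std_corner a b d} face_of (cbox 0 1 :: (real^3) set)"
proof -
  let ?F = "\<lambda>c e. {x \<in> cbox 0 1. x $ c = of_bool e} :: (real^3) set"
  have "(?F 1 a \<inter> ?F 2 b) \<inter> ?F 3 d face_of (cbox 0 1 :: (real^3) set)"
    by (intro face_of_Int unit_cube_side_face)
  moreover have "std_corner a b d \<in> cbox 0 1" by (auto simp: mem_box_cart forall_3)
  then have "(?F 1 a \<inter> ?F 2 b) \<inter> ?F 3 d = {std_corner a b d}"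
    by (auto simp: vec_eq_iff forall_3)
  ultimately show ?thesis by simp
qed

text \<open>A face with a further point contains the midpoint of that point and the centre of the
  side, which is interior to the cube.\<close>

lemma unit_cube_side_maximal:
  fixes G :: "(real^3) set"
  assumes G: "G face_of cbox 0 1" and sub: "{x \<in> cbox 0 1. x $ c = of_bool e} \<subseteq> G"
  shows "G = {x \<in> cbox 0 1. x $ c = of_bool e} \<or> G = cbox 0 1"
proof (rule ccontr)
  assume n: "\<not> ?thesis"
  have Gs: "G \<subseteq> cbox 0 1" using G by (rule face_of_imp_subset)
  then obtain x where x: "x \<in> G" "x $ c \<noteq> of_bool e" using n sub by blast
  have xb: "0 \<le> x $ i" "x $ i \<le> 1" for i using x Gs by (auto simp: mem_box_cart subset_iff)
  define y :: "real^3" where "y = (\<chi> i. if i = c then of_bool e else 1/2)"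
  have "y \<in> G" using sub by (auto simp: y_def mem_box_cart)
  have "convex G" using G by (rule face_of_imp_convex)
  then have m: "(1/2) *\<^sub>R x + (1/2) *\<^sub>R y \<in> G" using x \<open>y \<in> G\<close> by (simp add: convexD)
  have "(1/2) *\<^sub>R x + (1/2) *\<^sub>R y \<in> box 0 1"
  proof -
    have "0 < x $ i / 2 + y $ i / 2 \<and> x $ i / 2 + y $ i / 2 < 1" for i
      using xb[of i] x(2) by (cases e; cases "i = c") (auto simp: y_def)
    then show ?thesis by (simp add: mem_box_cart)
  qed
  then have "G \<inter> interior (cbox 0 1) \<noteq> {}" using m by auto
  then show False using face_of_disjoint_interior[OF G] n by blast
qed

text \<open>The side of the standard cube is a maximal proper face, so its image is a facet and has
  a supporting plane; the labels tell which vertices lie on it. The point of the ball in direction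
  \<open>n\<close> and the contact point give the two inequalities of tangency.\<close>

lemma circumscribed_side_plane:
  assumes "circumscribed V"
  shows "\<exists>n h. norm n = 1
    \<and> (\<forall>a b d. (std_corner a b d $ c = of_bool e \<longrightarrow> n \<bullet> V a b d = h)
             \<and> (std_corner a b d $ c \<noteq> of_bool e \<longrightarrow> n \<bullet> V a b d < h))
    \<and> (\<forall>z r. inscribed_sphere (cube_hull V) z r \<longrightarrow> n \<bullet> z + r = h)"
proof -
  let ?C = "{F. F face_of (cbox 0 1 :: (real^3) set)}"
  let ?S = "cube_hull V"
  \<comment> \<open>The intersection with \<open>UNIV\<close> fixes the type of the points.\<close>
  define F where "F = {x \<in> cbox 0 1. x $ c = of_bool e} \<inter> (UNIV :: (real^3) set)"
  have F: "F = {x \<in> cbox 0 1. x $ c = of_bool e}" by (simp add: F_def)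
  have FC: "F \<in> ?C" by (simp add: F unit_cube_side_face)
  obtain \<phi> where phi: "bij_betw \<phi> ?C {F. F face_of ?S}"
    "\<And>F G. F \<in> ?C \<Longrightarrow> G \<in> ?C \<Longrightarrow> F \<subseteq> G \<longleftrightarrow> \<phi> F \<subseteq> \<phi> G"
    "\<And>a b d. \<phi> {std_corner a b d} = {V a b d}"
    using assms unfolding circumscribed_def cubical_polytope_def by blast
  have Vmem: "V a b d \<in> \<phi> G \<longleftrightarrow> std_corner a b d \<in> G" if "G \<in> ?C" for a b d G
    using phi(2)[of "{std_corner a b d}" G] phi(3)[of a b d] unit_cube_corner_face[of a b d] that by simp
  have Vin: "V a b d \<in> ?S" for a b d unfolding cube_hull_def by (rule hull_inc) auto
  have corner: "std_corner a b d \<in> F \<longleftrightarrow> std_corner a b d $ c = of_bool e" for a b d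
    by (auto simp: F mem_box_cart forall_3)
  \<comment> \<open>Corners on the main diagonal lie on or off the side for all three axes
    alike.\<close>
  have diag: "std_corner x x x $ c = of_bool x" for x
    using exhaust_3[of c] by auto
  have F1: "\<phi> F face_of ?S" using phi(1) FC bij_betwE by blast
  have ne: "\<phi> F \<noteq> {}" using Vmem[OF FC, of e e e] corner[of e e e] diag by auto
  have neS: "\<phi> F \<noteq> ?S"
    using Vmem[OF FC, of "\<not> e" "\<not> e" "\<not> e"] corner[of "\<not> e" "\<not> e" "\<not> e"] diag[of "\<not> e"] Vin
    by (cases e) auto
  have facet: "\<phi> F facet_of ?S"
  proof (rule facet_of_maximal_face[OF polytope_cube_hull F1 ne neS])
    fix G assume G: "G face_of ?S" "\<phi> F \<subseteq> G"
    then have "G \<in> \<phi> ` ?C" using phi(1) by (simp add: bij_betw_def)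
    then obtain G0 where G0: "G0 \<in> ?C" "G = \<phi> G0" by blast
    then have "F \<subseteq> G0" using phi(2)[OF FC G0(1)] G by simp
    then consider "G0 = F" | "G0 = cbox 0 1"
      using unit_cube_side_maximal[of G0 c e] G0(1) by (auto simp: F)
    then show "G = \<phi> F \<or> G = ?S"
    proof cases
      case 2
      have "?S \<in> {F. F face_of ?S}" by (simp add: face_of_refl_eq cube_hull_def)
      then obtain X where X: "X \<in> ?C" "?S = \<phi> X" using phi(1) by (metis (no_types, lifting) bij_betw_def imageE)
      then have "X \<subseteq> cbox 0 1" using face_of_imp_subset by blast
      then have "?S \<subseteq> G" using phi(2)[of X "cbox 0 1"] X 2 G0 by auto
      then show ?thesis using face_of_imp_subset[OF G(1)] by blast
    qed (use G0 in simp)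
  qed
  have "\<phi> F exposed_face_of ?S"
    using F1 exposed_face_of_polyhedron[OF polytope_imp_polyhedron[OF polytope_cube_hull]] by blast
  then obtain m k where m: "m \<noteq> 0" "?S \<subseteq> {x. m \<bullet> x \<le> k}" "\<phi> F = ?S \<inter> {x. m \<bullet> x = k}"
    using ne neS unfolding exposed_face_of by blast
  define n where "n = (1 / norm m) *\<^sub>R m"
  define h where "h = k / norm m"
  have n: "norm n = 1" using m(1) by (simp add: n_def)
  have le: "n \<bullet> x \<le> h" if "x \<in> ?S" for x
    using m(1,2) that by (auto simp: n_def h_def divide_right_mono)
  have eq: "x \<in> \<phi> F \<longleftrightarrow> n \<bullet> x = h" if "x \<in> ?S" for x
    using m(1,3) that by (auto simp: n_def h_def)
  have tang: "n \<bullet> z + r = h" if s: "inscribed_sphere ?S z r" for z r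
  proof (rule antisym)
    have r: "r > 0" using s by (simp add: inscribed_sphere_def)
    have "dist z (z + r *\<^sub>R n) \<le> r" using n r by (simp add: dist_norm)
    then have "z + r *\<^sub>R n \<in> ?S" using s by (auto simp: inscribed_sphere_def)
    from le[OF this] show "n \<bullet> z + r \<le> h"
      using n by (simp add: inner_add_right dot_square_norm)
    obtain y where y: "y \<in> sphere z r" "y \<in> \<phi> F" using s facet unfolding inscribed_sphere_def by blast
    have "n \<bullet> (y - z) \<le> norm n * norm (y - z)" by (rule norm_cauchy_schwarz)
    then have "n \<bullet> y - n \<bullet> z \<le> r" using y n by (simp add: inner_diff_right dist_norm norm_minus_commute)
    moreover have "n \<bullet> y = h" using y(2) eq face_of_imp_subset[OF F1] by blast
    ultimately show "h \<le> n \<bullet> z + r" by simp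
  qed
  have "(std_corner a b d $ c = of_bool e \<longrightarrow> n \<bullet> V a b d = h)
             \<and> (std_corner a b d $ c \<noteq> of_bool e \<longrightarrow> n \<bullet> V a b d < h)" for a b d
    using eq[OF Vin, of a b d] le[OF Vin, of a b d] Vmem[OF FC, of a b d] corner[of a b d] by auto
  then show ?thesis using n tang by blast
qed

section \<open>Labelling a cube from the opposite corner\<close>

lemma cube_hull_antipodal: "cube_hull (\<lambda>a b d. V (\<not> a) (\<not> b) (\<not> d)) = cube_hull V"
proof -
  have "{V (\<not> a) (\<not> b) (\<not> d) | a b d. True} = {V a b d | a b d. True}"
  proof (intro subset_antisym subsetI)
    fix x assume "x \<in> {V a b d | a b d. True}"
    then obtain a b d where "x = V (\<not> \<not> a) (\<not> \<not> b) (\<not> \<not> d)" by auto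
    then show "x \<in> {V (\<not> a) (\<not> b) (\<not> d) | a b d. True}" by blast
  qed blast
  then show ?thesis by (simp add: cube_hull_def)
qed

text \<open>The point reflection of the standard cube permutes its faces; written as a projective
  map, it falls under the transport of faces above.\<close>

lemma cubical_polytope_antipodal:
  assumes "cubical_polytope V"
  shows "cubical_polytope (\<lambda>a b d. V (\<not> a) (\<not> b) (\<not> d))"
proof -
  define T :: "(real^3) \<times> real \<Rightarrow> (real^3) \<times> real" where "T X = (snd X *\<^sub>R 1 - fst X, snd X)" for X
  let ?C = "{F. F face_of (cbox 0 1 :: (real^3) set)}"
  let ?g = "proj_map T"
  have T: "linear T" by (rule linearI) (simp_all add: T_def algebra_simps)
  have inj: "inj T" by (rule injI) (auto simp: T_def prod_eq_iff)
  have S: "convex (cbox 0 1 :: (real^3) set)" "cbox 0 1 \<subseteq> {x. snd (T (x, 1)) > 0}"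
    by (auto simp: T_def)
  have g: "?g x = 1 - x" for x by (simp add: proj_map_def T_def)
  have "x \<in> ?g ` cbox 0 1" if "x \<in> cbox 0 1" for x
    using that by (intro image_eqI[of _ _ "1 - x"]) (auto simp: g mem_box_cart)
  then have im: "?g ` cbox 0 1 = cbox 0 1" by (auto simp: g mem_box_cart)
  obtain \<phi> where phi: "bij_betw \<phi> ?C {F. F face_of cube_hull V}"
    "\<And>F G. F \<in> ?C \<Longrightarrow> G \<in> ?C \<Longrightarrow> F \<subseteq> G \<longleftrightarrow> \<phi> F \<subseteq> \<phi> G"
    "\<And>a b d. \<phi> {std_corner a b d} = {V a b d}"
    using assms unfolding cubical_polytope_def by blast
  note bij = proj_map_faces_bij[OF T inj S, unfolded im]
  note hull = cube_hull_antipodal[of V]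
  have 1: "bij_betw (\<phi> \<circ> (`) ?g) ?C {F. F face_of cube_hull (\<lambda>a b d. V (\<not> a) (\<not> b) (\<not> d))}"
    unfolding hull by (rule bij_betw_trans[OF bij phi(1)])
  have ig: "inj ?g" by (rule injI) (simp add: g)
  have 2: "\<forall>F G. F face_of (cbox 0 1 :: (real^3) set) \<longrightarrow> G face_of (cbox 0 1 :: (real^3) set)
      \<longrightarrow> (F \<subseteq> G \<longleftrightarrow> (\<phi> \<circ> (`) ?g) F \<subseteq> (\<phi> \<circ> (`) ?g) G)"
  proof (intro allI impI)
    fix F G assume "F face_of (cbox 0 1 :: (real^3) set)" "G face_of (cbox 0 1 :: (real^3) set)"
    then have "?g ` F \<in> ?C" "?g ` G \<in> ?C" using bij_betwE[OF bij] by blast+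
    from phi(2)[OF this] show "F \<subseteq> G \<longleftrightarrow> (\<phi> \<circ> (`) ?g) F \<subseteq> (\<phi> \<circ> (`) ?g) G"
      by (simp add: inj_image_subset_iff[OF ig])
  qed
  have "1 - std_corner a b d = std_corner (\<not> a) (\<not> b) (\<not> d)" for a b d
    by (auto simp: vec_eq_iff forall_3)
  then have 3: "\<forall>a b d. (\<phi> \<circ> (`) ?g) {std_corner a b d} = {V (\<not> a) (\<not> b) (\<not> d)}"
    using phi(3) by (simp add: g)
  show ?thesis unfolding cubical_polytope_def
    using 1 2 3 by blast
qed

lemma circumscribed_antipodal:
  "circumscribed V \<Longrightarrow> circumscribed (\<lambda>a b d. V (\<not> a) (\<not> b) (\<not> d))"
  by (simp add: circumscribed_def cubical_polytope_antipodal cube_hull_antipodal)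

text \<open>\<open>A\<close>, \<open>B\<close>, \<open>C\<close> show that the products with
  \<open>x\<close>, \<open>y\<close>, \<open>w\<close> take all triples of values, and a surjective
  linear map of three-space is injective.\<close>

lemma orthogonal_to_dual_basis:
  fixes x y w A B C m :: "real^3"
  assumes d: "A \<bullet> x \<noteq> 0" "A \<bullet> y = 0" "A \<bullet> w = 0" "B \<bullet> x = 0" "B \<bullet> y \<noteq> 0" "B \<bullet> w = 0"
    "C \<bullet> x = 0" "C \<bullet> y = 0" "C \<bullet> w \<noteq> 0" and m: "m \<bullet> x = 0" "m \<bullet> y = 0" "m \<bullet> w = 0"
  shows "m = 0"
proof -
  define f :: "real^3 \<Rightarrow> real^3" where "f z = vector [z \<bullet> x, z \<bullet> y, z \<bullet> w]" for z
  have lin: "linear f"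
    by (rule linearI) (simp_all add: f_def vec_eq_iff forall_3 inner_add_left)
  have "surj f"
  proof (rule surjI)
    fix v :: "real^3"
    show "f ((v $ 1 / (A \<bullet> x)) *\<^sub>R A + (v $ 2 / (B \<bullet> y)) *\<^sub>R B + (v $ 3 / (C \<bullet> w)) *\<^sub>R C) = v"
      using d by (simp add: f_def vec_eq_iff forall_3 inner_add_left)
  qed
  then have "inj f" using lin linear_surjective_imp_injective by blast
  moreover have "f m = f 0" using m by (simp add: f_def)
  ultimately show ?thesis by (simp add: inj_eq)
qed

text \<open>
  The plane \<open>{x. n \<bullet> x + h = 0}\<close> oriented by its unit normal \<open>n\<close> is \<open>(n, 1, h)\<close>, a null vector of the Lorentz
  form \<open>lor\<close>. It touches the oriented sphere of centre \<open>z\<close> and signed radius \<open>r\<close> iff \<open>sph p z r = 0\<close>.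
\<close>
type_synonym laguerre = "(real^3) \<times> real \<times> real"

definition ev :: "laguerre \<Rightarrow> real^3 \<Rightarrow> real" where
  "ev p x = fst p \<bullet> x + snd (snd p)"

definition hev :: "laguerre \<Rightarrow> (real^3) \<times> real \<Rightarrow> real" where
  "hev p X = fst p \<bullet> fst X + snd (snd p) * snd X"

definition lor :: "laguerre \<Rightarrow> laguerre \<Rightarrow> real" where
  "lor p q = fst p \<bullet> fst q - fst (snd p) * fst (snd q)"

definition sph :: "laguerre \<Rightarrow> real^3 \<Rightarrow> real \<Rightarrow> real" where
  "sph p z r = ev p z + fst (snd p) * r"

definition oplane :: "laguerre \<Rightarrow> bool" where
  "oplane p \<longleftrightarrow> norm (fst p) = 1 \<and> fst (snd p) = 1"

lemma ev_linear [simp]: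
  "ev (p + q) x = ev p x + ev q x" "ev (p - q) x = ev p x - ev q x" "ev (a *\<^sub>R p) x = a * ev p x"
  "ev 0 x = 0" "ev (- p) x = - ev p x"
  by (simp_all add: ev_def inner_add_left inner_diff_left algebra_simps)

lemma hev_linear [simp]:
  "hev (p + q) X = hev p X + hev q X" "hev (p - q) X = hev p X - hev q X" "hev (a *\<^sub>R p) X = a * hev p X"
  "hev p (X + Y) = hev p X + hev p Y" "hev p (X - Y) = hev p X - hev p Y" "hev p (a *\<^sub>R X) = a * hev p X"
  "hev p 0 = 0" "hev 0 X = 0"
  by (simp_all add: hev_def inner_add_left inner_diff_left inner_add_right inner_diff_right algebra_simps)

lemma hev_point [simp]: "hev p (x, 1) = ev p x"
  by (simp add: hev_def ev_def)

lemma sph_linear [simp]: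
  "sph (p + q) z r = sph p z r + sph q z r" "sph (p - q) z r = sph p z r - sph q z r"
  "sph (a *\<^sub>R p) z r = a * sph p z r" "sph 0 z r = 0"
  by (simp_all add: sph_def algebra_simps)

lemma lor_linear [simp]:
  "lor (p + q) s = lor p s + lor q s" "lor (p - q) s = lor p s - lor q s" "lor (a *\<^sub>R p) s = a * lor p s"
  "lor s (p + q) = lor s p + lor s q" "lor s (p - q) = lor s p - lor s q" "lor s (a *\<^sub>R p) = a * lor s p"
  by (simp_all add: lor_def inner_add_left inner_diff_left inner_add_right inner_diff_right algebra_simps)

lemma lor_commute: "lor p q = lor q p"
  by (simp add: lor_def inner_commute mult.commute)

lemma oplane_null: "oplane p \<Longrightarrow> lor p p = 0"
  by (simp add: oplane_def lor_def dot_square_norm)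

text \<open>Both planes are null, so only the mixed product survives. This halving is what lets the
  reflection in \<open>u\<close> exchange \<open>p\<close> and \<open>p'\<close> up to
  factors.\<close>

lemma lor_refl_half:
  assumes "u = a *\<^sub>R p + a' *\<^sub>R p'" "oplane p" "oplane p'"
  shows "2 * a * lor p u = lor u u"
proof -
  have "lor u u = 2 * (a * a' * lor p p')" "lor p u = a' * lor p p'"
    using oplane_null[OF assms(2)] oplane_null[OF assms(3)] by (simp_all add: assms(1) lor_commute[of p' p])
  then show ?thesis by (simp add: algebra_simps)
qed

text \<open>
  The projective map that carries every plane tangent to the sphere \<open>(z, r)\<close> to its Lorentz reflection in \<open>u\<close>.
\<close>
definition lag_map :: "laguerre \<Rightarrow> real^3 \<Rightarrow> real \<Rightarrow> (real^3) \<times> real \<Rightarrow> (real^3) \<times> real" where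
  "lag_map u z r X = X - (2 * hev u X / (lor u u * r + 2 * fst (snd u) * sph u z r)) *\<^sub>R
     (r *\<^sub>R fst u + fst (snd u) *\<^sub>R z, fst (snd u))"

lemma linear_lag_map: "linear (lag_map u z r)"
  by (rule linearI) (simp_all add: lag_map_def algebra_simps add_divide_distrib scaleR_add_left)

lemma hev_lag_centre:
  "hev u (r *\<^sub>R fst u + fst (snd u) *\<^sub>R z, fst (snd u)) = r * lor u u + fst (snd u) * sph u z r"
  by (simp add: hev_def lor_def sph_def ev_def inner_add_right algebra_simps)

text \<open>Contact of \<open>p\<close> with the sphere turns its value at the centre of the map
  into \<open>r * lor p u\<close>; by \<open>lor_refl_half\<close> the terms then combine to the
  denominator. The plane \<open>p\<close> is thus carried to \<open>p'\<close>.\<close>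

lemma hev_lag_map:
  assumes u: "u = a *\<^sub>R p + a' *\<^sub>R p'" "oplane p" "oplane p'" and s: "sph p z r = 0"
    and ne: "lor u u * r + 2 * fst (snd u) * sph u z r \<noteq> 0"
  shows "a' * hev p' (lag_map u z r X) = - a * hev p X"
proof -
  define N where "N = lor u u * r + 2 * fst (snd u) * sph u z r"
  define g where "g = (r *\<^sub>R fst u + fst (snd u) *\<^sub>R z, fst (snd u))"
  have T: "lag_map u z r X = X - (2 * hev u X / N) *\<^sub>R g" by (simp add: lag_map_def N_def g_def)
  have p1: "fst (snd p) = 1" using u(2) by (simp add: oplane_def)
  have "hev p g = r * (fst p \<bullet> fst u) + fst (snd u) * ev p z"
    by (simp add: hev_def g_def ev_def inner_add_right algebra_simps)
  also have "ev p z = - r" using s p1 by (simp add: sph_def)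
  finally have "hev p g = r * lor p u" using p1 by (simp add: lor_def algebra_simps)
  then have pg: "2 * a * hev p g = r * lor u u" using lor_refl_half[OF u] by (simp add: algebra_simps)
  have ug: "hev u g = r * lor u u + fst (snd u) * sph u z r" unfolding g_def by (rule hev_lag_centre)
  have "a' * hev p' (lag_map u z r X) = hev (u - a *\<^sub>R p) (lag_map u z r X)" by (simp add: u(1))
  also have "\<dots> = hev u X - (hev u X / N) * (2 * hev u g - 2 * a * hev p g) - a * hev p X"
    by (simp add: T algebra_simps diff_divide_distrib)
  also have "2 * hev u g - 2 * a * hev p g = N" unfolding ug pg N_def by (simp add: algebra_simps)
  also have "hev u X / N * N = hev u X" using ne by (simp add: N_def)
  finally show ?thesis by simp
qed

text \<open>A rank-one change of the identity, with determinant \<open>- r * lor u u\<close> divided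
  by the denominator.\<close>

lemma bij_lag_map:
  assumes r: "r \<noteq> 0" and U: "lor u u \<noteq> 0" and ne: "lor u u * r + 2 * fst (snd u) * sph u z r \<noteq> 0"
  shows "bij (lag_map u z r)"
proof -
  define N where "N = lor u u * r + 2 * fst (snd u) * sph u z r"
  define g where "g = (r *\<^sub>R fst u + fst (snd u) *\<^sub>R z, fst (snd u))"
  have T: "lag_map u z r X = X - (2 * hev u X / N) *\<^sub>R g" for X by (simp add: lag_map_def N_def g_def)
  have ug: "hev u g = r * lor u u + fst (snd u) * sph u z r" unfolding g_def by (rule hev_lag_centre)
  have "X = 0" if "lag_map u z r X = 0" for X
  proof -
    have X: "X = (2 * hev u X / N) *\<^sub>R g" using that by (simp add: T)
    have "hev u X = (2 * hev u X / N) * hev u g" by (subst X) simp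
    then have "hev u X * N = 2 * hev u X * hev u g" using ne by (simp add: N_def field_simps)
    then have "hev u X * (r * lor u u) = 0" unfolding ug N_def by (simp add: algebra_simps)
    then have "hev u X = 0" using r U by simp
    then show "X = 0" using X by simp
  qed
  then have "inj (lag_map u z r)" using linear_injective_0[OF linear_lag_map] by blast
  then show ?thesis using linear_injective_imp_surjective[OF linear_lag_map] by (simp add: bij_def)
qed

text \<open>\<open>(z', r')\<close> is the sphere mirrored in \<open>u\<close>, and its quadratic
  form is the transported one because a reflection is an isometry.\<close>

lemma lag_map_sphere:
  fixes x z :: "real^3" and t :: real
  assumes U: "lor u u \<noteq> 0" and ne: "lor u u * r + 2 * fst (snd u) * sph u z r \<noteq> 0"
  defines "z' \<equiv> z - (2 * sph u z r / lor u u) *\<^sub>R fst u"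
    and "r' \<equiv> r + 2 * fst (snd u) * sph u z r / lor u u"
  defines "T \<equiv> lag_map u z r (x, t)"
  shows "(norm (fst T - snd T *\<^sub>R z'))\<^sup>2 - r'\<^sup>2 * (snd T)\<^sup>2 = (norm (x - t *\<^sub>R z))\<^sup>2 - r\<^sup>2 * t\<^sup>2"
proof -
  define m where "m = fst u"
  define \<rho> where "\<rho> = fst (snd u)"
  define e where "e = 2 * sph u z r / lor u u"
  define h where "h = hev u (x, t)"
  define k where "k = 2 * h / (lor u u * r + 2 * \<rho> * sph u z r)"
  have N: "lor u u * r + 2 * \<rho> * sph u z r = lor u u * r'"
    using U by (simp add: r'_def \<rho>_def field_simps)
  have r': "r' = r + \<rho> * e" by (simp add: r'_def e_def \<rho>_def)
  have eU: "e * lor u u = 2 * sph u z r" using U by (simp add: e_def)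
  have kU: "k * (lor u u * r') = 2 * h" using ne unfolding k_def N by (simp add: \<rho>_def[symmetric] N)
  have fT: "fst T = x - k *\<^sub>R (r *\<^sub>R m + \<rho> *\<^sub>R z)" and sT: "snd T = t - k * \<rho>"
    by (simp_all add: T_def lag_map_def m_def \<rho>_def k_def h_def)
  \<comment> \<open>Relative to the centres the pair of position and scaled radius moves by
    \<open>w\<close> along \<open>u\<close>; \<open>w\<close> is the amount at which a reflection
    keeps the Lorentz norm.\<close>
  define w where "w = e * t - k * r'"
  define X where "X = x - t *\<^sub>R z"
  have z': "z' = z - e *\<^sub>R m" by (simp add: z'_def e_def m_def)
  have 1: "fst T - snd T *\<^sub>R z' = X + w *\<^sub>R m"
    unfolding fT sT z' X_def w_def r' by (simp add: algebra_simps)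
  have 2: "r' * snd T = r * t + \<rho> * w" unfolding sT w_def r' by (simp add: algebra_simps)
  have U': "lor u u = m \<bullet> m - \<rho>\<^sup>2" by (simp add: lor_def m_def \<rho>_def power2_eq_square)
  have h: "h = X \<bullet> m + t * (sph u z r - \<rho> * r)"
    by (simp add: h_def hev_def sph_def ev_def X_def m_def \<rho>_def inner_diff_left inner_commute algebra_simps)
  have 3: "w * lor u u = 2 * sph u z r * t - 2 * h"
    using eU kU unfolding w_def by (simp add: algebra_simps)
  have "(norm (X + w *\<^sub>R m))\<^sup>2 = (norm X)\<^sup>2 + 2 * w * (X \<bullet> m) + w\<^sup>2 * (m \<bullet> m)"
    unfolding power2_norm_eq_inner
    by (simp add: inner_add_left inner_add_right inner_commute power2_eq_square algebra_simps)
  moreover have "r'\<^sup>2 * (snd T)\<^sup>2 = (r * t + \<rho> * w)\<^sup>2" using 2 by (simp add: power_mult_distrib[symmetric])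
  moreover have "2 * w * (X \<bullet> m) + w\<^sup>2 * (m \<bullet> m) - (r * t + \<rho> * w)\<^sup>2 = - r\<^sup>2 * t\<^sup>2"
  proof -
    have "2 * w * (X \<bullet> m) + w\<^sup>2 * (m \<bullet> m) - (r * t + \<rho> * w)\<^sup>2
      = - r\<^sup>2 * t\<^sup>2 + w * (2 * (X \<bullet> m) + w * lor u u - 2 * r * t * \<rho>)"
      unfolding U' by (simp add: power2_eq_square algebra_simps)
    also have "2 * (X \<bullet> m) + w * lor u u - 2 * r * t * \<rho> = 0"
      unfolding 3 h by (simp add: algebra_simps)
    finally show ?thesis by simp
  qed
  ultimately show ?thesis unfolding 1 X_def by simp
qed

text \<open>Positive \<open>\<sigma>\<close> means that all six planes are oriented outward,
  negative that all are inward; its absolute value carries no information. Both signs occur, since a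
  level plane bounds cells on both of its sides.\<close>

definition cube_planes :: "(bool \<Rightarrow> laguerre) \<Rightarrow> (bool \<Rightarrow> laguerre) \<Rightarrow> (bool \<Rightarrow> laguerre) \<Rightarrow> real \<Rightarrow> cube_points \<Rightarrow> bool" where
  "cube_planes P Q R \<sigma> V \<longleftrightarrow>
     (\<forall>e. oplane (P e) \<and> oplane (Q e) \<and> oplane (R e)) \<and>
     (\<forall>a b d. ev (P a) (V a b d) = 0 \<and> ev (Q b) (V a b d) = 0 \<and> ev (R d) (V a b d) = 0
        \<and> \<sigma> * ev (P (\<not> a)) (V a b d) < 0 \<and> \<sigma> * ev (Q (\<not> b)) (V a b d) < 0 \<and> \<sigma> * ev (R (\<not> d)) (V a b d) < 0)"

lemma cube_planesD:
  assumes "cube_planes P Q R \<sigma> V"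
  shows "oplane (P e)" "oplane (Q e)" "oplane (R e)"
    "ev (P a) (V a b d) = 0" "ev (Q b) (V a b d) = 0" "ev (R d) (V a b d) = 0"
    "a \<noteq> e \<Longrightarrow> \<sigma> * ev (P e) (V a b d) < 0" "b \<noteq> e \<Longrightarrow> \<sigma> * ev (Q e) (V a b d) < 0"
    "d \<noteq> e \<Longrightarrow> \<sigma> * ev (R e) (V a b d) < 0"
proof -
  show "oplane (P e)" "oplane (Q e)" "oplane (R e)"
    "ev (P a) (V a b d) = 0" "ev (Q b) (V a b d) = 0" "ev (R d) (V a b d) = 0"
    using assms by (auto simp: cube_planes_def)
  have *: "\<sigma> * ev (P (\<not> a)) (V a b d) < 0" "\<sigma> * ev (Q (\<not> b)) (V a b d) < 0" "\<sigma> * ev (R (\<not> d)) (V a b d) < 0"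
    using assms by (auto simp: cube_planes_def)
  show "a \<noteq> e \<Longrightarrow> \<sigma> * ev (P e) (V a b d) < 0" using *(1) by (cases e; cases a) auto
  show "b \<noteq> e \<Longrightarrow> \<sigma> * ev (Q e) (V a b d) < 0" using *(2) by (cases e; cases b) auto
  show "d \<noteq> e \<Longrightarrow> \<sigma> * ev (R e) (V a b d) < 0" using *(3) by (cases e; cases d) auto
qed

lemma cube_planes_incidence:
  assumes "cube_planes P Q R \<sigma> V"
  shows "ev (P e) (V a b d) = 0 \<longleftrightarrow> a = e" "ev (Q e) (V a b d) = 0 \<longleftrightarrow> b = e"
    "ev (R e) (V a b d) = 0 \<longleftrightarrow> d = e"
proof -
  show "ev (P e) (V a b d) = 0 \<longleftrightarrow> a = e"
  proof (cases "a = e")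
    case True
    then show ?thesis using cube_planesD(4)[OF assms] by simp
  next
    case False
    then have "\<sigma> * ev (P e) (V a b d) < 0" by (rule cube_planesD(7)[OF assms])
    then have "ev (P e) (V a b d) \<noteq> 0" by fastforce
    then show ?thesis using False by simp
  qed
  show "ev (Q e) (V a b d) = 0 \<longleftrightarrow> b = e"
  proof (cases "b = e")
    case True
    then show ?thesis using cube_planesD(5)[OF assms] by simp
  next
    case False
    then have "\<sigma> * ev (Q e) (V a b d) < 0" by (rule cube_planesD(8)[OF assms])
    then have "ev (Q e) (V a b d) \<noteq> 0" by fastforce
    then show ?thesis using False by simp
  qed
  show "ev (R e) (V a b d) = 0 \<longleftrightarrow> d = e"
  proof (cases "d = e")
    case True
    then show ?thesis using cube_planesD(6)[OF assms] by simp
  next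
    case False
    then have "\<sigma> * ev (R e) (V a b d) < 0" by (rule cube_planesD(9)[OF assms])
    then have "ev (R e) (V a b d) \<noteq> 0" by fastforce
    then show ?thesis using False by simp
  qed
qed

text \<open>The edges at a vertex form, up to factors, a basis dual to the three normals: each edge
  lies in two of the planes and leaves the third.\<close>

lemma cube_planes_vertex_unique:
  assumes c: "cube_planes P Q R \<sigma> V"
    and x: "fst (P a) \<bullet> x = 0" "fst (Q b) \<bullet> x = 0" "fst (R d) \<bullet> x = 0"
  shows "x = 0"
proof (rule orthogonal_to_dual_basis)
  have e: "ev p y - ev p w = fst p \<bullet> (y - w)" for p y w by (simp add: ev_def inner_diff_right)
  show "(V (\<not> a) b d - V a b d) \<bullet> fst (P a) \<noteq> 0" "(V (\<not> a) b d - V a b d) \<bullet> fst (Q b) = 0" "(V (\<not> a) b d - V a b d) \<bullet> fst (R d) = 0"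
    "(V a (\<not> b) d - V a b d) \<bullet> fst (P a) = 0" "(V a (\<not> b) d - V a b d) \<bullet> fst (Q b) \<noteq> 0" "(V a (\<not> b) d - V a b d) \<bullet> fst (R d) = 0"
    "(V a b (\<not> d) - V a b d) \<bullet> fst (P a) = 0" "(V a b (\<not> d) - V a b d) \<bullet> fst (Q b) = 0" "(V a b (\<not> d) - V a b d) \<bullet> fst (R d) \<noteq> 0"
    by (simp_all add: inner_commute[of _ "fst _"] e[symmetric] cube_planesD(4-6)[OF c] cube_planes_incidence[OF c])
  show "x \<bullet> fst (P a) = 0" "x \<bullet> fst (Q b) = 0" "x \<bullet> fst (R d) = 0" using x by (simp_all add: inner_commute)
qed

lemma cube_planes_dual_unique:
  assumes c: "cube_planes P Q R \<sigma> V"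
    and x: "x \<bullet> (V (\<not> a) b d - V a b d) = 0" "x \<bullet> (V a (\<not> b) d - V a b d) = 0" "x \<bullet> (V a b (\<not> d) - V a b d) = 0"
  shows "x = 0"
proof (rule orthogonal_to_dual_basis)
  have e: "ev p y - ev p w = fst p \<bullet> (y - w)" for p y w by (simp add: ev_def inner_diff_right)
  show "fst (P a) \<bullet> (V (\<not> a) b d - V a b d) \<noteq> 0" "fst (P a) \<bullet> (V a (\<not> b) d - V a b d) = 0" "fst (P a) \<bullet> (V a b (\<not> d) - V a b d) = 0"
    "fst (Q b) \<bullet> (V (\<not> a) b d - V a b d) = 0" "fst (Q b) \<bullet> (V a (\<not> b) d - V a b d) \<noteq> 0" "fst (Q b) \<bullet> (V a b (\<not> d) - V a b d) = 0"
    "fst (R d) \<bullet> (V (\<not> a) b d - V a b d) = 0" "fst (R d) \<bullet> (V a (\<not> b) d - V a b d) = 0" "fst (R d) \<bullet> (V a b (\<not> d) - V a b d) \<noteq> 0"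
    by (simp_all add: e[symmetric] cube_planesD(4-6)[OF c] cube_planes_incidence[OF c])
qed (use x in simp_all)

lemma ev_diff: "ev p y - ev p w = fst p \<bullet> (y - w)"
  by (simp add: ev_def inner_diff_right)

text \<open>A cube \<open>V\<close> and its mirror image \<open>V'\<close> under the reflection in
  \<open>u\<close>: corresponding planes span pencils through the same vector. The sphere
  \<open>(z, r)\<close> belongs to the first cube, and \<open>r\<close> is a signed radius.\<close>

locale laguerre_pair =
  fixes P Q R P' Q' R' :: "bool \<Rightarrow> laguerre" and \<sigma> \<tau> :: real and V V' :: cube_points
    and u :: laguerre and pa pb qa qb ra rb :: "bool \<Rightarrow> real" and z :: "real^3" and r :: real
  assumes cV: "cube_planes P Q R \<sigma> V" and cV': "cube_planes P' Q' R' \<tau> V'"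
    and uP: "\<And>e. u = pa e *\<^sub>R P e + pb e *\<^sub>R P' e"
    and uQ: "\<And>e. u = qa e *\<^sub>R Q e + qb e *\<^sub>R Q' e"
    and uR: "\<And>e. u = ra e *\<^sub>R R e + rb e *\<^sub>R R' e"
    and pos: "\<And>e. pa e > 0" "\<And>e. pb e > 0" "\<And>e. qa e > 0" "\<And>e. qb e > 0" "\<And>e. ra e > 0" "\<And>e. rb e > 0"
    and U: "lor u u \<noteq> 0"
    and tang: "\<And>e. sph (P e) z r = 0" "\<And>e. sph (Q e) z r = 0" "\<And>e. sph (R e) z r = 0"
    and r: "r \<noteq> 0" and sgn: "\<sigma> \<noteq> 0" "\<tau> \<noteq> 0"
begin

definition "z' = z - (2 * sph u z r / lor u u) *\<^sub>R fst u"
definition "r' = r + 2 * fst (snd u) * sph u z r / lor u u"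
abbreviation "T \<equiv> lag_map u z r"

lemma op: "oplane (P e)" "oplane (Q e)" "oplane (R e)" "oplane (P' e)" "oplane (Q' e)" "oplane (R' e)"
  using cV cV' by (auto simp: cube_planes_def)

text \<open>Mirroring the sphere lowers \<open>sph\<close> of a plane by a multiple of its product
  with \<open>u\<close>; the half from \<open>lor_refl_half\<close> makes the value at the mirrored
  plane vanish.\<close>

lemma sph_image_aux:
  assumes "u = a *\<^sub>R p + a' *\<^sub>R p'" "oplane p" "oplane p'" "sph p z r = 0" "a' > 0"
  shows "sph p' z' r' = 0"
proof -
  define e where "e = 2 * sph u z r / lor u u"
  have eU: "e * lor u u = 2 * sph u z r" using U by (simp add: e_def)
  have z': "z' = z - e *\<^sub>R fst u" and r'e: "r' = r + fst (snd u) * e"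
    by (simp_all add: z'_def r'_def e_def)
  have sp: "sph p z' r' = sph p z r - e * lor p u" for p
    by (simp add: sph_def ev_def lor_def z' r'e inner_diff_right algebra_simps)
  have "a' * sph p' z' r' = sph (u - a *\<^sub>R p) z' r'" by (simp add: assms(1))
  also have "\<dots> = sph u z r - e * lor u u + e * (a * lor p u)"
    by (simp add: sp assms(4) algebra_simps)
  also have "a * lor p u = lor u u / 2" using lor_refl_half[OF assms(1-3)] by simp
  finally have "a' * sph p' z' r' = 0" using eU by simp
  then show ?thesis using assms(5) by simp
qed

lemma tang': "sph (P' e) z' r' = 0" "sph (Q' e) z' r' = 0" "sph (R' e) z' r' = 0"
  using sph_image_aux[OF uP[of e]] sph_image_aux[OF uQ[of e]] sph_image_aux[OF uR[of e]] op tang pos by blast+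

lemma vertex':
  assumes "hev (P' a) X = 0" "hev (Q' b) X = 0" "hev (R' d) X = 0"
  shows "X = snd X *\<^sub>R (V' a b d, 1)"
proof -
  have v: "ev (P' a) (V' a b d) = 0" "ev (Q' b) (V' a b d) = 0" "ev (R' d) (V' a b d) = 0"
    using cV' by (auto simp: cube_planes_def)
  have h: "hev p X = fst p \<bullet> (fst X - snd X *\<^sub>R V' a b d) + snd X * ev p (V' a b d)" for p
    by (simp add: hev_def ev_def inner_diff_right algebra_simps)
  have "fst X - snd X *\<^sub>R V' a b d = 0"
    by (rule cube_planes_vertex_unique[OF cV', of a _ b d]) (use assms v in \<open>simp_all add: h\<close>)
  then show ?thesis by (simp add: prod_eq_iff)
qed

text \<open>A sphere of radius zero touching the six planes is a common point of them, and all
  vertices of the second cube would coincide. This keeps the denominator of \<open>lag_map\<close>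
  away from zero.\<close>

lemma r': "r' \<noteq> 0"
proof
  assume r0: "r' = 0"
  have h: "hev p (z', 1) = sph p z' r'" for p by (simp add: sph_def r0)
  have "(z', 1) = 1 *\<^sub>R (V' a b d, 1::real)" for a b d
    using vertex'[of a "(z', 1)" b d] tang'(1)[of a] tang'(2)[of b] tang'(3)[of d] unfolding h by simp
  then have "V' True True True = V' False True True" by (metis Pair_inject scaleR_one)
  then show False
    using cube_planes_incidence(1)[OF cV', of True True] cube_planes_incidence(1)[OF cV', of True False] by metis
qed

lemma N: "lor u u * r + 2 * fst (snd u) * sph u z r \<noteq> 0"
proof -
  have "lor u u * r + 2 * fst (snd u) * sph u z r = lor u u * r'"
    using U by (simp add: r'_def field_simps)
  then show ?thesis using U r' by simp
qed

lemmas bij = bij_lag_map[OF r U N]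

lemma rel: "pb e * hev (P' e) (T X) = - pa e * hev (P e) X"
  "qb e * hev (Q' e) (T X) = - qa e * hev (Q e) X" "rb e * hev (R' e) (T X) = - ra e * hev (R e) X"
  using hev_lag_map[OF uP op(1,4) tang(1) N] hev_lag_map[OF uQ op(2,5) tang(2) N]
    hev_lag_map[OF uR op(3,6) tang(3) N] by blast+

lemma vertex_image: "T (V a b d, 1) = snd (T (V a b d, 1)) *\<^sub>R (V' a b d, 1)"
proof (rule vertex')
  have v: "ev (P a) (V a b d) = 0" "ev (Q b) (V a b d) = 0" "ev (R d) (V a b d) = 0"
    using cV by (auto simp: cube_planes_def)
  show "hev (P' a) (T (V a b d, 1)) = 0" using rel(1)[of a "(V a b d, 1)"] v pos(2)[of a] by simp
  show "hev (Q' b) (T (V a b d, 1)) = 0" using rel(2)[of b "(V a b d, 1)"] v pos(4)[of b] by simp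
  show "hev (R' d) (T (V a b d, 1)) = 0" using rel(3)[of d "(V a b d, 1)"] v pos(6)[of d] by simp
qed

lemma vertex_image_ne: "snd (T (V a b d, 1)) \<noteq> 0"
proof
  assume "snd (T (V a b d, 1)) = 0"
  then have "T (V a b d, 1) = 0" using vertex_image[of a b d] by (metis scaleR_zero_left)
  then have "T (V a b d, 1) = T 0" using linear_0[OF linear_lag_map] by metis
  then have "(V a b d, 1::real) = 0" using bij by (meson bij_is_inj injD)
  then show False by (simp add: zero_prod_def)
qed

lemma proj_vertex: "proj_map T (V a b d) = V' a b d"
  by (rule proj_map_eqI[where T=T, OF vertex_image vertex_image_ne])

text \<open>Opposite signs mean that the cubes lie on opposite sides of corresponding oriented
  planes; the minus sign in \<open>rel\<close> compensates for this.\<close>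

lemma vertex_image_pos:
  assumes "\<sigma> * \<tau> < 0"
  shows "snd (T (V a b d, 1)) > 0"
proof -
  define t A B where "t = snd (T (V a b d, 1))" and "A = ev (P (\<not> a)) (V a b d)" and "B = ev (P' (\<not> a)) (V' a b d)"
  define X where "X = \<sigma>\<^sup>2 * pb (\<not> a) * (\<tau> * B)"
  have a: "\<sigma> * A < 0" "\<tau> * B < 0"
    using cube_planesD(7)[OF cV, of a "\<not> a" b d] cube_planesD(7)[OF cV', of a "\<not> a" b d]
    by (simp_all add: A_def B_def)
  have "pb (\<not> a) * (t * B) = - pa (\<not> a) * A"
    using rel(1)[of "\<not> a" "(V a b d, 1)"] unfolding t_def A_def B_def
    by (subst (asm) vertex_image) (simp only: hev_linear hev_point)
  moreover have "t * X = (\<sigma>\<^sup>2 * \<tau>) * (pb (\<not> a) * (t * B))" by (simp add: X_def)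
  ultimately have "t * X = - (\<sigma> * \<tau>) * pa (\<not> a) * (\<sigma> * A)" by (simp add: power2_eq_square)
  moreover have "- (\<sigma> * \<tau>) * pa (\<not> a) * (\<sigma> * A) < 0"
    by (rule mult_pos_neg[OF mult_pos_pos a(1)]) (use assms pos(1) in auto)
  ultimately have "t * X < 0" by simp
  moreover have "X < 0"
    unfolding X_def by (rule mult_pos_neg[OF mult_pos_pos a(2)]) (use pos(2) sgn in auto)
  ultimately show ?thesis unfolding t_def[symmetric] by (simp add: mult_less_0_iff)
qed

lemma circumscribed_image:
  assumes "\<sigma> * \<tau> < 0" "cubical_polytope V" "inscribed_sphere (cube_hull V) z \<bar>r\<bar>"
  shows "circumscribed V'"
proof -
  have "circumscribed (\<lambda>a b d. proj_map T (V a b d))"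
  proof (rule circumscribed_proj_map[OF linear_lag_map bij _ assms(2,3)])
    show "snd (T (V a b d, 1)) > 0" for a b d by (rule vertex_image_pos[OF assms(1)])
    show "\<bar>r'\<bar> > 0" using r' by simp
    show "(norm (fst (T (x, t)) - snd (T (x, t)) *\<^sub>R z'))\<^sup>2 - \<bar>r'\<bar>\<^sup>2 * (snd (T (x, t)))\<^sup>2
                 = (norm (x - t *\<^sub>R z))\<^sup>2 - \<bar>r\<bar>\<^sup>2 * t\<^sup>2" for x t
      using lag_map_sphere[OF U N, of x t] by (simp add: z'_def r'_def)
  qed
  then show ?thesis by (simp add: proj_vertex)
qed

text \<open>\<open>lag_map\<close> subtracts multiples of one fixed vector, so its point
  \<open>c\<close> is collinear with every point and its image. This point is finite because
  \<open>fst (snd u)\<close> is nonzero.\<close>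

lemma perspective_image:
  assumes ne: "\<And>a b d. V a b d \<noteq> V' a b d" and u: "fst (snd u) \<noteq> 0"
  shows "perspective V V'"
proof -
  define \<rho> where "\<rho> = fst (snd u)"
  define c where "c = (r / \<rho>) *\<^sub>R fst u + z"
  have "c \<in> affine hull {V a b d, V' a b d}" for a b d
  proof -
    let ?t = "snd (T (V a b d, 1))"
    define k where "k = 2 * hev u (V a b d, 1) / (lor u u * r + 2 * \<rho> * sph u z r)"
    have cc: "r *\<^sub>R fst u + \<rho> *\<^sub>R z = \<rho> *\<^sub>R c" using u by (simp add: c_def \<rho>_def scaleR_add_right)
    have "T (V a b d, 1) = (V a b d, 1) - k *\<^sub>R (\<rho> *\<^sub>R c, \<rho>)"
      by (simp add: lag_map_def k_def \<rho>_def[symmetric] cc)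
    then have t: "?t = 1 - k * \<rho>" and f: "fst (T (V a b d, 1)) = V a b d - (k * \<rho>) *\<^sub>R c" by simp_all
    have "fst (T (V a b d, 1)) = ?t *\<^sub>R V' a b d" using vertex_image[of a b d] by (metis fst_conv scaleR_Pair)
    then have e: "V a b d - (1 - ?t) *\<^sub>R c = ?t *\<^sub>R V' a b d" using t f by simp
    have "?t \<noteq> 1" using e ne[of a b d] by auto
    then have "1 - ?t \<noteq> 0" by simp
    have "(1 - ?t) *\<^sub>R c = V a b d - ?t *\<^sub>R V' a b d" using e by (simp add: algebra_simps)
    then have "(1 / (1 - ?t)) *\<^sub>R ((1 - ?t) *\<^sub>R c) = (1 / (1 - ?t)) *\<^sub>R (V a b d - ?t *\<^sub>R V' a b d)" by simp
    then have "c = (1 / (1 - ?t)) *\<^sub>R V a b d + (- ?t / (1 - ?t)) *\<^sub>R V' a b d"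
      using \<open>1 - ?t \<noteq> 0\<close> by (simp add: scaleR_diff_right)
    moreover have "1 / (1 - ?t) + (- ?t / (1 - ?t)) = 1" using \<open>1 - ?t \<noteq> 0\<close>
      by (simp add: field_simps)
    ultimately show ?thesis unfolding affine_hull_2 by blast
  qed
  then show ?thesis unfolding perspective_def using ne by blast
qed

end

subsection \<open>Lines and level planes of a net\<close>

text \<open>Betweenness gives consecutive parameter differences the same sign, and three points
  exclude a constant parametrization.\<close>

lemma on_line_param:
  assumes L: "on_line_in_order {a..b} g" and ab: "a + 2 \<le> b"
  shows "\<exists>x d \<tau>. d \<noteq> 0 \<and> (\<forall>k\<in>{a..b}. g k = x + \<tau> k *\<^sub>R d)
    \<and> (\<forall>k\<in>{a..b}. \<forall>l\<in>{a..b}. k < l \<longrightarrow> \<tau> k < (\<tau> l :: real))"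
proof -
  have "collinear (g ` {a..b})" using L by (simp add: on_line_in_order_def)
  then obtain u v where uv: "\<forall>y\<in>g ` {a..b}. \<exists>c. y = u + c *\<^sub>R v"
    unfolding collinear_alt by blast
  then have "\<forall>k\<in>{a..b}. \<exists>c. g k = u + c *\<^sub>R v" by blast
  from bchoice[OF this] obtain t where t: "\<And>k. k \<in> {a..b} \<Longrightarrow> g k = u + t k *\<^sub>R v" by blast
  have seg: "g k \<in> open_segment (g (k - 1)) (g (k + 1))" if "a < k" "k < b" for k
    using L that by (auto simp: on_line_in_order_def)
  have v: "v \<noteq> 0"
    using seg[of "a + 1"] t[of a] t[of "2 + a"] ab by (auto simp: in_segment)
  have same: "(t k - t (k - 1)) * (t (k + 1) - t k) > 0" if k: "a < k" "k < b" for k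
  proof -
    obtain w where w: "0 < w" "w < 1" "g k = (1 - w) *\<^sub>R g (k - 1) + w *\<^sub>R g (k + 1)"
      and ne: "g (k - 1) \<noteq> g (k + 1)"
      using seg[OF k] by (auto simp: in_segment)
    have e: "g k = u + t k *\<^sub>R v" "g (k - 1) = u + t (k - 1) *\<^sub>R v" "g (k + 1) = u + t (k + 1) *\<^sub>R v"
      using t[of k] t[of "k - 1"] t[of "k + 1"] k by auto
    have "t k *\<^sub>R v = ((1 - w) * t (k - 1) + w * t (k + 1)) *\<^sub>R v"
      using w(3) unfolding e by (simp add: algebra_simps)
    then have "t k = (1 - w) * t (k - 1) + w * t (k + 1)" using v by (simp only: scaleR_cancel_right) simp
    then have d: "t k - t (k - 1) = w * (t (k + 1) - t (k - 1))" "t (k + 1) - t k = (1 - w) * (t (k + 1) - t (k - 1))"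
      by (simp_all add: algebra_simps)
    have "t (k + 1) - t (k - 1) \<noteq> 0" using ne e by auto
    then have "(w * (1 - w)) * (t (k + 1) - t (k - 1))\<^sup>2 > 0" using w by simp
    then show ?thesis unfolding d by (simp add: power2_eq_square algebra_simps)
  qed
  \<comment> \<open>The common sign of all differences; multiplying parameter and direction by it
    makes the parameter increase.\<close>
  define s where "s = sgn (t (a + 1) - t a)"
  have s0: "s \<noteq> 0"
    using same[of "a + 1"] ab by (auto simp: s_def sgn_zero_iff)
  have ss: "s * s = 1" using s0 by (auto simp: s_def sgn_if)
  have step: "k < b \<longrightarrow> s * (t (k + 1) - t k) > 0" if "a \<le> k" for k
    using that
  proof (induction k rule: int_ge_induct)
    case base
    have "s * (t (a + 1) - t a) = \<bar>t (a + 1) - t a\<bar>" by (simp add: s_def sgn_mult_self_eq abs_sgn mult.commute)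
    then show ?case using s0 by (auto simp: s_def)
  next
    case (step k)
    show ?case
    proof
      assume k: "k + 1 < b"
      have "(t (k + 1) - t k) * (t (k + 1 + 1) - t (k + 1)) > 0" using same[of "k + 1"] step(1) k by simp
      moreover have "(s * x) * (s * y) = (s * s) * (x * y)" for x y by simp
      ultimately have "(s * (t (k + 1) - t k)) * (s * (t (k + 1 + 1) - t (k + 1))) > 0"
        by (simp only: ss mult_1_left)
      moreover have "s * (t (k + 1) - t k) > 0" using step k by simp
      ultimately show "s * (t (k + 1 + 1) - t (k + 1)) > 0" by (rule zero_less_mult_pos)
    qed
  qed
  have mono: "l \<le> b \<longrightarrow> s * t k < s * t l" if "k < l" "a \<le> k" for k l
    using that(1)
  proof (induction l rule: int_gr_induct)
    case base
    show ?case using step[of k] that by (auto simp: right_diff_distrib)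
  next
    case (step l)
    then show ?case using \<open>a \<le> l \<Longrightarrow> l < b \<longrightarrow> s * (t (l + 1) - t l) > 0\<close> that by (auto simp: right_diff_distrib)
  qed
  have "g k = u + (s * t k) *\<^sub>R (s *\<^sub>R v)" if "k \<in> {a..b}" for k
  proof -
    have "s * t k * s = (s * s) * t k" by simp
    then show ?thesis using t[OF that] by (simp only: scaleR_scaleR ss mult_1_left)
  qed
  moreover have "s *\<^sub>R v \<noteq> 0" using s0 v by simp
  moreover have "s * t k < s * t l" if "k \<in> {a..b}" "l \<in> {a..b}" "k < l" for k l
    using mono[OF that(3)] that by simp
  ultimately show ?thesis
    by (intro exI[of _ u] exI[of _ "s *\<^sub>R v"] exI[of _ "\<lambda>k. s * t k"]) blast
qed

lemma ev_affine: "ev p (x + t *\<^sub>R d) = ev p x + t * (fst p \<bullet> d)"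
  by (simp add: ev_def inner_add_right)

lemma on_line_zero:
  assumes L: "on_line_in_order {a..b} g" "a + 2 \<le> b" and k: "k \<in> {a..b}" "l \<in> {a..b}" "k \<noteq> l"
    and z: "ev p (g k) = 0" "ev p (g l) = 0" and m: "m \<in> {a..b}"
  shows "ev p (g m) = 0"
proof -
  obtain x d \<tau> where "d \<noteq> 0 \<and> (\<forall>k\<in>{a..b}. g k = x + \<tau> k *\<^sub>R d)
    \<and> (\<forall>k\<in>{a..b}. \<forall>l\<in>{a..b}. k < l \<longrightarrow> \<tau> k < (\<tau> l :: real))"
    using on_line_param[OF L] by blast
  then have p: "d \<noteq> 0" "\<And>k. k \<in> {a..b} \<Longrightarrow> g k = x + \<tau> k *\<^sub>R d"
    "\<And>k l. k \<in> {a..b} \<Longrightarrow> l \<in> {a..b} \<Longrightarrow> k < l \<Longrightarrow> \<tau> k < \<tau> l"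
    by blast+
  have "\<tau> k \<noteq> \<tau> l" using p(3)[OF k(1,2)] p(3)[OF k(2,1)] k(3) by (cases "k < l") auto
  moreover have e: "ev p x + \<tau> k * (fst p \<bullet> d) = 0" "ev p x + \<tau> l * (fst p \<bullet> d) = 0"
    using z p(2)[OF k(1)] p(2)[OF k(2)] by (simp_all add: ev_affine)
  have "(\<tau> k - \<tau> l) * (fst p \<bullet> d)
      = (ev p x + \<tau> k * (fst p \<bullet> d)) - (ev p x + \<tau> l * (fst p \<bullet> d))"
    by (simp add: left_diff_distrib)
  then have "(\<tau> k - \<tau> l) * (fst p \<bullet> d) = 0" using e by simp
  ultimately have "fst p \<bullet> d = 0" by simp
  then show ?thesis using e p(2)[OF m] by (simp add: ev_affine)
qed

lemma on_line_pencil: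
  assumes L: "on_line_in_order {a..b} g" "a + 2 \<le> b" and k: "k \<in> {a..b}" and z: "ev p (g k) = 0"
  shows "\<exists>\<tau> B. (\<forall>k\<in>{a..b}. \<forall>l\<in>{a..b}. k < l \<longrightarrow> \<tau> k < (\<tau> l :: real))
    \<and> (\<forall>n\<in>{a..b}. s * ev p (g n) = (\<tau> n - \<tau> k) * B)"
proof -
  obtain x d \<tau> where "d \<noteq> 0 \<and> (\<forall>k\<in>{a..b}. g k = x + \<tau> k *\<^sub>R d)
    \<and> (\<forall>k\<in>{a..b}. \<forall>l\<in>{a..b}. k < l \<longrightarrow> \<tau> k < (\<tau> l :: real))"
    using on_line_param[OF L] by blast
  then have p: "\<And>k. k \<in> {a..b} \<Longrightarrow> g k = x + \<tau> k *\<^sub>R d"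
    and m: "\<forall>k\<in>{a..b}. \<forall>l\<in>{a..b}. k < l \<longrightarrow> \<tau> k < \<tau> l"
    by blast+
  have k0: "ev p x = - \<tau> k * (fst p \<bullet> d)" using z p[OF k] by (simp add: ev_affine)
  have "s * ev p (g n) = (\<tau> n - \<tau> k) * (s * (fst p \<bullet> d))" if "n \<in> {a..b}" for n
    using p[OF that] k0 by (simp add: ev_affine algebra_simps)
  then show ?thesis using m by blast
qed

text \<open>An affine function with a zero on the line has constant sign on either side of it. The
  factor \<open>s\<close> lets one statement cover both orientations.\<close>

lemma on_line_sign_up:
  assumes L: "on_line_in_order {a..b} g" "a + 2 \<le> b" and k: "k \<in> {a..b}" "l \<in> {a..b}" "m \<in> {a..b}"
    and z: "ev p (g k) = 0" "s * ev p (g l) < 0" and kl: "k < l"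
  shows "k < m \<Longrightarrow> s * ev p (g m) < 0" "m < k \<Longrightarrow> s * ev p (g m) > 0"
proof -
  obtain \<tau> B where t: "\<forall>k\<in>{a..b}. \<forall>l\<in>{a..b}. k < l \<longrightarrow> \<tau> k < (\<tau> l :: real)"
    and f: "\<forall>n\<in>{a..b}. s * ev p (g n) = (\<tau> n - \<tau> k) * B"
    using on_line_pencil[OF L k(1) z(1)] by blast
  have "(\<tau> l - \<tau> k) * B < 0" using z(2) f k(2) by metis
  moreover have "\<tau> l - \<tau> k > 0" using t k kl by simp
  ultimately have B: "B < 0" by (simp add: mult_less_0_iff)
  have fm: "s * ev p (g m) = (\<tau> m - \<tau> k) * B" using f k(3) by blast
  show "s * ev p (g m) < 0" if "k < m"
  proof -
    have "\<tau> m - \<tau> k > 0" using t k that by simp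
    then show ?thesis unfolding fm using B by (rule mult_pos_neg)
  qed
  show "s * ev p (g m) > 0" if "m < k"
  proof -
    have "\<tau> m - \<tau> k < 0" using t k that by simp
    then show ?thesis unfolding fm using B by (rule mult_neg_neg)
  qed
qed

lemma on_line_sign_down:
  assumes L: "on_line_in_order {a..b} g" "a + 2 \<le> b" and k: "k \<in> {a..b}" "l \<in> {a..b}" "m \<in> {a..b}"
    and z: "ev p (g k) = 0" "s * ev p (g l) < 0" and kl: "l < k"
  shows "m < k \<Longrightarrow> s * ev p (g m) < 0" "k < m \<Longrightarrow> s * ev p (g m) > 0"
proof -
  obtain \<tau> B where t: "\<forall>k\<in>{a..b}. \<forall>l\<in>{a..b}. k < l \<longrightarrow> \<tau> k < (\<tau> l :: real)"
    and f: "\<forall>n\<in>{a..b}. s * ev p (g n) = (\<tau> n - \<tau> k) * B"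
    using on_line_pencil[OF L k(1) z(1)] by blast
  have "(\<tau> l - \<tau> k) * B < 0" using z(2) f k(2) by metis
  moreover have "\<tau> l - \<tau> k < 0" using t k kl by simp
  ultimately have B: "B > 0" by (simp add: mult_less_0_iff)
  have fm: "s * ev p (g m) = (\<tau> m - \<tau> k) * B" using f k(3) by blast
  show "s * ev p (g m) < 0" if "m < k"
  proof -
    have "\<tau> m - \<tau> k < 0" using t k that by simp
    then show ?thesis unfolding fm using B by (rule mult_neg_pos)
  qed
  show "s * ev p (g m) > 0" if "k < m"
  proof -
    have "\<tau> m - \<tau> k > 0" using t k that by simp
    then show ?thesis unfolding fm using B by (rule mult_pos_pos)
  qed
qed

lemma on_line_reverse:
  assumes "on_line_in_order {a..b} g"
  shows "on_line_in_order {1 - b..1 - a} (\<lambda>i. g (1 - i))"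
proof -
  have "(\<lambda>i. g (1 - i)) ` {1 - b..1 - a} = g ` {a..b}"
  proof (intro subset_antisym subsetI)
    fix y assume "y \<in> g ` {a..b}"
    then obtain i where "i \<in> {a..b}" "y = g i" by blast
    then show "y \<in> (\<lambda>i. g (1 - i)) ` {1 - b..1 - a}" by (intro image_eqI[of _ _ "1 - i"]) auto
  qed auto
  moreover have "g (1 - k) \<in> open_segment (g (1 - (k - 1))) (g (1 - (k + 1)))"
    if "k - 1 \<in> {1 - b..1 - a}" "k \<in> {1 - b..1 - a}" "k + 1 \<in> {1 - b..1 - a}" for k
  proof -
    have "g (1 - k) \<in> open_segment (g ((1 - k) - 1)) (g ((1 - k) + 1))"
    proof -
      have "\<forall>k. k - 1 \<in> {a..b} \<and> k \<in> {a..b} \<and> k + 1 \<in> {a..b} \<longrightarrow> g k \<in> open_segment (g (k - 1)) (g (k + 1))"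
        using assms unfolding on_line_in_order_def by blast
      then show ?thesis by (rule allE[of _ "1 - k"]) (use that in auto)
    qed
    then show ?thesis by (subst open_segment_commute) (simp add: algebra_simps)
  qed
  ultimately show ?thesis using assms unfolding on_line_in_order_def by simp
qed

text \<open>What the orientation argument takes from an IS-net: the spheres are dropped, the outward
  planes of the cells are kept. The form is symmetric in the three directions, so permutations and
  reversals of the indices act on it.\<close>

definition planar_net :: "int set \<Rightarrow> int set \<Rightarrow> int set \<Rightarrow> lattice_map \<Rightarrow> bool" where
  "planar_net I J K f \<longleftrightarrow>
     (\<forall>i\<in>I. \<forall>j\<in>J. on_line_in_order K (\<lambda>k. f i j k)) \<and>
     (\<forall>j\<in>J. \<forall>k\<in>K. on_line_in_order I (\<lambda>i. f i j k)) \<and>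
     (\<forall>i\<in>I. \<forall>k\<in>K. on_line_in_order J (\<lambda>j. f i j k)) \<and>
     (\<forall>i j k. is_net_cube I J K 1 i j k \<longrightarrow> (\<exists>P Q R. cube_planes P Q R 1 (net_cube f 1 i j k)))"

lemma cube_planes_swap12: "cube_planes P Q R \<sigma> V \<Longrightarrow> cube_planes Q P R \<sigma> (\<lambda>a b d. V b a d)"
  unfolding cube_planes_def by blast

lemma cube_planes_swap23: "cube_planes P Q R \<sigma> V \<Longrightarrow> cube_planes P R Q \<sigma> (\<lambda>a b d. V a d b)"
  unfolding cube_planes_def by blast

lemma net_cube_swap:
  "net_cube (\<lambda>j i k. f i j k) c j i k = (\<lambda>b a d. net_cube f c i j k a b d)"
  "net_cube (\<lambda>i k j. f i j k) c i k j = (\<lambda>a d b. net_cube f c i j k a b d)"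
  by (simp_all add: net_cube_def)

lemma is_net_cube_swap:
  "is_net_cube J I K c j i k = is_net_cube I J K c i j k"
  "is_net_cube I K J c i k j = is_net_cube I J K c i j k"
  by (auto simp: is_net_cube_def)

lemma planar_netD:
  assumes "planar_net I J K f"
  shows "i \<in> I \<Longrightarrow> j \<in> J \<Longrightarrow> on_line_in_order K (\<lambda>k. f i j k)"
    "j \<in> J \<Longrightarrow> k \<in> K \<Longrightarrow> on_line_in_order I (\<lambda>i. f i j k)"
    "i \<in> I \<Longrightarrow> k \<in> K \<Longrightarrow> on_line_in_order J (\<lambda>j. f i j k)"
    "is_net_cube I J K 1 i j k \<Longrightarrow> \<exists>P Q R. cube_planes P Q R 1 (net_cube f 1 i j k)"
  using assms unfolding planar_net_def by simp_all

lemma planar_net_swap12: "planar_net I J K f \<Longrightarrow> planar_net J I K (\<lambda>j i k. f i j k)"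
  unfolding planar_net_def[of J I K]
proof (intro conjI ballI allI impI)
  assume n: "planar_net I J K f"
  fix i j k assume "is_net_cube J I K 1 j i k"
  then have "is_net_cube I J K 1 i j k" by (simp add: is_net_cube_swap(1)[of I])
  from planar_netD(4)[OF n this] obtain P Q R where "cube_planes P Q R 1 (net_cube f 1 i j k)" by blast
  from cube_planes_swap12[OF this]
  show "\<exists>P Q R. cube_planes P Q R 1 (net_cube (\<lambda>j i k. f i j k) 1 j i k)"
    unfolding net_cube_swap(1)[where f=f] by blast
qed (simp_all add: planar_netD)

lemma planar_net_swap23: "planar_net I J K f \<Longrightarrow> planar_net I K J (\<lambda>i k j. f i j k)"
  unfolding planar_net_def[of I K J]
proof (intro conjI ballI allI impI)
  assume n: "planar_net I J K f"
  fix i j k assume "is_net_cube I K J 1 i k j"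
  then have "is_net_cube I J K 1 i j k" by (simp add: is_net_cube_swap(2)[of I J])
  from planar_netD(4)[OF n this] obtain P Q R where "cube_planes P Q R 1 (net_cube f 1 i j k)" by blast
  from cube_planes_swap23[OF this]
  show "\<exists>P Q R. cube_planes P Q R 1 (net_cube (\<lambda>i k j. f i j k) 1 i k j)"
    unfolding net_cube_swap(2)[where f=f] by blast
qed (simp_all add: planar_netD)

lemma cube_planes_flip:
  assumes "cube_planes P Q R \<sigma> V"
  shows "cube_planes (\<lambda>e. P (\<not> e)) Q R \<sigma> (\<lambda>a b d. V (\<not> a) b d)"
  by (simp add: cube_planes_def[of "\<lambda>e. P (\<not> e)"] cube_planesD[OF assms])

text \<open>The reversal \<open>i \<mapsto> 1 - i\<close> takes the interval from \<open>i\<close>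
  to \<open>i + 1\<close> to the one from \<open>- i\<close> to \<open>1 - i\<close>, so starting
  indices of cells keep their parity.\<close>

lemma planar_net_reverse:
  assumes "planar_net {a..b} J K f"
  shows "planar_net {1 - b..1 - a} J K (\<lambda>i. f (1 - i))"
  unfolding planar_net_def
proof (intro conjI ballI allI impI)
  have 1: "1 - i \<in> {a..b}" if "i \<in> {1 - b..1 - a}" for i using that by auto
  show "on_line_in_order K (f (1 - i) j)" if "i \<in> {1 - b..1 - a}" "j \<in> J" for i j
    using planar_netD(1)[OF assms 1[OF that(1)] that(2)] by simp
  show "on_line_in_order J (\<lambda>j. f (1 - i) j k)" if "i \<in> {1 - b..1 - a}" "k \<in> K" for i k
    using planar_netD(3)[OF assms 1[OF that(1)] that(2)] by simp
  show "on_line_in_order {1 - b..1 - a} (\<lambda>i. f (1 - i) j k)" if "j \<in> J" "k \<in> K" for j k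
    by (rule on_line_reverse[OF planar_netD(2)[OF assms that]])
  show "\<exists>P Q R. cube_planes P Q R 1 (net_cube (\<lambda>i. f (1 - i)) 1 i j k)"
    if "is_net_cube {1 - b..1 - a} J K 1 i j k" for i j k
  proof -
    have "is_net_cube {a..b} J K 1 (- i) j k" using that by (auto simp: is_net_cube_def)
    from planar_netD(4)[OF assms this] obtain P Q R where c: "cube_planes P Q R 1 (net_cube f 1 (- i) j k)"
      by blast
    have "net_cube (\<lambda>i. f (1 - i)) 1 i j k = (\<lambda>a b d. net_cube f 1 (- i) j k (\<not> a) b d)"
      by (intro ext) (auto simp: net_cube_def)
    then have "cube_planes (\<lambda>e. P (\<not> e)) Q R 1 (net_cube (\<lambda>i. f (1 - i)) 1 i j k)"
      using cube_planes_flip[OF c] by simp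
    then show ?thesis by blast
  qed
qed

text \<open>Two edges in the side fix the normal up to a factor, and unit length leaves only the
  orientation open.\<close>

lemma cube_planes_plane_unique:
  assumes c: "cube_planes P Q R \<sigma> V" and p: "oplane p" and z: "\<And>b d. ev p (V a b d) = 0"
  obtains t where "t = 1 \<or> t = - 1" "\<And>y. ev p y = t * ev (P a) y" "fst p = t *\<^sub>R fst (P a)"
proof -
  define w where "w = V (\<not> a) False False - V a False False"
  have n: "fst (P a) \<bullet> w \<noteq> 0"
    using cube_planes_incidence(1)[OF c, of a "\<not> a" False False] cube_planesD(4)[OF c, of a False False]
    by (simp add: w_def ev_diff[symmetric])
  define t where "t = (fst p \<bullet> w) / (fst (P a) \<bullet> w)"
  have "fst p - t *\<^sub>R fst (P a) = 0"
  proof (rule cube_planes_dual_unique[OF c, of _ a False False])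
    show "(fst p - t *\<^sub>R fst (P a)) \<bullet> (V (\<not> a) False False - V a False False) = 0"
      using n by (simp add: inner_diff_left t_def w_def[symmetric])
    have "fst p \<bullet> (V a x y - V a False False) = 0" "fst (P a) \<bullet> (V a x y - V a False False) = 0" for x y
      using z cube_planesD(4)[OF c] by (simp_all add: ev_diff[symmetric])
    then show "(fst p - t *\<^sub>R fst (P a)) \<bullet> (V a (\<not> False) False - V a False False) = 0"
      "(fst p - t *\<^sub>R fst (P a)) \<bullet> (V a False (\<not> False) - V a False False) = 0"
      by (simp_all add: inner_diff_left)
  qed
  then have f: "fst p = t *\<^sub>R fst (P a)" by simp
  have "norm (fst p) = \<bar>t\<bar> * norm (fst (P a))" by (simp add: f)
  then have "\<bar>t\<bar> = 1" using p cube_planesD(1)[OF c, of a] by (simp add: oplane_def)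
  then have "t = 1 \<or> t = - 1" by linarith
  moreover have "ev p y = t * ev (P a) y" for y
  proof -
    have "ev p y - ev p (V a False False) = t * (ev (P a) y - ev (P a) (V a False False))"
      by (simp only: ev_diff f inner_scaleR_left)
    then show ?thesis using z cube_planesD(4)[OF c] by simp
  qed
  ultimately show ?thesis using f that by blast
qed

lemma int_step2_invariant:
  fixes P :: "int \<Rightarrow> bool"
  assumes step: "\<And>j. lo \<le> j \<Longrightarrow> j + 2 \<le> hi \<Longrightarrow> even (j - j0) \<Longrightarrow> P j = P (j + 2)"
    and j0: "lo \<le> j0" "j0 \<le> hi" and j1: "lo \<le> j1" "j1 \<le> hi" and ev: "even (j1 - j0)"
  shows "P j0 = P j1"
proof -
  have *: "lo \<le> x \<Longrightarrow> x + 2 * int n \<le> hi \<Longrightarrow> even (x - j0) \<Longrightarrow> P x = P (x + 2 * int n)" for x n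
  proof (induction n)
    case (Suc n)
    then have "P x = P (x + 2 * int n)" by simp
    also have "\<dots> = P (x + 2 * int n + 2)" using Suc.prems by (intro step) auto
    finally show ?case by (simp add: algebra_simps)
  qed simp
  show ?thesis
  proof (cases "j0 \<le> j1")
    case True
    obtain m where m: "j1 - j0 = 2 * m" using ev by blast
    have "m \<ge> 0" using m True by simp
    then show ?thesis using *[of j0 "nat m"] m j0 j1 by (simp add: algebra_simps)
  next
    case False
    obtain m where m: "j1 - j0 = 2 * m" using ev by blast
    have "- m \<ge> 0" using m False by simp
    then show ?thesis using *[of j1 "nat (- m)"] m j0 j1 ev by (simp add: algebra_simps)
  qed
qed

section \<open>Orienting the plane of a level\<close>

definition opp :: "laguerre \<Rightarrow> laguerre" where
  "opp p = (- fst p, fst (snd p), - snd (snd p))"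

lemma ev_opp [simp]: "ev (opp p) x = - ev p x"
  by (simp add: ev_def opp_def)

lemma oplane_opp [simp]: "oplane (opp p) = oplane p"
  by (simp add: oplane_def opp_def)

definition flat :: "int set \<Rightarrow> int set \<Rightarrow> lattice_map \<Rightarrow> int \<Rightarrow> laguerre \<Rightarrow> bool" where
  "flat J K f i p \<longleftrightarrow> oplane p \<and> (\<forall>j\<in>J. \<forall>k\<in>K. ev p (f i j k) = 0)"

lemma flat_opp [simp]: "flat J K f i (opp p) = flat J K f i p"
  by (simp add: flat_def)

text \<open>The orientation that is outward for the cells starting at the level and inward for those
  ending there.\<close>

definition level_plane :: "int set \<Rightarrow> int set \<Rightarrow> int set \<Rightarrow> lattice_map \<Rightarrow> int \<Rightarrow> laguerre \<Rightarrow> bool" where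
  "level_plane I J K f i p \<longleftrightarrow> flat J K f i p \<and>
     (\<forall>j k. is_net_cube I J K 1 i j k \<longrightarrow> (\<forall>b d. ev p (f (i + 1) (j + of_bool b) (k + of_bool d)) < 0)) \<and>
     (\<forall>j k. is_net_cube I J K 1 (i - 1) j k \<longrightarrow> (\<forall>b d. ev p (f (i - 1) (j + of_bool b) (k + of_bool d)) > 0))"

locale thick_net =
  fixes a1 b1 a2 b2 a3 b3 :: int and f :: lattice_map
  assumes net: "planar_net {a1..b1} {a2..b2} {a3..b3} f"
    and thick: "a1 + 2 \<le> b1" "a2 + 2 \<le> b2" "a3 + 2 \<le> b3"
begin

abbreviation "cell i j k \<equiv> is_net_cube {a1..b1} {a2..b2} {a3..b3} 1 i j k"
abbreviation "fl i p \<equiv> flat {a2..b2} {a3..b3} f i p"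

lemma cell_iff: "cell i j k \<longleftrightarrow> even (i - j) \<and> even (i - k) \<and> a1 \<le> i \<and> i < b1 \<and> a2 \<le> j \<and> j < b2 \<and> a3 \<le> k \<and> k < b3"
  by (auto simp: is_net_cube_def)

lemma cell_exists:
  assumes "a1 \<le> i" "i < b1"
  shows "\<exists>j k. cell i j k"
proof -
  have "cell i (if even (i - a2) then a2 else a2 + 1) (if even (i - a3) then a3 else a3 + 1)"
    using assms thick by (auto simp: cell_iff)
  then show ?thesis by blast
qed

lemma net_cube_1: "net_cube f 1 i j k a b d = f (i + of_bool a) (j + of_bool b) (k + of_bool d)"
  by (simp add: net_cube_def)

lemma cell_planes:
  assumes "cell i j k"
  shows "\<exists>P Q R. cube_planes P Q R 1 (net_cube f 1 i j k)"
  using planar_netD(4)[OF net assms] .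

text \<open>The plane of one cell side contains two lines of the level, and every line of the level
  in the other direction meets both.\<close>

lemma flat_exists:
  assumes i: "a1 \<le> i" "i \<le> b1"
  shows "\<exists>p. fl i p"
proof -
  \<comment> \<open>The last level is taken as the upper side of a cell, every other one as a lower
    side.\<close>
  define i0 where "i0 = (if i < b1 then i else i - 1)"
  define e where "e = (i \<noteq> i0)"
  have ie: "i = i0 + of_bool e" by (auto simp: e_def i0_def)
  have "a1 \<le> i0" "i0 < b1" using i thick by (auto simp: i0_def)
  from cell_exists[OF this] obtain j k where c: "cell i0 j k" by blast
  from cell_planes[OF c] obtain P Q R where P: "cube_planes P Q R 1 (net_cube f 1 i0 j k)" by blast
  let ?p = "P e"
  have z: "ev ?p (f i (j + of_bool b) (k + of_bool d)) = 0" for b d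
    using cube_planesD(4)[OF P, of e b d] by (simp add: net_cube_1 ie)
  have jk: "j \<in> {a2..b2}" "j + 1 \<in> {a2..b2}" "k \<in> {a3..b3}" "k + 1 \<in> {a3..b3}" "i \<in> {a1..b1}"
    using c i by (auto simp: cell_iff)
  have z0: "ev ?p (f i j k') = 0" if "k' \<in> {a3..b3}" for k'
    by (rule on_line_zero[OF planar_netD(1)[OF net jk(5,1)] thick(3) jk(3,4)])
      (use z[of False False] z[of False True] that in auto)
  have z1: "ev ?p (f i (j + 1) k') = 0" if "k' \<in> {a3..b3}" for k'
    by (rule on_line_zero[OF planar_netD(1)[OF net jk(5,2)] thick(3) jk(3,4)])
      (use z[of True False] z[of True True] that in auto)
  have "ev ?p (f i j' k') = 0" if "j' \<in> {a2..b2}" "k' \<in> {a3..b3}" for j' k'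
    by (rule on_line_zero[OF planar_netD(3)[OF net jk(5) that(2)] thick(2) jk(1,2) _ z0[OF that(2)] z1[OF that(2)] that(1)])
      simp
  then show ?thesis using cube_planesD(1)[OF P, of e] unfolding flat_def by blast
qed

lemma upper_plane:
  assumes p: "fl i p" and c: "cell i j k" and P: "cube_planes P Q R 1 (net_cube f 1 i j k)"
  obtains t where "t = 1 \<or> t = - 1" "\<And>y. ev p y = t * ev (P False) y"
proof -
  have "ev p (net_cube f 1 i j k False b d) = 0" for b d
    using p c by (auto simp: flat_def net_cube_1 cell_iff of_bool_def)
  moreover have "oplane p" using p by (simp add: flat_def)
  ultimately show ?thesis using cube_planes_plane_unique[OF P] that by metis
qed

lemma lower_plane:
  assumes p: "fl i p" and c: "cell (i - 1) j k" and P: "cube_planes P Q R 1 (net_cube f 1 (i - 1) j k)"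
  obtains t where "t = 1 \<or> t = - 1" "\<And>y. ev p y = t * ev (P True) y"
proof -
  have "ev p (net_cube f 1 (i - 1) j k True b d) = 0" for b d
    using p c by (auto simp: flat_def net_cube_1 cell_iff of_bool_def)
  moreover have "oplane p" using p by (simp add: flat_def)
  ultimately show ?thesis using cube_planes_plane_unique[OF P] that by metis
qed

lemma upper_same:
  assumes p: "fl i p" and c: "cell i j k"
  shows "ev p (f (i + 1) (j + of_bool b) (k + of_bool d)) < 0 \<longleftrightarrow> ev p (f (i + 1) j k) < 0"
    "ev p (f (i + 1) (j + of_bool b) (k + of_bool d)) \<noteq> 0"
proof -
  from cell_planes[OF c] obtain P Q R where P: "cube_planes P Q R 1 (net_cube f 1 i j k)" by blast
  obtain t where t: "t = 1 \<or> t = - 1" "\<And>y. ev p y = t * ev (P False) y" using upper_plane[OF p c P] by blast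
  have n: "ev (P False) (f (i + 1) (j + of_bool b) (k + of_bool d)) < 0" for b d
    using cube_planesD(7)[OF P, of True False b d] by (simp add: net_cube_1)
  show "ev p (f (i + 1) (j + of_bool b) (k + of_bool d)) < 0 \<longleftrightarrow> ev p (f (i + 1) j k) < 0"
    using t(1) n[of b d] n[of False False] by (auto simp: t(2))
  show "ev p (f (i + 1) (j + of_bool b) (k + of_bool d)) \<noteq> 0"
    using t(1) n[of b d] by (auto simp: t(2))
qed

lemma lower_same:
  assumes p: "fl i p" and c: "cell (i - 1) j k"
  shows "ev p (f (i - 1) (j + of_bool b) (k + of_bool d)) > 0 \<longleftrightarrow> ev p (f (i - 1) j k) > 0"
    "ev p (f (i - 1) (j + of_bool b) (k + of_bool d)) \<noteq> 0"
proof -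
  from cell_planes[OF c] obtain P Q R where P: "cube_planes P Q R 1 (net_cube f 1 (i - 1) j k)" by blast
  obtain t where t: "t = 1 \<or> t = - 1" "\<And>y. ev p y = t * ev (P True) y" using lower_plane[OF p c P] by blast
  have n: "ev (P True) (f (i - 1) (j + of_bool b) (k + of_bool d)) < 0" for b d
    using cube_planesD(7)[OF P, of False True b d] by (simp add: net_cube_1)
  show "ev p (f (i - 1) (j + of_bool b) (k + of_bool d)) > 0 \<longleftrightarrow> ev p (f (i - 1) j k) > 0"
    using t(1) n[of b d] n[of False False] by (auto simp: t(2))
  show "ev p (f (i - 1) (j + of_bool b) (k + of_bool d)) \<noteq> 0"
    using t(1) n[of b d] by (auto simp: t(2))
qed

lemma across:
  assumes p: "fl i p" and i: "a1 < i" "i < b1" and jk: "j \<in> {a2..b2}" "k \<in> {a3..b3}"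
  shows "ev p (f (i + 1) j k) < 0 \<longleftrightarrow> ev p (f (i - 1) j k) > 0"
proof -
  note L = planar_netD(2)[OF net jk] thick(1)
  have m: "i \<in> {a1..b1}" "i + 1 \<in> {a1..b1}" "i - 1 \<in> {a1..b1}" using i by auto
  have z: "ev p (f i j k) = 0" using p jk by (simp add: flat_def)
  show ?thesis
  proof
    assume "ev p (f (i + 1) j k) < 0"
    then show "ev p (f (i - 1) j k) > 0"
      using on_line_sign_up(2)[OF L m z, of 1] by simp
  next
    assume "ev p (f (i - 1) j k) > 0"
    then show "ev p (f (i + 1) j k) < 0"
      using on_line_sign_down(2)[OF L m(1,3,2) z, of "- 1"] by simp
  qed
qed

text \<open>The cells \<open>j\<close> and \<open>j + 2\<close> above the level have no common
  vertex, but a cell below it, displaced by one in the second and third index, shares a vertex with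
  each. The sign is carried down and up again along the lines through these vertices.\<close>

lemma step_j_interior:
  assumes p: "fl i p" and i: "a1 < i" "i < b1" and c: "cell i j k" "cell i (j + 2) k"
  shows "ev p (f (i + 1) j k) < 0 \<longleftrightarrow> ev p (f (i + 1) (j + 2) k) < 0"
proof -
  define x where "x = (k + 2 \<le> b3)"
  define k' where "k' = (if x then k + 1 else k - 1)"
  define l where "l = k + of_bool x"
  have lk: "l = k' + of_bool (\<not> x)" by (auto simp: l_def k'_def)
  have low: "cell (i - 1) (j + 1) k'"
    using c i thick by (auto simp: cell_iff k'_def x_def)
  have J: "j + 1 \<in> {a2..b2}" "j + 2 \<in> {a2..b2}" "l \<in> {a3..b3}"
    using c by (auto simp: cell_iff l_def x_def)
  have "ev p (f (i + 1) j k) < 0 \<longleftrightarrow> ev p (f (i + 1) (j + 1) l) < 0"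
    using upper_same(1)[OF p c(1), of True x] by (simp add: l_def)
  also have "\<dots> \<longleftrightarrow> ev p (f (i - 1) (j + 1) l) > 0" by (rule across[OF p i J(1,3)])
  also have "\<dots> \<longleftrightarrow> ev p (f (i - 1) (j + 2) l) > 0"
    using lower_same(1)[OF p low, of False "\<not> x"] lower_same(1)[OF p low, of True "\<not> x"]
    by (simp add: lk add.commute)
  also have "\<dots> \<longleftrightarrow> ev p (f (i + 1) (j + 2) l) < 0" by (rule across[OF p i J(2,3), symmetric])
  also have "\<dots> \<longleftrightarrow> ev p (f (i + 1) (j + 2) k) < 0"
    using upper_same(1)[OF p c(2), of False x] by (simp add: l_def)
  finally show ?thesis .
qed

end

lemma thick_net_swap12: "thick_net a1 b1 a2 b2 a3 b3 f \<Longrightarrow> thick_net a2 b2 a1 b1 a3 b3 (\<lambda>j i k. f i j k)"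
  unfolding thick_net_def using planar_net_swap12 by blast

lemma thick_net_swap23: "thick_net a1 b1 a2 b2 a3 b3 f \<Longrightarrow> thick_net a1 b1 a3 b3 a2 b2 (\<lambda>i k j. f i j k)"
  unfolding thick_net_def using planar_net_swap23 by blast

lemma thick_net_reverse: "thick_net a1 b1 a2 b2 a3 b3 f \<Longrightarrow> thick_net (1 - b1) (1 - a1) a2 b2 a3 b3 (\<lambda>i. f (1 - i))"
  unfolding thick_net_def using planar_net_reverse by auto

context thick_net
begin

text \<open>\<open>step_j\<close> and \<open>step_k\<close> connect all cells above the level, so
  one orientation fits them all; the cells below follow along lines through common vertices.\<close>

lemma flat_level_plane:
  assumes p: "fl i p" and i: "a1 \<le> i" "i < b1"
    and step_j: "\<And>j k. cell i j k \<Longrightarrow> cell i (j + 2) k \<Longrightarrow> ev p (f (i + 1) j k) < 0 \<longleftrightarrow> ev p (f (i + 1) (j + 2) k) < 0"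
    and step_k: "\<And>j k. cell i j k \<Longrightarrow> cell i j (k + 2) \<Longrightarrow> ev p (f (i + 1) j k) < 0 \<longleftrightarrow> ev p (f (i + 1) j (k + 2)) < 0"
  shows "\<exists>p. level_plane {a1..b1} {a2..b2} {a3..b3} f i p"
proof -
  have "\<exists>j k. cell i j k" by (rule cell_exists[OF i])
  then obtain j0 k0 where c0: "cell i j0 k0" by (elim exE)
  have same: "ev p (f (i + 1) j0 k0) < 0 \<longleftrightarrow> ev p (f (i + 1) j k) < 0" if c: "cell i j k" for j k
  proof -
    have "ev p (f (i + 1) j0 k0) < 0 \<longleftrightarrow> ev p (f (i + 1) j k0) < 0"
      by (rule int_step2_invariant[where lo = a2 and hi = "b2 - 1" and P = "\<lambda>j. ev p (f (i + 1) j k0) < 0"])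
        (use c c0 in \<open>auto simp: cell_iff intro!: step_j\<close>)
    also have "\<dots> \<longleftrightarrow> ev p (f (i + 1) j k) < 0"
      by (rule int_step2_invariant[where lo = a3 and hi = "b3 - 1" and P = "\<lambda>k. ev p (f (i + 1) j k) < 0"])
        (use c c0 in \<open>auto simp: cell_iff intro!: step_k\<close>)
    finally show ?thesis .
  qed
  define q where "q = (if ev p (f (i + 1) j0 k0) < 0 then p else opp p)"
  have q: "fl i q" using p by (simp add: q_def)
  have up: "ev q (f (i + 1) (j + of_bool b) (k + of_bool d)) < 0" if c: "cell i j k" for j k b d
    using same[OF c] upper_same[OF p c, of b d] by (auto simp: q_def)
  have low: "ev q (f (i - 1) (j + of_bool b) (k + of_bool d)) > 0" if c: "cell (i - 1) j k" for j k b d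
  proof -
    \<comment> \<open>Picks an upper cell that shares exactly one vertex with the lower one and
      stays inside the cuboid.\<close>
    define x y where "x = (j + 2 \<le> b2)" and "y = (k + 2 \<le> b3)"
    define j' k' where "j' = (if x then j + 1 else j - 1)" and "k' = (if y then k + 1 else k - 1)"
    have c': "cell i j' k'" using c i thick by (auto simp: cell_iff j'_def k'_def x_def y_def)
    have e: "j + of_bool x = j' + of_bool (\<not> x)" "k + of_bool y = k' + of_bool (\<not> y)"
      by (auto simp: j'_def k'_def)
    have "ev q (f (i + 1) (j + of_bool x) (k + of_bool y)) < 0" unfolding e by (rule up[OF c'])
    moreover have "j + of_bool x \<in> {a2..b2}" "k + of_bool y \<in> {a3..b3}" "a1 < i"
      using c by (auto simp: cell_iff x_def y_def)
    ultimately have "ev q (f (i - 1) (j + of_bool x) (k + of_bool y)) > 0"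
      using across[OF q _ i(2)] by blast
    then show ?thesis using lower_same(1)[OF q c] by blast
  qed
  show ?thesis unfolding level_plane_def using q up low by blast
qed

end

lemma (in thick_net) step_k_interior:
  assumes p: "fl i p" and i: "a1 < i" "i < b1" and c: "cell i j k" "cell i j (k + 2)"
  shows "ev p (f (i + 1) j k) < 0 \<longleftrightarrow> ev p (f (i + 1) j (k + 2)) < 0"
proof (rule thick_net.step_j_interior[OF thick_net_swap23[OF thick_net_axioms]])
  show "flat {a3..b3} {a2..b2} (\<lambda>i k j. f i j k) i p" using p by (auto simp: flat_def)
  show "is_net_cube {a1..b1} {a3..b3} {a2..b2} 1 i k j" "is_net_cube {a1..b1} {a3..b3} {a2..b2} 1 i (k + 2) j"
    using c by (auto simp: is_net_cube_def)
qed (rule i)+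

lemma (in thick_net) level_plane_interior:
  assumes "a1 < i" "i < b1"
  shows "\<exists>p. level_plane {a1..b1} {a2..b2} {a3..b3} f i p"
proof -
  from flat_exists[of i] assms obtain p where p: "fl i p" by auto
  show ?thesis
    by (rule flat_level_plane[OF p _ assms(2)]) (use assms step_j_interior[OF p assms] step_k_interior[OF p assms] in auto)
qed

text \<open>
  Otherwise the coplanar lines \<open>j \<mapsto> f a1 j k\<close> and \<open>j \<mapsto> f (a1 + 1) j k\<close> would cross between \<open>j\<close> and \<open>j + 2\<close>.
\<close>
lemma (in thick_net) strip:
  assumes p: "fl a1 p" and p1: "level_plane {a1..b1} {a2..b2} {a3..b3} f (a1 + 1) p1"
    and c: "cell a1 j k" "cell a1 (j + 2) k" and neg: "ev p (f (a1 + 1) j k) < 0"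
  shows "ev p (f (a1 + 1) (j + 2) k) < 0"
proof (rule ccontr)
  assume "\<not> ev p (f (a1 + 1) (j + 2) k) < 0"
  then have pos2: "ev p (f (a1 + 1) (j + 2) k) > 0" using upper_same(2)[OF p c(2), of False False] by simp
  define A where "A = (\<lambda>j. f a1 j k)"
  define B where "B = (\<lambda>j. f (a1 + 1) j k)"
  have m: "a1 \<in> {a1..b1}" "a1 + 1 \<in> {a1..b1}" "k \<in> {a3..b3}" using thick c by (auto simp: cell_iff)
  have LA: "on_line_in_order {a2..b2} A" and LB: "on_line_in_order {a2..b2} B"
    using planar_netD(3)[OF net m(1,3)] planar_netD(3)[OF net m(2,3)] by (simp_all add: A_def B_def)
  have J: "j \<in> {a2..b2}" "j + 1 \<in> {a2..b2}" "j + 2 \<in> {a2..b2}" "j + 3 \<in> {a2..b2}"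
    using c by (auto simp: cell_iff)
  from cell_planes[OF c(1)] obtain P Q R where P: "cube_planes P Q R 1 (net_cube f 1 a1 j k)" by blast
  from cell_planes[OF c(2)] obtain P2 Q2 R2 where P2: "cube_planes P2 Q2 R2 1 (net_cube f 1 a1 (j + 2) k)" by blast
  let ?q = "Q False" and ?q3 = "Q2 True" and ?r = "R False"
  have q: "ev ?q (A j) = 0" "ev ?q (B j) = 0" "ev ?q (A (j + 1)) < 0" "ev ?q (B (j + 1)) < 0"
    using cube_planesD(5)[OF P, of False False False] cube_planesD(5)[OF P, of False True False]
      cube_planesD(8)[OF P, of True False False False] cube_planesD(8)[OF P, of True False True False]
    by (simp_all add: net_cube_1 A_def B_def)
  have q3: "ev ?q3 (A (j + 3)) = 0" "ev ?q3 (B (j + 3)) = 0" "ev ?q3 (A (j + 2)) < 0" "ev ?q3 (B (j + 2)) < 0"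
    using cube_planesD(5)[OF P2, of True False False] cube_planesD(5)[OF P2, of True True False]
      cube_planesD(8)[OF P2, of False True False False] cube_planesD(8)[OF P2, of False True True False]
    by (simp_all add: net_cube_1 A_def B_def add.commute[of 3])
  have r: "ev ?r (A j) = 0" "ev ?r (B j) = 0" "ev ?r (A (j + 1)) = 0" "ev ?r (B (j + 1)) = 0"
    using cube_planesD(6)[OF P, of False False False] cube_planesD(6)[OF P, of False True False]
      cube_planesD(6)[OF P, of False False True] cube_planesD(6)[OF P, of False True True]
    by (simp_all add: net_cube_1 A_def B_def)
  have qB: "ev ?q (B (j + 2)) < 0"
    using on_line_sign_up(1)[OF LB thick(2) J(1,2,3) q(2), of 1] q(4) by simp
  have q3B: "ev ?q3 (B (j + 1)) < 0"
    using on_line_sign_down(1)[OF LB thick(2) J(4,3,2) q3(2), of 1] q3(4) by simp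
  have rB: "ev ?r (B (j + 2)) = 0"
    by (rule on_line_zero[OF LB thick(2) J(1,2) _ r(2,4) J(3)]) simp
  define g1 g2 where "g1 = ev p (B (j + 1))" and "g2 = ev p (B (j + 2))"
  have g: "g1 < 0" "g2 > 0"
    using upper_same(1)[OF p c(1), of True False] neg pos2 by (simp_all add: g1_def g2_def B_def)
  \<comment> \<open>\<open>X\<close> is the point between \<open>B (j + 1)\<close> and
    \<open>B (j + 2)\<close> where the line \<open>B\<close> crosses the plane
    \<open>p\<close>.\<close>
  define \<theta> where "\<theta> = - g1 / (g2 - g1)"
  have th: "0 < \<theta>" "\<theta> < 1" using g by (simp_all add: \<theta>_def field_simps)
  define X where "X = (1 - \<theta>) *\<^sub>R B (j + 1) + \<theta> *\<^sub>R B (j + 2)"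
  have evX: "ev s X = (1 - \<theta>) * ev s (B (j + 1)) + \<theta> * ev s (B (j + 2))" for s
    by (simp add: X_def ev_def inner_add_right algebra_simps)
  have pX: "ev p X = 0"
  proof -
    have "(1 - \<theta>) * g1 + \<theta> * g2 = g1 + \<theta> * (g2 - g1)" by (simp add: algebra_simps)
    also have "\<dots> = 0" using g by (simp add: \<theta>_def)
    finally show ?thesis by (simp add: evX g1_def g2_def)
  qed
  have qX: "ev ?q X < 0"
    unfolding evX using th q(4) qB by (intro add_neg_neg mult_pos_neg) auto
  have q3X: "ev ?q3 X < 0"
    unfolding evX using th q3(4) q3B by (intro add_neg_neg mult_pos_neg) auto
  have rX: "ev ?r X = 0" by (simp add: evX r rB)
  have hB: "ev p1 (B j') = 0" if "j' \<in> {a2..b2}" for j'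
    using p1 that m by (simp add: level_plane_def flat_def B_def)
  have hX: "ev p1 X = 0" by (simp add: evX hB[OF J(2)] hB[OF J(3)])
  have hA: "ev p1 (A j) > 0" "ev p1 (A (j + 3)) > 0"
  proof -
    have "\<forall>j k. cell (a1 + 1 - 1) j k \<longrightarrow> (\<forall>b d. ev p1 (f (a1 + 1 - 1) (j + of_bool b) (k + of_bool d)) > 0)"
      using p1 unfolding level_plane_def by blast
    then have *: "ev p1 (f a1 (j + of_bool b) (k + of_bool d)) > 0" if "cell a1 j k" for j k b d
      using that by simp
    show "ev p1 (A j) > 0" using *[OF c(1), of False False] by (simp add: A_def)
    show "ev p1 (A (j + 3)) > 0" using *[OF c(2), of True False] by (simp add: A_def add.commute[of 3])
  qed
  obtain t where t: "t = 1 \<or> t = - 1" "\<And>y. ev p y = t * ev (P False) y" using upper_plane[OF p c(1) P] by blast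
  \<comment> \<open>\<open>X\<close> lies on \<open>p\<close> and on \<open>?r\<close>, which meet
    in the line \<open>A\<close>; its position there is read off from \<open>?q\<close>.\<close>
  define \<kappa> where "\<kappa> = ev ?q X / ev ?q (A (j + 1))"
  have "X - A j - \<kappa> *\<^sub>R (A (j + 1) - A j) = 0"
  proof (rule cube_planes_vertex_unique[OF P])
    have e: "fst s \<bullet> (X - A j - \<kappa> *\<^sub>R (A (j + 1) - A j)) = (ev s X - ev s (A j)) - \<kappa> * (ev s (A (j + 1)) - ev s (A j))" for s
      by (simp add: ev_def inner_diff_right algebra_simps)
    have "ev p (A j) = 0" "ev p (A (j + 1)) = 0" using p m J by (simp_all add: flat_def A_def)
    then have "ev (P False) (A j) = 0" "ev (P False) (A (j + 1)) = 0" "ev (P False) X = 0"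
      using t pX by auto
    then show "fst (P False) \<bullet> (X - A j - \<kappa> *\<^sub>R (A (j + 1) - A j)) = 0" by (simp add: e)
    show "fst (Q False) \<bullet> (X - A j - \<kappa> *\<^sub>R (A (j + 1) - A j)) = 0"
      unfolding e using q by (simp add: \<kappa>_def)
    show "fst (R False) \<bullet> (X - A j - \<kappa> *\<^sub>R (A (j + 1) - A j)) = 0" by (simp add: e r rX)
  qed
  then have XA: "X = A j + \<kappa> *\<^sub>R (A (j + 1) - A j)" by (simp add: algebra_simps)
  obtain x d \<tau> where xd: "d \<noteq> 0 \<and> (\<forall>k\<in>{a2..b2}. A k = x + \<tau> k *\<^sub>R d)
    \<and> (\<forall>k\<in>{a2..b2}. \<forall>l\<in>{a2..b2}. k < l \<longrightarrow> \<tau> k < (\<tau> l :: real))"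
    using on_line_param[OF LA thick(2)] by blast
  have Ax: "A j = x + \<tau> j *\<^sub>R d" "A (j + 1) = x + \<tau> (j + 1) *\<^sub>R d" "A (j + 2) = x + \<tau> (j + 2) *\<^sub>R d"
     "A (j + 3) = x + \<tau> (j + 3) *\<^sub>R d" using xd J by blast+
  have mono: "\<tau> j < \<tau> (j + 1)" "\<tau> (j + 2) < \<tau> (j + 3)" using xd J by simp_all
  define \<xi> where "\<xi> = \<tau> j + \<kappa> * (\<tau> (j + 1) - \<tau> j)"
  have Xx: "X = x + \<xi> *\<^sub>R d" unfolding XA Ax \<xi>_def by (simp add: algebra_simps)
  have d: "ev s X - ev s (A j) = (\<xi> - \<tau> j) * (fst s \<bullet> d)"
    "ev s X - ev s (A (j + 3)) = (\<xi> - \<tau> (j + 3)) * (fst s \<bullet> d)"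
    "ev s (A (j + 1)) - ev s (A j) = (\<tau> (j + 1) - \<tau> j) * (fst s \<bullet> d)"
    "ev s (A (j + 2)) - ev s (A (j + 3)) = (\<tau> (j + 2) - \<tau> (j + 3)) * (fst s \<bullet> d)" for s
    unfolding Xx Ax ev_affine by (simp_all add: algebra_simps)
  \<comment> \<open>The sides \<open>?q\<close> and \<open>?q3\<close> place \<open>X\<close>
    strictly between \<open>A j\<close> and \<open>A (j + 3)\<close>. At both of these
    \<open>p1\<close> is positive, yet it vanishes at \<open>X\<close>.\<close>
  have "(\<tau> (j + 1) - \<tau> j) * (fst ?q \<bullet> d) < 0" using d(3)[of ?q] q by simp
  then have Bq: "fst ?q \<bullet> d < 0" using mono by (simp add: mult_less_0_iff)
  have "(\<xi> - \<tau> j) * (fst ?q \<bullet> d) < 0" using d(1)[of ?q] q qX by simp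
  then have xi1: "\<xi> - \<tau> j > 0" using Bq by (simp add: mult_less_0_iff)
  have "(\<xi> - \<tau> j) * (fst p1 \<bullet> d) < 0" using d(1)[of p1] hA hX by simp
  then have Bh: "fst p1 \<bullet> d < 0" using xi1 by (simp add: mult_less_0_iff)
  have "(\<tau> (j + 2) - \<tau> (j + 3)) * (fst ?q3 \<bullet> d) < 0" using d(4)[of ?q3] q3 by simp
  then have B3: "fst ?q3 \<bullet> d > 0" using mono by (simp add: mult_less_0_iff)
  have "(\<xi> - \<tau> (j + 3)) * (fst ?q3 \<bullet> d) < 0" using d(2)[of ?q3] q3 q3X by simp
  then have "\<xi> - \<tau> (j + 3) < 0" using B3 by (simp add: mult_less_0_iff)
  then have "(\<xi> - \<tau> (j + 3)) * (fst p1 \<bullet> d) > 0" using Bh by (rule mult_neg_neg)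
  then show False using d(2)[of p1] hA hX by simp
qed

lemma (in thick_net) step_j_boundary:
  assumes p: "fl a1 p" and c: "cell a1 j k" "cell a1 (j + 2) k"
  shows "ev p (f (a1 + 1) j k) < 0 \<longleftrightarrow> ev p (f (a1 + 1) (j + 2) k) < 0"
proof -
  from level_plane_interior[of "a1 + 1"] thick obtain p1
    where p1: "level_plane {a1..b1} {a2..b2} {a3..b3} f (a1 + 1) p1" by auto
  show ?thesis
  proof
    show "ev p (f (a1 + 1) j k) < 0 \<Longrightarrow> ev p (f (a1 + 1) (j + 2) k) < 0" by (rule strip[OF p p1 c])
    show "ev p (f (a1 + 1) (j + 2) k) < 0 \<Longrightarrow> ev p (f (a1 + 1) j k) < 0"
      \<comment> \<open>The converse is the same crossing argument for the reversed plane.\<close>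
      using strip[OF _ p1 c, of "opp p"] p upper_same(2)[OF p c(1), of False False] by fastforce
  qed
qed

lemma (in thick_net) step_k_boundary:
  assumes p: "fl a1 p" and c: "cell a1 j k" "cell a1 j (k + 2)"
  shows "ev p (f (a1 + 1) j k) < 0 \<longleftrightarrow> ev p (f (a1 + 1) j (k + 2)) < 0"
proof (rule thick_net.step_j_boundary[OF thick_net_swap23[OF thick_net_axioms]])
  show "flat {a3..b3} {a2..b2} (\<lambda>i k j. f i j k) a1 p" using p by (auto simp: flat_def)
  show "is_net_cube {a1..b1} {a3..b3} {a2..b2} 1 a1 k j" "is_net_cube {a1..b1} {a3..b3} {a2..b2} 1 a1 (k + 2) j"
    using c by (auto simp: is_net_cube_def)
qed

lemma (in thick_net) level_plane_upper:
  assumes "a1 \<le> i" "i < b1"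
  shows "\<exists>p. level_plane {a1..b1} {a2..b2} {a3..b3} f i p"
proof (cases "i = a1")
  case True
  from flat_exists[of a1] thick obtain p where p: "fl a1 p" by auto
  show ?thesis unfolding True
    by (rule flat_level_plane[OF p]) (use thick step_j_boundary[OF p] step_k_boundary[OF p] in auto)
qed (use assms level_plane_interior in auto)

lemma (in thick_net) level_plane_exists:
  assumes "a1 \<le> i" "i \<le> b1"
  shows "\<exists>p. level_plane {a1..b1} {a2..b2} {a3..b3} f i p"
proof (cases "i = b1")
  case True
  \<comment> \<open>Reversal makes \<open>b1\<close> the first level. It also exchanges the two
    sides, which \<open>opp\<close> undoes.\<close>
  obtain p where p: "level_plane {1 - b1..1 - a1} {a2..b2} {a3..b3} (\<lambda>i. f (1 - i)) (1 - b1) p"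
    using thick_net.level_plane_upper[OF thick_net_reverse[OF thick_net_axioms], of "1 - b1"] thick by auto
  have "level_plane {a1..b1} {a2..b2} {a3..b3} f b1 (opp p)"
    unfolding level_plane_def
  proof (intro conjI allI impI)
    show "fl b1 (opp p)" using p by (simp add: level_plane_def flat_def)
    show "ev (opp p) (f (b1 + 1) (j + of_bool b) (k + of_bool d)) < 0" if "cell b1 j k" for j k b d
      using that by (simp add: cell_iff)
    show "ev (opp p) (f (b1 - 1) (j + of_bool b) (k + of_bool d)) > 0" if c: "cell (b1 - 1) j k" for j k b d
    proof -
      have "is_net_cube {1 - b1..1 - a1} {a2..b2} {a3..b3} 1 (1 - b1) j k"
        using c by (auto simp: is_net_cube_def)
      moreover have "1 - (1 - b1 + 1) = b1 - 1" by simp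
      ultimately show ?thesis using p unfolding level_plane_def by (metis (no_types, lifting) ev_opp neg_0_less_iff_less)
    qed
  qed
  then show ?thesis unfolding True by blast
qed (use assms level_plane_upper in auto)

subsection \<open>Oriented planes of a net\<close>

lemma circumscribed_cube_planes:
  assumes "circumscribed V"
  shows "\<exists>P Q R. cube_planes P Q R 1 V \<and> (\<forall>z r. inscribed_sphere (cube_hull V) z r \<longrightarrow>
    (\<forall>e. sph (P e) z r = 0 \<and> sph (Q e) z r = 0 \<and> sph (R e) z r = 0))"
proof -
  have "\<exists>p. oplane p \<and> (\<forall>a b d. (std_corner a b d $ c = of_bool e \<longrightarrow> ev p (V a b d) = 0)
             \<and> (std_corner a b d $ c \<noteq> of_bool e \<longrightarrow> ev p (V a b d) < 0))
    \<and> (\<forall>z r. inscribed_sphere (cube_hull V) z r \<longrightarrow> sph p z r = 0)" for c e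
  proof -
    obtain n h where nh: "norm n = 1"
      "\<forall>a b d. (std_corner a b d $ c = of_bool e \<longrightarrow> n \<bullet> V a b d = h)
             \<and> (std_corner a b d $ c \<noteq> of_bool e \<longrightarrow> n \<bullet> V a b d < h)"
      "\<forall>z r. inscribed_sphere (cube_hull V) z r \<longrightarrow> n \<bullet> z + r = h"
      using circumscribed_side_plane[OF assms, of c e] by blast
    have "sph (n, 1, - h) z r = n \<bullet> z + r - h" for z r by (simp add: sph_def ev_def)
    moreover have "ev (n, 1, - h) x = n \<bullet> x - h" for x by (simp add: ev_def)
    ultimately show ?thesis using nh by (intro exI[of _ "(n, 1, - h)"]) (simp add: oplane_def)
  qed
  then have "\<forall>c. \<exists>F. \<forall>e. oplane (F e) \<and> (\<forall>a b d. (std_corner a b d $ c = of_bool e \<longrightarrow> ev (F e) (V a b d) = 0)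
             \<and> (std_corner a b d $ c \<noteq> of_bool e \<longrightarrow> ev (F e) (V a b d) < 0))
    \<and> (\<forall>z r. inscribed_sphere (cube_hull V) z r \<longrightarrow> sph (F e) z r = 0)"
    by (intro allI choice) blast
  from choice[OF this] obtain F where F: "\<And>c e. oplane (F c e)"
    "\<And>c e a b d. std_corner a b d $ c = of_bool e \<Longrightarrow> ev (F c e) (V a b d) = 0"
    "\<And>c e a b d. std_corner a b d $ c \<noteq> of_bool e \<Longrightarrow> ev (F c e) (V a b d) < 0"
    "\<And>c e z r. inscribed_sphere (cube_hull V) z r \<Longrightarrow> sph (F c e) z r = 0" by blast
  have "cube_planes (F 1) (F 2) (F 3) 1 V"
    unfolding cube_planes_def by (auto simp: F(1) of_bool_eq_iff intro!: F(2,3))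
  then show ?thesis using F(4) by blast
qed

text \<open>Reversing a plane amounts to reversing the sign of the radius, and the side on which the
  cube lies forces the factor between the two orientations to be \<open>\<sigma>\<close>.\<close>

lemma sph_orientation:
  assumes c: "cube_planes P Q R \<sigma> V" and c0: "cube_planes P0 Q0 R0 1 V" and s: "\<sigma> = 1 \<or> \<sigma> = - 1"
    and t: "sph (P0 e) z \<rho> = 0"
  shows "sph (P e) z (\<sigma> * \<rho>) = 0"
proof -
  obtain t where t1: "t = 1 \<or> t = - 1" and ev: "\<And>y. ev (P e) y = t * ev (P0 e) y"
    using cube_planes_plane_unique[OF c0 cube_planesD(1)[OF c, of e] cube_planesD(4)[OF c]] by metis
  have "\<sigma> * ev (P e) (V (\<not> e) False False) < 0" "ev (P0 e) (V (\<not> e) False False) < 0"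
    using cube_planesD(7)[OF c, of "\<not> e" e False False] cube_planesD(7)[OF c0, of "\<not> e" e False False] by simp_all
  then have "t = \<sigma>" using t1 s by (auto simp: ev)
  moreover have "fst (snd (P e)) = 1" "fst (snd (P0 e)) = 1"
    using cube_planesD(1)[OF c, of e] cube_planesD(1)[OF c0, of e] by (simp_all add: oplane_def)
  ultimately have "sph (P e) z (\<sigma> * \<rho>) = \<sigma> * sph (P0 e) z \<rho>" by (simp add: sph_def ev algebra_simps)
  then show ?thesis using t by simp
qed

lemma cube_planes_tangent:
  assumes c: "cube_planes P Q R \<sigma> V" and s: "\<sigma> = 1 \<or> \<sigma> = - 1"
    and V: "circumscribed V" "inscribed_sphere (cube_hull V) z \<rho>"
  shows "sph (P e) z (\<sigma> * \<rho>) = 0" "sph (Q e) z (\<sigma> * \<rho>) = 0" "sph (R e) z (\<sigma> * \<rho>) = 0"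
proof -
  obtain P0 Q0 R0 where c0: "cube_planes P0 Q0 R0 1 V"
    and t: "\<And>e. sph (P0 e) z \<rho> = 0" "\<And>e. sph (Q0 e) z \<rho> = 0" "\<And>e. sph (R0 e) z \<rho> = 0"
    using circumscribed_cube_planes[OF V(1)] V(2) by blast
  show "sph (P e) z (\<sigma> * \<rho>) = 0" by (rule sph_orientation[OF c c0 s t(1)])
  show "sph (Q e) z (\<sigma> * \<rho>) = 0"
    by (rule sph_orientation[OF cube_planes_swap12[OF c] cube_planes_swap12[OF c0] s t(2)])
  show "sph (R e) z (\<sigma> * \<rho>) = 0"
    by (rule sph_orientation[OF cube_planes_swap12[OF cube_planes_swap23[OF c]]
          cube_planes_swap12[OF cube_planes_swap23[OF c0]] s t(3)])
qed

text \<open>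
  A coordinate plane separates a cell of even index from one of odd index, so one orientation of the plane
  is the outward one for the former and the inward one for the latter.
\<close>
definition sg :: "int \<Rightarrow> real" where "sg i = (if even i then 1 else - 1)"

lemma sg_cases: "sg i = 1 \<or> sg i = - 1" by (simp add: sg_def)

lemma sg_simps [simp]: "sg i * sg i = 1" "sg i \<noteq> 0" "\<bar>sg i\<bar> = 1" by (simp_all add: sg_def)

lemma sg_add1 [simp]: "sg (i + 1) = - sg i" by (simp add: sg_def)

lemma sg_odd: "odd c \<Longrightarrow> sg (i + c) = - sg i" by (simp add: sg_def)

text \<open>\<open>sg i * rad i j k\<close> is the signed radius with which the oriented planes
  touch the sphere of a cell. Membership of \<open>Z i j k\<close> in the hull serves to tell the
  spheres of different cells apart.\<close>

locale laguerre_net =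
  fixes a1 b1 a2 b2 a3 b3 :: int and f :: lattice_map and p q r :: "int \<Rightarrow> laguerre"
    and Z :: lattice_map and rad :: "int \<Rightarrow> int \<Rightarrow> int \<Rightarrow> real"
  assumes thick: "a1 + 2 \<le> b1" "a2 + 2 \<le> b2" "a3 + 2 \<le> b3"
    and lines: "\<And>i j. i \<in> {a1..b1} \<Longrightarrow> j \<in> {a2..b2} \<Longrightarrow> on_line_in_order {a3..b3} (\<lambda>k. f i j k)"
      "\<And>j k. j \<in> {a2..b2} \<Longrightarrow> k \<in> {a3..b3} \<Longrightarrow> on_line_in_order {a1..b1} (\<lambda>i. f i j k)"
      "\<And>i k. i \<in> {a1..b1} \<Longrightarrow> k \<in> {a3..b3} \<Longrightarrow> on_line_in_order {a2..b2} (\<lambda>j. f i j k)"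
    and oplanes: "\<And>i. i \<in> {a1..b1} \<Longrightarrow> oplane (p i)" "\<And>j. j \<in> {a2..b2} \<Longrightarrow> oplane (q j)"
      "\<And>k. k \<in> {a3..b3} \<Longrightarrow> oplane (r k)"
    and inc: "\<And>i j k. i \<in> {a1..b1} \<Longrightarrow> j \<in> {a2..b2} \<Longrightarrow> k \<in> {a3..b3} \<Longrightarrow>
      ev (p i) (f i j k) = 0 \<and> ev (q j) (f i j k) = 0 \<and> ev (r k) (f i j k) = 0"
    and cell_planes: "\<And>i j k. is_net_cube {a1..b1} {a2..b2} {a3..b3} 1 i j k \<Longrightarrow>
      cube_planes (\<lambda>e. p (i + of_bool e)) (\<lambda>e. q (j + of_bool e)) (\<lambda>e. r (k + of_bool e)) (sg i) (net_cube f 1 i j k)"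
    and cell_sphere: "\<And>i j k. is_net_cube {a1..b1} {a2..b2} {a3..b3} 1 i j k \<Longrightarrow>
      rad i j k > 0 \<and> Z i j k \<in> cube_hull (net_cube f 1 i j k) \<and>
      (\<forall>e. sph (p (i + of_bool e)) (Z i j k) (sg i * rad i j k) = 0 \<and>
           sph (q (j + of_bool e)) (Z i j k) (sg i * rad i j k) = 0 \<and>
           sph (r (k + of_bool e)) (Z i j k) (sg i * rad i j k) = 0)"

lemma cube_hull_swap:
  "cube_hull (\<lambda>b a d. V a b d) = cube_hull V" "cube_hull (\<lambda>a d b. V a b d) = cube_hull V"
proof -
  have "{V a b d | b a d. True} = {V a b d | a b d. True}" "{V a b d | a d b. True} = {V a b d | a b d. True}"
    by blast+
  then show "cube_hull (\<lambda>b a d. V a b d) = cube_hull V" "cube_hull (\<lambda>a d b. V a b d) = cube_hull V"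
    by (simp_all add: cube_hull_def)
qed

lemma laguerre_net_swap12:
  assumes "laguerre_net a1 b1 a2 b2 a3 b3 f p q r Z rad"
  shows "laguerre_net a2 b2 a1 b1 a3 b3 (\<lambda>j i k. f i j k) q p r (\<lambda>j i k. Z i j k) (\<lambda>j i k. rad i j k)"
proof -
  interpret laguerre_net a1 b1 a2 b2 a3 b3 f p q r Z rad by fact
  show ?thesis
  proof
    fix j i k assume "is_net_cube {a2..b2} {a1..b1} {a3..b3} 1 j i k"
    then have c: "is_net_cube {a1..b1} {a2..b2} {a3..b3} 1 i j k" by (auto simp: is_net_cube_def)
    then have s: "sg j = sg i" by (auto simp: is_net_cube_def sg_def)
    show "cube_planes (\<lambda>e. q (j + of_bool e)) (\<lambda>e. p (i + of_bool e)) (\<lambda>e. r (k + of_bool e)) (sg j)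
       (net_cube (\<lambda>j i k. f i j k) 1 j i k)"
      unfolding s net_cube_swap(1)[where f=f] by (rule cube_planes_swap12[OF cell_planes[OF c]])
    show "rad i j k > 0 \<and> Z i j k \<in> cube_hull (net_cube (\<lambda>j i k. f i j k) 1 j i k) \<and>
      (\<forall>e. sph (q (j + of_bool e)) (Z i j k) (sg j * rad i j k) = 0 \<and>
           sph (p (i + of_bool e)) (Z i j k) (sg j * rad i j k) = 0 \<and>
           sph (r (k + of_bool e)) (Z i j k) (sg j * rad i j k) = 0)"
      unfolding s net_cube_swap(1)[where f=f] cube_hull_swap(1)[of "net_cube f 1 i j k"] using cell_sphere[OF c] by blast
  qed (use thick lines oplanes inc in simp_all)
qed

lemma laguerre_net_swap23:
  assumes "laguerre_net a1 b1 a2 b2 a3 b3 f p q r Z rad"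
  shows "laguerre_net a1 b1 a3 b3 a2 b2 (\<lambda>i k j. f i j k) p r q (\<lambda>i k j. Z i j k) (\<lambda>i k j. rad i j k)"
proof -
  interpret laguerre_net a1 b1 a2 b2 a3 b3 f p q r Z rad by fact
  show ?thesis
  proof
    fix i k j assume "is_net_cube {a1..b1} {a3..b3} {a2..b2} 1 i k j"
    then have c: "is_net_cube {a1..b1} {a2..b2} {a3..b3} 1 i j k" by (auto simp: is_net_cube_def)
    show "cube_planes (\<lambda>e. p (i + of_bool e)) (\<lambda>e. r (k + of_bool e)) (\<lambda>e. q (j + of_bool e)) (sg i)
       (net_cube (\<lambda>i k j. f i j k) 1 i k j)"
      unfolding net_cube_swap(2)[where f=f] by (rule cube_planes_swap23[OF cell_planes[OF c]])
    show "rad i j k > 0 \<and> Z i j k \<in> cube_hull (net_cube (\<lambda>i k j. f i j k) 1 i k j) \<and>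
      (\<forall>e. sph (p (i + of_bool e)) (Z i j k) (sg i * rad i j k) = 0 \<and>
           sph (r (k + of_bool e)) (Z i j k) (sg i * rad i j k) = 0 \<and>
           sph (q (j + of_bool e)) (Z i j k) (sg i * rad i j k) = 0)"
      unfolding net_cube_swap(2)[where f=f] cube_hull_swap(2)[of "net_cube f 1 i j k"] using cell_sphere[OF c] by blast
  qed (use thick lines oplanes inc in simp_all)
qed

lemma checkerboard_planar_net: "checkerboard_IS_net I J K f \<Longrightarrow> planar_net I J K f"
  unfolding planar_net_def
proof (intro conjI allI impI)
  assume n: "checkerboard_IS_net I J K f"
  show "\<forall>i\<in>I. \<forall>j\<in>J. on_line_in_order K (\<lambda>k. f i j k)" "\<forall>j\<in>J. \<forall>k\<in>K. on_line_in_order I (\<lambda>i. f i j k)"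
    "\<forall>i\<in>I. \<forall>k\<in>K. on_line_in_order J (\<lambda>j. f i j k)"
    using n unfolding checkerboard_IS_net_def by simp_all
  fix i j k assume "is_net_cube I J K 1 i j k"
  then have "circumscribed (net_cube f 1 i j k)" using n unfolding checkerboard_IS_net_def by simp
  from circumscribed_cube_planes[OF this] show "\<exists>P Q R. cube_planes P Q R 1 (net_cube f 1 i j k)" by blast
qed

text \<open>A level plane is oriented along its index, hence outward on one side of a cell and
  inward on the opposite one. Alternating the orientation with the parity of the level makes both
  agree with \<open>sg i\<close>.\<close>

definition signed_plane :: "int \<Rightarrow> laguerre \<Rightarrow> laguerre" where
  "signed_plane i p = (sg i *\<^sub>R fst p, fst (snd p), sg i * snd (snd p))"

lemma ev_signed_plane [simp]: "ev (signed_plane i p) x = sg i * ev p x"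
  by (simp add: ev_def signed_plane_def algebra_simps)

lemma oplane_signed_plane [simp]: "oplane (signed_plane i p) = oplane p"
  by (simp add: oplane_def signed_plane_def)

definition level_signs :: "int set \<Rightarrow> int set \<Rightarrow> int set \<Rightarrow> lattice_map \<Rightarrow> (int \<Rightarrow> laguerre) \<Rightarrow> bool" where
  "level_signs I J K f p \<longleftrightarrow>
     (\<forall>i\<in>I. oplane (p i) \<and> (\<forall>j\<in>J. \<forall>k\<in>K. ev (p i) (f i j k) = 0)) \<and>
     (\<forall>i j k. is_net_cube I J K 1 i j k \<longrightarrow> (\<forall>b d. sg i * ev (p i) (f (i + 1) (j + of_bool b) (k + of_bool d)) < 0
        \<and> sg i * ev (p (i + 1)) (f i (j + of_bool b) (k + of_bool d)) < 0))"

lemma level_signsD: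
  assumes "level_signs I J K f p"
  shows "i \<in> I \<Longrightarrow> oplane (p i)" "i \<in> I \<Longrightarrow> j \<in> J \<Longrightarrow> k \<in> K \<Longrightarrow> ev (p i) (f i j k) = 0"
    "is_net_cube I J K 1 i j k \<Longrightarrow> sg i * ev (p i) (f (i + 1) (j + of_bool b) (k + of_bool d)) < 0"
    "is_net_cube I J K 1 i j k \<Longrightarrow> sg i * ev (p (i + 1)) (f i (j + of_bool b) (k + of_bool d)) < 0"
  using assms unfolding level_signs_def by simp_all

lemma (in thick_net) level_signs_exists: "\<exists>p. level_signs {a1..b1} {a2..b2} {a3..b3} f p"
proof -
  have "\<forall>i\<in>{a1..b1}. \<exists>p. level_plane {a1..b1} {a2..b2} {a3..b3} f i p" using level_plane_exists by simp
  from bchoice[OF this] obtain p where p: "\<And>i. i \<in> {a1..b1} \<Longrightarrow> level_plane {a1..b1} {a2..b2} {a3..b3} f i (p i)"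
    by blast
  have "level_signs {a1..b1} {a2..b2} {a3..b3} f (\<lambda>i. signed_plane i (p i))"
    unfolding level_signs_def
  proof (intro conjI ballI allI impI)
    fix i assume "i \<in> {a1..b1}"
    from p[OF this] show "ev (signed_plane i (p i)) (f i j k) = 0"
      if "j \<in> {a2..b2}" "k \<in> {a3..b3}" for j k
      using that by (auto simp: level_plane_def flat_def)
    from p[OF \<open>i \<in> {a1..b1}\<close>] show "oplane (signed_plane i (p i))" by (auto simp: level_plane_def flat_def)
  next
    fix i j k b d assume c: "cell i j k"
    then have i: "i \<in> {a1..b1}" "i + 1 \<in> {a1..b1}" by (auto simp: cell_iff)
    have "ev (p i) (f (i + 1) (j + of_bool b) (k + of_bool d)) < 0"
      using p[OF i(1)] c by (auto simp: level_plane_def)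
    then show "sg i * ev (signed_plane i (p i)) (f (i + 1) (j + of_bool b) (k + of_bool d)) < 0"
      by (simp add: mult.assoc[symmetric])
    have "\<forall>j k. is_net_cube {a1..b1} {a2..b2} {a3..b3} 1 (i + 1 - 1) j k \<longrightarrow>
      (\<forall>b d. ev (p (i + 1)) (f (i + 1 - 1) (j + of_bool b) (k + of_bool d)) > 0)"
      using p[OF i(2)] unfolding level_plane_def by blast
    then have "ev (p (i + 1)) (f i (j + of_bool b) (k + of_bool d)) > 0" using c by simp
    then show "sg i * ev (signed_plane (i + 1) (p (i + 1))) (f i (j + of_bool b) (k + of_bool d)) < 0"
      by (simp add: mult.assoc[symmetric])
  qed
  then show ?thesis by blast
qed

text \<open>The planes are fixed before \<open>Z\<close> and \<open>rad\<close>, so that they also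
  serve centres prescribed from outside.\<close>

lemma laguerre_net_exists:
  assumes net: "checkerboard_IS_net {a1..b1} {a2..b2} {a3..b3} f"
    and thick: "a1 + 2 \<le> b1" "a2 + 2 \<le> b2" "a3 + 2 \<le> b3"
  shows "\<exists>p q r. \<forall>Z rad. (\<forall>i j k. is_net_cube {a1..b1} {a2..b2} {a3..b3} 1 i j k \<longrightarrow>
        inscribed_sphere (cube_hull (net_cube f 1 i j k)) (Z i j k) (rad i j k)) \<longrightarrow>
      laguerre_net a1 b1 a2 b2 a3 b3 f p q r Z rad"
proof -
  note pn = checkerboard_planar_net[OF net]
  have t: "thick_net a1 b1 a2 b2 a3 b3 f" using pn thick by (simp add: thick_net_def)
  obtain p where p: "level_signs {a1..b1} {a2..b2} {a3..b3} f p"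
    using thick_net.level_signs_exists[OF t] by blast
  obtain q where q: "level_signs {a2..b2} {a1..b1} {a3..b3} (\<lambda>j i k. f i j k) q"
    using thick_net.level_signs_exists[OF thick_net_swap12[OF t]] by blast
  obtain r where r: "level_signs {a3..b3} {a1..b1} {a2..b2} (\<lambda>k i j. f i j k) r"
    using thick_net.level_signs_exists[OF thick_net_swap12[OF thick_net_swap23[OF t]]] by blast
  have planes: "cube_planes (\<lambda>e. p (i + of_bool e)) (\<lambda>e. q (j + of_bool e)) (\<lambda>e. r (k + of_bool e)) (sg i) (net_cube f 1 i j k)"
    if c: "is_net_cube {a1..b1} {a2..b2} {a3..b3} 1 i j k" for i j k
  proof -
    have m: "i + of_bool e \<in> {a1..b1}" "j + of_bool e \<in> {a2..b2}" "k + of_bool e \<in> {a3..b3}" for e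
      using c by (auto simp: is_net_cube_def of_bool_def)
    have s: "sg j = sg i" "sg k = sg i" using c by (auto simp: is_net_cube_def sg_def)
    have c2: "is_net_cube {a2..b2} {a1..b1} {a3..b3} 1 j i k" "is_net_cube {a3..b3} {a1..b1} {a2..b2} 1 k i j"
      using c by (auto simp: is_net_cube_def)
    have P: "sg i * ev (p i) (f (i + 1) (j + of_bool b) (k + of_bool d)) < 0"
      "sg i * ev (p (i + 1)) (f i (j + of_bool b) (k + of_bool d)) < 0" for b d
      using level_signsD(3,4)[OF p c] by blast+
    have Q: "sg i * ev (q j) (f (i + of_bool b) (j + 1) (k + of_bool d)) < 0"
      "sg i * ev (q (j + 1)) (f (i + of_bool b) j (k + of_bool d)) < 0" for b d
      using level_signsD(3,4)[OF q c2(1)] unfolding s by blast+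
    have R: "sg i * ev (r k) (f (i + of_bool b) (j + of_bool d) (k + 1)) < 0"
      "sg i * ev (r (k + 1)) (f (i + of_bool b) (j + of_bool d) k) < 0" for b d
      using level_signsD(3,4)[OF r c2(2)] unfolding s by blast+
    show ?thesis unfolding cube_planes_def
    proof (intro conjI allI)
      fix a b d
      show "oplane (p (i + of_bool a))" "oplane (q (j + of_bool a))" "oplane (r (k + of_bool a))"
        by (rule level_signsD(1)[OF p m(1)] level_signsD(1)[OF q m(2)] level_signsD(1)[OF r m(3)])+
      show "ev (p (i + of_bool a)) (net_cube f 1 i j k a b d) = 0"
        "ev (q (j + of_bool b)) (net_cube f 1 i j k a b d) = 0"
        "ev (r (k + of_bool d)) (net_cube f 1 i j k a b d) = 0"
        unfolding net_cube_def mult_1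
        by (rule level_signsD(2)[OF p m(1) m(2) m(3)] level_signsD(2)[OF q m(2) m(1) m(3)]
          level_signsD(2)[OF r m(3) m(1) m(2)])+
      show "sg i * ev (p (i + of_bool (\<not> a))) (net_cube f 1 i j k a b d) < 0"
        using P[of b d] by (cases a) (simp_all add: net_cube_def)
      show "sg i * ev (q (j + of_bool (\<not> b))) (net_cube f 1 i j k a b d) < 0"
        using Q[of a d] by (cases b) (simp_all add: net_cube_def)
      show "sg i * ev (r (k + of_bool (\<not> d))) (net_cube f 1 i j k a b d) < 0"
        using R[of a b] by (cases d) (simp_all add: net_cube_def)
    qed
  qed
  have circ: "circumscribed (net_cube f 1 i j k)" if "is_net_cube {a1..b1} {a2..b2} {a3..b3} 1 i j k" for i j k
    using net that unfolding checkerboard_IS_net_def by blast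
  have "laguerre_net a1 b1 a2 b2 a3 b3 f p q r Z rad"
    if Z: "\<forall>i j k. is_net_cube {a1..b1} {a2..b2} {a3..b3} 1 i j k \<longrightarrow>
        inscribed_sphere (cube_hull (net_cube f 1 i j k)) (Z i j k) (rad i j k)" for Z rad
  proof
    fix i j k
    show "on_line_in_order {a3..b3} (\<lambda>k. f i j k)" if "i \<in> {a1..b1}" "j \<in> {a2..b2}" using planar_netD(1)[OF pn that] .
    show "on_line_in_order {a1..b1} (\<lambda>i. f i j k)" if "j \<in> {a2..b2}" "k \<in> {a3..b3}" using planar_netD(2)[OF pn that] .
    show "on_line_in_order {a2..b2} (\<lambda>j. f i j k)" if "i \<in> {a1..b1}" "k \<in> {a3..b3}" using planar_netD(3)[OF pn that] .
    show "oplane (p i)" if "i \<in> {a1..b1}" by (rule level_signsD(1)[OF p that])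
    show "oplane (q j)" if "j \<in> {a2..b2}" by (rule level_signsD(1)[OF q that])
    show "oplane (r k)" if "k \<in> {a3..b3}" by (rule level_signsD(1)[OF r that])
    show "ev (p i) (f i j k) = 0 \<and> ev (q j) (f i j k) = 0 \<and> ev (r k) (f i j k) = 0"
      if "i \<in> {a1..b1}" "j \<in> {a2..b2}" "k \<in> {a3..b3}"
      using level_signsD(2)[OF p that] level_signsD(2)[OF q that(2,1,3)] level_signsD(2)[OF r that(3,1,2)] by simp
    assume c: "is_net_cube {a1..b1} {a2..b2} {a3..b3} 1 i j k"
    show "cube_planes (\<lambda>e. p (i + of_bool e)) (\<lambda>e. q (j + of_bool e)) (\<lambda>e. r (k + of_bool e)) (sg i) (net_cube f 1 i j k)"
      by (rule planes[OF c])
    have ins: "inscribed_sphere (cube_hull (net_cube f 1 i j k)) (Z i j k) (rad i j k)" using Z c by blast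
    then have "rad i j k > 0" "Z i j k \<in> cube_hull (net_cube f 1 i j k)" by (auto simp: inscribed_sphere_def)
    then show "rad i j k > 0 \<and> Z i j k \<in> cube_hull (net_cube f 1 i j k) \<and>
      (\<forall>e. sph (p (i + of_bool e)) (Z i j k) (sg i * rad i j k) = 0 \<and>
           sph (q (j + of_bool e)) (Z i j k) (sg i * rad i j k) = 0 \<and>
           sph (r (k + of_bool e)) (Z i j k) (sg i * rad i j k) = 0)"
      using cube_planes_tangent[OF planes[OF c] sg_cases circ[OF c] ins] by blast
  qed (rule thick)+
  then show ?thesis by blast
qed

lemma cube_planes_antipodal:
  assumes "cube_planes P Q R \<sigma> V"
  shows "cube_planes (\<lambda>e. P (\<not> e)) (\<lambda>e. Q (\<not> e)) (\<lambda>e. R (\<not> e)) \<sigma> (\<lambda>a b d. V (\<not> a) (\<not> b) (\<not> d))"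
  by (simp add: cube_planes_def[of "\<lambda>e. P (\<not> e)"] cube_planesD[OF assms])

context laguerre_net
begin

abbreviation "ncube \<equiv> is_net_cube {a1..b1} {a2..b2} {a3..b3}"

text \<open>An edge line of the large cube begins and ends in unit cells, where the signs of the
  planes are known; the order on the line carries them to the far end.\<close>

lemma net_cube_sign_p:
  assumes c: "ncube c i j k" "c > 0"
  shows "sg i * ev (p (i + c * of_bool (\<not> a))) (net_cube f c i j k a b d) < 0"
proof -
  define x y where "x = j + c * of_bool b" and "y = k + c * of_bool d"
  \<comment> \<open>The unit cells along this edge inside the large cube; \<open>c - 1\<close> is
    even, so they have the right parity.\<close>
  define j0 k0 where "j0 = (if b then j + c - 1 else j)" and "k0 = (if d then k + c - 1 else k)"
  have m: "i \<in> {a1..b1}" "i + 1 \<in> {a1..b1}" "i + c - 1 \<in> {a1..b1}" "i + c \<in> {a1..b1}" "x \<in> {a2..b2}" "y \<in> {a3..b3}"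
    using c by (auto simp: is_net_cube_def x_def y_def of_bool_def)
  have c0: "ncube 1 i j0 k0" "ncube 1 (i + c - 1) j0 k0"
    using c by (auto simp: is_net_cube_def j0_def k0_def)
  have e: "x = j0 + of_bool b" "y = k0 + of_bool d" by (auto simp: x_def y_def j0_def k0_def)
  have s: "sg (i + c - 1) = sg i" using c by (auto simp: is_net_cube_def sg_def)
  note L = lines(2)[OF m(5,6)] thick(1)
  show ?thesis
  proof (cases a)
    case True
    have "sg i * ev (p i) (f (i + 1) x y) < 0"
      using cube_planesD(7)[OF cell_planes[OF c0(1)], of True False b d] by (simp add: net_cube_def e)
    then have "sg i * ev (p i) (f (i + c) x y) < 0"
      using on_line_sign_up(1)[OF L m(1,2,4)] inc[OF m(1,5,6)] c(2) by simp
    then show ?thesis using True by (simp add: net_cube_def x_def y_def)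
  next
    case False
    have "sg i * ev (p (i + c)) (f (i + c - 1) x y) < 0"
      using cube_planesD(7)[OF cell_planes[OF c0(2)], of False True b d] by (simp add: net_cube_def e s)
    then have "sg i * ev (p (i + c)) (f i x y) < 0"
      using on_line_sign_down(1)[OF L m(4,3,1)] inc[OF m(4,5,6)] c(2) by simp
    then show ?thesis using False by (simp add: net_cube_def x_def y_def)
  qed
qed

lemma ncube_sg: "ncube c i j k \<Longrightarrow> sg j = sg i \<and> sg k = sg i"
  by (auto simp: is_net_cube_def sg_def)

lemma net_cube_planes_pos:
  assumes c: "ncube c i j k" "c > 0"
  shows "cube_planes (\<lambda>e. p (i + c * of_bool e)) (\<lambda>e. q (j + c * of_bool e)) (\<lambda>e. r (k + c * of_bool e))
    (sg i) (net_cube f c i j k)"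
  unfolding cube_planes_def
proof (intro conjI allI)
  have m: "i + c * of_bool e \<in> {a1..b1}" "j + c * of_bool e \<in> {a2..b2}" "k + c * of_bool e \<in> {a3..b3}" for e
    using c by (auto simp: is_net_cube_def of_bool_def)
  fix a b d
  show "oplane (p (i + c * of_bool a))" "oplane (q (j + c * of_bool a))" "oplane (r (k + c * of_bool a))"
    by (intro oplanes m)+
  show "ev (p (i + c * of_bool a)) (net_cube f c i j k a b d) = 0"
    "ev (q (j + c * of_bool b)) (net_cube f c i j k a b d) = 0"
    "ev (r (k + c * of_bool d)) (net_cube f c i j k a b d) = 0"
    using inc[OF m(1)[of a] m(2)[of b] m(3)[of d]] by (simp_all add: net_cube_def)
  show "sg i * ev (p (i + c * of_bool (\<not> a))) (net_cube f c i j k a b d) < 0"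
    by (rule net_cube_sign_p[OF c])
  have s: "sg i = sg j" "sg i = sg k" using ncube_sg[OF c(1)] by auto
  have c2: "is_net_cube {a2..b2} {a1..b1} {a3..b3} c j i k" "is_net_cube {a3..b3} {a1..b1} {a2..b2} c k i j"
    using c by (auto simp: is_net_cube_def)
  show "sg i * ev (q (j + c * of_bool (\<not> b))) (net_cube f c i j k a b d) < 0"
    using laguerre_net.net_cube_sign_p[OF laguerre_net_swap12[OF laguerre_net_axioms] c2(1) c(2), of b a d]
    by (simp add: net_cube_def s(1))
  show "sg i * ev (r (k + c * of_bool (\<not> d))) (net_cube f c i j k a b d) < 0"
    using laguerre_net.net_cube_sign_p[OF laguerre_net_swap12[OF laguerre_net_swap23[OF laguerre_net_axioms]] c2(2) c(2), of d a b]
    by (simp add: net_cube_def s(2))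
qed

lemma net_cube_neg: "net_cube f (- c) (i + c) (j + c) (k + c) = (\<lambda>a b d. net_cube f c i j k (\<not> a) (\<not> b) (\<not> d))"
  by (intro ext) (auto simp: net_cube_def of_bool_def)

lemma ncube_neg: "ncube c i j k \<Longrightarrow> ncube (- c) (i + c) (j + c) (k + c)"
  by (auto simp: is_net_cube_def)

text \<open>A cube of negative size is named from its other end \<open>i + c\<close>, whose parity
  is opposite; this accounts for the factor \<open>sgn c\<close>.\<close>

lemma net_cube_planes:
  assumes c: "ncube c i j k"
  shows "cube_planes (\<lambda>e. p (i + c * of_bool e)) (\<lambda>e. q (j + c * of_bool e)) (\<lambda>e. r (k + c * of_bool e))
    (sgn c * sg i) (net_cube f c i j k)"
proof (cases "c > 0")
  case True
  then show ?thesis using net_cube_planes_pos[OF c] by simp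
next
  case False
  have odd: "odd c" using c by (auto simp: is_net_cube_def)
  then have neg: "c < 0" using False by (cases "c = 0") auto
  have "cube_planes (\<lambda>e. p (i + c + - c * of_bool e)) (\<lambda>e. q (j + c + - c * of_bool e)) (\<lambda>e. r (k + c + - c * of_bool e))
    (sg (i + c)) (net_cube f (- c) (i + c) (j + c) (k + c))"
    using net_cube_planes_pos[OF ncube_neg[OF c]] neg by simp
  from cube_planes_antipodal[OF this]
  have "cube_planes (\<lambda>e. p (i + c + - c * of_bool (\<not> e))) (\<lambda>e. q (j + c + - c * of_bool (\<not> e)))
     (\<lambda>e. r (k + c + - c * of_bool (\<not> e))) (sg (i + c)) (net_cube f c i j k)"
    unfolding net_cube_neg by simp
  moreover have "x + c + - c * of_bool (\<not> e) = x + c * of_bool e" for x e by (cases e) simp_all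
  ultimately have "cube_planes (\<lambda>e. p (i + c * of_bool e)) (\<lambda>e. q (j + c * of_bool e)) (\<lambda>e. r (k + c * of_bool e))
    (sg (i + c)) (net_cube f c i j k)" by (simp only:)
  then show ?thesis using neg sg_odd[OF odd, of i] by simp
qed

end

subsection \<open>Pencils of oriented planes\<close>

lemma four_orthogonal_dependent:
  fixes A B C D \<delta> :: "(real^3) \<times> real"
  assumes d: "\<delta> \<noteq> 0" and o: "A \<bullet> \<delta> = 0" "B \<bullet> \<delta> = 0" "C \<bullet> \<delta> = 0" "D \<bullet> \<delta> = 0"
  shows "\<exists>a b c e. (a \<noteq> 0 \<or> b \<noteq> 0 \<or> c \<noteq> 0 \<or> e \<noteq> 0) \<and> a *\<^sub>R A + b *\<^sub>R B = c *\<^sub>R C + e *\<^sub>R D"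
proof -
  define L :: "(real^3) \<times> real \<Rightarrow> (real^3) \<times> real" where
    "L X = fst X $ 1 *\<^sub>R A + fst X $ 2 *\<^sub>R B - fst X $ 3 *\<^sub>R C - snd X *\<^sub>R D" for X
  have lin: "linear L" by (rule linearI) (simp_all add: L_def algebra_simps)
  have "\<not> inj L"
  proof
    assume "inj L"
    then have "surj L" using linear_injective_imp_surjective[OF lin] by simp
    then obtain X where "\<delta> = L X" by (meson surjD)
    then have "\<delta> \<bullet> \<delta> = L X \<bullet> \<delta>" by simp
    also have "\<dots> = 0" using o by (simp add: L_def inner_add_left inner_diff_left)
    finally show False using d by simp
  qed
  then obtain X where X: "X \<noteq> 0" "L X = 0" using linear_injective_0[OF lin] by blast
  have "fst X $ 1 \<noteq> 0 \<or> fst X $ 2 \<noteq> 0 \<or> fst X $ 3 \<noteq> 0 \<or> snd X \<noteq> 0"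
    using X(1) by (auto simp: prod_eq_iff vec_eq_iff forall_3)
  moreover have "fst X $ 1 *\<^sub>R A + fst X $ 2 *\<^sub>R B = fst X $ 3 *\<^sub>R C + snd X *\<^sub>R D"
    using X(2) by (simp add: L_def algebra_simps)
  ultimately show ?thesis by blast
qed

text \<open>Contact with both spheres makes the normal and radius coordinates orthogonal to the
  difference of the spheres, which leaves three dimensions for four planes. The offset coordinate
  then follows from contact with one sphere.\<close>

lemma sph_two_dependent:
  assumes ne: "(z, \<rho>) \<noteq> (z', \<rho>')"
    and t: "sph A z \<rho> = 0" "sph B z \<rho> = 0" "sph C z \<rho> = 0" "sph D z \<rho> = 0"
    and t': "sph A z' \<rho>' = 0" "sph B z' \<rho>' = 0" "sph C z' \<rho>' = 0" "sph D z' \<rho>' = 0"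
  shows "\<exists>a b c e. (a \<noteq> 0 \<or> b \<noteq> 0 \<or> c \<noteq> 0 \<or> e \<noteq> 0) \<and> a *\<^sub>R A + b *\<^sub>R B = c *\<^sub>R C + e *\<^sub>R D"
proof -
  define d where "d = (z - z', \<rho> - \<rho>')"
  have o: "(fst X, fst (snd X)) \<bullet> d = sph X z \<rho> - sph X z' \<rho>'" for X :: laguerre
    by (simp add: d_def sph_def ev_def inner_diff_right algebra_simps)
  have "d \<noteq> 0" using ne by (auto simp: d_def zero_prod_def)
  then obtain a b c e where n: "a \<noteq> 0 \<or> b \<noteq> 0 \<or> c \<noteq> 0 \<or> e \<noteq> 0"
    and eq: "a *\<^sub>R (fst A, fst (snd A)) + b *\<^sub>R (fst B, fst (snd B)) = c *\<^sub>R (fst C, fst (snd C)) + e *\<^sub>R (fst D, fst (snd D))"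
    using four_orthogonal_dependent[of d "(fst A, fst (snd A))" "(fst B, fst (snd B))" "(fst C, fst (snd C))" "(fst D, fst (snd D))"]
      t t' unfolding o by auto
  let ?x = "a *\<^sub>R A + b *\<^sub>R B" and ?y = "c *\<^sub>R C + e *\<^sub>R D"
  have e: "fst ?x = fst ?y" "fst (snd ?x) = fst (snd ?y)" using eq by simp_all
  have "sph ?x z \<rho> = 0" "sph ?y z \<rho> = 0" using t by simp_all
  then have "snd (snd ?x) = snd (snd ?y)" unfolding sph_def ev_def e by linarith
  then have "?x = ?y" using e by (simp only: prod_eq_iff)
  then show ?thesis using n by blast
qed

text \<open>At the vertex \<open>x\<close> on \<open>A\<close> and \<open>B\<close> only
  \<open>A'\<close> and \<open>B'\<close> contribute, so their coefficients are inverse to their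
  values there up to a common factor, which \<open>y\<close> and \<open>w\<close> show to be
  nonzero. Dividing by it makes relations between different pencils comparable.\<close>

lemma two_pencils_meet:
  assumes ne: "(z, \<rho>) \<noteq> (z', \<rho>')"
    and t: "sph A z \<rho> = 0" "sph A' z \<rho> = 0" "sph B z \<rho> = 0" "sph B' z \<rho> = 0"
    and t': "sph A z' \<rho>' = 0" "sph A' z' \<rho>' = 0" "sph B z' \<rho>' = 0" "sph B' z' \<rho>' = 0"
    and x: "ev A x = 0" "ev B x = 0" "ev A' x \<noteq> 0" "ev B' x \<noteq> 0"
    and y: "ev A y \<noteq> 0" "ev B y = 0" "ev B w \<noteq> 0" "ev A w = 0"
  shows "\<exists>a b. a *\<^sub>R A + (1 / ev A' x) *\<^sub>R A' = b *\<^sub>R B + (1 / ev B' x) *\<^sub>R B'"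
proof -
  obtain a b c e where n: "a \<noteq> 0 \<or> b \<noteq> 0 \<or> c \<noteq> 0 \<or> e \<noteq> 0"
    and eq: "a *\<^sub>R A + b *\<^sub>R A' = c *\<^sub>R B + e *\<^sub>R B'"
    using sph_two_dependent[OF ne t t'] by blast
  have E: "a * ev A v + b * ev A' v = c * ev B v + e * ev B' v" for v
    using arg_cong[OF eq, of "\<lambda>p. ev p v"] by simp
  define k where "k = b * ev A' x"
  have k: "k = e * ev B' x" using E[of x] x by (simp add: k_def)
  have "k \<noteq> 0"
  proof
    assume "k = 0"
    then have "b = 0" "e = 0" using k x by (auto simp: k_def)
    then have "a = 0" "c = 0" using E[of y] E[of w] y by auto
    then show False using n \<open>b = 0\<close> \<open>e = 0\<close> by blast
  qed
  have "b / k = 1 / ev A' x" using \<open>k \<noteq> 0\<close> by (simp add: k_def)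
  moreover have "e / k = 1 / ev B' x" using \<open>k \<noteq> 0\<close> by (simp add: k)
  moreover have "(1 / k) *\<^sub>R (a *\<^sub>R A + b *\<^sub>R A') = (1 / k) *\<^sub>R (c *\<^sub>R B + e *\<^sub>R B')" by (simp only: eq)
  ultimately have "(a / k) *\<^sub>R A + (1 / ev A' x) *\<^sub>R A' = (c / k) *\<^sub>R B + (1 / ev B' x) *\<^sub>R B'"
    by (simp add: scaleR_add_right)
  then show ?thesis by blast
qed

section \<open>Positive combinations of two planes\<close>

definition pencil :: "laguerre \<Rightarrow> laguerre \<Rightarrow> laguerre \<Rightarrow> bool" where
  "pencil v x y \<longleftrightarrow> (\<exists>a b. a > 0 \<and> b > 0 \<and> v = a *\<^sub>R x + b *\<^sub>R y)"

lemma pencil_commute: "pencil v x y \<longleftrightarrow> pencil v y x"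
  unfolding pencil_def by (metis add.commute)

lemma pencil_scale: "pencil v x y \<Longrightarrow> c > 0 \<Longrightarrow> pencil (c *\<^sub>R v) x y"
proof -
  assume "pencil v x y" "c > 0"
  then obtain a b where "a > 0" "b > 0" "v = a *\<^sub>R x + b *\<^sub>R y" by (auto simp: pencil_def)
  then have "c *\<^sub>R v = (c * a) *\<^sub>R x + (c * b) *\<^sub>R y" "c * a > 0" "c * b > 0"
    using \<open>c > 0\<close> by (simp_all add: scaleR_add_right)
  then show ?thesis unfolding pencil_def by blast
qed

lemma pencil_rho:
  assumes "pencil v x y" "oplane x" "oplane y"
  shows "fst (snd v) > 0"
  using assms by (auto simp: pencil_def oplane_def)

text \<open>At each vertex \<open>v\<close> equals, for every direction, one coefficient times the
  value of the opposite plane, and these values all have the same sign. Going from vertex to vertex,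
  one positive coefficient forces all six to be positive.\<close>

lemma pencil_signs:
  assumes c: "cube_planes P Q R \<sigma> V"
    and v: "v = a False *\<^sub>R P False + a True *\<^sub>R P True" "v = b False *\<^sub>R Q False + b True *\<^sub>R Q True"
      "v = e False *\<^sub>R R False + e True *\<^sub>R R True"
    and pos: "a True > 0"
  shows "pencil v (P False) (P True)" "pencil v (Q False) (Q True)" "pencil v (R False) (R True)"
proof -
  have E: "ev v (V x y w) = a (\<not> x) * ev (P (\<not> x)) (V x y w)" "ev v (V x y w) = b (\<not> y) * ev (Q (\<not> y)) (V x y w)"
    "ev v (V x y w) = e (\<not> w) * ev (R (\<not> w)) (V x y w)" for x y w
    using cube_planesD(4)[OF c, of x y w] cube_planesD(5)[OF c, of y x w] cube_planesD(6)[OF c, of w x y]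
      arg_cong[OF v(1), of "\<lambda>p. ev p (V x y w)"] arg_cong[OF v(2), of "\<lambda>p. ev p (V x y w)"]
      arg_cong[OF v(3), of "\<lambda>p. ev p (V x y w)"]
    by (cases x; cases y; cases w; simp)+
  have S: "\<sigma> * ev (P (\<not> x)) (V x y w) < 0" "\<sigma> * ev (Q (\<not> y)) (V x y w) < 0" "\<sigma> * ev (R (\<not> w)) (V x y w) < 0" for x y w
    by (rule cube_planesD[OF c]; simp)+
  have iff: "k > 0 \<longleftrightarrow> \<sigma> * e < 0" if "e = k * s" "\<sigma> * s < 0" for k e s :: real
  proof -
    have "\<sigma> * e = k * (\<sigma> * s)" using that(1) by simp
    then show ?thesis using that(2) by (auto simp: mult_less_0_iff zero_less_mult_iff)
  qed
  have A: "a (\<not> x) > 0 \<longleftrightarrow> \<sigma> * ev v (V x y w) < 0" for x y w by (rule iff[OF E(1) S(1)])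
  have B: "b (\<not> y) > 0 \<longleftrightarrow> \<sigma> * ev v (V x y w) < 0" for x y w by (rule iff[OF E(2) S(2)])
  have C: "e (\<not> w) > 0 \<longleftrightarrow> \<sigma> * ev v (V x y w) < 0" for x y w by (rule iff[OF E(3) S(3)])
  have b: "b x > 0" for x using A[of False "\<not> x" False] B[of "\<not> x" False False] pos by simp
  have e: "e x > 0" for x using A[of False False "\<not> x"] C[of "\<not> x" False False] pos by simp
  have a: "a x > 0" for x using A[of "\<not> x" False False] B[of False "\<not> x" False] b[of True] by simp
  show "pencil v (P False) (P True)" "pencil v (Q False) (Q True)" "pencil v (R False) (R True)"
    unfolding pencil_def using v a b e by blast+
qed

text \<open>Each auxiliary sphere touches two of the three pairs of opposite planes, so the pencils
  meet in pairs. All three meetings are normalized at the same vertex, and independence of the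
  planes there makes them agree.\<close>

lemma cube_concurrent:
  assumes c: "cube_planes P Q R \<sigma> V"
    and t: "\<And>e. sph (P e) z \<rho> = 0 \<and> sph (Q e) z \<rho> = 0 \<and> sph (R e) z \<rho> = 0"
    and t1: "\<And>e. sph (Q e) za \<rho>a = 0 \<and> sph (R e) za \<rho>a = 0" "(z, \<rho>) \<noteq> (za, \<rho>a)"
    and t2: "\<And>e. sph (P e) zb \<rho>b = 0 \<and> sph (R e) zb \<rho>b = 0" "(z, \<rho>) \<noteq> (zb, \<rho>b)"
    and t3: "\<And>e. sph (P e) zc \<rho>c = 0 \<and> sph (Q e) zc \<rho>c = 0" "(z, \<rho>) \<noteq> (zc, \<rho>c)"
  shows "\<exists>v. pencil v (P False) (P True) \<and> pencil v (Q False) (Q True) \<and> pencil v (R False) (R True)"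
proof -
  let ?A = "P False" and ?A' = "P True" and ?B = "Q False" and ?B' = "Q True" and ?C = "R False" and ?C' = "R True"
  let ?x = "V False False False" and ?xa = "V True False False" and ?xb = "V False True False" and ?xc = "V False False True"
  note I = cube_planes_incidence[OF c]
  have ab: "\<exists>a b. a *\<^sub>R ?A + (1 / ev ?A' ?x) *\<^sub>R ?A' = b *\<^sub>R ?B + (1 / ev ?B' ?x) *\<^sub>R ?B'"
    by (rule two_pencils_meet[OF t3(2), where y = ?xa and w = ?xb]) (use t t3(1) in \<open>simp_all add: I\<close>)
  have ac: "\<exists>a c. a *\<^sub>R ?A + (1 / ev ?A' ?x) *\<^sub>R ?A' = c *\<^sub>R ?C + (1 / ev ?C' ?x) *\<^sub>R ?C'"
    by (rule two_pencils_meet[OF t2(2), where y = ?xa and w = ?xc]) (use t t2(1) in \<open>simp_all add: I\<close>)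
  have bc: "\<exists>b c. b *\<^sub>R ?B + (1 / ev ?B' ?x) *\<^sub>R ?B' = c *\<^sub>R ?C + (1 / ev ?C' ?x) *\<^sub>R ?C'"
    by (rule two_pencils_meet[OF t1(2), where y = ?xb and w = ?xc]) (use t t1(1) in \<open>simp_all add: I\<close>)
  obtain a b where 1: "a *\<^sub>R ?A + (1 / ev ?A' ?x) *\<^sub>R ?A' = b *\<^sub>R ?B + (1 / ev ?B' ?x) *\<^sub>R ?B'" using ab by blast
  obtain a2 c2 where 2: "a2 *\<^sub>R ?A + (1 / ev ?A' ?x) *\<^sub>R ?A' = c2 *\<^sub>R ?C + (1 / ev ?C' ?x) *\<^sub>R ?C'" using ac by blast
  obtain b3 c3 where 3: "b3 *\<^sub>R ?B + (1 / ev ?B' ?x) *\<^sub>R ?B' = c3 *\<^sub>R ?C + (1 / ev ?C' ?x) *\<^sub>R ?C'" using bc by blast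
  define v where "v = a *\<^sub>R ?A + (1 / ev ?A' ?x) *\<^sub>R ?A'"
  \<comment> \<open>Combining the three relations eliminates \<open>?A'\<close>, \<open>?B'\<close>
    and \<open>?C'\<close>; the rest is tested at a neighbour of \<open>?x\<close> that lies on
    \<open>?B\<close> and \<open>?C\<close> but not on \<open>?A\<close>.\<close>
  have E: "(a - a2) * ev ?A y = (b - b3) * ev ?B y + (c3 - c2) * ev ?C y" for y
    using arg_cong[OF 1, of "\<lambda>p. ev p y"] arg_cong[OF 2, of "\<lambda>p. ev p y"] arg_cong[OF 3, of "\<lambda>p. ev p y"]
    by (simp add: algebra_simps)
  have "ev ?A ?xa \<noteq> 0" "ev ?B ?xa = 0" "ev ?C ?xa = 0" by (simp_all add: I)
  then have "a = a2" using E[of ?xa] by simp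
  then have v2: "v = c2 *\<^sub>R ?C + (1 / ev ?C' ?x) *\<^sub>R ?C'" using 2 by (simp add: v_def)
  have v1: "v = b *\<^sub>R ?B + (1 / ev ?B' ?x) *\<^sub>R ?B'" using 1 by (simp add: v_def)
  have ne: "ev ?A' ?x \<noteq> 0" by (simp add: I)
  define s where "s = sgn (ev ?A' ?x)"
  have s: "s / ev ?A' ?x > 0" using ne by (auto simp: s_def sgn_if)
  let ?a = "\<lambda>e. if e then s / ev ?A' ?x else s * a" and ?b = "\<lambda>e. if e then s / ev ?B' ?x else s * b"
    and ?c = "\<lambda>e. if e then s / ev ?C' ?x else s * c2"
  have "s *\<^sub>R v = ?a False *\<^sub>R P False + ?a True *\<^sub>R P True" "s *\<^sub>R v = ?b False *\<^sub>R Q False + ?b True *\<^sub>R Q True"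
      "s *\<^sub>R v = ?c False *\<^sub>R R False + ?c True *\<^sub>R R True"
    unfolding if_True if_False by (subst v_def v1 v2, simp add: scaleR_add_right)+
  from pencil_signs[OF c this] s show ?thesis by (intro exI[of _ "s *\<^sub>R v"]) simp
qed

text \<open>Eliminating \<open>B'\<close> from the two vectors leaves a multiple of \<open>B\<close>
  in the span of \<open>C\<close> and \<open>C'\<close>; evaluation at \<open>x\<close> and then at
  \<open>y\<close> shows that it is zero.\<close>

lemma pencils_proportional:
  assumes v: "pencil v B B'" "pencil v C C'" and v': "pencil v' B B'" "pencil v' C C'"
    and x: "ev B x = 0" "ev C x = 0" "ev C' x \<noteq> 0" "ev B' x \<noteq> 0" and y: "ev B y \<noteq> 0" "ev C y = 0"
  shows "\<exists>c>0. v' = c *\<^sub>R v"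
proof -
  obtain b b' where b: "b > 0" "b' > 0" "v = b *\<^sub>R B + b' *\<^sub>R B'" using v(1) by (auto simp: pencil_def)
  obtain c c' where c: "v = c *\<^sub>R C + c' *\<^sub>R C'" using v(2) by (auto simp: pencil_def)
  obtain d d' where d: "d > 0" "d' > 0" "v' = d *\<^sub>R B + d' *\<^sub>R B'" using v'(1) by (auto simp: pencil_def)
  obtain e e' where e: "v' = e *\<^sub>R C + e' *\<^sub>R C'" using v'(2) by (auto simp: pencil_def)
  have 1: "b' *\<^sub>R v' - d' *\<^sub>R v = (b' * d - d' * b) *\<^sub>R B" by (simp add: b(3) d(3) algebra_simps)
  have 2: "b' *\<^sub>R v' - d' *\<^sub>R v = (b' * e - d' * c) *\<^sub>R C + (b' * e' - d' * c') *\<^sub>R C'"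
    by (simp add: c e algebra_simps)
  have E: "(b' * d - d' * b) * ev B y = (b' * e - d' * c) * ev C y + (b' * e' - d' * c') * ev C' y" for y
    using arg_cong[OF trans[OF 1[symmetric] 2], of "\<lambda>p. ev p y"] by simp
  have "b' * e' - d' * c' = 0" using E[of x] x by simp
  then have "b' * d - d' * b = 0" using E[of y] y by simp
  then have "b' *\<^sub>R v' = d' *\<^sub>R v" using 1 by simp
  then have "(1 / b') *\<^sub>R (b' *\<^sub>R v') = (1 / b') *\<^sub>R (d' *\<^sub>R v)" by simp
  then have "v' = (d' / b') *\<^sub>R v" using b by simp
  then show ?thesis using b d by (intro exI[of _ "d' / b'"]) simp
qed

text \<open>Unit normals with product 1 coincide, by equality in the Cauchy-Schwarz inequality.
  Parallel planes of equal orientation cannot each have the opposite side of the cube on the side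
  given by \<open>\<sigma>\<close>.\<close>

lemma opposite_lor:
  assumes c: "cube_planes P Q R \<sigma> V"
  shows "lor (P False) (P True) \<noteq> 0"
proof
  let ?p = "P False" and ?q = "P True"
  assume "lor ?p ?q = 0"
  moreover have o: "norm (fst ?p) = 1" "norm (fst ?q) = 1" "fst (snd ?p) = 1" "fst (snd ?q) = 1"
    using cube_planesD(1)[OF c] by (auto simp: oplane_def)
  ultimately have "fst ?p \<bullet> fst ?q = norm (fst ?p) * norm (fst ?q)" by (simp add: lor_def)
  then have "norm (fst ?p) *\<^sub>R fst ?q = norm (fst ?q) *\<^sub>R fst ?p" using norm_cauchy_schwarz_eq by blast
  then have "fst ?q = fst ?p" using o by simp
  then have e: "ev ?q x = ev ?p x + (snd (snd ?q) - snd (snd ?p))" for x by (simp add: ev_def)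
  have "\<sigma> * ev ?q (V False False False) < 0" "\<sigma> * ev ?p (V True False False) < 0"
    by (rule cube_planesD[OF c]; simp)+
  moreover have "ev ?p (V False False False) = 0" "ev ?q (V True False False) = 0"
    by (rule cube_planesD[OF c])+
  ultimately show False using e[of "V False False False"] e[of "V True False False"]
    by (auto simp: mult_less_0_iff)
qed

lemma pencil_lor:
  assumes c: "cube_planes P Q R \<sigma> V" and v: "pencil v (P False) (P True)"
  shows "lor v v \<noteq> 0"
proof -
  obtain a b where ab: "a > 0" "b > 0" "v = a *\<^sub>R P False + b *\<^sub>R P True" using v by (auto simp: pencil_def)
  have "lor v v = 2 * a * b * lor (P False) (P True)"
    using oplane_null[OF cube_planesD(1)[OF c]] by (simp add: ab(3) lor_commute[of "P True" "P False"])
  then show ?thesis using ab opposite_lor[OF c] by simp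
qed

section \<open>Reflections of pencils and projective cubes\<close>

definition reflect :: "laguerre \<Rightarrow> laguerre \<Rightarrow> laguerre" where
  "reflect v x = x - (2 * lor x v / lor v v) *\<^sub>R v"

lemma refl_pencil:
  assumes v: "v = a *\<^sub>R x + b *\<^sub>R y" "b \<noteq> 0" "oplane x" "oplane y" "lor v v \<noteq> 0"
  shows "reflect v y = - (a / b) *\<^sub>R x"
proof -
  have "2 * b * lor y v = lor v v"
    by (rule lor_refl_half[of v b y a x]) (use v in \<open>simp_all add: add.commute\<close>)
  then have "2 * lor y v / lor v v = 1 / b" using v(2,5) by (simp add: field_simps)
  then have "reflect v y = y - (1 / b) *\<^sub>R (a *\<^sub>R x + b *\<^sub>R y)" unfolding reflect_def by (simp add: v(1)[symmetric])
  then show ?thesis using v(2) by (simp add: scaleR_add_right)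
qed

lemma reflect_linear: "reflect v (a *\<^sub>R x + b *\<^sub>R y) = a *\<^sub>R reflect v x + b *\<^sub>R reflect v y"
  by (simp add: reflect_def algebra_simps add_divide_distrib)

text \<open>Reflection in \<open>v\<close> takes \<open>x\<close> and \<open>y\<close> to negative
  multiples of \<open>x'\<close> and \<open>y'\<close>; the minus sign restores a positive
  combination.\<close>

lemma pencil_refl:
  assumes u: "pencil u x y" and x: "pencil v x' x" "pencil v y' y"
    and o: "oplane x" "oplane x'" "oplane y" "oplane y'" and n: "lor v v \<noteq> 0"
  shows "pencil (- reflect v u) x' y'"
proof -
  obtain a b where ab: "a > 0" "b > 0" "u = a *\<^sub>R x + b *\<^sub>R y" using u by (auto simp: pencil_def)
  obtain c c' where c: "c > 0" "c' > 0" "v = c *\<^sub>R x' + c' *\<^sub>R x" using x(1) by (auto simp: pencil_def)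
  obtain d d' where d: "d > 0" "d' > 0" "v = d *\<^sub>R y' + d' *\<^sub>R y" using x(2) by (auto simp: pencil_def)
  have rx: "reflect v x = - (c / c') *\<^sub>R x'" by (rule refl_pencil[OF c(3)]) (use c o n in auto)
  have ry: "reflect v y = - (d / d') *\<^sub>R y'" by (rule refl_pencil[OF d(3)]) (use d o n in auto)
  have "- reflect v u = (a * c / c') *\<^sub>R x' + (b * d / d') *\<^sub>R y'"
    unfolding ab(3) reflect_linear rx ry by simp
  moreover have "a * c / c' > 0" "b * d / d' > 0" using ab c d by simp_all
  ultimately show ?thesis unfolding pencil_def by blast
qed

lemma projective_cube_pencil:
  assumes c: "cube_planes P Q R \<sigma> V"
    and v: "pencil v (P False) (P True)" "pencil v (Q False) (Q True)" "pencil v (R False) (R True)"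
  shows "projective_cube V"
proof -
  obtain a a' where a: "a > 0" "a' > 0" "v = a *\<^sub>R P False + a' *\<^sub>R P True" using v(1) by (auto simp: pencil_def)
  obtain b b' where b: "b > 0" "b' > 0" "v = b *\<^sub>R Q False + b' *\<^sub>R Q True" using v(2) by (auto simp: pencil_def)
  obtain d d' where d: "d > 0" "d' > 0" "v = d *\<^sub>R R False + d' *\<^sub>R R True" using v(3) by (auto simp: pencil_def)
  note I = cube_planesD(4-6)[OF c]
  have ev0: "\<sigma> * ev v (V x y w) < 0" for x y w
  proof -
    have "ev v (V x y w) = (if x then a else a') * ev (P (\<not> x)) (V x y w)"
      using I(1)[of True y w] I(1)[of False y w] by (cases x) (simp_all add: a(3))
    then have e: "\<sigma> * ev v (V x y w) = (if x then a else a') * (\<sigma> * ev (P (\<not> x)) (V x y w))" by simp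
    show ?thesis unfolding e
    proof (rule mult_pos_neg)
      show "(if x then a else a') > 0" using a by simp
      show "\<sigma> * ev (P (\<not> x)) (V x y w) < 0" by (rule cube_planesD(7)[OF c]) simp
    qed
  qed
  \<comment> \<open>As \<open>v = a *\<^sub>R P False + a' *\<^sub>R P True\<close>, the quotient of
    the first term by \<open>v\<close> is 0 on one side and 1 on the other. The factor
    \<open>- \<sigma>\<close> makes the denominator positive at the vertices.\<close>
  define S :: "(real^3) \<times> real \<Rightarrow> (real^3) \<times> real" where
    "S X = (- \<sigma>) *\<^sub>R (vector [a * hev (P False) X, b * hev (Q False) X, d * hev (R False) X], hev v X)" for X
  have lin: "linear S"
    by (rule linearI) (simp_all add: S_def prod_eq_iff vec_eq_iff forall_3 algebra_simps)
  have s0: "\<sigma> \<noteq> 0" using ev0[of True True True] by auto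
  have "X = 0" if "S X = 0" for X
  proof -
    have h: "hev (P False) X = 0" "hev (Q False) X = 0" "hev (R False) X = 0" "hev v X = 0"
    proof -
      have "(vector [a * hev (P False) X, b * hev (Q False) X, d * hev (R False) X] :: real^3, hev v X) = 0"
        using that s0 unfolding S_def scaleR_eq_0_iff by simp
      then show "hev (P False) X = 0" "hev (Q False) X = 0" "hev (R False) X = 0" "hev v X = 0"
        using a(1) b(1) d(1) by (auto simp: prod_eq_iff vec_eq_iff forall_3)
    qed
    have e: "hev p X = fst p \<bullet> (fst X - snd X *\<^sub>R V False False False) + snd X * ev p (V False False False)" for p
      by (simp add: hev_def ev_def inner_diff_right algebra_simps)
    have "fst X - snd X *\<^sub>R V False False False = 0"
      by (rule cube_planes_vertex_unique[OF c, of False _ False False])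
        (use h(1-3) I in \<open>simp_all add: e\<close>)
    then have "snd X * ev v (V False False False) = 0" using h(4) by (simp add: e)
    then have "snd X = 0" using ev0[of False False False] by auto
    then show ?thesis using \<open>fst X - _ = 0\<close> by (simp add: prod_eq_iff)
  qed
  then have inj: "inj S" using linear_injective_0[OF lin] by blast
  then obtain T where T: "linear T" "\<And>X. T (S X) = X" "\<And>X. S (T X) = X"
    using linear_injective_isomorphism[OF lin] by blast
  have bij: "bij T" by (rule o_bij[of S]) (auto simp: T)
  have SV: "S (V x y w, 1) = (- \<sigma> * ev v (V x y w)) *\<^sub>R (std_corner x y w, 1)" for x y w
  proof -
    have "a * ev (P False) (V x y w) = ev v (V x y w) * of_bool x"
      using I(1)[of True y w] I(1)[of False y w] by (cases x) (simp_all add: a(3))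
    moreover have "b * ev (Q False) (V x y w) = ev v (V x y w) * of_bool y"
      using I(2)[of True x w] I(2)[of False x w] by (cases y) (simp_all add: b(3))
    moreover have "d * ev (R False) (V x y w) = ev v (V x y w) * of_bool w"
      using I(3)[of True x y] I(3)[of False x y] by (cases w) (simp_all add: d(3))
    ultimately show ?thesis by (simp add: S_def vec_eq_iff forall_3)
  qed
  have TC: "T (std_corner x y w, 1) = (1 / (- \<sigma> * ev v (V x y w))) *\<^sub>R (V x y w, 1)" for x y w
  proof -
    have n: "- \<sigma> * ev v (V x y w) \<noteq> 0" using ev0[of x y w] by auto
    have "(V x y w, 1) = T ((- \<sigma> * ev v (V x y w)) *\<^sub>R (std_corner x y w, 1))" using T(2) SV by metis
    also have "\<dots> = (- \<sigma> * ev v (V x y w)) *\<^sub>R T (std_corner x y w, 1)" by (rule linear_cmul[OF T(1)])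
    finally show ?thesis using n by simp
  qed
  have pos: "snd (T (std_corner x y w, 1)) > 0" for x y w
    unfolding TC using ev0[of x y w] by simp
  have PT: "proj_map T (std_corner x y w) = V x y w" for x y w
    by (rule proj_map_eqI[where T=T, OF TC]) (use ev0[of x y w] in auto)
  have "proj_map T ` cube_hull std_corner = cube_hull V"
    using cube_hull_proj_map[where V=std_corner, OF T(1) bij_is_inj[OF bij] pos] by (simp add: PT)
  moreover have "cube_hull std_corner \<subseteq> {x. snd (T (x, 1)) > 0}"
    by (rule cube_hull_homog_pos[where V=std_corner, OF T(1) pos])
  ultimately have "(\<forall>x\<in>cbox 0 1. proj_finite_at T x)" "proj_map T ` cbox 0 1 = cube_hull V"
    unfolding cube_hull_std_corner proj_finite_at_def by force+
  then show ?thesis unfolding projective_cube_def using T(1) bij PT by blast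
qed

text \<open>Instantiates \<open>laguerre_pair\<close> with coefficients drawn from the pencils and
  with the inscribed sphere of \<open>V\<close>, its radius signed by
  \<open>\<sigma>\<close>.\<close>

lemma pair_image:
  assumes c: "cube_planes P Q R \<sigma> V" "cube_planes P' Q' R' \<tau> V'"
    and u: "\<And>e. pencil u (P e) (P' e)" "\<And>e. pencil u (Q e) (Q' e)" "\<And>e. pencil u (R e) (R' e)"
    and U: "lor u u \<noteq> 0" and s: "\<sigma> = 1 \<or> \<sigma> = - 1" "\<tau> = 1 \<or> \<tau> = - 1" and V: "circumscribed V"
  shows "\<sigma> * \<tau> < 0 \<Longrightarrow> circumscribed V'"
    "(\<And>a b d. V a b d \<noteq> V' a b d) \<Longrightarrow> perspective V V'"
proof -
  obtain pa pb where p: "\<And>e. pa e > 0" "\<And>e. pb e > 0" "\<And>e. u = pa e *\<^sub>R P e + pb e *\<^sub>R P' e"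
    using u(1) unfolding pencil_def by metis
  obtain qa qb where q: "\<And>e. qa e > 0" "\<And>e. qb e > 0" "\<And>e. u = qa e *\<^sub>R Q e + qb e *\<^sub>R Q' e"
    using u(2) unfolding pencil_def by metis
  obtain ra rb where r: "\<And>e. ra e > 0" "\<And>e. rb e > 0" "\<And>e. u = ra e *\<^sub>R R e + rb e *\<^sub>R R' e"
    using u(3) unfolding pencil_def by metis
  obtain z \<rho> where z: "inscribed_sphere (cube_hull V) z \<rho>" and cub: "cubical_polytope V"
    using V unfolding circumscribed_def by blast
  have rho: "\<rho> > 0" using z by (simp add: inscribed_sphere_def)
  interpret laguerre_pair P Q R P' Q' R' \<sigma> \<tau> V V' u pa pb qa qb ra rb z "\<sigma> * \<rho>"
    by unfold_locales (use c p q r U s rho cube_planes_tangent[OF c(1) s(1) V z] in auto)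
  have "\<bar>\<sigma> * \<rho>\<bar> = \<rho>" using s rho by auto
  then show "\<sigma> * \<tau> < 0 \<Longrightarrow> circumscribed V'" using circumscribed_image cub z by simp
  show "(\<And>a b d. V a b d \<noteq> V' a b d) \<Longrightarrow> perspective V V'"
    using perspective_image pencil_rho[OF u(1)[of True] cube_planesD(1)[OF c(1)] cube_planesD(1)[OF c(2)]] by simp
qed

text \<open>\<open>(x, \<kappa>)\<close> is a direction in which the sphere could vary while
  touching all six planes. For \<open>\<kappa> \<noteq> 0\<close> it could be shrunk to a point
  common to the planes, and opposite vertices would coincide.\<close>

lemma cube_no_common_direction:
  assumes c: "cube_planes P Q R \<sigma> V"
    and t: "\<And>e. sph (P e) z \<rho> = 0 \<and> sph (Q e) z \<rho> = 0 \<and> sph (R e) z \<rho> = 0"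
    and x: "\<And>e. fst (P e) \<bullet> x + \<kappa> = 0 \<and> fst (Q e) \<bullet> x + \<kappa> = 0 \<and> fst (R e) \<bullet> x + \<kappa> = 0"
  shows "x = 0 \<and> \<kappa> = 0"
proof (cases "\<kappa> = 0")
  case True
  have "x = 0" by (rule cube_planes_vertex_unique[OF c, of False _ False False]) (use x[of False] True in simp_all)
  then show ?thesis using True by simp
next
  case False
  have o: "fst (snd (P e)) = 1" "fst (snd (Q e)) = 1" "fst (snd (R e)) = 1" for e
    using cube_planesD(1-3)[OF c] by (auto simp: oplane_def)
  have "z = V e e e + (\<rho> / \<kappa>) *\<^sub>R x" for e
  proof -
    have "z - V e e e - (\<rho> / \<kappa>) *\<^sub>R x = 0"
    proof (rule cube_planes_vertex_unique[OF c, of e _ e e])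
      have *: "fst p \<bullet> (z - V e e e - (\<rho> / \<kappa>) *\<^sub>R x) = 0"
        if "ev p (V e e e) = 0" "sph p z \<rho> = 0" "fst p \<bullet> x + \<kappa> = 0" "fst (snd p) = 1" for p
      proof -
        have "fst p \<bullet> x = - \<kappa>" "ev p z = - \<rho>" using that by (simp_all add: sph_def)
        then show ?thesis using that(1) False by (simp add: inner_diff_right ev_diff[symmetric])
            (simp add: ev_def)
      qed
      show "fst (P e) \<bullet> (z - V e e e - (\<rho> / \<kappa>) *\<^sub>R x) = 0"
        by (rule *) (use t[of e] x[of e] o cube_planesD(4)[OF c] in auto)
      show "fst (Q e) \<bullet> (z - V e e e - (\<rho> / \<kappa>) *\<^sub>R x) = 0"
        by (rule *) (use t[of e] x[of e] o cube_planesD(5)[OF c] in auto)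
      show "fst (R e) \<bullet> (z - V e e e - (\<rho> / \<kappa>) *\<^sub>R x) = 0"
        by (rule *) (use t[of e] x[of e] o cube_planesD(6)[OF c] in auto)
    qed
    then show ?thesis by (simp add: algebra_simps)
  qed
  from this[of True] this[of False] have "V True True True = V False False False" by (metis add_right_cancel)
  then show ?thesis
    using cube_planes_incidence(1)[OF c, of True True True True] cube_planes_incidence(1)[OF c, of True False False False]
    by simp
qed

lemma cube_tangent_unique:
  assumes c: "cube_planes P Q R \<sigma> V"
    and t: "\<And>e. sph (P e) z \<rho> = 0 \<and> sph (Q e) z \<rho> = 0 \<and> sph (R e) z \<rho> = 0"
    and t': "\<And>e. sph (P e) z' \<rho>' = 0 \<and> sph (Q e) z' \<rho>' = 0 \<and> sph (R e) z' \<rho>' = 0"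
  shows "z = z'" "\<rho> = \<rho>'"
proof -
  have o: "fst (snd (P e)) = 1" "fst (snd (Q e)) = 1" "fst (snd (R e)) = 1" for e
    using cube_planesD(1-3)[OF c] by (auto simp: oplane_def)
  have d: "fst p \<bullet> (z - z') + (\<rho> - \<rho>') = 0" if "sph p z \<rho> = 0" "sph p z' \<rho>' = 0" "fst (snd p) = 1" for p
    using that by (simp add: sph_def ev_def inner_diff_right)
  have "z - z' = 0 \<and> \<rho> - \<rho>' = 0"
    by (rule cube_no_common_direction[OF c t]) (use d t t' o in blast)
  then show "z = z'" "\<rho> = \<rho>'" by simp_all
qed

subsection \<open>Net-cubes\<close>

context laguerre_net
begin

lemma net12: "laguerre_net a2 b2 a1 b1 a3 b3 (\<lambda>j i k. f i j k) q p r (\<lambda>j i k. Z i j k) (\<lambda>j i k. rad i j k)"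
  by (rule laguerre_net_swap12[OF laguerre_net_axioms])

lemma net23: "laguerre_net a1 b1 a3 b3 a2 b2 (\<lambda>i k j. f i j k) p r q (\<lambda>i k j. Z i j k) (\<lambda>i k j. rad i j k)"
  by (rule laguerre_net_swap23[OF laguerre_net_axioms])

text \<open>The plane \<open>r (k + 1)\<close> separates the centres: it touches the first sphere,
  and by the order on the lines the second cell lies strictly beyond it. Equal parity gives
  \<open>k + 1 < k'\<close>.\<close>

lemma sphere_distinct_less:
  assumes c: "ncube 1 i j k" "ncube 1 i j k'" and k: "k < k'"
  shows "Z i j k \<noteq> Z i j k'"
proof -
  have m: "k \<in> {a3..b3}" "k + 1 \<in> {a3..b3}" using c by (auto simp: is_net_cube_def)
  have "even (k' - k)" using c by (auto simp: is_net_cube_def)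
  then have k2: "k + 1 < k'" using k by presburger
  have "sph (r (k + 1)) (Z i j k) (sg i * rad i j k) = 0" and rad: "rad i j k > 0"
    using cell_sphere[OF c(1)] by (auto dest!: spec[of _ True])
  then have "ev (r (k + 1)) (Z i j k) = - sg i * rad i j k"
    using oplanes(3)[OF m(2)] by (simp add: sph_def oplane_def)
  then have neg: "sg i * ev (r (k + 1)) (Z i j k) < 0" using rad by (simp add: mult.assoc[symmetric])
  let ?H = "{x. sg i * ev (r (k + 1)) x > 0}"
  have "convex ?H"
  proof -
    have "?H = {x. (sg i *\<^sub>R fst (r (k + 1))) \<bullet> x > - sg i * snd (snd (r (k + 1)))}"
      by (auto simp: ev_def algebra_simps)
    then show ?thesis using convex_halfspace_gt[of "- sg i * snd (snd (r (k + 1)))" "sg i *\<^sub>R fst (r (k + 1))"] by metis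
  qed
  moreover have "net_cube f 1 i j k' a b d \<in> ?H" for a b d
  proof -
    define x y l where "x = i + of_bool a" and "y = j + of_bool b" and "l = k' + of_bool d"
    have xy: "x \<in> {a1..b1}" "y \<in> {a2..b2}" "l \<in> {a3..b3}"
      using c by (auto simp: is_net_cube_def x_def y_def l_def of_bool_def)
    have z: "ev (r (k + 1)) (f x y (k + 1)) = 0" using inc[OF xy(1,2) m(2)] by simp
    have "sg i * ev (r (k + 1)) (f x y k) < 0"
      using cube_planesD(9)[OF cell_planes[OF c(1)], of False True a b] by (simp add: net_cube_def x_def y_def)
    from on_line_sign_down(2)[OF lines(1)[OF xy(1,2)] thick(3) m(2,1) xy(3) z this]
    show ?thesis using k2 by (simp add: net_cube_def x_def y_def l_def of_bool_def)
  qed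
  ultimately have "cube_hull (net_cube f 1 i j k') \<subseteq> ?H"
    unfolding cube_hull_def by (intro hull_minimal) auto
  then have "sg i * ev (r (k + 1)) (Z i j k') > 0" using cell_sphere[OF c(2)] by blast
  then show ?thesis using neg by auto
qed

lemma sphere_distinct_r:
  assumes "ncube 1 i j k" "ncube 1 i j k'" "k \<noteq> k'"
  shows "Z i j k \<noteq> Z i j k'"
  using sphere_distinct_less[OF assms(1,2)] sphere_distinct_less[OF assms(2,1)] assms(3) by (metis linorder_neqE)

end

context laguerre_net
begin

lemma sphere_distinct_q:
  assumes "ncube 1 i j k" "ncube 1 i j' k" "j \<noteq> j'"
  shows "Z i j k \<noteq> Z i j' k"
proof (rule laguerre_net.sphere_distinct_r[OF net23 _ _ assms(3)])
  show "is_net_cube {a1..b1} {a3..b3} {a2..b2} 1 i k j" "is_net_cube {a1..b1} {a3..b3} {a2..b2} 1 i k j'"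
    using assms by (auto simp: is_net_cube_def)
qed

lemma sphere_distinct_p:
  assumes "ncube 1 i j k" "ncube 1 i' j k" "i \<noteq> i'"
  shows "Z i j k \<noteq> Z i' j k"
proof (rule laguerre_net.sphere_distinct_r[OF laguerre_net_swap23[OF net12] _ _ assms(3)])
  show "is_net_cube {a2..b2} {a3..b3} {a1..b1} 1 j k i" "is_net_cube {a2..b2} {a3..b3} {a1..b1} 1 j k i'"
    using assms by (auto simp: is_net_cube_def)
qed

text \<open>Moving the cell in one direction keeps the four planes of the other two directions,
  which thus touch two different spheres. The three directions supply the three auxiliary
  spheres.\<close>

lemma cell_pencil:
  assumes c: "ncube 1 i j k" and c1: "ncube 1 i' j k" "i' \<noteq> i" and c2: "ncube 1 i j' k" "j' \<noteq> j"
    and c3: "ncube 1 i j k'" "k' \<noteq> k"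
  shows "\<exists>v. pencil v (p i) (p (i + 1)) \<and> pencil v (q j) (q (j + 1)) \<and> pencil v (r k) (r (k + 1))"
proof -
  have "\<exists>v. pencil v (p (i + of_bool False)) (p (i + of_bool True)) \<and> pencil v (q (j + of_bool False)) (q (j + of_bool True))
     \<and> pencil v (r (k + of_bool False)) (r (k + of_bool True))"
  proof (rule cube_concurrent[OF cell_planes[OF c], where z = "Z i j k" and \<rho> = "sg i * rad i j k"
        and za = "Z i' j k" and \<rho>a = "sg i' * rad i' j k" and zb = "Z i j' k" and \<rho>b = "sg i * rad i j' k"
        and zc = "Z i j k'" and \<rho>c = "sg i * rad i j k'"])
    show "(Z i j k, sg i * rad i j k) \<noteq> (Z i' j k, sg i' * rad i' j k)"
      using sphere_distinct_p[OF c c1(1)] c1(2) by auto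
    show "(Z i j k, sg i * rad i j k) \<noteq> (Z i j' k, sg i * rad i j' k)"
      using sphere_distinct_q[OF c c2(1)] c2(2) by auto
    show "(Z i j k, sg i * rad i j k) \<noteq> (Z i j k', sg i * rad i j k')"
      using sphere_distinct_r[OF c c3(1)] c3(2) by auto
  qed (use cell_sphere[OF c] cell_sphere[OF c1(1)] cell_sphere[OF c2(1)] cell_sphere[OF c3(1)] in blast)+
  then show ?thesis by simp
qed

text \<open>\<open>\<epsilon>\<close> matters modulo 2 only. One vector serves all cells of the
  parity class and all three directions.\<close>

definition class_pencil :: "int \<Rightarrow> laguerre \<Rightarrow> bool" where
  "class_pencil \<epsilon> v \<longleftrightarrow>
     (\<forall>i. even (i - \<epsilon>) \<longrightarrow> a1 \<le> i \<longrightarrow> i < b1 \<longrightarrow> pencil v (p i) (p (i + 1))) \<and>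
     (\<forall>j. even (j - \<epsilon>) \<longrightarrow> a2 \<le> j \<longrightarrow> j < b2 \<longrightarrow> pencil v (q j) (q (j + 1))) \<and>
     (\<forall>k. even (k - \<epsilon>) \<longrightarrow> a3 \<le> k \<longrightarrow> k < b3 \<longrightarrow> pencil v (r k) (r (k + 1)))"

text \<open>The two given cells provide every cell of the class with another one in each direction.
  Vectors of cells that differ in one index share the pencils of the other two directions and are
  therefore proportional.\<close>

lemma class_pencil_exists:
  assumes c1: "ncube 1 i1 j1 k1" and c2: "ncube 1 i2 j2 k2" and ne: "i1 \<noteq> i2" "j1 \<noteq> j2" "k1 \<noteq> k2" and ev: "even (i1 - i2)"
  shows "\<exists>v. class_pencil i1 v"
proof -
  let ?V = "net_cube f 1 i1 j1 k1"
  have I: "ev (p i1) (?V a b d) = 0 \<longleftrightarrow> \<not> a" "ev (p (i1 + 1)) (?V a b d) = 0 \<longleftrightarrow> a"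
    "ev (q j1) (?V a b d) = 0 \<longleftrightarrow> \<not> b" "ev (q (j1 + 1)) (?V a b d) = 0 \<longleftrightarrow> b"
    "ev (r k1) (?V a b d) = 0 \<longleftrightarrow> \<not> d" "ev (r (k1 + 1)) (?V a b d) = 0 \<longleftrightarrow> d" for a b d
    using cube_planes_incidence[OF cell_planes[OF c1], of False a b d]
      cube_planes_incidence[OF cell_planes[OF c1], of True a b d] by simp_all
  have cells: "ncube 1 i j k" if "even (i - i1)" "a1 \<le> i" "i < b1" "even (j - i1)" "a2 \<le> j" "j < b2"
    "even (k - i1)" "a3 \<le> k" "k < b3" for i j k
    using that by (auto simp: is_net_cube_def)
  have m: "even (i1 - i1)" "a1 \<le> i1" "i1 < b1" "even (j1 - i1)" "a2 \<le> j1" "j1 < b2" "even (k1 - i1)" "a3 \<le> k1" "k1 < b3"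
    "even (i2 - i1)" "a1 \<le> i2" "i2 < b1" "even (j2 - i1)" "a2 \<le> j2" "j2 < b2" "even (k2 - i1)" "a3 \<le> k2" "k2 < b3"
    using c1 c2 ev by (auto simp: is_net_cube_def)
  have ex: "\<exists>v. pencil v (p i) (p (i + 1)) \<and> pencil v (q j) (q (j + 1)) \<and> pencil v (r k) (r (k + 1))"
    if c: "ncube 1 i j k" and e: "even (i - i1)" for i j k
  proof -
    \<comment> \<open>One of the two given cells always has an index different from the present
      one.\<close>
    define i' j' k' where "i' = (if i = i1 then i2 else i1)" and "j' = (if j = j1 then j2 else j1)"
      and "k' = (if k = k1 then k2 else k1)"
    have n: "i' \<noteq> i" "j' \<noteq> j" "k' \<noteq> k" using ne by (auto simp: i'_def j'_def k'_def)
    have mm: "even (i - i1)" "a1 \<le> i" "i < b1" "even (j - i1)" "a2 \<le> j" "j < b2" "even (k - i1)" "a3 \<le> k" "k < b3"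
      using c e by (auto simp: is_net_cube_def)
    have "ncube 1 i' j k" "ncube 1 i j' k" "ncube 1 i j k'"
      unfolding i'_def j'_def k'_def using mm m by (auto intro!: cells split: if_splits)
    then show ?thesis using cell_pencil[OF c _ n(1) _ n(2) _ n(3)] by blast
  qed
  obtain v where v: "pencil v (p i1) (p (i1 + 1))" "pencil v (q j1) (q (j1 + 1))" "pencil v (r k1) (r (k1 + 1))"
    using ex[OF c1] by auto
  have unscale: "pencil v x y" if s: "pencil v' x y" "\<exists>c>0. v' = c *\<^sub>R v" for v' x y
  proof -
    obtain c where "c > 0" "v' = c *\<^sub>R v" using s(2) by blast
    then show ?thesis using pencil_scale[OF s(1), of "1 / c"] by simp
  qed
  have "pencil v (p i) (p (i + 1))" if t: "even (i - i1)" "a1 \<le> i" "i < b1" for i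
  proof -
    obtain v' where v': "pencil v' (p i) (p (i + 1))" "pencil v' (q j1) (q (j1 + 1))" "pencil v' (r k1) (r (k1 + 1))"
      using ex[OF cells[OF t m(4-9)] t(1)] by blast
    show ?thesis
      by (rule unscale[OF v'(1)], rule pencils_proportional[OF v(2,3) v'(2,3), where x = "?V False False False" and y = "?V False True False"])
        (simp_all add: I)
  qed
  moreover have "pencil v (q j) (q (j + 1))" if t: "even (j - i1)" "a2 \<le> j" "j < b2" for j
  proof -
    obtain v' where v': "pencil v' (p i1) (p (i1 + 1))" "pencil v' (q j) (q (j + 1))" "pencil v' (r k1) (r (k1 + 1))"
      using ex[OF cells[OF m(1-3) t m(7-9)]] by auto
    show ?thesis
      by (rule unscale[OF v'(2)], rule pencils_proportional[OF v(1,3) v'(1,3), where x = "?V False False False" and y = "?V True False False"])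
        (simp_all add: I)
  qed
  moreover have "pencil v (r k) (r (k + 1))" if t: "even (k - i1)" "a3 \<le> k" "k < b3" for k
  proof -
    obtain v' where v': "pencil v' (p i1) (p (i1 + 1))" "pencil v' (q j1) (q (j1 + 1))" "pencil v' (r k) (r (k + 1))"
      using ex[OF cells[OF m(1-6) t]] by auto
    show ?thesis
      by (rule unscale[OF v'(3)], rule pencils_proportional[OF v(1,2) v'(1,2), where x = "?V False False False" and y = "?V True False False"])
        (simp_all add: I)
  qed
  ultimately show ?thesis unfolding class_pencil_def by blast
qed

lemma class_pencil_lor:
  assumes "ncube 1 i j k" "class_pencil \<epsilon> v" "even (i - \<epsilon>)"
  shows "lor v v \<noteq> 0"
proof -
  have "pencil v (p i) (p (i + 1))" using assms by (auto simp: class_pencil_def is_net_cube_def)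
  then show ?thesis using pencil_lor[OF cell_planes[OF assms(1)]] by simp
qed

lemma sg_unit: "c \<noteq> 0 \<Longrightarrow> sgn (real_of_int c) * sg i = 1 \<or> sgn (real_of_int c) * sg i = - 1"
  by (auto simp: sg_def sgn_if)

text \<open>The cube of size \<open>c + 2\<close> is the mirror image of the concentric one of size
  \<open>c\<close>: corresponding planes bound unit intervals, and at both ends these belong to the
  parity class of \<open>i\<close>.\<close>

lemma circumscribed_odd:
  assumes C: "\<And>i j k. ncube 1 i j k \<Longrightarrow> circumscribed (net_cube f 1 i j k)"
  shows "ncube (2 * int n + 1) i j k \<Longrightarrow> circumscribed (net_cube f (2 * int n + 1) i j k)"
proof (induction n arbitrary: i j k)
  case 0
  then show ?case using C by simp
next
  case (Suc n)
  define c where "c = 2 * int n + 1"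
  have c2: "2 * int (Suc n) + 1 = c + 2" by (simp add: c_def)
  have big: "ncube (c + 2) i j k" using Suc.prems by (simp only: c2)
  have small: "ncube c (i + 1) (j + 1) (k + 1)"
    using big by (auto simp: is_net_cube_def c_def)
  have cells: "ncube 1 i j k" "ncube 1 (i + c + 1) (j + c + 1) (k + c + 1)" and e: "even (c + 1)"
    using big by (auto simp: is_net_cube_def c_def)
  have "\<exists>v. class_pencil i v"
    by (rule class_pencil_exists[OF cells]) (use e in \<open>auto simp: c_def\<close>)
  then obtain v where v: "class_pencil i v" ..
  have r: "a1 \<le> i" "i < b1" "a1 \<le> i + c + 1" "i + c + 1 < b1" "a2 \<le> j" "j < b2" "a2 \<le> j + c + 1" "j + c + 1 < b2"
    "a3 \<le> k" "k < b3" "a3 \<le> k + c + 1" "k + c + 1 < b3" "even (i - i)" "even (j - i)" "even (k - i)"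
    "even (i + c + 1 - i)" "even (j + c + 1 - i)" "even (k + c + 1 - i)"
    using cells e by (auto simp: is_net_cube_def)
  have V: "pencil v (p i) (p (i + 1))" "pencil v (p (i + c + 1)) (p (i + c + 1 + 1))"
    "pencil v (q j) (q (j + 1))" "pencil v (q (j + c + 1)) (q (j + c + 1 + 1))"
    "pencil v (r k) (r (k + 1))" "pencil v (r (k + c + 1)) (r (k + c + 1 + 1))"
    using v r unfolding class_pencil_def by blast+
  have "circumscribed (net_cube f (c + 2) i j k)"
  proof (rule pair_image(1)[OF net_cube_planes_pos[OF small] net_cube_planes_pos[OF big]])
    show "pencil v (p (i + 1 + c * of_bool e)) (p (i + (c + 2) * of_bool e))" for e
      using V(1,2) pencil_commute by (cases e) (auto simp: algebra_simps)
    show "pencil v (q (j + 1 + c * of_bool e)) (q (j + (c + 2) * of_bool e))" for e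
      using V(3,4) pencil_commute by (cases e) (auto simp: algebra_simps)
    show "pencil v (r (k + 1 + c * of_bool e)) (r (k + (c + 2) * of_bool e))" for e
      using V(5,6) pencil_commute by (cases e) (auto simp: algebra_simps)
    show "lor v v \<noteq> 0" by (rule class_pencil_lor[OF cells(1) v]) simp
    show "circumscribed (net_cube f c (i + 1) (j + 1) (k + 1))"
      using Suc.IH[of "i + 1" "j + 1" "k + 1"] small by (simp only: c_def[symmetric])
  qed (use sg_cases in \<open>auto simp: c_def\<close>)
  then show ?case by (simp only: c2)
qed

lemma circumscribed_net_cube:
  assumes C: "\<And>i j k. ncube 1 i j k \<Longrightarrow> circumscribed (net_cube f 1 i j k)" and c: "ncube c i j k"
  shows "circumscribed (net_cube f c i j k)"
proof -
  have odd: "odd c" using c by (auto simp: is_net_cube_def)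
  have pos: "circumscribed (net_cube f c i j k)" if c: "ncube c i j k" "c > 0" for c i j k
  proof -
    obtain m where "c = 2 * m + 1" using c by (auto simp: is_net_cube_def elim: oddE)
    then have "c = 2 * int (nat m) + 1" using c(2) by simp
    then show ?thesis using circumscribed_odd[OF C, of "nat m" i j k] c(1) by simp
  qed
  show ?thesis
  proof (cases "c > 0")
    case True
    then show ?thesis using pos c by blast
  next
    case False
    then have "- c > 0" using odd by (cases "c = 0") auto
    from circumscribed_antipodal[OF pos[OF ncube_neg[OF c] this]]
    show ?thesis unfolding net_cube_neg by simp
  qed
qed

text \<open>\<open>m\<close> is half the difference of the sizes. Perspectivity concerns the
  vertices alone, so cubes with either sign of the size can be paired.\<close>

lemma perspective_net_cubes:
  assumes c: "ncube c i j k" and c': "ncube (c + 2 * m) (i - m) (j - m) (k - m)" and m: "odd m"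
    and V: "circumscribed (net_cube f c i j k)"
    and u: "pencil u (p i) (p (i - m))" "pencil u (q j) (q (j - m))" "pencil u (r k) (r (k - m))"
      "pencil u (p (i + c)) (p (i + c + m))" "pencil u (q (j + c)) (q (j + c + m))" "pencil u (r (k + c)) (r (k + c + m))"
  shows "perspective (net_cube f c i j k) (net_cube f (c + 2 * m) (i - m) (j - m) (k - m))"
proof -
  have odd: "odd c" using c by (auto simp: is_net_cube_def)
  \<comment> \<open>Corresponding vertices are opposite corners of these net-cubes of size
    \<open>- m\<close>, so they differ; one of the cubes also yields
    \<open>lor u u \<noteq> 0\<close>.\<close>
  have corner: "ncube (- m) (if a then i + c + m else i) (if b then j + c + m else j) (if d then k + c + m else k)" for a b d
    using c c' m odd by (auto simp: is_net_cube_def algebra_simps)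
  have n: "c \<noteq> 0" "c + 2 * m \<noteq> 0" using odd by presburger+
  show ?thesis
  proof (rule pair_image(2)[OF net_cube_planes[OF c] net_cube_planes[OF c'] _ _ _ _ sg_unit[OF n(1)] sg_unit[OF n(2)] V])
    show "pencil u (p (i + c * of_bool e)) (p (i - m + (c + 2 * m) * of_bool e))" for e
      using u(1,4) by (cases e) (auto simp: algebra_simps)
    show "pencil u (q (j + c * of_bool e)) (q (j - m + (c + 2 * m) * of_bool e))" for e
      using u(2,5) by (cases e) (auto simp: algebra_simps)
    show "pencil u (r (k + c * of_bool e)) (r (k - m + (c + 2 * m) * of_bool e))" for e
      using u(3,6) by (cases e) (auto simp: algebra_simps)
    show "lor u u \<noteq> 0"
      using pencil_lor[OF net_cube_planes[OF corner[of False False False]], of u] u(1) by simp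
    show "net_cube f c i j k a b d \<noteq> net_cube f (c + 2 * m) (i - m) (j - m) (k - m) a b d" for a b d
    proof -
      let ?W = "net_cube f (- m) (if a then i + c + m else i) (if b then j + c + m else j) (if d then k + c + m else k)"
      have "net_cube f c i j k a b d = ?W a b d"
        by (cases a; cases b; cases d) (simp_all add: net_cube_def)
      moreover have "net_cube f (c + 2 * m) (i - m) (j - m) (k - m) a b d = ?W (\<not> a) (\<not> b) (\<not> d)"
        by (cases a; cases b; cases d) (simp_all add: net_cube_def algebra_simps)
      moreover have "?W a b d \<noteq> ?W (\<not> a) (\<not> b) (\<not> d)"
        using cube_planes_incidence(1)[OF net_cube_planes[OF corner[of a b d]], of a a b d]
          cube_planes_incidence(1)[OF net_cube_planes[OF corner[of a b d]], of a "\<not> a" "\<not> b" "\<not> d"] by metis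
      ultimately show ?thesis by simp
    qed
  qed
qed

end

text \<open>Distances are counted from the even index, so that \<open>m\<close> and
  \<open>- m\<close> stand for the two families of pairs at distance
  \<open>\<bar>m\<bar>\<close>.\<close>

definition seq_pencil :: "int \<Rightarrow> int \<Rightarrow> (int \<Rightarrow> laguerre) \<Rightarrow> laguerre \<Rightarrow> int \<Rightarrow> bool" where
  "seq_pencil lo hi x u m \<longleftrightarrow>
     (\<forall>i. even i \<longrightarrow> i \<in> {lo..hi} \<longrightarrow> i + m \<in> {lo..hi} \<longrightarrow> pencil u (x i) (x (i + m)))"

lemma seq_pencilD: "seq_pencil lo hi x u m \<Longrightarrow> even i \<Longrightarrow> i \<in> {lo..hi} \<Longrightarrow> i + m \<in> {lo..hi} \<Longrightarrow> pencil u (x i) (x (i + m))"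
  by (simp add: seq_pencil_def)

text \<open>The pair \<open>i\<close>, \<open>i + m + 2\<close> is the mirror image in
  \<open>v\<close> of the inner pair \<open>i + 1\<close>, \<open>i + 1 + m\<close>. The even end of
  the inner pair is its upper one, hence the offset \<open>- m\<close> for \<open>u\<close>.\<close>

lemma seq_pencil_step_up:
  assumes v: "seq_pencil lo hi x v 1" and u: "seq_pencil lo hi x u (- m)" and o: "\<And>i. i \<in> {lo..hi} \<Longrightarrow> oplane (x i)"
    and n: "lor v v \<noteq> 0" and m: "odd m" "m > 0"
  shows "seq_pencil lo hi x (- reflect v u) (m + 2)"
  unfolding seq_pencil_def
proof (intro allI impI)
  fix i assume i: "even i" "i \<in> {lo..hi}" "i + (m + 2) \<in> {lo..hi}"
  have r: "i + 1 \<in> {lo..hi}" "i + 1 + m \<in> {lo..hi}" "i + 1 + m + 1 \<in> {lo..hi}" "i + 1 + m + - m \<in> {lo..hi}"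
    using i m by auto
  have e: "even (i + 1 + m)" using i m by simp
  have "pencil u (x (i + 1 + m)) (x (i + 1))" using seq_pencilD[OF u e r(2,4)] by simp
  moreover have "pencil v (x (i + 1 + m + 1)) (x (i + 1 + m))" using seq_pencilD[OF v e r(2,3)] pencil_commute by blast
  moreover have "pencil v (x i) (x (i + 1))" using seq_pencilD[OF v i(1,2) r(1)] .
  ultimately have "pencil (- reflect v u) (x (i + 1 + m + 1)) (x i)"
    by (rule pencil_refl) (use o i r n in auto)
  then show "pencil (- reflect v u) (x i) (x (i + (m + 2)))" using pencil_commute by (simp add: algebra_simps)
qed

lemma seq_pencil_step_down:
  assumes v: "seq_pencil lo hi x v (- 1)" and u: "seq_pencil lo hi x u m" and o: "\<And>i. i \<in> {lo..hi} \<Longrightarrow> oplane (x i)"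
    and n: "lor v v \<noteq> 0" and m: "odd m" "m > 0"
  shows "seq_pencil lo hi x (- reflect v u) (- (m + 2))"
  unfolding seq_pencil_def
proof (intro allI impI)
  fix i assume i: "even i" "i \<in> {lo..hi}" "i + - (m + 2) \<in> {lo..hi}"
  have r: "i + - 1 \<in> {lo..hi}" "i - 1 - m \<in> {lo..hi}" "i - 1 - m + - 1 \<in> {lo..hi}" "i - 1 - m + m \<in> {lo..hi}"
    using i m by auto
  have e: "even (i - 1 - m)" using i m by simp
  have "pencil u (x (i - 1 - m)) (x (i - 1))" using seq_pencilD[OF u e r(2,4)] by simp
  moreover have "pencil v (x (i - 1 - m + - 1)) (x (i - 1 - m))" using seq_pencilD[OF v e r(2,3)] pencil_commute by blast
  moreover have "pencil v (x i) (x (i - 1))" using seq_pencilD[OF v i(1,2) r(1)] by simp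
  ultimately have "pencil (- reflect v u) (x (i - 1 - m + - 1)) (x i)"
    by (rule pencil_refl) (use o i r n in auto)
  then show "pencil (- reflect v u) (x i) (x (i + - (m + 2)))" using pencil_commute by (simp add: algebra_simps)
qed

lemma odd_pos_int_induct:
  assumes "odd m" "m > 0"
  obtains n where "m = 2 * int n + 1"
proof -
  obtain l where "m = 2 * l + 1" using assms by (auto elim: oddE)
  then have "m = 2 * int (nat l) + 1" using assms by simp
  then show ?thesis using that by blast
qed

context laguerre_net
begin

definition net_pencil :: "laguerre \<Rightarrow> int \<Rightarrow> bool" where
  "net_pencil u m \<longleftrightarrow> seq_pencil a1 b1 p u m \<and> seq_pencil a2 b2 q u m \<and> seq_pencil a3 b3 r u m"

text \<open>Length 4 leaves room for a shift by one to the parity of \<open>\<epsilon>\<close> and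
  then for two unit cells at distance 2.\<close>

lemma class_pencils_large:
  assumes large: "a1 + 4 \<le> b1" "a2 + 4 \<le> b2" "a3 + 4 \<le> b3"
  shows "\<exists>i j k v. ncube 1 i j k \<and> ncube 1 (i + 2) (j + 2) (k + 2) \<and> even (i - \<epsilon>) \<and> class_pencil \<epsilon> v \<and> lor v v \<noteq> 0"
proof -
  define i j k where "i = (if even (a1 - \<epsilon>) then a1 else a1 + 1)" and "j = (if even (a2 - \<epsilon>) then a2 else a2 + 1)"
    and "k = (if even (a3 - \<epsilon>) then a3 else a3 + 1)"
  have e: "even (i - \<epsilon>)" "even (j - \<epsilon>)" "even (k - \<epsilon>)" by (auto simp: i_def j_def k_def)
  have r: "a1 \<le> i" "i + 3 \<le> b1" "a2 \<le> j" "j + 3 \<le> b2" "a3 \<le> k" "k + 3 \<le> b3"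
    using large by (auto simp: i_def j_def k_def)
  have c: "ncube 1 i j k" "ncube 1 (i + 2) (j + 2) (k + 2)" using e r by (auto simp: is_net_cube_def)
  obtain v where v: "class_pencil i v" using class_pencil_exists[OF c] by auto
  have "even (x - i) \<longleftrightarrow> even (x - \<epsilon>)" for x using e(1) by auto
  then have "class_pencil \<epsilon> v" using v unfolding class_pencil_def by simp
  then show ?thesis using c e(1) class_pencil_lor[OF c(1)] by blast
qed

text \<open>Each reflection passes from \<open>- m\<close> to \<open>m + 2\<close> or from
  \<open>m\<close> to \<open>- (m + 2)\<close>, so both signs are carried through one
  induction.\<close>

lemma net_pencil_exists:
  assumes large: "a1 + 4 \<le> b1" "a2 + 4 \<le> b2" "a3 + 4 \<le> b3" and m: "odd m"
  shows "\<exists>u. net_pencil u m"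
proof -
  obtain v where v: "class_pencil 0 v" "lor v v \<noteq> 0" using class_pencils_large[OF large, of 0] by blast
  obtain w where w: "class_pencil 1 w" "lor w w \<noteq> 0" using class_pencils_large[OF large, of 1] by blast
  have V: "net_pencil v 1" using v(1) unfolding net_pencil_def seq_pencil_def class_pencil_def by auto
  have W: "net_pencil w (- 1)"
  proof -
    have *: "pencil w (x i) (x (i + - 1))" if "\<forall>i. even (i - 1) \<longrightarrow> lo \<le> i \<longrightarrow> i < hi \<longrightarrow> pencil w (x i) (x (i + 1))"
      "even i" "i \<in> {lo..hi}" "i + - 1 \<in> {lo..hi}" for x :: "int \<Rightarrow> laguerre" and lo hi i
    proof -
      have "even (i - 1 - 1)" using that(2) by presburger
      then have "pencil w (x (i - 1)) (x (i - 1 + 1))" using that(1)[rule_format, of "i - 1"] that(3,4) by simp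
      then show ?thesis using pencil_commute[of w "x (i - 1)"] by simp
    qed
    show ?thesis unfolding net_pencil_def seq_pencil_def using w(1) * unfolding class_pencil_def by blast
  qed
  have "\<exists>u u'. net_pencil u (2 * int n + 1) \<and> net_pencil u' (- (2 * int n + 1))" for n
  proof (induction n)
    case 0
    then show ?case using V W by (intro exI[of _ v] exI[of _ w]) simp
  next
    case (Suc n)
    define l where "l = 2 * int n + 1"
    have l: "odd l" "l > 0" by (simp_all add: l_def)
    obtain u u' where u: "net_pencil u l" "net_pencil u' (- l)" using Suc unfolding l_def by blast
    have "net_pencil (- reflect v u') (l + 2)"
      unfolding net_pencil_def
      by (intro conjI seq_pencil_step_up) (use V u v l oplanes in \<open>auto simp: net_pencil_def\<close>)
    moreover have "net_pencil (- reflect w u) (- (l + 2))"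
      unfolding net_pencil_def
      by (intro conjI seq_pencil_step_down) (use W u w l oplanes in \<open>auto simp: net_pencil_def\<close>)
    moreover have "2 * int (Suc n) + 1 = l + 2" by (simp add: l_def)
    ultimately show ?case by metis
  qed
  note * = this
  show ?thesis
  proof (cases "m > 0")
    case True
    then obtain n where "m = 2 * int n + 1" using odd_pos_int_induct[OF m] by blast
    then show ?thesis using *[of n] by blast
  next
    case False
    then have "- m > 0" "odd (- m)" using m by (cases "m = 0", auto)
    then obtain n where "- m = 2 * int n + 1" using odd_pos_int_induct by blast
    then have "m = - (2 * int n + 1)" by simp
    then show ?thesis using *[of n] by blast
  qed
qed

lemma projective_net_cube:
  assumes large: "a1 + 4 \<le> b1" "a2 + 4 \<le> b2" "a3 + 4 \<le> b3" and c: "ncube c i j k"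
  shows "projective_cube (net_cube f c i j k)"
proof -
  have odd: "odd c" and r: "i \<in> {a1..b1}" "i + c \<in> {a1..b1}" "j \<in> {a2..b2}" "j + c \<in> {a2..b2}" "k \<in> {a3..b3}" "k + c \<in> {a3..b3}"
    and e: "even j = even i" "even k = even i"
    using c by (auto simp: is_net_cube_def)
  have "\<exists>u. pencil u (p i) (p (i + c)) \<and> pencil u (q j) (q (j + c)) \<and> pencil u (r k) (r (k + c))"
  proof (cases "even i")
    case True
    obtain u where "net_pencil u c" using net_pencil_exists[OF large odd] by blast
    then have "pencil u (p i) (p (i + c))" "pencil u (q j) (q (j + c))" "pencil u (r k) (r (k + c))"
      using True e r by (auto simp: net_pencil_def intro!: seq_pencilD)
    then show ?thesis by blast
  next
    case False
    \<comment> \<open>\<open>net_pencil\<close> counts from even indices, and here the even end is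
      \<open>i + c\<close>.\<close>
    obtain u where u: "net_pencil u (- c)" using net_pencil_exists[OF large, of "- c"] odd by auto
    have *: "pencil u (x (i + c)) (x (i + c + - c))"
      if "seq_pencil lo hi x u (- c)" "odd i" "i \<in> {lo..hi}" "i + c \<in> {lo..hi}" for lo hi x i
      by (rule seq_pencilD[OF that(1)]) (use that odd in auto)
    have "pencil u (p (i + c)) (p (i + c + - c))" "pencil u (q (j + c)) (q (j + c + - c))" "pencil u (r (k + c)) (r (k + c + - c))"
      using u False e r unfolding net_pencil_def by (blast intro: *)+
    then show ?thesis using pencil_commute by (intro exI[of _ u]) simp
  qed
  then obtain u where u: "pencil u (p i) (p (i + c))" "pencil u (q j) (q (j + c))" "pencil u (r k) (r (k + c))" by blast
  show ?thesis by (rule projective_cube_pencil[OF net_cube_planes[OF c], of u]) (use u in simp_all)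
qed

text \<open>In a large net \<open>net_pencil_exists\<close> supplies the vector. Otherwise
  corresponding planes belong to adjacent levels, and the unit cells between them at two opposite
  corners of the cube are a pair as in \<open>class_pencil_exists\<close>.\<close>

lemma concentric_pencil:
  assumes c: "ncube c i j k" and c': "ncube (c + 2 * m) (i - m) (j - m) (k - m)" and m: "odd m"
    and large: "a1 + 4 \<le> b1 \<and> a2 + 4 \<le> b2 \<and> a3 + 4 \<le> b3 \<or> (\<bar>m\<bar> = 1 \<and> m \<noteq> - c)"
  shows "\<exists>u. pencil u (p i) (p (i - m)) \<and> pencil u (q j) (q (j - m)) \<and> pencil u (r k) (r (k - m)) \<and>
      pencil u (p (i + c)) (p (i + c + m)) \<and> pencil u (q (j + c)) (q (j + c + m)) \<and> pencil u (r (k + c)) (r (k + c + m))"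
proof -
  have odd: "odd c" and e: "even j = even i" "even k = even i" using c by (auto simp: is_net_cube_def)
  have rng: "i \<in> {a1..b1}" "i + c \<in> {a1..b1}" "j \<in> {a2..b2}" "j + c \<in> {a2..b2}" "k \<in> {a3..b3}" "k + c \<in> {a3..b3}"
    "i - m \<in> {a1..b1}" "i + c + m \<in> {a1..b1}" "j - m \<in> {a2..b2}" "j + c + m \<in> {a2..b2}" "k - m \<in> {a3..b3}" "k + c + m \<in> {a3..b3}"
    using c c' by (auto simp: is_net_cube_def algebra_simps)
  show ?thesis
  proof (cases "a1 + 4 \<le> b1 \<and> a2 + 4 \<le> b2 \<and> a3 + 4 \<le> b3")
    case True
    have *: "pencil u (x i) (x (i - m)) \<and> pencil u (x (i + c)) (x (i + c + m))"
      if "seq_pencil lo hi x u (if even i then - m else m)" "i \<in> {lo..hi}" "i + c \<in> {lo..hi}" "i - m \<in> {lo..hi}" "i + c + m \<in> {lo..hi}"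
      for x u i lo hi
    proof (cases "even i")
      case True
      then have s: "seq_pencil lo hi x u (- m)" using that(1) by simp
      have "pencil u (x i) (x (i + - m))" by (rule seq_pencilD[OF s]) (use True that in auto)
      moreover have "pencil u (x (i + c + m)) (x (i + c + m + - m))"
        by (rule seq_pencilD[OF s]) (use True that m odd in auto)
      ultimately show ?thesis using pencil_commute by simp
    next
      case False
      then have s: "seq_pencil lo hi x u m" using that(1) by simp
      have "pencil u (x (i - m)) (x (i - m + m))" by (rule seq_pencilD[OF s]) (use False that m in auto)
      moreover have "pencil u (x (i + c)) (x (i + c + m))"
        by (rule seq_pencilD[OF s]) (use False that m odd in auto)
      ultimately show ?thesis using pencil_commute by simp
    qed
    have "odd (if even i then - m else m)" using m by simp
    then obtain u where "net_pencil u (if even i then - m else m)" using net_pencil_exists True by blast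
    then have u: "seq_pencil a1 b1 p u (if even i then - m else m)" "seq_pencil a2 b2 q u (if even j then - m else m)"
       "seq_pencil a3 b3 r u (if even k then - m else m)" by (simp_all add: net_pencil_def e)
    show ?thesis
      using *[OF u(1) rng(1,2,7,8)] *[OF u(2) rng(3,4,9,10)] *[OF u(3) rng(5,6,11,12)] by blast
  next
    case False
    then have m1: "m = 1 \<or> m = - 1" "m \<noteq> - c" using large by auto
    \<comment> \<open>Starting points, relative to the corner, of the unit intervals between
      corresponding planes. They coincide exactly for \<open>m = - c\<close>, when the second cube
      is the first one with opposite labels.\<close>
    define s t where "s = (if m = 1 then - 1 else 0 :: int)" and "t = (if m = 1 then c else c - 1)"
    have st: "s \<noteq> t" "even (t - s)" using m1 odd by (auto simp: s_def t_def)
    have cells: "ncube 1 (i + s) (j + s) (k + s)" "ncube 1 (i + t) (j + t) (k + t)"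
      using m1(1) rng e odd by (auto simp: is_net_cube_def s_def t_def)
    obtain v where v: "class_pencil (i + s) v"
      using class_pencil_exists[OF cells] st by auto
    have V: "pencil v (p (i + s)) (p (i + s + 1))" "pencil v (p (i + t)) (p (i + t + 1))"
      "pencil v (q (j + s)) (q (j + s + 1))" "pencil v (q (j + t)) (q (j + t + 1))"
      "pencil v (r (k + s)) (r (k + s + 1))" "pencil v (r (k + t)) (r (k + t + 1))"
      using v cells st e unfolding class_pencil_def is_net_cube_def by auto
    have V': "pencil v (p (i + s + 1)) (p (i + s))" "pencil v (p (i + t + 1)) (p (i + t))"
      "pencil v (q (j + s + 1)) (q (j + s))" "pencil v (q (j + t + 1)) (q (j + t))"
      "pencil v (r (k + s + 1)) (r (k + s))" "pencil v (r (k + t + 1)) (r (k + t))"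
      using V pencil_commute by blast+
    show ?thesis
      using m1(1) V V' by (intro exI[of _ v]) (auto simp: s_def t_def add_diff_eq)
  qed
qed

end

subsection \<open>Centres of the inscribed spheres\<close>

text \<open>Each step combines a plane with \<open>v\<close> or with \<open>w\<close>, so modulo
  these two vectors all planes of one direction are proportional.\<close>

lemma alternating_pencil_span:
  fixes x :: "int \<Rightarrow> laguerre"
  assumes step: "\<And>i. lo \<le> i \<Longrightarrow> i < hi \<Longrightarrow> pencil v (x i) (x (i + 1)) \<or> pencil w (x i) (x (i + 1))"
    and i0: "i0 \<in> {lo..hi}" and i: "i \<in> {lo..hi}"
  shows "\<exists>\<alpha> \<beta> \<gamma>. \<alpha> \<noteq> 0 \<and> x i = \<alpha> *\<^sub>R x i0 + \<beta> *\<^sub>R w + \<gamma> *\<^sub>R v"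
proof -
  let ?S = "\<lambda>y. \<exists>\<alpha> \<beta> \<gamma>. \<alpha> \<noteq> 0 \<and> y = \<alpha> *\<^sub>R x i0 + \<beta> *\<^sub>R w + \<gamma> *\<^sub>R v"
  have trans: "?S z" if y: "?S y" and yz: "pencil v y z \<or> pencil w y z" for y z
  proof -
    obtain \<alpha> \<beta> \<gamma> where a: "\<alpha> \<noteq> 0" "y = \<alpha> *\<^sub>R x i0 + \<beta> *\<^sub>R w + \<gamma> *\<^sub>R v" using y by blast
    from yz show ?thesis
    proof
      assume "pencil v y z"
      then obtain a' b where b: "a' > 0" "b > 0" "v = a' *\<^sub>R y + b *\<^sub>R z" by (auto simp: pencil_def)
      have "b *\<^sub>R z = v - a' *\<^sub>R y" using b(3) by simp
      then have "(1 / b) *\<^sub>R (b *\<^sub>R z) = (1 / b) *\<^sub>R (v - a' *\<^sub>R y)" by (rule arg_cong)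
      then have "z = (- a' * \<alpha> / b) *\<^sub>R x i0 + (- a' * \<beta> / b) *\<^sub>R w + ((1 - a' * \<gamma>) / b) *\<^sub>R v"
        using b(2) by (simp add: a(2) scaleR_diff_right scaleR_add_right diff_divide_distrib scaleR_diff_left)
      moreover have "- a' * \<alpha> / b \<noteq> 0" using a b by simp
      ultimately show ?thesis by blast
    next
      assume "pencil w y z"
      then obtain a' b where b: "a' > 0" "b > 0" "w = a' *\<^sub>R y + b *\<^sub>R z" by (auto simp: pencil_def)
      have "b *\<^sub>R z = w - a' *\<^sub>R y" using b(3) by simp
      then have "(1 / b) *\<^sub>R (b *\<^sub>R z) = (1 / b) *\<^sub>R (w - a' *\<^sub>R y)" by (rule arg_cong)
      then have "z = (- a' * \<alpha> / b) *\<^sub>R x i0 + ((1 - a' * \<beta>) / b) *\<^sub>R w + (- a' * \<gamma> / b) *\<^sub>R v"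
        using b(2) by (simp add: a(2) scaleR_diff_right scaleR_add_right diff_divide_distrib scaleR_diff_left)
      moreover have "- a' * \<alpha> / b \<noteq> 0" using a b by simp
      ultimately show ?thesis by blast
    qed
  qed
  have base: "?S (x i0)" by (intro exI[of _ 1] exI[of _ 0]) simp
  have up: "i \<le> hi \<longrightarrow> ?S (x i)" if "i0 \<le> i" for i
    using that
  proof (induction i rule: int_ge_induct)
    case (step i)
    show ?case
    proof
      assume "i + 1 \<le> hi"
      moreover have "?S (x i)" using step \<open>i + 1 \<le> hi\<close> by simp
      ultimately show "?S (x (i + 1))" using trans assms(1)[of i] step(1) i0 by auto
    qed
  qed (use base in simp)
  have down: "lo \<le> i \<longrightarrow> ?S (x i)" if "i \<le> i0" for i
    using that
  proof (induction i rule: int_le_induct)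
    case (step i)
    show ?case
    proof
      assume l: "lo \<le> i - 1"
      have "?S (x i)" using step l by simp
      moreover have "pencil v (x i) (x (i - 1)) \<or> pencil w (x i) (x (i - 1))"
        using assms(1)[of "i - 1"] l step(1) i0 pencil_commute by simp
      ultimately show "?S (x (i - 1))" using trans by blast
    qed
  qed (use base in simp)
  show ?thesis using up[of i] down[of i] i by (cases "i0 \<le> i") auto
qed

lemma alternating_pencil_coeffs:
  fixes x :: "int \<Rightarrow> laguerre"
  assumes v: "\<forall>i. even (i - \<epsilon>) \<longrightarrow> lo \<le> i \<longrightarrow> i < hi \<longrightarrow> pencil v (x i) (x (i + 1))"
    and w: "\<forall>i. even (i - (\<epsilon> + 1)) \<longrightarrow> lo \<le> i \<longrightarrow> i < hi \<longrightarrow> pencil w (x i) (x (i + 1))"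
    and i0: "i0 \<in> {lo..hi}"
  shows "\<exists>t. \<forall>i\<in>{lo..hi}. fst (t i) \<noteq> 0 \<and> x i = fst (t i) *\<^sub>R x i0 + fst (snd (t i)) *\<^sub>R w + snd (snd (t i)) *\<^sub>R v"
proof (rule bchoice, rule ballI)
  fix i assume i: "i \<in> {lo..hi}"
  have step: "pencil v (x i) (x (i + 1)) \<or> pencil w (x i) (x (i + 1))" if "lo \<le> i" "i < hi" for i
  proof (cases "even (i - \<epsilon>)")
    case True
    then show ?thesis using v that by blast
  next
    case False
    then have "even (i - (\<epsilon> + 1))" by presburger
    then show ?thesis using w that by blast
  qed
  have "\<exists>\<alpha> \<beta> \<gamma>. \<alpha> \<noteq> 0 \<and> x i = \<alpha> *\<^sub>R x i0 + \<beta> *\<^sub>R w + \<gamma> *\<^sub>R v"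
    by (rule alternating_pencil_span[OF _ i0 i]) (rule step)
  then obtain \<alpha> \<beta> \<gamma> where "\<alpha> \<noteq> 0" "x i = \<alpha> *\<^sub>R x i0 + \<beta> *\<^sub>R w + \<gamma> *\<^sub>R v" by blast
  then show "\<exists>t. fst t \<noteq> 0 \<and> x i = fst t *\<^sub>R x i0 + fst (snd t) *\<^sub>R w + snd (snd t) *\<^sub>R v"
    by (intro exI[of _ "(\<alpha>, \<beta>, \<gamma>)"]) simp
qed

context laguerre_net
begin

text \<open>Modulo \<open>v\<close>, the plane \<open>p i\<close> is a combination of
  \<open>p i0\<close> and \<open>w\<close> with coefficients depending on \<open>i\<close>. It
  vanishes at the centres of its cells, which fixes the quotient of \<open>p i0\<close> by
  \<open>w\<close> there as a function of \<open>i\<close> alone; likewise for \<open>q\<close> and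
  \<open>r\<close>. These quotients are the grid coordinates.\<close>

lemma centre_grid:
  assumes c0: "ncube 1 i0 j0 k0" and c1: "ncube 1 i1 j0 k0" "i1 \<noteq> i0" and e0: "even (i0 - \<epsilon>)"
    and v: "class_pencil \<epsilon> v" and w: "class_pencil (\<epsilon> + 1) w"
  shows "proj_orthogonal_grid {i. even (i - \<epsilon>) \<and> i \<in> {a1..b1} \<and> i + 1 \<in> {a1..b1}}
      {j. even (j - \<epsilon>) \<and> j \<in> {a2..b2} \<and> j + 1 \<in> {a2..b2}} {k. even (k - \<epsilon>) \<and> k \<in> {a3..b3} \<and> k + 1 \<in> {a3..b3}} Z"
proof -
  let ?I = "{i. even (i - \<epsilon>) \<and> i \<in> {a1..b1} \<and> i + 1 \<in> {a1..b1}}"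
    and ?J = "{j. even (j - \<epsilon>) \<and> j \<in> {a2..b2} \<and> j + 1 \<in> {a2..b2}}"
    and ?K = "{k. even (k - \<epsilon>) \<and> k \<in> {a3..b3} \<and> k + 1 \<in> {a3..b3}}"
  have cell: "ncube 1 i j k" if "i \<in> ?I" "j \<in> ?J" "k \<in> ?K" for i j k
    using that by (auto simp: is_net_cube_def)
  have m0: "i0 \<in> ?I" "i1 \<in> ?I" "j0 \<in> ?J" "k0 \<in> ?K" using c0 c1(1) e0 by (auto simp: is_net_cube_def)
  note V = v[unfolded class_pencil_def] and W0 = w[unfolded class_pencil_def]
  have "i0 \<in> {a1..b1}" using m0 by blast
  from alternating_pencil_coeffs[OF conjunct1[OF V] conjunct1[OF W0] this]
  obtain tp where tp: "\<And>i. i \<in> {a1..b1} \<Longrightarrow> fst (tp i) \<noteq> 0"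
    "\<And>i. i \<in> {a1..b1} \<Longrightarrow> p i = fst (tp i) *\<^sub>R p i0 + fst (snd (tp i)) *\<^sub>R w + snd (snd (tp i)) *\<^sub>R v" by blast
  have "j0 \<in> {a2..b2}" using m0 by blast
  from alternating_pencil_coeffs[OF conjunct1[OF conjunct2[OF V]] conjunct1[OF conjunct2[OF W0]] this]
  obtain tq where tq: "\<And>i. i \<in> {a2..b2} \<Longrightarrow> fst (tq i) \<noteq> 0"
    "\<And>i. i \<in> {a2..b2} \<Longrightarrow> q i = fst (tq i) *\<^sub>R q j0 + fst (snd (tq i)) *\<^sub>R w + snd (snd (tq i)) *\<^sub>R v" by blast
  have "k0 \<in> {a3..b3}" using m0 by blast
  from alternating_pencil_coeffs[OF conjunct2[OF conjunct2[OF V]] conjunct2[OF conjunct2[OF W0]] this]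
  obtain tr where tr: "\<And>i. i \<in> {a3..b3} \<Longrightarrow> fst (tr i) \<noteq> 0"
    "\<And>i. i \<in> {a3..b3} \<Longrightarrow> r i = fst (tr i) *\<^sub>R r k0 + fst (snd (tr i)) *\<^sub>R w + snd (snd (tr i)) *\<^sub>R v" by blast
  have P0: "pencil v (p i) (p (i + 1))" if "i \<in> ?I" for i using V that by simp
  have Q0: "pencil v (q j) (q (j + 1))" if "j \<in> ?J" for j using V that by simp
  have R0: "pencil v (r k) (r (k + 1))" if "k \<in> ?K" for k using V that by simp
  define \<rho> where "\<rho> = fst (snd v)"
  have rho: "\<rho> \<noteq> 0" using pencil_rho[OF P0[OF m0(1)]] oplanes(1) m0(1) by (auto simp: \<rho>_def)
  \<comment> \<open>On \<open>v = 0\<close> the radius is a linear function of the homogeneous centre.\<close>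
  define lam where "lam X = - hev v X / \<rho>" for X
  define lin where "lin x X = hev x X + fst (snd x) * lam X" for x X
  have lin_x: "lin (a *\<^sub>R x + b *\<^sub>R y) X = a * lin x X + b * lin y X" "lin (a *\<^sub>R x + b *\<^sub>R y + c *\<^sub>R z) X = a * lin x X + b * lin y X + c * lin z X" for a b c x y z X
    by (simp_all add: lin_def algebra_simps)
  have lin_v: "lin v X = 0" for X using rho by (simp add: lin_def lam_def \<rho>_def)
  have lin_X: "lin x (X + Y) = lin x X + lin x Y" "lin x (a *\<^sub>R X) = a * lin x X" for x X Y a
    by (simp_all add: lin_def lam_def algebra_simps add_divide_distrib diff_divide_distrib)
  have lin_p: "lin (p i) X = fst (tp i) * lin (p i0) X + fst (snd (tp i)) * lin w X" if "i \<in> {a1..b1}" for i X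
    by (subst tp(2)[OF that]) (simp add: lin_x lin_v)
  have lin_q: "lin (q j) X = fst (tq j) * lin (q j0) X + fst (snd (tq j)) * lin w X" if "j \<in> {a2..b2}" for j X
    by (subst tq(2)[OF that]) (simp add: lin_x lin_v)
  have lin_r: "lin (r k) X = fst (tr k) * lin (r k0) X + fst (snd (tr k)) * lin w X" if "k \<in> {a3..b3}" for k X
    by (subst tr(2)[OF that]) (simp add: lin_x lin_v)
  have tang: "sph (p i) (Z i j k) (sg i * rad i j k) = 0" "sph (p (i + 1)) (Z i j k) (sg i * rad i j k) = 0"
    "sph (q j) (Z i j k) (sg i * rad i j k) = 0" "sph (q (j + 1)) (Z i j k) (sg i * rad i j k) = 0"
    "sph (r k) (Z i j k) (sg i * rad i j k) = 0" "sph (r (k + 1)) (Z i j k) (sg i * rad i j k) = 0"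
    if "ncube 1 i j k" for i j k
    using cell_sphere[OF that] by (auto dest: spec[of _ True] spec[of _ False])
  have unique: "z = Z i j k" if c: "ncube 1 i j k" and z: "sph (p i) z s = 0" "sph (p (i + 1)) z s = 0" "sph (q j) z s = 0" "sph (q (j + 1)) z s = 0"
    "sph (r k) z s = 0" "sph (r (k + 1)) z s = 0" for i j k z s
  proof (rule cube_tangent_unique(1)[OF cell_planes[OF c], of z s _ "sg i * rad i j k"])
    show "sph (p (i + of_bool e)) z s = 0 \<and> sph (q (j + of_bool e)) z s = 0 \<and> sph (r (k + of_bool e)) z s = 0" for e
      using z by (cases e) simp_all
    show "sph (p (i + of_bool e)) (Z i j k) (sg i * rad i j k) = 0 \<and> sph (q (j + of_bool e)) (Z i j k) (sg i * rad i j k) = 0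
      \<and> sph (r (k + of_bool e)) (Z i j k) (sg i * rad i j k) = 0" for e
      using cell_sphere[OF c] by blast
  qed
  \<comment> \<open>A sphere touching all planes of the net would be the sphere of the cell
    \<open>(i0, j0, k0)\<close> and of the cell \<open>(i1, j0, k0)\<close> at once.\<close>
  have no_common: False
    if "\<And>i. i \<in> {a1..b1} \<Longrightarrow> sph (p i) z s = 0" "\<And>j. j \<in> {a2..b2} \<Longrightarrow> sph (q j) z s = 0" "\<And>k. k \<in> {a3..b3} \<Longrightarrow> sph (r k) z s = 0" for z s
  proof -
    have "z = Z i0 j0 k0" by (rule unique[OF c0]) (use that m0 in auto)
    moreover have "z = Z i1 j0 k0" by (rule unique[OF c1(1)]) (use that m0 in auto)
    ultimately show False using sphere_distinct_p[OF c0 c1(1)] c1(2) by simp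
  qed
  define S :: "(real^3) \<times> real \<Rightarrow> (real^3) \<times> real" where
    "S X = (vector [lin (p i0) X, lin (q j0) X, lin (r k0) X], lin w X)" for X
  have linS: "linear S"
    by (rule linearI) (simp_all add: S_def prod_eq_iff vec_eq_iff forall_3 lin_X)
  have all0: "(i \<in> {a1..b1} \<longrightarrow> lin (p i) X = 0) \<and> (j \<in> {a2..b2} \<longrightarrow> lin (q j) X = 0) \<and> (k \<in> {a3..b3} \<longrightarrow> lin (r k) X = 0)"
    if "lin (p i0) X = 0" "lin (q j0) X = 0" "lin (r k0) X = 0" "lin w X = 0" for X i j k
    using that by (simp add: lin_p lin_q lin_r)
  have o1: "fst (snd (p i)) = 1" if "i \<in> {a1..b1}" for i using oplanes(1)[OF that] by (simp add: oplane_def)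
  have o2: "fst (snd (q j)) = 1" if "j \<in> {a2..b2}" for j using oplanes(2)[OF that] by (simp add: oplane_def)
  have o3: "fst (snd (r k)) = 1" if "k \<in> {a3..b3}" for k using oplanes(3)[OF that] by (simp add: oplane_def)
  \<comment> \<open>A finite kernel point would be the centre of a sphere touching all planes, an
    infinite one a direction in which the sphere of the first cell can vary.\<close>
  have kernel: "X = 0" if "lin (p i0) X = 0" "lin (q j0) X = 0" "lin (r k0) X = 0" "lin w X = 0" for X
  proof (cases "snd X = 0")
    case True
    have l: "lin x X = fst x \<bullet> fst X + lam X" if "fst (snd x) = 1" for x
      using that True by (simp add: lin_def hev_def)
    have mm: "i0 + of_bool e \<in> {a1..b1}" "j0 + of_bool e \<in> {a2..b2}" "k0 + of_bool e \<in> {a3..b3}" for e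
      using m0 by (auto simp: of_bool_def)
    have "fst X = 0 \<and> lam X = 0"
    proof (rule cube_no_common_direction[OF cell_planes[OF c0], of "Z i0 j0 k0" "sg i0 * rad i0 j0 k0"])
      show "sph (p (i0 + of_bool e)) (Z i0 j0 k0) (sg i0 * rad i0 j0 k0) = 0 \<and> sph (q (j0 + of_bool e)) (Z i0 j0 k0) (sg i0 * rad i0 j0 k0) = 0
        \<and> sph (r (k0 + of_bool e)) (Z i0 j0 k0) (sg i0 * rad i0 j0 k0) = 0" for e using cell_sphere[OF c0] by blast
      show "fst (p (i0 + of_bool e)) \<bullet> fst X + lam X = 0 \<and> fst (q (j0 + of_bool e)) \<bullet> fst X + lam X = 0 \<and> fst (r (k0 + of_bool e)) \<bullet> fst X + lam X = 0" for e
        using all0[OF that, of "i0 + of_bool e" "j0 + of_bool e" "k0 + of_bool e"] mm[of e]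
          l[OF o1[OF mm(1)[of e]]] l[OF o2[OF mm(2)[of e]]] l[OF o3[OF mm(3)[of e]]] by simp
    qed
    then show ?thesis using True by (simp add: prod_eq_iff)
  next
    case False
    have l: "lin x X = snd X * sph x ((1 / snd X) *\<^sub>R fst X) (lam X / snd X)" for x
      using False by (simp add: lin_def hev_def sph_def ev_def algebra_simps)
    have "False"
      by (rule no_common[of "(1 / snd X) *\<^sub>R fst X" "lam X / snd X"])
        (use all0[OF that] False in \<open>auto simp: l\<close>)
    then show ?thesis ..
  qed
  have "X = 0" if "S X = 0" for X
    using that by (intro kernel) (simp_all add: S_def prod_eq_iff vec_eq_iff forall_3)
  then have "inj S" using linear_injective_0[OF linS] by blast
  then obtain T where T: "linear T" "\<And>X. T (S X) = X" "\<And>X. S (T X) = X"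
    using linear_injective_isomorphism[OF linS] by blast
  have bij: "bij T" by (rule o_bij[of S]) (auto simp: T)
  have lin_sph: "lin x (Z i j k, 1) = sph x (Z i j k) (sg i * rad i j k)" if ijk: "i \<in> ?I" "j \<in> ?J" "k \<in> ?K" for x i j k
  proof -
    note c = cell[OF ijk]
    obtain a b where "v = a *\<^sub>R p i + b *\<^sub>R p (i + 1)" using P0[OF ijk(1)] by (auto simp: pencil_def)
    then have "sph v (Z i j k) (sg i * rad i j k) = 0" using tang(1,2)[OF c] by simp
    then have "ev v (Z i j k) = - \<rho> * (sg i * rad i j k)" by (simp add: sph_def \<rho>_def)
    then have "lam (Z i j k, 1) = sg i * rad i j k" using rho by (simp add: lam_def)
    then show ?thesis by (simp add: lin_def sph_def)
  qed
  have W: "lin w (Z i j k, 1) \<noteq> 0" if ijk: "i \<in> ?I" "j \<in> ?J" "k \<in> ?K" for i j k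
  proof
    assume w0: "lin w (Z i j k, 1) = 0"
    note c = cell[OF ijk]
    have "lin (p i) (Z i j k, 1) = 0" "lin (q j) (Z i j k, 1) = 0" "lin (r k) (Z i j k, 1) = 0"
      using tang[OF c] by (simp_all add: lin_sph[OF ijk])
    then have "lin (p i0) (Z i j k, 1) = 0" "lin (q j0) (Z i j k, 1) = 0" "lin (r k0) (Z i j k, 1) = 0"
      using lin_p[of i "(Z i j k, 1)"] lin_q[of j "(Z i j k, 1)"] lin_r[of k "(Z i j k, 1)"] w0 tp(1)[of i] tq(1)[of j] tr(1)[of k] ijk by simp_all
    from kernel[OF this w0] show False by (simp add: zero_prod_def)
  qed
  \<comment> \<open>At a centre \<open>lin (p i)\<close> vanishes; this is the resulting ratio of
    \<open>lin (p i0)\<close> to \<open>lin w\<close>.\<close>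
  define x where "x i = - fst (snd (tp i)) / fst (tp i)" for i
  define y where "y j = - fst (snd (tq j)) / fst (tq j)" for j
  define zz where "zz k = - fst (snd (tr k)) / fst (tr k)" for k
  have co: "lin (p i0) (Z i j k, 1) = x i * lin w (Z i j k, 1)" "lin (q j0) (Z i j k, 1) = y j * lin w (Z i j k, 1)"
    "lin (r k0) (Z i j k, 1) = zz k * lin w (Z i j k, 1)" if ijk: "i \<in> ?I" "j \<in> ?J" "k \<in> ?K" for i j k
  proof -
    note c = cell[OF ijk]
    have "lin (p i) (Z i j k, 1) = 0" "lin (q j) (Z i j k, 1) = 0" "lin (r k) (Z i j k, 1) = 0"
      using tang[OF c] by (simp_all add: lin_sph[OF ijk])
    then show "lin (p i0) (Z i j k, 1) = x i * lin w (Z i j k, 1)" "lin (q j0) (Z i j k, 1) = y j * lin w (Z i j k, 1)"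
      "lin (r k0) (Z i j k, 1) = zz k * lin w (Z i j k, 1)"
      using lin_p[of i "(Z i j k, 1)"] lin_q[of j "(Z i j k, 1)"] lin_r[of k "(Z i j k, 1)"] tp(1)[of i] tq(1)[of j] tr(1)[of k] ijk
      by (simp_all add: x_def y_def zz_def field_simps)
  qed
  have grid: "T (vector [x i, y j, zz k], 1) = (1 / lin w (Z i j k, 1)) *\<^sub>R (Z i j k, 1)" if ijk: "i \<in> ?I" "j \<in> ?J" "k \<in> ?K" for i j k
  proof -
    let ?W = "lin w (Z i j k, 1)"
    have "S (Z i j k, 1) = ?W *\<^sub>R (vector [x i, y j, zz k], 1)"
      by (simp add: S_def co[OF ijk] vec_eq_iff forall_3)
    then have "(Z i j k, 1) = T (?W *\<^sub>R (vector [x i, y j, zz k], 1))" using T(2) by metis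
    also have "\<dots> = ?W *\<^sub>R T (vector [x i, y j, zz k], 1)" by (rule linear_cmul[OF T(1)])
    finally have "(1 / ?W) *\<^sub>R (Z i j k, 1) = (1 / ?W) *\<^sub>R (?W *\<^sub>R T (vector [x i, y j, zz k], 1))" by (rule arg_cong)
    also have "\<dots> = T (vector [x i, y j, zz k], 1)" using W[OF ijk] by simp
    finally show ?thesis by (rule sym)
  qed
  have second: "sph (s (l + 1)) z t' = 0" if t: "pencil v (s l) (s (l + 1))" "sph (s l) z t' = 0" "sph v z t' = 0" for s :: "int \<Rightarrow> laguerre" and l z t'
  proof -
    obtain a b where "a > 0" "b > 0" "v = a *\<^sub>R s l + b *\<^sub>R s (l + 1)" using t(1) by (auto simp: pencil_def)
    then show ?thesis using t(2,3) by simp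
  qed
  have sv: "sph v (Z i j k) (sg i * rad i j k) = 0" if ijk: "i \<in> ?I" "j \<in> ?J" "k \<in> ?K" for i j k
    using lin_v lin_sph[OF ijk] by metis
  \<comment> \<open>Equal coordinates would make the sphere of the cell \<open>i\<close> touch
    \<open>p i'\<close> and, through \<open>v\<close>, also \<open>p (i' + 1)\<close>; two cells
    would have the same sphere.\<close>
  have "inj_on x ?I"
  proof (rule inj_onI, rule ccontr)
    fix i i' assume i: "i \<in> ?I" "i' \<in> ?I" "x i = x i'" "i \<noteq> i'"
    note c = cell[OF i(1) m0(3,4)] and c' = cell[OF i(2) m0(3,4)]
    let ?X = "(Z i j0 k0, 1::real)"
    have "lin (p i') ?X = fst (tp i') * (x i' * lin w ?X) + fst (snd (tp i')) * lin w ?X"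
      using lin_p[of i' ?X] co(1)[OF i(1) m0(3,4)] i by simp
    also have "\<dots> = 0" using tp(1)[of i'] i(2) by (simp add: x_def)
    finally have s: "sph (p i') (Z i j0 k0) (sg i * rad i j0 k0) = 0" by (simp add: lin_sph[OF i(1) m0(3,4)])
    have "Z i j0 k0 = Z i' j0 k0"
      by (rule unique[OF c' s second[where s = p, OF P0[OF i(2)] s sv[OF i(1) m0(3,4)]]]) (use tang[OF c] in auto)
    then show False using sphere_distinct_p[OF c c'] i(4) by simp
  qed
  moreover have "inj_on y ?J"
  proof (rule inj_onI, rule ccontr)
    fix j j' assume j: "j \<in> ?J" "j' \<in> ?J" "y j = y j'" "j \<noteq> j'"
    note c = cell[OF m0(1) j(1) m0(4)] and c' = cell[OF m0(1) j(2) m0(4)]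
    let ?X = "(Z i0 j k0, 1::real)"
    have "lin (q j') ?X = fst (tq j') * (y j' * lin w ?X) + fst (snd (tq j')) * lin w ?X"
      using lin_q[of j' ?X] co(2)[OF m0(1) j(1) m0(4)] j by simp
    also have "\<dots> = 0" using tq(1)[of j'] j(2) by (simp add: y_def)
    finally have s: "sph (q j') (Z i0 j k0) (sg i0 * rad i0 j k0) = 0" by (simp add: lin_sph[OF m0(1) j(1) m0(4)])
    have "Z i0 j k0 = Z i0 j' k0"
      by (rule unique[OF c' _ _ s second[where s = q, OF Q0[OF j(2)] s sv[OF m0(1) j(1) m0(4)]]]) (use tang[OF c] in auto)
    then show False using sphere_distinct_q[OF c c'] j(4) by simp
  qed
  moreover have "inj_on zz ?K"
  proof (rule inj_onI, rule ccontr)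
    fix k k' assume k: "k \<in> ?K" "k' \<in> ?K" "zz k = zz k'" "k \<noteq> k'"
    note c = cell[OF m0(1,3) k(1)] and c' = cell[OF m0(1,3) k(2)]
    let ?X = "(Z i0 j0 k, 1::real)"
    have "lin (r k') ?X = fst (tr k') * (zz k' * lin w ?X) + fst (snd (tr k')) * lin w ?X"
      using lin_r[of k' ?X] co(3)[OF m0(1,3) k(1)] k by simp
    also have "\<dots> = 0" using tr(1)[of k'] k(2) by (simp add: zz_def)
    finally have s: "sph (r k') (Z i0 j0 k) (sg i0 * rad i0 j0 k) = 0" by (simp add: lin_sph[OF m0(1,3) k(1)])
    have "Z i0 j0 k = Z i0 j0 k'"
      by (rule unique[OF c' _ _ _ _ s second[where s = r, OF R0[OF k(2)] s sv[OF m0(1,3) k(1)]]]) (use tang[OF c] in auto)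
    then show False using sphere_distinct_r[OF c c'] k(4) by simp
  qed
  moreover have "proj_finite_at T (vector [x i, y j, zz k]) \<and> Z i j k = proj_map T (vector [x i, y j, zz k])"
    if ijk: "i \<in> ?I" "j \<in> ?J" "k \<in> ?K" for i j k
    using proj_map_eqI[where T = T, OF grid[OF ijk]] W[OF ijk] by (simp add: proj_finite_at_def grid[OF ijk])
  ultimately show ?thesis
    unfolding proj_orthogonal_grid_def using T(1) bij
    by (intro exI[of _ T] exI[of _ x] exI[of _ y] exI[of _ zz] conjI ballI) blast+
qed

lemma centre_grid_large:
  assumes large: "a1 + 4 \<le> b1" "a2 + 4 \<le> b2" "a3 + 4 \<le> b3"
  shows "proj_orthogonal_grid {i. even (i - \<epsilon>) \<and> i \<in> {a1..b1} \<and> i + 1 \<in> {a1..b1}}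
      {j. even (j - \<epsilon>) \<and> j \<in> {a2..b2} \<and> j + 1 \<in> {a2..b2}} {k. even (k - \<epsilon>) \<and> k \<in> {a3..b3} \<and> k + 1 \<in> {a3..b3}} Z"
proof -
  obtain i j k v where c: "ncube 1 i j k" "ncube 1 (i + 2) (j + 2) (k + 2)" "even (i - \<epsilon>)" and v: "class_pencil \<epsilon> v"
    using class_pencils_large[OF large, of \<epsilon>] by blast
  obtain w where w: "class_pencil (\<epsilon> + 1) w" using class_pencils_large[OF large, of "\<epsilon> + 1"] by blast
  have "ncube 1 (i + 2) j k" using c by (auto simp: is_net_cube_def)
  then show ?thesis using centre_grid[OF c(1) _ _ c(3) v w] by simp
qed

end

subsection \<open>Quadrics through diagonal lines\<close>

lemma orthogonal_plane_basis:
  fixes n :: "real^3"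
  assumes "n \<noteq> 0"
  shows "\<exists>u v. n \<bullet> u = 0 \<and> n \<bullet> v = 0 \<and> (\<forall>a b. a *\<^sub>R u + b *\<^sub>R v = 0 \<longrightarrow> a = 0 \<and> b = 0)
    \<and> (\<forall>x. n \<bullet> x = 0 \<longrightarrow> (\<exists>a b. x = a *\<^sub>R u + b *\<^sub>R v))"
proof -
  obtain B where B: "B \<subseteq> {x. n \<bullet> x = 0}" "independent B" "{x. n \<bullet> x = 0} \<subseteq> span B" "card B = dim {x. n \<bullet> x = 0}"
    using basis_exists by blast
  have "card B = 2" using dim_hyperplane[OF assms] B(4) by simp
  then obtain u v where uv: "B = {u, v}" "u \<noteq> v" by (auto simp: card_2_iff)
  have "a = 0 \<and> b = 0" if "a *\<^sub>R u + b *\<^sub>R v = 0" for a b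
  proof -
    have "finite B" using uv by simp
    have "(\<Sum>x\<in>B. (if x = u then a else b) *\<^sub>R x) = 0" using that uv by simp
    then have "\<forall>x\<in>B. (if x = u then a else b) = 0"
      using B(2) \<open>finite B\<close> independentD[of B B "\<lambda>x. if x = u then a else b"] by blast
    then show ?thesis using uv by auto
  qed
  moreover have "\<exists>a b. x = a *\<^sub>R u + b *\<^sub>R v" if x: "n \<bullet> x = 0" for x
  proof -
    have "x \<in> span {u, v}" using B(3) uv x by blast
    then obtain a where "x - a *\<^sub>R u \<in> span {v}" unfolding span_insert by blast
    then obtain b where "x - a *\<^sub>R u = b *\<^sub>R v" unfolding span_singleton by blast
    then have "x = a *\<^sub>R u + b *\<^sub>R v" by (simp add: algebra_simps)
    then show ?thesis by blast
  qed
  ultimately show ?thesis using B(1) uv by blast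
qed

lemma coplanar_hyperplane:
  fixes n :: "real^3"
  assumes n: "n \<noteq> 0" and S: "\<And>x. x \<in> S \<Longrightarrow> n \<bullet> x = h"
  shows "coplanar S"
proof -
  obtain u v where uv: "\<forall>x. n \<bullet> x = 0 \<longrightarrow> (\<exists>a b. x = a *\<^sub>R u + b *\<^sub>R v)"
    using orthogonal_plane_basis[OF n] by blast
  define c where "c = (h / (n \<bullet> n)) *\<^sub>R n"
  have c: "n \<bullet> c = h" using n by (simp add: c_def)
  have "x \<in> affine hull {c, c + u, c + v}" if "x \<in> S" for x
  proof -
    have "n \<bullet> (x - c) = 0" using S[OF that] c by (simp add: inner_diff_right)
    then obtain a b where "x - c = a *\<^sub>R u + b *\<^sub>R v" using uv by blast
    then have "x = (1 - a - b) *\<^sub>R c + a *\<^sub>R (c + u) + b *\<^sub>R (c + v)" by (simp add: algebra_simps)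
    moreover have "(1 - a - b) + a + b = 1" by simp
    ultimately show ?thesis unfolding affine_hull_3 by blast
  qed
  then show ?thesis unfolding coplanar_def by blast
qed

definition av :: "(real^3) \<times> real \<Rightarrow> real^3 \<Rightarrow> real" where
  "av y x = fst y \<bullet> x + snd y"

lemma av_linear [simp]:
  "av (y + z) x = av y x + av z x" "av (y - z) x = av y x - av z x" "av (a *\<^sub>R y) x = a * av y x"
  "av (- y) x = - av y x" "av 0 x = 0" "av (0, c) x = c"
  by (simp_all add: av_def inner_add_left inner_diff_left algebra_simps)

section \<open>Linear independence of four planes\<close>

definition lin_indep4 :: "'a::real_vector \<Rightarrow> 'a \<Rightarrow> 'a \<Rightarrow> 'a \<Rightarrow> bool" where
  "lin_indep4 y z v w \<longleftrightarrow> (\<forall>a b c d. a *\<^sub>R y + b *\<^sub>R z + c *\<^sub>R v + d *\<^sub>R w = 0 \<longrightarrow> a = 0 \<and> b = 0 \<and> c = 0 \<and> d = 0)"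

text \<open>The combination map on four-space: injectivity is independence and surjectivity is
  spanning, which are equivalent by dimension.\<close>

definition quad_comb :: "'a::real_vector \<Rightarrow> 'a \<Rightarrow> 'a \<Rightarrow> 'a \<Rightarrow> (real^3) \<times> real \<Rightarrow> 'a" where
  "quad_comb y z v w X = fst X $ 1 *\<^sub>R y + fst X $ 2 *\<^sub>R z + fst X $ 3 *\<^sub>R v + snd X *\<^sub>R w"

lemma linear_quad_comb: "linear (quad_comb y z v w)"
  by (rule linearI) (simp_all add: quad_comb_def algebra_simps)

lemma quad_comb_vector: "quad_comb y z v w (vector [a, b, c], d) = a *\<^sub>R y + b *\<^sub>R z + c *\<^sub>R v + d *\<^sub>R w"
  by (simp add: quad_comb_def)

lemma lin_indep4_inj: "lin_indep4 y z v w \<longleftrightarrow> inj (quad_comb y z v w)"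
proof
  assume l: "lin_indep4 y z v w"
  have "X = 0" if "quad_comb y z v w X = 0" for X
    using l that unfolding lin_indep4_def quad_comb_def by (auto simp: prod_eq_iff vec_eq_iff forall_3)
  then show "inj (quad_comb y z v w)" using linear_injective_0[OF linear_quad_comb] by blast
next
  assume i: "inj (quad_comb y z v w)"
  show "lin_indep4 y z v w" unfolding lin_indep4_def
  proof (intro allI impI)
    fix a b c d assume "a *\<^sub>R y + b *\<^sub>R z + c *\<^sub>R v + d *\<^sub>R w = 0"
    then have "quad_comb y z v w (vector [a, b, c], d) = 0" by (simp add: quad_comb_vector)
    then have "(vector [a, b, c] :: real^3, d) = 0" using i linear_injective_0[OF linear_quad_comb] by blast
    then show "a = 0 \<and> b = 0 \<and> c = 0 \<and> d = 0" by (simp add: prod_eq_iff vec_eq_iff forall_3)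
  qed
qed

lemma lin_indep4_span:
  fixes y z v w x :: "(real^3) \<times> real"
  assumes "lin_indep4 y z v w"
  shows "\<exists>a b c d. x = a *\<^sub>R y + b *\<^sub>R z + c *\<^sub>R v + d *\<^sub>R w"
proof -
  have "surj (quad_comb y z v w)"
    using assms linear_inj_imp_surj[OF linear_quad_comb[of y z v w]] by (simp add: lin_indep4_inj)
  then obtain X where "x = quad_comb y z v w X" by (meson surjD)
  then show ?thesis unfolding quad_comb_def by blast
qed

lemma span_lin_indep4:
  fixes y z v w :: "(real^3) \<times> real"
  assumes s: "\<And>x. \<exists>a b c d. x = a *\<^sub>R y + b *\<^sub>R z + c *\<^sub>R v + d *\<^sub>R w"
  shows "lin_indep4 y z v w"
proof -
  have "surj (quad_comb y z v w)"
  proof (rule surjI)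
    fix x
    show "quad_comb y z v w (SOME X. quad_comb y z v w X = x) = x"
    proof (rule someI_ex)
      obtain a b c d where "x = a *\<^sub>R y + b *\<^sub>R z + c *\<^sub>R v + d *\<^sub>R w" using s by blast
      then show "\<exists>X. quad_comb y z v w X = x" by (metis quad_comb_vector)
    qed
  qed
  then show ?thesis using linear_surj_imp_inj[OF linear_quad_comb[of y z v w]] by (simp add: lin_indep4_inj)
qed

lemma lin_indep4_extend:
  fixes y z v :: "(real^3) \<times> real"
  assumes i: "\<And>a b c. a *\<^sub>R y + b *\<^sub>R z + c *\<^sub>R v = 0 \<Longrightarrow> a = 0 \<and> b = 0 \<and> c = 0"
  shows "\<exists>w. lin_indep4 y z v w"
proof -
  \<comment> \<open>Filled up with the zero vector the system is dependent, so it does not span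
    four-space; any vector outside its span will do.\<close>
  have "\<not> lin_indep4 y z v 0"
  proof
    assume "lin_indep4 y z v 0"
    then have "0 *\<^sub>R y + 0 *\<^sub>R z + 0 *\<^sub>R v + 1 *\<^sub>R 0 = 0 \<longrightarrow> (1::real) = 0"
      unfolding lin_indep4_def by blast
    then show False by simp
  qed
  then have "\<exists>w. \<nexists>a b c d. w = a *\<^sub>R y + b *\<^sub>R z + c *\<^sub>R v + d *\<^sub>R 0"
    using span_lin_indep4[of y z v 0] by blast
  then obtain w where "\<nexists>a b c d. w = a *\<^sub>R y + b *\<^sub>R z + c *\<^sub>R v + d *\<^sub>R 0" by blast
  then have w: "w \<noteq> a *\<^sub>R y + b *\<^sub>R z + c *\<^sub>R v" for a b c by auto
  have "a = 0 \<and> b = 0 \<and> c = 0 \<and> d = 0" if e: "a *\<^sub>R y + b *\<^sub>R z + c *\<^sub>R v + d *\<^sub>R w = 0" for a b c d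
  proof -
    have "d = 0"
    proof (rule ccontr)
      assume d: "d \<noteq> 0"
      have "d *\<^sub>R w = - (a *\<^sub>R y + b *\<^sub>R z + c *\<^sub>R v)" using e by (metis add.commute eq_neg_iff_add_eq_0)
      then have "(1 / d) *\<^sub>R (d *\<^sub>R w) = (1 / d) *\<^sub>R (- (a *\<^sub>R y + b *\<^sub>R z + c *\<^sub>R v))" by (rule arg_cong)
      then have "w = (- a / d) *\<^sub>R y + (- b / d) *\<^sub>R z + (- c / d) *\<^sub>R v" using d by (simp add: scaleR_add_right scaleR_diff_right)
      then show False using w by blast
    qed
    then show ?thesis using e i by simp
  qed
  then show ?thesis unfolding lin_indep4_def by blast
qed

section \<open>Quadrics as sums of two products of affine functions\<close>

lemma one_sheeted_hyperboloid_forms: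
  fixes x1 x2 x3 :: "(real^3) \<times> real"
  assumes i: "\<And>a b c. a *\<^sub>R fst x1 + b *\<^sub>R fst x2 + c *\<^sub>R fst x3 = 0 \<Longrightarrow> a = 0 \<and> b = 0 \<and> c = 0"
  shows "one_sheeted_hyperboloid {x. (av x1 x)\<^sup>2 + (av x2 x)\<^sup>2 - (av x3 x)\<^sup>2 = 1}"
proof -
  define N :: "real^3^3" where "N = transpose (vector [fst x1, fst x2, fst x3])"
  have N: "N *v y = y $ 1 *\<^sub>R fst x1 + y $ 2 *\<^sub>R fst x2 + y $ 3 *\<^sub>R fst x3" for y
    by (simp add: N_def vec_eq_iff forall_3 matrix_vector_mult_def transpose_def sum_3 mult.commute)
  have "y = 0" if "N *v y = 0" for y
    using i[of "y $ 1" "y $ 2" "y $ 3"] that unfolding N by (simp add: vec_eq_iff forall_3)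
  then have "invertible N" using matrix_left_invertible_ker[of N] invertible_left_inverse[of N] by blast
  then have "invertible (transpose N)" by (simp add: transpose_invertible)
  then obtain B where B: "B ** transpose N = mat 1" "transpose N ** B = mat 1" unfolding invertible_def by blast
  have M: "transpose N *v x = vector [fst x1 \<bullet> x, fst x2 \<bullet> x, fst x3 \<bullet> x]" for x
    by (simp add: N_def vec_eq_iff forall_3 matrix_vector_mult_def transpose_def sum_3 inner_vec_def)
  define M where "M = transpose N"
  note B = B[folded M_def] and M = M[folded M_def]
  define s :: "real^3" where "s = vector [snd x1, snd x2, snd x3]"
  let ?Q = "{x :: real^3. (x$1)\<^sup>2 + (x$2)\<^sup>2 - (x$3)\<^sup>2 = 1}"
  let ?H = "{x. (av x1 x)\<^sup>2 + (av x2 x)\<^sup>2 - (av x3 x)\<^sup>2 = 1}"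
  have mem: "x \<in> ?H \<longleftrightarrow> M *v x + s \<in> ?Q" for x
    unfolding M by (simp add: s_def av_def)
  have "?H = (\<lambda>x. B *v x + (- (B *v s))) ` ?Q"
  proof (intro subset_antisym subsetI)
    fix x assume "x \<in> ?H"
    then have "M *v x + s \<in> ?Q" using mem by blast
    moreover have "x = B *v (M *v x + s) + (- (B *v s))"
      by (simp add: matrix_vector_right_distrib matrix_vector_mul_assoc B)
    ultimately show "x \<in> (\<lambda>x. B *v x + (- (B *v s))) ` ?Q" by blast
  next
    fix x assume "x \<in> (\<lambda>x. B *v x + (- (B *v s))) ` ?Q"
    then obtain y where y: "y \<in> ?Q" "x = B *v y + (- (B *v s))" by blast
    have "M *v x + s = y"
      unfolding y(2) by (simp add: matrix_vector_right_distrib matrix_vector_mult_diff_distrib matrix_vector_mul_assoc B)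
    then have "M *v x + s \<in> ?Q" using y(1) by (simp only:)
    then show "x \<in> ?H" using mem by blast
  qed
  moreover have "invertible B" using B unfolding invertible_def by blast
  ultimately show ?thesis unfolding one_sheeted_hyperboloid_def by blast
qed

lemma unit_vector_exists: "\<exists>c s \<rho>. c\<^sup>2 + s\<^sup>2 = (1::real) \<and> a = \<rho> * c \<and> b = \<rho> * s \<and> \<rho>\<^sup>2 = a\<^sup>2 + b\<^sup>2"
proof (cases "a = 0 \<and> b = 0")
  case True
  then show ?thesis by (intro exI[of _ 1] exI[of _ 0]) simp
next
  case False
  define \<rho> where "\<rho> = sqrt (a\<^sup>2 + b\<^sup>2)"
  have pos: "a\<^sup>2 + b\<^sup>2 > 0" using False by (simp add: sum_power2_gt_zero_iff)
  then have r: "\<rho> > 0" "\<rho>\<^sup>2 = a\<^sup>2 + b\<^sup>2" by (simp_all add: \<rho>_def)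
  have "(a / \<rho>)\<^sup>2 + (b / \<rho>)\<^sup>2 = (a\<^sup>2 + b\<^sup>2) / \<rho>\<^sup>2" by (simp add: power_divide add_divide_distrib)
  also have "\<dots> = 1" unfolding r(2) using pos by (intro divide_self) linarith
  finally have "(a / \<rho>)\<^sup>2 + (b / \<rho>)\<^sup>2 = 1" .
  then show ?thesis using r by (intro exI[of _ "a / \<rho>"] exI[of _ "b / \<rho>"] exI[of _ \<rho>]) simp
qed

text \<open>The form is a difference of two sums of two squares. Rotations within the positive and
  within the negative pair bring the constant function 1 to
  \<open>a *\<^sub>R p1 + b *\<^sub>R n1\<close>, and a hyperbolic change of \<open>p1\<close> and
  \<open>n1\<close> turns one square into 1. \<open>A * B + C * D\<close> is, up to a factor, the
  dual form at the plane at infinity; its sign decides which square this is.\<close>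

lemma hyperboloid_quadric_neg:
  fixes y1 z1 y2 z2 :: "(real^3) \<times> real"
  assumes ind: "lin_indep4 y1 z1 y2 z2" and one: "(0, 1) = A *\<^sub>R y1 + B *\<^sub>R z1 + C *\<^sub>R y2 + D *\<^sub>R z2"
    and K: "A * B + C * D < 0"
  shows "one_sheeted_hyperboloid {x. av y1 x * av z1 x + av y2 x * av z2 x = 0}"
proof -
  obtain c s a where cs: "c\<^sup>2 + s\<^sup>2 = 1" "A + B = a * c" "C + D = a * s" "a\<^sup>2 = (A + B)\<^sup>2 + (C + D)\<^sup>2"
    using unit_vector_exists by blast
  obtain c' s' b where cs': "c'\<^sup>2 + s'\<^sup>2 = 1" "A - B = b * c'" "C - D = b * s'" "b\<^sup>2 = (A - B)\<^sup>2 + (C - D)\<^sup>2"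
    using unit_vector_exists by blast
  have ab: "b\<^sup>2 - a\<^sup>2 = - 4 * (A * B + C * D)" unfolding cs(4) cs'(4) by (simp add: power2_eq_square algebra_simps)
  then have pos: "b\<^sup>2 - a\<^sup>2 > 0" using K by simp
  define k where "k = sqrt (b\<^sup>2 - a\<^sup>2)"
  have k: "k > 0" "k\<^sup>2 = b\<^sup>2 - a\<^sup>2" using pos by (simp_all add: k_def)
  define P1 where "P1 = (1/2) *\<^sub>R (y1 + z1)"
  define N1 where "N1 = (1/2) *\<^sub>R (y1 - z1)"
  define P2 where "P2 = (1/2) *\<^sub>R (y2 + z2)"
  define N2 where "N2 = (1/2) *\<^sub>R (y2 - z2)"
  define p1 where "p1 = c *\<^sub>R P1 + s *\<^sub>R P2"
  define p2 where "p2 = - s *\<^sub>R P1 + c *\<^sub>R P2"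
  define n1 where "n1 = c' *\<^sub>R N1 + s' *\<^sub>R N2"
  define n2 where "n2 = - s' *\<^sub>R N1 + c' *\<^sub>R N2"
  have sum_half: "y1 = P1 + N1" "z1 = P1 - N1" "y2 = P2 + N2" "z2 = P2 - N2"
    by (simp_all add: P1_def N1_def P2_def N2_def flip: scaleR_add_right scaleR_diff_right scaleR_2)
  have one': "(0, 1) = a *\<^sub>R p1 + b *\<^sub>R n1"
  proof -
    have "(0, 1) = (A + B) *\<^sub>R P1 + (A - B) *\<^sub>R N1 + (C + D) *\<^sub>R P2 + (C - D) *\<^sub>R N2"
      unfolding one sum_half by (simp add: algebra_simps)
    also have "\<dots> = a *\<^sub>R p1 + b *\<^sub>R n1"
      unfolding cs(2,3) cs'(2,3) p1_def n1_def by (simp add: algebra_simps)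
    finally show ?thesis .
  qed
  have ind': "lin_indep4 p1 p2 n1 n2" unfolding lin_indep4_def
  proof (intro allI impI)
    fix w x y z assume e: "w *\<^sub>R p1 + x *\<^sub>R p2 + y *\<^sub>R n1 + z *\<^sub>R n2 = 0"
    define W X Y Z where "W = w * c - x * s" and "X = w * s + x * c" and "Y = y * c' - z * s'" and "Z = y * s' + z * c'"
    have "w *\<^sub>R p1 + x *\<^sub>R p2 + y *\<^sub>R n1 + z *\<^sub>R n2
      = W *\<^sub>R P1 + X *\<^sub>R P2 + Y *\<^sub>R N1 + Z *\<^sub>R N2"
      by (simp add: p1_def p2_def n1_def n2_def W_def X_def Y_def Z_def algebra_simps)
    also have "\<dots> = ((W + Y) / 2) *\<^sub>R y1 + ((W - Y) / 2) *\<^sub>R z1 + ((X + Z) / 2) *\<^sub>R y2 + ((X - Z) / 2) *\<^sub>R z2"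
      by (simp add: P1_def P2_def N1_def N2_def algebra_simps add_divide_distrib diff_divide_distrib)
    finally have "(W + Y) / 2 = 0 \<and> (W - Y) / 2 = 0 \<and> (X + Z) / 2 = 0 \<and> (X - Z) / 2 = 0"
      using e ind unfolding lin_indep4_def by metis
    then have 0: "W = 0" "X = 0" "Y = 0" "Z = 0" by simp_all
    have "w = (c\<^sup>2 + s\<^sup>2) * w" "x = (c\<^sup>2 + s\<^sup>2) * x" using cs(1) by simp_all
    moreover have "(c\<^sup>2 + s\<^sup>2) * w = c * W + s * X" "(c\<^sup>2 + s\<^sup>2) * x = c * X - s * W"
      by (simp_all add: W_def X_def power2_eq_square algebra_simps)
    moreover have "y = (c'\<^sup>2 + s'\<^sup>2) * y" "z = (c'\<^sup>2 + s'\<^sup>2) * z" using cs'(1) by simp_all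
    moreover have "(c'\<^sup>2 + s'\<^sup>2) * y = c' * Y + s' * Z" "(c'\<^sup>2 + s'\<^sup>2) * z = c' * Z - s' * Y"
      by (simp_all add: Y_def Z_def power2_eq_square algebra_simps)
    ultimately show "w = 0 \<and> x = 0 \<and> y = 0 \<and> z = 0" using 0 by simp
  qed
  \<comment> \<open>As \<open>a * av p1 x + b * av n1 x = 1\<close>, the square of \<open>X\<close>
    minus 1 is \<open>b\<^sup>2 - a\<^sup>2\<close> times the difference of the squares of
    \<open>p1\<close> and \<open>n1\<close>.\<close>
  define X where "X = b *\<^sub>R p1 + a *\<^sub>R n1"
  have "one_sheeted_hyperboloid {x. (av X x)\<^sup>2 + (av (k *\<^sub>R p2) x)\<^sup>2 - (av (k *\<^sub>R n2) x)\<^sup>2 = 1}"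
  proof (rule one_sheeted_hyperboloid_forms)
    fix l m n assume "l *\<^sub>R fst X + m *\<^sub>R fst (k *\<^sub>R p2) + n *\<^sub>R fst (k *\<^sub>R n2) = 0"
    then have f: "fst (l *\<^sub>R X + (m * k) *\<^sub>R p2 + (n * k) *\<^sub>R n2) = 0" by (simp add: mult.commute)
    define d where "d = snd (l *\<^sub>R X + (m * k) *\<^sub>R p2 + (n * k) *\<^sub>R n2)"
    have "l *\<^sub>R X + (m * k) *\<^sub>R p2 + (n * k) *\<^sub>R n2 = d *\<^sub>R (0, 1)"
      using f by (simp add: prod_eq_iff d_def)
    then have "(l * b - d * a) *\<^sub>R p1 + (m * k) *\<^sub>R p2 + (l * a - d * b) *\<^sub>R n1 + (n * k) *\<^sub>R n2 = 0"
      unfolding one' X_def by (simp add: algebra_simps)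
    then have z: "l * b - d * a = 0" "m * k = 0" "l * a - d * b = 0" "n * k = 0"
      using ind' unfolding lin_indep4_def by blast+
    have "l * (b\<^sup>2 - a\<^sup>2) = b * (l * b - d * a) - a * (l * a - d * b)" by (simp add: power2_eq_square algebra_simps)
    then have "l = 0" using z(1,3) pos by simp
    then show "l = 0 \<and> m = 0 \<and> n = 0" using z(2,4) k by simp
  qed
  moreover have "(av X x)\<^sup>2 + (av (k *\<^sub>R p2) x)\<^sup>2 - (av (k *\<^sub>R n2) x)\<^sup>2 = 1
    \<longleftrightarrow> av y1 x * av z1 x + av y2 x * av z2 x = 0" for x
  proof -
    have o: "a * av p1 x + b * av n1 x = 1" using arg_cong[OF one', of "\<lambda>y. av y x"] by simp
    have "av y1 x * av z1 x + av y2 x * av z2 x = (av P1 x)\<^sup>2 + (av P2 x)\<^sup>2 - ((av N1 x)\<^sup>2 + (av N2 x)\<^sup>2)"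
      unfolding sum_half by (simp add: power2_eq_square algebra_simps)
    also have "(av P1 x)\<^sup>2 + (av P2 x)\<^sup>2 = (c\<^sup>2 + s\<^sup>2) * ((av P1 x)\<^sup>2 + (av P2 x)\<^sup>2)" using cs(1) by simp
    also have "\<dots> = (av p1 x)\<^sup>2 + (av p2 x)\<^sup>2"
      by (simp add: p1_def p2_def power2_eq_square algebra_simps)
    also have "(av N1 x)\<^sup>2 + (av N2 x)\<^sup>2 = (c'\<^sup>2 + s'\<^sup>2) * ((av N1 x)\<^sup>2 + (av N2 x)\<^sup>2)" using cs'(1) by simp
    also have "\<dots> = (av n1 x)\<^sup>2 + (av n2 x)\<^sup>2"
      by (simp add: n1_def n2_def power2_eq_square algebra_simps)
    finally have E: "av y1 x * av z1 x + av y2 x * av z2 x = (av p1 x)\<^sup>2 + (av p2 x)\<^sup>2 - ((av n1 x)\<^sup>2 + (av n2 x)\<^sup>2)" .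
    have "(av X x)\<^sup>2 + (av (k *\<^sub>R p2) x)\<^sup>2 - (av (k *\<^sub>R n2) x)\<^sup>2 - (a * av p1 x + b * av n1 x)\<^sup>2
      = (b * av p1 x + a * av n1 x)\<^sup>2 - (a * av p1 x + b * av n1 x)\<^sup>2 + k\<^sup>2 * ((av p2 x)\<^sup>2 - (av n2 x)\<^sup>2)"
      by (simp add: X_def power_mult_distrib algebra_simps)
    also have "\<dots> = k\<^sup>2 * ((av p1 x)\<^sup>2 + (av p2 x)\<^sup>2 - ((av n1 x)\<^sup>2 + (av n2 x)\<^sup>2))"
      unfolding k(2) by (simp add: power2_eq_square algebra_simps)
    finally have "(av X x)\<^sup>2 + (av (k *\<^sub>R p2) x)\<^sup>2 - (av (k *\<^sub>R n2) x)\<^sup>2 - 1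
      = k\<^sup>2 * (av y1 x * av z1 x + av y2 x * av z2 x)" unfolding o E by simp
    then show ?thesis using k(1) by auto
  qed
  ultimately show ?thesis by simp
qed

text \<open>Negating both \<open>z1\<close> and \<open>z2\<close> keeps the quadric and changes the
  sign of \<open>A * B + C * D\<close>.\<close>

lemma hyperboloid_quadric:
  fixes y1 z1 y2 z2 :: "(real^3) \<times> real"
  assumes ind: "lin_indep4 y1 z1 y2 z2" and one: "(0, 1) = A *\<^sub>R y1 + B *\<^sub>R z1 + C *\<^sub>R y2 + D *\<^sub>R z2"
    and K: "A * B + C * D \<noteq> 0"
  shows "one_sheeted_hyperboloid {x. av y1 x * av z1 x + av y2 x * av z2 x = 0}"
proof (cases "A * B + C * D < 0")
  case True
  then show ?thesis using hyperboloid_quadric_neg[OF ind one] by blast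
next
  case False
  have "lin_indep4 y1 (- z1) y2 (- z2)" unfolding lin_indep4_def
  proof (intro allI impI)
    fix a b c d assume "a *\<^sub>R y1 + b *\<^sub>R - z1 + c *\<^sub>R y2 + d *\<^sub>R - z2 = 0"
    then have "a *\<^sub>R y1 + (- b) *\<^sub>R z1 + c *\<^sub>R y2 + (- d) *\<^sub>R z2 = 0" by simp
    then have "a = 0 \<and> - b = 0 \<and> c = 0 \<and> - d = 0" using ind unfolding lin_indep4_def by blast
    then show "a = 0 \<and> b = 0 \<and> c = 0 \<and> d = 0" by simp
  qed
  moreover have "(0, 1) = A *\<^sub>R y1 + (- B) *\<^sub>R (- z1) + C *\<^sub>R y2 + (- D) *\<^sub>R (- z2)" using one by simp
  moreover have "A * - B + C * - D < 0" using False K by simp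
  ultimately have "one_sheeted_hyperboloid {x. av y1 x * av (- z1) x + av y2 x * av (- z2) x = 0}"
    by (rule hyperboloid_quadric_neg)
  moreover have "av y1 x * av (- z1) x + av y2 x * av (- z2) x = 0 \<longleftrightarrow> av y1 x * av z1 x + av y2 x * av z2 x = 0" for x
    by auto
  ultimately show ?thesis by simp
qed

lemma one_sheeted_hyperboloid_not_UNIV:
  assumes "one_sheeted_hyperboloid H"
  shows "H \<noteq> UNIV"
proof
  assume U: "H = UNIV"
  obtain A :: "real^3^3" and c where A: "invertible A" "H = (\<lambda>x. A *v x + c) ` {x. (x$1)\<^sup>2 + (x$2)\<^sup>2 - (x$3)\<^sup>2 = 1}"
    using assms unfolding one_sheeted_hyperboloid_def by blast
  have "c \<in> H" using U by simp
  then obtain x where x: "c = A *v x + c" "(x$1)\<^sup>2 + (x$2)\<^sup>2 - (x$3)\<^sup>2 = 1" using A(2) by blast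
  have "A *v x = 0" using x(1) by simp
  then have "x = 0" using A(1) invertible_left_inverse[of A] matrix_left_invertible_ker[of A] by blast
  then show False using x(2) by simp
qed

lemma possibly_degenerate_quadric:
  assumes ne: "\<exists>x. av y1 x * av z1 x + av y2 x * av z2 x \<noteq> 0"
  shows "possibly_degenerate_hyperboloid {x. av y1 x * av z1 x + av y2 x * av z2 x = 0}"
proof -
  define h where "h y = (1/2) *\<^sub>R y" for y :: "(real^3) \<times> real"
  have q: "(av (h (y1 + z1)) x)\<^sup>2 + (av (h (y2 + z2)) x)\<^sup>2 - (av (h (y1 - z1)) x)\<^sup>2 - (av (h (y2 - z2)) x)\<^sup>2
    = av y1 x * av z1 x + av y2 x * av z2 x" for x
    by (simp add: h_def power2_eq_square algebra_simps)
  let ?q = "\<lambda>x. (fst (h (y1 + z1)) \<bullet> x + snd (h (y1 + z1)))\<^sup>2 + (fst (h (y2 + z2)) \<bullet> x + snd (h (y2 + z2)))\<^sup>2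
     - (fst (h (y1 - z1)) \<bullet> x + snd (h (y1 - z1)))\<^sup>2 - (fst (h (y2 - z2)) \<bullet> x + snd (h (y2 - z2)))\<^sup>2"
  have q': "?q x = av y1 x * av z1 x + av y2 x * av z2 x" for x using q[of x] by (simp only: av_def)
  have "(\<exists>x. ?q x \<noteq> 0) \<and> {x. av y1 x * av z1 x + av y2 x * av z2 x = 0} = {x. ?q x = 0}"
    unfolding q' using ne by simp
  then show ?thesis unfolding possibly_degenerate_hyperboloid_def Let_def by blast
qed

definition good_quadric :: "(real^3) set \<Rightarrow> bool" where
  "good_quadric H \<longleftrightarrow> one_sheeted_hyperboloid H \<and> possibly_degenerate_hyperboloid H"

lemma good_quadric_forms:
  fixes y1 z1 y2 z2 :: "(real^3) \<times> real"
  assumes "lin_indep4 y1 z1 y2 z2" "(0, 1) = A *\<^sub>R y1 + B *\<^sub>R z1 + C *\<^sub>R y2 + D *\<^sub>R z2" "A * B + C * D \<noteq> 0"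
  shows "good_quadric {x. av y1 x * av z1 x + av y2 x * av z2 x = 0}"
proof -
  have h: "one_sheeted_hyperboloid {x. av y1 x * av z1 x + av y2 x * av z2 x = 0}"
    by (rule hyperboloid_quadric[OF assms])
  from one_sheeted_hyperboloid_not_UNIV[OF this] have "\<exists>x. av y1 x * av z1 x + av y2 x * av z2 x \<noteq> 0" by blast
  then show ?thesis using h possibly_degenerate_quadric unfolding good_quadric_def by blast
qed

text \<open>Every quadric \<open>\<alpha> \<gamma> + l \<beta> \<delta> = 0\<close> contains the
  four edges. It touches the plane at infinity for \<open>A * C + l * B * D = 0\<close>, and as one
  of the two products is nonzero, \<open>l\<close> can be taken as 1 or -1.\<close>

lemma quadrilateral_quadric:
  fixes \<alpha> \<beta> \<gamma> \<delta> :: "(real^3) \<times> real"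
  assumes ind: "lin_indep4 \<alpha> \<beta> \<gamma> \<delta>" and one: "(0, 1) = A *\<^sub>R \<alpha> + B *\<^sub>R \<beta> + C *\<^sub>R \<gamma> + D *\<^sub>R \<delta>"
    and ne: "A * C \<noteq> 0 \<or> B * D \<noteq> 0"
  shows "\<exists>H. good_quadric H \<and> {x. av \<alpha> x = 0 \<and> av \<delta> x = 0} \<subseteq> H \<and> {x. av \<alpha> x = 0 \<and> av \<beta> x = 0} \<subseteq> H
    \<and> {x. av \<beta> x = 0 \<and> av \<gamma> x = 0} \<subseteq> H \<and> {x. av \<gamma> x = 0 \<and> av \<delta> x = 0} \<subseteq> H"
proof -
  define l :: real where "l = (if A * C + B * D \<noteq> 0 then 1 else - 1)"
  have l: "l \<noteq> 0" "l * l = 1" by (auto simp: l_def)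
  have k: "A * C + (l * B) * D \<noteq> 0" using ne by (auto simp: l_def)
  have "good_quadric {x. av \<alpha> x * av \<gamma> x + av (l *\<^sub>R \<beta>) x * av \<delta> x = 0}"
  proof (rule good_quadric_forms)
    show "lin_indep4 \<alpha> \<gamma> (l *\<^sub>R \<beta>) \<delta>" unfolding lin_indep4_def
    proof (intro allI impI)
      fix a b c d assume "a *\<^sub>R \<alpha> + b *\<^sub>R \<gamma> + c *\<^sub>R l *\<^sub>R \<beta> + d *\<^sub>R \<delta> = 0"
      then have "a *\<^sub>R \<alpha> + (c * l) *\<^sub>R \<beta> + b *\<^sub>R \<gamma> + d *\<^sub>R \<delta> = 0" by (simp add: algebra_simps)
      then have "a = 0 \<and> c * l = 0 \<and> b = 0 \<and> d = 0" using ind unfolding lin_indep4_def by blast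
      then show "a = 0 \<and> b = 0 \<and> c = 0 \<and> d = 0" using l by simp
    qed
    have "B *\<^sub>R \<beta> = (l * B) *\<^sub>R (l *\<^sub>R \<beta>)" using l(2) by (simp add: mult.commute mult.left_commute)
    then show "(0, 1) = A *\<^sub>R \<alpha> + C *\<^sub>R \<gamma> + (l * B) *\<^sub>R (l *\<^sub>R \<beta>) + D *\<^sub>R \<delta>" using one by (simp add: algebra_simps)
  qed (rule k)
  then show ?thesis by (rule_tac exI[of _ "{x. av \<alpha> x * av \<gamma> x + av (l *\<^sub>R \<beta>) x * av \<delta> x = 0}"]) auto
qed

text \<open>For a diagonal with at most one line. Two planes \<open>\<alpha>\<close>,
  \<open>\<delta>\<close> through it are completed to a quadrilateral with
  \<open>\<beta> + \<delta> = (0, 1)\<close>, so that \<open>B * D\<close> is 1.\<close>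

lemma collinear_in_hyperboloid:
  fixes L :: "(real^3) set"
  assumes "collinear L"
  shows "\<exists>H. good_quadric H \<and> L \<subseteq> H"
proof -
  obtain u v where uv: "\<forall>x\<in>L. \<exists>c. x = u + c *\<^sub>R v" using assms unfolding collinear_alt by blast
  \<comment> \<open>\<open>L\<close> may be empty or a single point; any direction then
    serves.\<close>
  define d :: "real^3" where "d = (if v = 0 then axis 1 1 else v)"
  have d: "d \<noteq> 0" by (auto simp: d_def axis_eq_0_iff)
  have ud: "\<exists>c. x = u + c *\<^sub>R d" if "x \<in> L" for x
    using uv that by (cases "v = 0") (auto simp: d_def intro: exI[of _ 0])
  obtain n1 n2 where n: "d \<bullet> n1 = 0" "d \<bullet> n2 = 0" "\<forall>a b. a *\<^sub>R n1 + b *\<^sub>R n2 = 0 \<longrightarrow> a = 0 \<and> b = 0"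
    using orthogonal_plane_basis[OF d] by blast
  define \<alpha> \<delta> where "\<alpha> = (n1, - (n1 \<bullet> u))" and "\<delta> = (n2, - (n2 \<bullet> u))"
  define \<beta> where "\<beta> = (0, 1) - \<delta>"
  have i3: "a = 0 \<and> b = 0 \<and> c = 0" if "a *\<^sub>R \<alpha> + b *\<^sub>R \<beta> + c *\<^sub>R \<delta> = 0" for a b c
  proof -
    have f: "a *\<^sub>R n1 + (c - b) *\<^sub>R n2 = 0"
      using arg_cong[OF that, of fst] by (simp add: \<alpha>_def \<beta>_def \<delta>_def algebra_simps)
    then have 0: "a = 0" "c - b = 0" using n(3) by blast+
    have "a * snd \<alpha> + b * snd \<beta> + c * snd \<delta> = 0" using arg_cong[OF that, of snd] by simp
    then have "b = 0" using 0 by (simp add: \<beta>_def algebra_simps)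
    then show ?thesis using 0 by simp
  qed
  obtain \<gamma> where g: "lin_indep4 \<alpha> \<beta> \<delta> \<gamma>" using lin_indep4_extend[OF i3] by blast
  have g': "lin_indep4 \<alpha> \<beta> \<gamma> \<delta>" unfolding lin_indep4_def
  proof (intro allI impI)
    fix a b c e assume "a *\<^sub>R \<alpha> + b *\<^sub>R \<beta> + c *\<^sub>R \<gamma> + e *\<^sub>R \<delta> = 0"
    then have "a *\<^sub>R \<alpha> + b *\<^sub>R \<beta> + e *\<^sub>R \<delta> + c *\<^sub>R \<gamma> = 0" by (simp add: algebra_simps)
    then show "a = 0 \<and> b = 0 \<and> c = 0 \<and> e = 0" using g unfolding lin_indep4_def by blast
  qed
  have one: "(0, 1) = 0 *\<^sub>R \<alpha> + 1 *\<^sub>R \<beta> + 0 *\<^sub>R \<gamma> + 1 *\<^sub>R \<delta>" by (simp add: \<beta>_def)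
  from quadrilateral_quadric[OF g' one] obtain H where H: "good_quadric H" "{x. av \<alpha> x = 0 \<and> av \<delta> x = 0} \<subseteq> H" by auto
  have "L \<subseteq> {x. av \<alpha> x = 0 \<and> av \<delta> x = 0}"
  proof
    fix x assume "x \<in> L"
    then obtain c where "x = u + c *\<^sub>R d" using ud by blast
    then show "x \<in> {x. av \<alpha> x = 0 \<and> av \<delta> x = 0}"
      using n(1,2) by (simp add: \<alpha>_def \<delta>_def av_def inner_add_right inner_commute)
  qed
  then show ?thesis using H by blast
qed

section \<open>Tangent planes of the quadric of a diagonal\<close>

definition bar :: "laguerre \<Rightarrow> (real^3) \<times> real" where
  "bar p = (fst p, snd (snd p))"

lemma bar_linear [simp]:
  "bar (p + q) = bar p + bar q" "bar (p - q) = bar p - bar q" "bar (a *\<^sub>R p) = a *\<^sub>R bar p" "bar (- p) = - bar p"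
  by (simp_all add: bar_def)

lemma av_bar [simp]: "av (bar p) x = ev p x"
  by (simp add: av_def bar_def ev_def)

lemma fst_bar [simp]: "fst (bar p) = fst p"
  by (simp add: bar_def)

text \<open>
  Up to a factor, the equation of the quadric whose tangent planes are the combinations \<open>s v + t w + f q + g r\<close>
  with \<open>s\<^sup>2\<langle>v,v\<rangle> + 2st\<langle>v,w\<rangle> + t\<^sup>2\<langle>w,w\<rangle> + 2f\<langle>q, sv + tw\<rangle> + 2g\<langle>r, sv + tw\<rangle> = 0\<close>. All planes through the line
  \<open>q = r = 0\<close> are among them, and the condition is invariant under the reflections in \<open>v\<close> and \<open>w\<close>.
\<close>
definition diag_form :: "laguerre \<Rightarrow> laguerre \<Rightarrow> laguerre \<Rightarrow> laguerre \<Rightarrow> real^3 \<Rightarrow> real" where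
  "diag_form v w q r x =
     (let D = lor v q * lor w r - lor v r * lor w q;
          y1 = lor w r * ev q x - lor w q * ev r x; y2 = lor v q * ev r x - lor v r * ev q x
      in 2 * D * (ev v x * y1 + ev w x * y2) - (lor v v * y1\<^sup>2 + 2 * lor v w * y1 * y2 + lor w w * y2\<^sup>2))"

lemma diag_form_zero: "ev q x = 0 \<Longrightarrow> ev r x = 0 \<Longrightarrow> diag_form v w q r x = 0"
  by (simp add: diag_form_def)

lemma diag_form_swap: "diag_form v w q r x = diag_form w v q r x"
  by (simp add: diag_form_def Let_def lor_commute[of w v] power2_eq_square algebra_simps)

lemma diag_form_scale: "diag_form v w (c *\<^sub>R q) (d *\<^sub>R r) x = (c * d)\<^sup>2 * diag_form v w q r x"
proof -
  have D: "lor v (c *\<^sub>R q) * lor w (d *\<^sub>R r) - lor v (d *\<^sub>R r) * lor w (c *\<^sub>R q)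
      = (c * d) * (lor v q * lor w r - lor v r * lor w q)"
    and y1: "lor w (d *\<^sub>R r) * ev (c *\<^sub>R q) x - lor w (c *\<^sub>R q) * ev (d *\<^sub>R r) x
      = (c * d) * (lor w r * ev q x - lor w q * ev r x)"
    and y2: "lor v (c *\<^sub>R q) * ev (d *\<^sub>R r) x - lor v (d *\<^sub>R r) * ev (c *\<^sub>R q) x
      = (c * d) * (lor v q * ev r x - lor v r * ev q x)"
    by (simp_all add: algebra_simps)
  show ?thesis unfolding diag_form_def Let_def D y1 y2
    by (simp add: power2_eq_square algebra_simps)
qed

text \<open>\<open>D\<close> and \<open>y2\<close> change sign, and the shift of \<open>y1\<close>
  in the linear part is compensated by the quadratic one. The reflection in \<open>w\<close> follows
  by \<open>diag_form_swap\<close>.\<close>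

lemma diag_form_refl:
  assumes a: "lor v v \<noteq> 0"
  shows "diag_form v w (reflect v q) (reflect v r) x = diag_form v w q r x"
proof -
  define a m b where "a = lor v v" and "m = lor v w" and "b = lor w w"
  define k l where "k = 2 * lor q v / a" and "l = 2 * lor r v / a"
  have vq: "lor v q = a * k / 2" "lor v r = a * l / 2"
    using a by (simp_all add: k_def l_def a_def lor_commute[of v q] lor_commute[of v r])
  have q': "reflect v q = q - k *\<^sub>R v" "reflect v r = r - l *\<^sub>R v"
    by (simp_all add: reflect_def k_def l_def a_def)
  have l': "lor v (reflect v q) = - (a * k / 2)" "lor v (reflect v r) = - (a * l / 2)"
    "lor w (reflect v q) = lor w q - k * m" "lor w (reflect v r) = lor w r - l * m"
    "ev (reflect v q) x = ev q x - k * ev v x" "ev (reflect v r) x = ev r x - l * ev v x"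
    by (simp_all add: q' vq a_def m_def lor_commute[of w v])
  define Y Dd y where "Y = k * ev r x - l * ev q x" and "Dd = k * lor w r - l * lor w q"
    and "y = lor w r * ev q x - lor w q * ev r x"
  have 1: "lor v q * lor w r - lor v r * lor w q = (a / 2) * Dd"
    "lor v (reflect v q) * lor w (reflect v r) - lor v (reflect v r) * lor w (reflect v q) = - ((a / 2) * Dd)"
    "lor v q * ev r x - lor v r * ev q x = (a / 2) * Y"
    "lor v (reflect v q) * ev (reflect v r) x - lor v (reflect v r) * ev (reflect v q) x = - ((a / 2) * Y)"
    "lor w (reflect v r) * ev (reflect v q) x - lor w (reflect v q) * ev (reflect v r) x = y + m * Y - Dd * ev v x"
    unfolding l' vq by (simp_all add: Dd_def Y_def y_def field_simps)
  show ?thesis unfolding diag_form_def Let_def 1 y_def[symmetric] a_def[symmetric] m_def[symmetric] b_def[symmetric]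
    by (simp add: power2_eq_square algebra_simps add_divide_distrib diff_divide_distrib)
qed

section \<open>Diagonal families of lines\<close>

lemma reflect_lor: "lor v v \<noteq> 0 \<Longrightarrow> lor (reflect v x) (reflect v y) = lor x y"
  by (simp add: reflect_def lor_commute[of v y] field_simps)

lemma pencil_refl_partner:
  assumes "pencil v x y" "oplane x" "oplane y" "lor v v \<noteq> 0"
  shows "\<exists>c. c \<noteq> 0 \<and> y = c *\<^sub>R reflect v x"
proof -
  obtain a b where ab: "a > 0" "b > 0" "v = a *\<^sub>R x + b *\<^sub>R y" using assms(1) by (auto simp: pencil_def)
  have "reflect v x = - (b / a) *\<^sub>R y"
    by (rule refl_pencil) (use ab assms in \<open>simp_all add: add.commute\<close>)
  then have "y = (- (a / b)) *\<^sub>R reflect v x" using ab by simp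
  moreover have "- (a / b) \<noteq> 0" using ab by simp
  ultimately show ?thesis by blast
qed

text \<open>The family is given by two planes through each line. Both are indexed along the
  diagonal, so that in each step the same reflection moves both. \<open>pencil_odd\<close> is the
  source of common planes of lines from opposite rulings.\<close>

locale diagonal_family =
  fixes lo hi :: int and q r :: "int \<Rightarrow> laguerre" and L :: "int \<Rightarrow> (real^3) set" and v w :: laguerre
  assumes two: "lo < hi"
    and L_eq: "\<And>j. j \<in> {lo..hi} \<Longrightarrow> L j = {x. ev (q j) x = 0 \<and> ev (r j) x = 0}"
    and planes: "\<And>j. j \<in> {lo..hi} \<Longrightarrow> oplane (q j) \<and> oplane (r j)"
    and normals: "\<And>j a b. j \<in> {lo..hi} \<Longrightarrow> a *\<^sub>R fst (q j) + b *\<^sub>R fst (r j) = 0 \<Longrightarrow> a = 0 \<and> b = 0"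
    and pencil_v: "\<And>j. lo \<le> j \<Longrightarrow> j < hi \<Longrightarrow> even (j - lo) \<Longrightarrow> pencil v (q j) (q (j + 1)) \<and> pencil v (r j) (r (j + 1))"
    and pencil_w: "\<And>j. lo \<le> j \<Longrightarrow> j < hi \<Longrightarrow> odd (j - lo) \<Longrightarrow> pencil w (q j) (q (j + 1)) \<and> pencil w (r j) (r (j + 1))"
    and nonnull: "lor v v \<noteq> 0" "lor w w \<noteq> 0"
    and pencil_odd: "\<And>i j. i \<in> {lo..hi} \<Longrightarrow> j \<in> {lo..hi} \<Longrightarrow> odd (j - i) \<Longrightarrow>
      \<exists>u. pencil u (q i) (q j) \<and> pencil u (r i) (r j)"
    and leave: "\<exists>x\<in>L lo. ev (q (lo + 1)) x \<noteq> 0"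
begin

text \<open>The pencil of planes through \<open>L j\<close>, together with zero, as equations in
  homogeneous coordinates.\<close>

definition dual :: "int \<Rightarrow> (real^3) \<times> real \<Rightarrow> bool" where
  "dual j y \<longleftrightarrow> (\<exists>a b. y = a *\<^sub>R bar (q j) + b *\<^sub>R bar (r j))"

lemma dual_comb: "dual j y \<Longrightarrow> dual j z \<Longrightarrow> dual j (a *\<^sub>R y + b *\<^sub>R z)"
proof -
  assume "dual j y" "dual j z"
  then obtain c d e g where "y = c *\<^sub>R bar (q j) + d *\<^sub>R bar (r j)" "z = e *\<^sub>R bar (q j) + g *\<^sub>R bar (r j)"
    unfolding dual_def by blast
  then have "a *\<^sub>R y + b *\<^sub>R z = (a * c + b * e) *\<^sub>R bar (q j) + (a * d + b * g) *\<^sub>R bar (r j)"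
    by (simp add: algebra_simps)
  then show ?thesis unfolding dual_def by blast
qed

lemma dual_scale: "dual j y \<Longrightarrow> dual j (a *\<^sub>R y)"
  using dual_comb[of j y y a 0] by simp

lemma dual_r: "dual j (bar (r j))"
  unfolding dual_def by (rule exI[of _ 0], rule exI[of _ 1]) simp

lemma dual_line: "j \<in> {lo..hi} \<Longrightarrow> dual j y \<Longrightarrow> x \<in> L j \<Longrightarrow> av y x = 0"
  unfolding dual_def by (auto simp: L_eq)

lemma dual_fst: "j \<in> {lo..hi} \<Longrightarrow> dual j y \<Longrightarrow> fst y = 0 \<Longrightarrow> y = 0"
proof -
  assume j: "j \<in> {lo..hi}" and "dual j y" and f: "fst y = 0"
  then obtain a b where y: "y = a *\<^sub>R bar (q j) + b *\<^sub>R bar (r j)" unfolding dual_def by blast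
  then have "a *\<^sub>R fst (q j) + b *\<^sub>R fst (r j) = 0" using f by simp
  from normals[OF j this] show "y = 0" unfolding y by simp
qed

lemma dual_one: "j \<in> {lo..hi} \<Longrightarrow> \<not> dual j (0, 1)"
  using dual_fst[of j "(0, 1)"] by (auto simp: prod_eq_iff)

lemma bar_indep: "j \<in> {lo..hi} \<Longrightarrow> a *\<^sub>R bar (q j) + b *\<^sub>R bar (r j) = 0 \<Longrightarrow> a = 0 \<and> b = 0"
proof -
  assume j: "j \<in> {lo..hi}" and e: "a *\<^sub>R bar (q j) + b *\<^sub>R bar (r j) = 0"
  have "fst (a *\<^sub>R bar (q j) + b *\<^sub>R bar (r j)) = 0" unfolding e by simp
  then show ?thesis using normals[OF j] by simp
qed

text \<open>\<open>u\<close> is a combination of \<open>q i\<close>, \<open>q j\<close> and also of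
  \<open>r i\<close>, \<open>r j\<close>. Equating these and sorting by line gives one plane through
  both lines, so lines of opposite parity are coplanar.\<close>

lemma meet:
  assumes "i \<in> {lo..hi}" "j \<in> {lo..hi}" "odd (j - i)"
  shows "\<exists>y a b c d. y = a *\<^sub>R bar (q i) + b *\<^sub>R bar (r i) \<and> y = c *\<^sub>R bar (q j) + d *\<^sub>R bar (r j)
    \<and> a \<noteq> 0 \<and> b \<noteq> 0 \<and> c \<noteq> 0 \<and> d \<noteq> 0 \<and> y \<noteq> 0 \<and> dual i y \<and> dual j y"
proof -
  obtain u where u: "pencil u (q i) (q j)" "pencil u (r i) (r j)" using pencil_odd[OF assms] by blast
  obtain a b where ab: "a > 0" "b > 0" "u = a *\<^sub>R q i + b *\<^sub>R q j" using u(1) unfolding pencil_def by blast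
  obtain c d where cd: "c > 0" "d > 0" "u = c *\<^sub>R r i + d *\<^sub>R r j" using u(2) unfolding pencil_def by blast
  define y where "y = a *\<^sub>R bar (q i) + (- c) *\<^sub>R bar (r i)"
  have "bar (a *\<^sub>R q i + b *\<^sub>R q j) = bar (c *\<^sub>R r i + d *\<^sub>R r j)" using ab(3) cd(3) by simp
  then have "a *\<^sub>R bar (q i) + b *\<^sub>R bar (q j) = c *\<^sub>R bar (r i) + d *\<^sub>R bar (r j)" by simp
  then have y2: "y = (- b) *\<^sub>R bar (q j) + d *\<^sub>R bar (r j)" unfolding y_def by (simp add: algebra_simps)
  have "y \<noteq> 0" using bar_indep[OF assms(1)] ab(1) unfolding y_def by fastforce
  moreover have "dual i y" using y_def unfolding dual_def by blast
  moreover have "dual j y" using y2 unfolding dual_def by blast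
  ultimately show ?thesis using y_def y2 ab cd
    by (intro exI[of _ y] exI[of _ a] exI[of _ "- c"] exI[of _ "- b"] exI[of _ d]) simp
qed

lemma lines_in_quadric:
  assumes "dual j y" "dual j z" "j \<in> {lo..hi}" "{x. av y x = 0 \<and> av z x = 0} \<subseteq> H"
  shows "L j \<subseteq> H"
  using assms dual_line by blast

text \<open>For two lines of opposite parity general position demands nothing, so a genuine
  hyperboloid has to exist outright. Their common plane and one further plane through each are
  completed by a fourth, depending on whether the plane at infinity is a combination of these
  three.\<close>

lemma quadrilateral_two:
  assumes S: "hi = lo + 1"
  shows "\<exists>H. good_quadric H \<and> (\<forall>j\<in>{lo..hi}. L j \<subseteq> H)"
proof -
  have m: "lo \<in> {lo..hi}" "lo + 1 \<in> {lo..hi}" using S by auto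
  obtain \<alpha> a b c d where al: "\<alpha> = a *\<^sub>R bar (q lo) + b *\<^sub>R bar (r lo)" "\<alpha> = c *\<^sub>R bar (q (lo + 1)) + d *\<^sub>R bar (r (lo + 1))"
    "a \<noteq> 0" "c \<noteq> 0" "\<alpha> \<noteq> 0" "dual lo \<alpha>" "dual (lo + 1) \<alpha>"
    using meet[OF m] by auto
  define \<delta> \<beta> where "\<delta> = bar (r lo)" and "\<beta> = bar (r (lo + 1))"
  have du: "dual lo \<delta>" "dual (lo + 1) \<beta>" by (simp_all add: \<delta>_def \<beta>_def dual_r)
  obtain x where x: "x \<in> L lo" "ev (q (lo + 1)) x \<noteq> 0" using leave by blast
  have ax: "av \<alpha> x = 0" "av \<delta> x = 0" using dual_line[OF m(1)] al(6) du(1) x(1) by blast+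
  have "av \<beta> x \<noteq> 0"
  proof
    assume "av \<beta> x = 0"
    then have "ev (r (lo + 1)) x = 0" by (simp add: \<beta>_def)
    moreover have "c * ev (q (lo + 1)) x + d * ev (r (lo + 1)) x = 0" using ax(1) unfolding al(2) by simp
    ultimately show False using x(2) al(4) by simp
  qed
  have i3: "l = 0 \<and> m = 0 \<and> n = 0" if e: "l *\<^sub>R \<alpha> + m *\<^sub>R \<beta> + n *\<^sub>R \<delta> = 0" for l m n
  proof -
    have "l * av \<alpha> x + m * av \<beta> x + n * av \<delta> x = 0" using arg_cong[OF e, of "\<lambda>y. av y x"] by simp
    then have m0: "m = 0" using ax \<open>av \<beta> x \<noteq> 0\<close> by simp
    then have "(l * a) *\<^sub>R bar (q lo) + (l * b + n) *\<^sub>R bar (r lo) = 0"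
      using e unfolding al(1) \<delta>_def by (simp add: algebra_simps)
    then have "l * a = 0 \<and> l * b + n = 0" by (rule bar_indep[OF m(1)])
    then show ?thesis using al(3) m0 by auto
  qed
  have ex: "\<exists>\<gamma> A B C D. lin_indep4 \<alpha> \<beta> \<gamma> \<delta> \<and> (0, 1) = A *\<^sub>R \<alpha> + B *\<^sub>R \<beta> + C *\<^sub>R \<gamma> + D *\<^sub>R \<delta> \<and> (A * C \<noteq> 0 \<or> B * D \<noteq> 0)"
  proof (cases "\<exists>A B D. (0, 1) = A *\<^sub>R \<alpha> + B *\<^sub>R \<beta> + D *\<^sub>R \<delta>")
    case True
    then obtain A B D where o: "(0, 1) = A *\<^sub>R \<alpha> + B *\<^sub>R \<beta> + D *\<^sub>R \<delta>" by blast
    have "B \<noteq> 0"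
    proof
      assume "B = 0"
      then have "(0, 1) = A *\<^sub>R \<alpha> + D *\<^sub>R \<delta>" using o by simp
      then show False using dual_comb[OF al(6) du(1)] dual_one[OF m(1)] by metis
    qed
    moreover have "D \<noteq> 0"
    proof
      assume "D = 0"
      then have "(0, 1) = A *\<^sub>R \<alpha> + B *\<^sub>R \<beta>" using o by simp
      then show False using dual_comb[OF al(7) du(2)] dual_one[OF m(2)] by metis
    qed
    moreover obtain \<gamma> where g: "lin_indep4 \<alpha> \<beta> \<delta> \<gamma>" using lin_indep4_extend[OF i3] by blast
    have "lin_indep4 \<alpha> \<beta> \<gamma> \<delta>" unfolding lin_indep4_def
    proof (intro allI impI)
      fix l m n k assume "l *\<^sub>R \<alpha> + m *\<^sub>R \<beta> + n *\<^sub>R \<gamma> + k *\<^sub>R \<delta> = 0"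
      then have "l *\<^sub>R \<alpha> + m *\<^sub>R \<beta> + k *\<^sub>R \<delta> + n *\<^sub>R \<gamma> = 0" by (simp add: algebra_simps)
      then show "l = 0 \<and> m = 0 \<and> n = 0 \<and> k = 0" using g unfolding lin_indep4_def by blast
    qed
    moreover have "(0, 1) = A *\<^sub>R \<alpha> + B *\<^sub>R \<beta> + 0 *\<^sub>R \<gamma> + D *\<^sub>R \<delta>" using o by simp
    ultimately show ?thesis
      by (intro exI[of _ \<gamma>] exI[of _ A] exI[of _ B] exI[of _ 0] exI[of _ D]) simp
  next
    case False
    define \<gamma> where "\<gamma> = (0, 1) - \<alpha>"
    have "lin_indep4 \<alpha> \<beta> \<gamma> \<delta>" unfolding lin_indep4_def
    proof (intro allI impI)
      fix l m n k assume "l *\<^sub>R \<alpha> + m *\<^sub>R \<beta> + n *\<^sub>R \<gamma> + k *\<^sub>R \<delta> = 0"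
      then have e: "n *\<^sub>R (0, 1) = (n - l) *\<^sub>R \<alpha> + (- m) *\<^sub>R \<beta> + (- k) *\<^sub>R \<delta>"
        unfolding \<gamma>_def by (simp add: algebra_simps eq_neg_iff_add_eq_0)
      have n0: "n = 0"
      proof (rule ccontr)
        assume n: "n \<noteq> 0"
        have "(1 / n) *\<^sub>R (n *\<^sub>R (0, 1)) = (1 / n) *\<^sub>R ((n - l) *\<^sub>R \<alpha> + (- m) *\<^sub>R \<beta> + (- k) *\<^sub>R \<delta>)" unfolding e ..
        then have "(0, 1) = ((n - l) / n) *\<^sub>R \<alpha> + (- m / n) *\<^sub>R \<beta> + (- k / n) *\<^sub>R \<delta>"
          using n by (simp add: scaleR_add_right scaleR_diff_right)
        then show False using False by blast
      qed
      then have "(- l) *\<^sub>R \<alpha> + (- m) *\<^sub>R \<beta> + (- k) *\<^sub>R \<delta> = 0" using e by (simp add: zero_prod_def)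
      then have "- l = 0 \<and> - m = 0 \<and> - k = 0" by (rule i3)
      then show "l = 0 \<and> m = 0 \<and> n = 0 \<and> k = 0" using n0 by simp
    qed
    moreover have "(0, 1) = 1 *\<^sub>R \<alpha> + 0 *\<^sub>R \<beta> + 1 *\<^sub>R \<gamma> + 0 *\<^sub>R \<delta>" by (simp add: \<gamma>_def)
    ultimately show ?thesis
      by (intro exI[of _ \<gamma>] exI[of _ 1] exI[of _ 0] exI[of _ 1] exI[of _ 0]) simp
  qed
  then obtain \<gamma> A B C D where g: "lin_indep4 \<alpha> \<beta> \<gamma> \<delta>" "(0, 1) = A *\<^sub>R \<alpha> + B *\<^sub>R \<beta> + C *\<^sub>R \<gamma> + D *\<^sub>R \<delta>"
    "A * C \<noteq> 0 \<or> B * D \<noteq> 0" by blast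
  from quadrilateral_quadric[OF g] obtain H where H: "good_quadric H"
    "{x. av \<alpha> x = 0 \<and> av \<delta> x = 0} \<subseteq> H" "{x. av \<alpha> x = 0 \<and> av \<beta> x = 0} \<subseteq> H" by blast
  have "L lo \<subseteq> H" by (rule lines_in_quadric[OF al(6) du(1) m(1) H(2)])
  moreover have "L (lo + 1) \<subseteq> H" by (rule lines_in_quadric[OF al(7) du(2) m(2) H(3)])
  moreover have "{lo..hi} = {lo, lo + 1}" using S by auto
  ultimately show ?thesis using H(1) by auto
qed

text \<open>A nonzero plane through both lines would make them coplanar; it is a finite plane by
  \<open>dual_fst\<close>.\<close>

lemma dual_disjoint:
  assumes gp: "rulings_in_general_position {lo..hi} L" and j: "i \<in> {lo..hi}" "j \<in> {lo..hi}" "i \<noteq> j" "even (i - j)"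
    and y: "dual i y" "dual j y"
  shows "y = 0"
proof (rule ccontr)
  assume "y \<noteq> 0"
  then have n: "fst y \<noteq> 0" using dual_fst[OF j(1) y(1)] by blast
  have "coplanar (L i \<union> L j)"
  proof (rule coplanar_hyperplane[OF n])
    fix x assume "x \<in> L i \<union> L j"
    then have "av y x = 0" using dual_line j(1,2) y by blast
    then show "fst y \<bullet> x = - snd y" by (simp add: av_def)
  qed
  then show False using gp j unfolding rulings_in_general_position_def by blast
qed

text \<open>The outer lines are skew and the middle one is coplanar with each. Further planes
  through the outer lines complete a quadrilateral, and turning \<open>\<delta>\<close> about its
  line corrects an unlucky position of the plane at infinity.\<close>

lemma quadrilateral_three:
  assumes S: "hi = lo + 2" and gp: "rulings_in_general_position {lo..hi} L"
  shows "\<exists>H. good_quadric H \<and> (\<forall>j\<in>{lo..hi}. L j \<subseteq> H)"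
proof -
  have m: "lo \<in> {lo..hi}" "lo + 1 \<in> {lo..hi}" "lo + 2 \<in> {lo..hi}" using S by auto
  obtain \<alpha> a b where al: "\<alpha> = a *\<^sub>R bar (q lo) + b *\<^sub>R bar (r lo)" "a \<noteq> 0" "dual lo \<alpha>" "dual (lo + 1) \<alpha>"
    using meet[OF m(1,2)] by auto
  obtain \<beta> c d where be: "\<beta> = c *\<^sub>R bar (q (lo + 2)) + d *\<^sub>R bar (r (lo + 2))" "c \<noteq> 0" "dual (lo + 1) \<beta>" "dual (lo + 2) \<beta>"
  proof -
    have "odd (lo + 2 - (lo + 1))" by simp
    from meet[OF m(2,3) this] show ?thesis using that by blast
  qed
  define \<delta> \<gamma> where "\<delta> = bar (r lo)" and "\<gamma> = bar (r (lo + 2))"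
  have du: "dual lo \<delta>" "dual (lo + 2) \<gamma>" by (simp_all add: \<delta>_def \<gamma>_def dual_r)
  have ind: "lin_indep4 \<alpha> \<beta> \<gamma> \<delta>" unfolding lin_indep4_def
  proof (intro allI impI)
    fix k l m' n assume e: "k *\<^sub>R \<alpha> + l *\<^sub>R \<beta> + m' *\<^sub>R \<gamma> + n *\<^sub>R \<delta> = 0"
    define y where "y = k *\<^sub>R \<alpha> + n *\<^sub>R \<delta>"
    have y2: "y = (- l) *\<^sub>R \<beta> + (- m') *\<^sub>R \<gamma>"
      using e unfolding y_def by (simp add: algebra_simps eq_neg_iff_add_eq_0)
    have "y = 0"
    proof (rule dual_disjoint[OF gp m(1,3)])
      show "dual lo y" unfolding y_def by (rule dual_comb[OF al(3) du(1)])
      show "dual (lo + 2) y" unfolding y2 by (rule dual_comb[OF be(4) du(2)])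
    qed simp_all
    have "(k * a) *\<^sub>R bar (q lo) + (k * b + n) *\<^sub>R bar (r lo) = y"
      "(- l * c) *\<^sub>R bar (q (lo + 2)) + (- l * d - m') *\<^sub>R bar (r (lo + 2)) = y"
      subgoal unfolding y_def al(1) \<delta>_def by (simp add: algebra_simps)
      subgoal unfolding y2 be(1) \<gamma>_def by (simp add: algebra_simps)
      done
    with \<open>y = 0\<close> have "k * a = 0 \<and> k * b + n = 0" "- l * c = 0 \<and> - l * d - m' = 0"
      using bar_indep[OF m(1)] bar_indep[OF m(3)] by blast+
    then show "k = 0 \<and> l = 0 \<and> m' = 0 \<and> n = 0" using al(2) be(2) by auto
  qed
  obtain A B C D where one: "(0, 1) = A *\<^sub>R \<alpha> + B *\<^sub>R \<beta> + C *\<^sub>R \<gamma> + D *\<^sub>R \<delta>"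
    using lin_indep4_span[OF ind, of "(0, 1)"] by blast
  have BC: "B \<noteq> 0 \<or> C \<noteq> 0"
  proof (rule ccontr)
    assume "\<not> (B \<noteq> 0 \<or> C \<noteq> 0)"
    then have "(0, 1) = A *\<^sub>R \<alpha> + D *\<^sub>R \<delta>" using one by simp
    then show False using dual_comb[OF al(3) du(1)] dual_one[OF m(1)] by metis
  qed
  have AD: "A \<noteq> 0 \<or> D \<noteq> 0"
  proof (rule ccontr)
    assume "\<not> (A \<noteq> 0 \<or> D \<noteq> 0)"
    then have "(0, 1) = B *\<^sub>R \<beta> + C *\<^sub>R \<gamma>" using one by simp
    then show False using dual_comb[OF be(4) du(2)] dual_one[OF m(3)] by metis
  qed
  have CD: "C \<noteq> 0 \<or> D \<noteq> 0"
  proof (rule ccontr)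
    assume "\<not> (C \<noteq> 0 \<or> D \<noteq> 0)"
    then have "(0, 1) = A *\<^sub>R \<alpha> + B *\<^sub>R \<beta>" using one by simp
    then show False using dual_comb[OF al(4) be(3)] dual_one[OF m(2)] by metis
  qed
  \<comment> \<open>\<open>\<delta>\<close> needs a change only for \<open>A = 0\<close> and
    \<open>B * D = 0\<close>. Then \<open>C\<close> and \<open>D\<close> are nonzero, and adding
    \<open>\<alpha>\<close> to \<open>\<delta>\<close> gives \<open>\<alpha>\<close> the coefficient
    \<open>- D\<close>.\<close>
  define t where "t = (if B * D = 0 \<and> A = 0 then 1 else 0 :: real)"
  define \<delta>' where "\<delta>' = t *\<^sub>R \<alpha> + 1 *\<^sub>R \<delta>"
  have du': "dual lo \<delta>'" unfolding \<delta>'_def by (rule dual_comb[OF al(3) du(1)])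
  have ind': "lin_indep4 \<alpha> \<beta> \<gamma> \<delta>'" unfolding lin_indep4_def
  proof (intro allI impI)
    fix k l m n assume "k *\<^sub>R \<alpha> + l *\<^sub>R \<beta> + m *\<^sub>R \<gamma> + n *\<^sub>R \<delta>' = 0"
    then have "(k + n * t) *\<^sub>R \<alpha> + l *\<^sub>R \<beta> + m *\<^sub>R \<gamma> + n *\<^sub>R \<delta> = 0"
      unfolding \<delta>'_def by (simp add: algebra_simps)
    then have "k + n * t = 0 \<and> l = 0 \<and> m = 0 \<and> n = 0" using ind unfolding lin_indep4_def by blast
    then show "k = 0 \<and> l = 0 \<and> m = 0 \<and> n = 0" by auto
  qed
  have one': "(0, 1) = (A - t * D) *\<^sub>R \<alpha> + B *\<^sub>R \<beta> + C *\<^sub>R \<gamma> + D *\<^sub>R \<delta>'"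
    unfolding one \<delta>'_def by (simp add: algebra_simps)
  have ne: "(A - t * D) * C \<noteq> 0 \<or> B * D \<noteq> 0" using BC AD CD by (auto simp: t_def)
  from quadrilateral_quadric[OF ind' one' ne] obtain H where H: "good_quadric H"
    "{x. av \<alpha> x = 0 \<and> av \<delta>' x = 0} \<subseteq> H" "{x. av \<alpha> x = 0 \<and> av \<beta> x = 0} \<subseteq> H"
    "{x. av \<beta> x = 0 \<and> av \<gamma> x = 0} \<subseteq> H" by blast
  have "L lo \<subseteq> H" by (rule lines_in_quadric[OF al(3) du' m(1) H(2)])
  moreover have "L (lo + 1) \<subseteq> H" by (rule lines_in_quadric[OF al(4) be(3) m(2) H(3)])
  moreover have "L (lo + 2) \<subseteq> H" by (rule lines_in_quadric[OF be(4) du(2) m(3) H(4)])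
  moreover have "{lo..hi} = {lo, lo + 1, lo + 2}" using S by auto
  ultimately show ?thesis using H(1) by auto
qed

text \<open>Lines at distance 3 are coplanar too, so the four lines close up to a quadrilateral with
  four common planes. If both products vanished, the plane at infinity would contain one of the
  lines.\<close>

lemma quadrilateral_four:
  assumes S: "hi = lo + 3" and gp: "rulings_in_general_position {lo..hi} L"
  shows "\<exists>H. good_quadric H \<and> (\<forall>j\<in>{lo..hi}. L j \<subseteq> H)"
proof -
  have m: "lo \<in> {lo..hi}" "lo + 1 \<in> {lo..hi}" "lo + 2 \<in> {lo..hi}" "lo + 3 \<in> {lo..hi}" using S by auto
  obtain \<alpha> where al: "\<alpha> \<noteq> 0" "dual lo \<alpha>" "dual (lo + 1) \<alpha>" using meet[OF m(1,2)] by auto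
  obtain \<beta> where be: "\<beta> \<noteq> 0" "dual (lo + 1) \<beta>" "dual (lo + 2) \<beta>" using meet[OF m(2,3)] by auto
  obtain \<gamma> where ga: "\<gamma> \<noteq> 0" "dual (lo + 2) \<gamma>" "dual (lo + 3) \<gamma>" using meet[OF m(3,4)] by auto
  obtain \<delta> where de: "\<delta> \<noteq> 0" "dual (lo + 3) \<delta>" "dual lo \<delta>" using meet[OF m(4,1)] by auto
  have two: "k = 0 \<and> l = 0" if e: "k *\<^sub>R y + l *\<^sub>R z = 0" and y: "y \<noteq> 0" "dual (lo + 1) y" and z: "z \<noteq> 0" "dual (lo + 3) z" for k l y z
  proof -
    have "k *\<^sub>R y = (- l) *\<^sub>R z" using e by (simp add: eq_neg_iff_add_eq_0)
    then have "dual (lo + 3) (k *\<^sub>R y)" using dual_scale[OF z(2), of "- l"] by simp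
    then have "k *\<^sub>R y = 0" using dual_disjoint[OF gp m(2,4) _ _ dual_scale[OF y(2)]] by simp
    then show ?thesis using e y(1) z(1) by simp
  qed
  have ind: "lin_indep4 \<alpha> \<beta> \<gamma> \<delta>" unfolding lin_indep4_def
  proof (intro allI impI)
    fix k l m' n assume e: "k *\<^sub>R \<alpha> + l *\<^sub>R \<beta> + m' *\<^sub>R \<gamma> + n *\<^sub>R \<delta> = 0"
    define y where "y = k *\<^sub>R \<alpha> + n *\<^sub>R \<delta>"
    have y2: "y = (- l) *\<^sub>R \<beta> + (- m') *\<^sub>R \<gamma>"
      using e unfolding y_def by (simp add: algebra_simps eq_neg_iff_add_eq_0)
    have y0: "y = 0"
    proof (rule dual_disjoint[OF gp m(1,3)])
      show "dual lo y" unfolding y_def by (rule dual_comb[OF al(2) de(3)])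
      show "dual (lo + 2) y" unfolding y2 by (rule dual_comb[OF be(3) ga(2)])
    qed simp_all
    have "k = 0 \<and> n = 0" by (rule two[OF y0[unfolded y_def] al(1,3) de(1,2)])
    moreover have "- l = 0 \<and> - m' = 0" by (rule two[OF y0[unfolded y2] be(1,2) ga(1,3)])
    ultimately show "k = 0 \<and> l = 0 \<and> m' = 0 \<and> n = 0" by simp
  qed
  obtain A B C D where one: "(0, 1) = A *\<^sub>R \<alpha> + B *\<^sub>R \<beta> + C *\<^sub>R \<gamma> + D *\<^sub>R \<delta>"
    using lin_indep4_span[OF ind, of "(0, 1)"] by blast
  have ne: "A * C \<noteq> 0 \<or> B * D \<noteq> 0"
  proof (rule ccontr)
    assume "\<not> (A * C \<noteq> 0 \<or> B * D \<noteq> 0)"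
    then consider "A = 0" "B = 0" | "A = 0" "D = 0" | "C = 0" "B = 0" | "C = 0" "D = 0" by auto
    then show False
    proof cases
      case 1
      then have "(0, 1) = C *\<^sub>R \<gamma> + D *\<^sub>R \<delta>" using one by simp
      then show False using dual_comb[OF ga(3) de(2)] dual_one[OF m(4)] by metis
    next
      case 2
      then have "(0, 1) = B *\<^sub>R \<beta> + C *\<^sub>R \<gamma>" using one by simp
      then show False using dual_comb[OF be(3) ga(2)] dual_one[OF m(3)] by metis
    next
      case 3
      then have "(0, 1) = A *\<^sub>R \<alpha> + D *\<^sub>R \<delta>" using one by simp
      then show False using dual_comb[OF al(2) de(3)] dual_one[OF m(1)] by metis
    next
      case 4
      then have "(0, 1) = A *\<^sub>R \<alpha> + B *\<^sub>R \<beta>" using one by simp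
      then show False using dual_comb[OF al(3) be(2)] dual_one[OF m(2)] by metis
    qed
  qed
  from quadrilateral_quadric[OF ind one ne] obtain H where H: "good_quadric H"
    "{x. av \<alpha> x = 0 \<and> av \<delta> x = 0} \<subseteq> H" "{x. av \<alpha> x = 0 \<and> av \<beta> x = 0} \<subseteq> H"
    "{x. av \<beta> x = 0 \<and> av \<gamma> x = 0} \<subseteq> H" "{x. av \<gamma> x = 0 \<and> av \<delta> x = 0} \<subseteq> H" by blast
  have "L lo \<subseteq> H" by (rule lines_in_quadric[OF al(2) de(3) m(1) H(2)])
  moreover have "L (lo + 1) \<subseteq> H" by (rule lines_in_quadric[OF al(3) be(2) m(2) H(3)])
  moreover have "L (lo + 2) \<subseteq> H" by (rule lines_in_quadric[OF be(3) ga(2) m(3) H(4)])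
  moreover have "L (lo + 3) \<subseteq> H" by (rule lines_in_quadric[OF ga(3) de(2) m(4) H(5)])
  moreover have "{lo..hi} = {lo, lo + 1, lo + 2, lo + 3}" using S by auto
  ultimately show ?thesis using H(1) by auto
qed

lemma step_refl:
  assumes "lo \<le> j" "j < hi"
  shows "\<exists>z c d. (z = v \<or> z = w) \<and> lor z z \<noteq> 0 \<and> c \<noteq> 0 \<and> d \<noteq> 0 \<and> q (j + 1) = c *\<^sub>R reflect z (q j) \<and> r (j + 1) = d *\<^sub>R reflect z (r j)"
proof -
  have o: "oplane (q j)" "oplane (q (j + 1))" "oplane (r j)" "oplane (r (j + 1))" using planes assms by auto
  obtain z where z: "z = v \<or> z = w" "pencil z (q j) (q (j + 1))" "pencil z (r j) (r (j + 1))"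
    using pencil_v[OF assms] pencil_w[OF assms] by blast
  then have n: "lor z z \<noteq> 0" using nonnull by blast
  show ?thesis
    using pencil_refl_partner[OF z(2) o(1,2) n] pencil_refl_partner[OF z(3) o(3,4) n] z(1) n by blast
qed

lemma diag_form_invariant:
  assumes "lo \<le> j"
  shows "j \<le> hi \<Longrightarrow> \<exists>k. k \<noteq> 0 \<and> (\<forall>x. diag_form v w (q j) (r j) x = k * diag_form v w (q lo) (r lo) x)"
  using assms
proof (induction j rule: int_ge_induct)
  case base
  show ?case by (rule exI[of _ 1]) simp
next
  case (step j)
  then obtain k where k: "k \<noteq> 0" "\<And>x. diag_form v w (q j) (r j) x = k * diag_form v w (q lo) (r lo) x" by auto
  have "j < hi" using step.prems by simp
  from step_refl[OF step.hyps(1) this] obtain z c d where z: "z = v \<or> z = w" "lor z z \<noteq> 0" "c \<noteq> 0" "d \<noteq> 0" "q (j + 1) = c *\<^sub>R reflect z (q j)" "r (j + 1) = d *\<^sub>R reflect z (r j)"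
    by blast
  have "diag_form v w (reflect z (q j)) (reflect z (r j)) x = diag_form v w (q j) (r j) x" for x
    using z(1)
  proof
    assume "z = v"
    then show ?thesis using diag_form_refl[OF nonnull(1)] by simp
  next
    assume "z = w"
    then show ?thesis using diag_form_refl[OF nonnull(2)] unfolding diag_form_swap[of v w] by simp
  qed
  then have "diag_form v w (q (j + 1)) (r (j + 1)) x = ((c * d)\<^sup>2 * k) * diag_form v w (q lo) (r lo) x" for x
    unfolding z(5,6) diag_form_scale by (simp add: k(2))
  then show ?case using z(3,4) k(1) by (intro exI[of _ "(c * d)\<^sup>2 * k"]) simp
qed

lemma diag_form_vanishes:
  assumes "j \<in> {lo..hi}" "x \<in> L j"
  shows "diag_form v w (q lo) (r lo) x = 0"
proof -
  obtain k where "k \<noteq> 0" "diag_form v w (q j) (r j) x = k * diag_form v w (q lo) (r lo) x"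
    using diag_form_invariant[of j] assms(1) by auto
  moreover have "diag_form v w (q j) (r j) x = 0" by (rule diag_form_zero) (use assms in \<open>auto simp: L_eq\<close>)
  ultimately show ?thesis by simp
qed

text \<open>\<open>y1\<close> and \<open>y2\<close> are the combinations of \<open>q lo\<close> and
  \<open>r lo\<close> with \<open>lor w y1 = 0\<close>, \<open>lor v y2 = 0\<close> and
  \<open>lor v y1 = lor w y2 = D\<close>. In terms of them \<open>diag_form\<close> is a sum of two
  products.\<close>

definition D where "D = lor v (q lo) * lor w (r lo) - lor v (r lo) * lor w (q lo)"
definition y1 where "y1 = lor w (r lo) *\<^sub>R q lo - lor w (q lo) *\<^sub>R r lo"
definition y2 where "y2 = lor v (q lo) *\<^sub>R r lo - lor v (r lo) *\<^sub>R q lo"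
definition z1 where "z1 = (2 * D) *\<^sub>R v - lor v v *\<^sub>R y1 - lor v w *\<^sub>R y2"
definition z2 where "z2 = (2 * D) *\<^sub>R w - lor w w *\<^sub>R y2 - lor v w *\<^sub>R y1"

lemma diag_form_eq: "diag_form v w (q lo) (r lo) x = ev y1 x * ev z1 x + ev y2 x * ev z2 x"
proof -
  have e: "ev y1 x = lor w (r lo) * ev (q lo) x - lor w (q lo) * ev (r lo) x"
    "ev y2 x = lor v (q lo) * ev (r lo) x - lor v (r lo) * ev (q lo) x"
    by (simp_all add: y1_def y2_def)
  show ?thesis unfolding diag_form_def Let_def D_def[symmetric] e[symmetric]
    by (simp add: z1_def z2_def power2_eq_square algebra_simps)
qed

lemma quadric_lines: "j \<in> {lo..hi} \<Longrightarrow> L j \<subseteq> {x. av (bar y1) x * av (bar z1) x + av (bar y2) x * av (bar z2) x = 0}"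
  using diag_form_vanishes[of j] unfolding diag_form_eq by auto

lemma lo_mem: "lo \<in> {lo..hi}" "lo + 1 \<in> {lo..hi}"
  using two by auto

text \<open>Moving off the first line, the form is quadratic in the parameter with linear
  coefficient \<open>2 * D * ev v x\<close>, which is nonzero at a point of the line not on
  \<open>v\<close>.\<close>

lemma quadric_proper:
  assumes "D \<noteq> 0"
  shows "\<exists>x. av (bar y1) x * av (bar z1) x + av (bar y2) x * av (bar z2) x \<noteq> 0"
proof -
  obtain x where x: "x \<in> L lo" "ev (q (lo + 1)) x \<noteq> 0" using leave by blast
  have x0: "ev (q lo) x = 0" "ev (r lo) x = 0" using x(1) L_eq[OF lo_mem(1)] by auto
  obtain a b where ab: "b > 0" "v = a *\<^sub>R q lo + b *\<^sub>R q (lo + 1)"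
    using pencil_v[of lo] two by (auto simp: pencil_def)
  then have vx: "ev v x \<noteq> 0" using x(2) x0 by simp
  have "fst y1 \<bullet> fst y1 * (fst y2 \<bullet> fst y2) - (fst y1 \<bullet> fst y2) * (fst y1 \<bullet> fst y2) \<noteq> 0"
  proof
    define g h k where "g = fst y1 \<bullet> fst y1" and "h = fst y1 \<bullet> fst y2" and "k = fst y2 \<bullet> fst y2"
    assume "fst y1 \<bullet> fst y1 * (fst y2 \<bullet> fst y2) - (fst y1 \<bullet> fst y2) * (fst y1 \<bullet> fst y2) = 0"
    then have det: "g * k - h * h = 0" by (simp add: g_def h_def k_def)
    have "(k *\<^sub>R fst y1 - h *\<^sub>R fst y2) \<bullet> (k *\<^sub>R fst y1 - h *\<^sub>R fst y2) = k * (g * k - h * h)"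
      by (simp add: inner_diff_left inner_diff_right g_def h_def k_def inner_commute[of "fst y2" "fst y1"] algebra_simps)
    then have e: "k *\<^sub>R fst y1 - h *\<^sub>R fst y2 = 0" using det by simp
    have "(k * lor w (r lo) + h * lor v (r lo)) *\<^sub>R fst (q lo) + (- k * lor w (q lo) - h * lor v (q lo)) *\<^sub>R fst (r lo)
      = k *\<^sub>R fst y1 - h *\<^sub>R fst y2" by (simp add: y1_def y2_def algebra_simps)
    also note e
    finally have 0: "k * lor w (r lo) + h * lor v (r lo) = 0" "- k * lor w (q lo) - h * lor v (q lo) = 0"
      using normals[OF lo_mem(1)] by blast+
    have "k * D = lor v (q lo) * (k * lor w (r lo) + h * lor v (r lo)) + lor v (r lo) * (- k * lor w (q lo) - h * lor v (q lo))"
      by (simp add: D_def algebra_simps)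
    then have "k * D = 0" unfolding 0 by simp
    then have "fst y2 = 0" using assms by (simp add: k_def)
    then have "(- lor v (r lo)) *\<^sub>R fst (q lo) + lor v (q lo) *\<^sub>R fst (r lo) = 0" by (simp add: y2_def)
    then have "- lor v (r lo) = 0 \<and> lor v (q lo) = 0" by (rule normals[OF lo_mem(1)])
    then show False using assms by (simp add: D_def)
  qed
  then obtain k where k: "k \<noteq> 0" "k = fst y1 \<bullet> fst y1 * (fst y2 \<bullet> fst y2) - (fst y1 \<bullet> fst y2) * (fst y1 \<bullet> fst y2)" by blast
  \<comment> \<open>Solves \<open>fst y1 \<bullet> d = 1\<close>,
    \<open>fst y2 \<bullet> d = 0\<close> by means of the Gram determinant \<open>k\<close>.\<close>
  define d where "d = (1 / k) *\<^sub>R ((fst y2 \<bullet> fst y2) *\<^sub>R fst y1 - (fst y1 \<bullet> fst y2) *\<^sub>R fst y2)"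
  have "fst y1 \<bullet> d = (1 / k) * (fst y1 \<bullet> fst y1 * (fst y2 \<bullet> fst y2) - (fst y1 \<bullet> fst y2) * (fst y1 \<bullet> fst y2))"
    by (simp add: d_def inner_diff_right mult.commute)
  then have d1: "fst y1 \<bullet> d = 1" unfolding k(2)[symmetric] using k(1) by simp
  have d2: "fst y2 \<bullet> d = 0" unfolding d_def
    by (simp add: inner_diff_right inner_commute[of "fst y2" "fst y1"])
  have y0: "ev y1 x = 0" "ev y2 x = 0" by (simp_all add: y1_def y2_def x0)
  have sh: "ev p (x + t *\<^sub>R d) = ev p x + t * (fst p \<bullet> d)" for p t
    by (simp add: ev_def inner_add_right)
  have val: "diag_form v w (q lo) (r lo) (x + t *\<^sub>R d)
     = t * (2 * D * (ev v x + t * (fst v \<bullet> d)) - lor v v * t)" for t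
    unfolding diag_form_eq sh d1 d2 y0 by (simp add: z1_def y0 d1 d2 inner_diff_left algebra_simps)
  \<comment> \<open>Opposite parameters isolate the linear coefficient.\<close>
  have "diag_form v w (q lo) (r lo) (x + 1 *\<^sub>R d) \<noteq> 0 \<or> diag_form v w (q lo) (r lo) (x + (- 1) *\<^sub>R d) \<noteq> 0"
  proof (rule ccontr)
    assume "\<not> ?thesis"
    then have "2 * D * (ev v x + (fst v \<bullet> d)) - lor v v = 0" "2 * D * (ev v x - (fst v \<bullet> d)) + lor v v = 0"
      unfolding val by simp_all
    then have "2 * D * (ev v x + (fst v \<bullet> d)) - lor v v + (2 * D * (ev v x - (fst v \<bullet> d)) + lor v v) = 0" by simp
    then have "4 * (D * ev v x) = 0" by (simp add: algebra_simps)
    then show False using vx assms by simp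
  qed
  then have "\<exists>x. diag_form v w (q lo) (r lo) x \<noteq> 0" by blast
  then show ?thesis unfolding diag_form_eq by simp
qed

text \<open>\<open>D = 0\<close> yields a combination of \<open>q lo\<close> and \<open>r lo\<close>
  that is Lorentz orthogonal to \<open>v\<close> and \<open>w\<close>. Both reflections fix it, so
  it belongs to the pencil of every line.\<close>

lemma common_plane:
  assumes "D = 0"
  shows "\<exists>y. y \<noteq> 0 \<and> (\<forall>j\<in>{lo..hi}. dual j y)"
proof -
  have "\<exists>\<mu> \<nu>. (\<mu> \<noteq> 0 \<or> \<nu> \<noteq> 0) \<and> \<mu> * lor v (q lo) + \<nu> * lor v (r lo) = 0 \<and> \<mu> * lor w (q lo) + \<nu> * lor w (r lo) = 0"
  proof (cases "lor v (q lo) = 0 \<and> lor v (r lo) = 0")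
    case True
    show ?thesis
    proof (cases "lor w (q lo) = 0 \<and> lor w (r lo) = 0")
      case True
      then show ?thesis using \<open>lor v (q lo) = 0 \<and> lor v (r lo) = 0\<close> by (intro exI[of _ 1]) simp
    next
      case False
      then show ?thesis using True by (intro exI[of _ "lor w (r lo)"] exI[of _ "- lor w (q lo)"]) auto
    qed
  next
    case False
    then show ?thesis using assms by (intro exI[of _ "lor v (r lo)"] exI[of _ "- lor v (q lo)"]) (auto simp: D_def algebra_simps)
  qed
  then obtain \<mu> \<nu> where mn: "\<mu> \<noteq> 0 \<or> \<nu> \<noteq> 0" "\<mu> * lor v (q lo) + \<nu> * lor v (r lo) = 0" "\<mu> * lor w (q lo) + \<nu> * lor w (r lo) = 0"
    by blast
  define y where "y = \<mu> *\<^sub>R q lo + \<nu> *\<^sub>R r lo"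
  have perp: "lor y v = 0" "lor y w = 0"
    using mn(2,3) by (simp_all add: y_def lor_commute[of "q lo"] lor_commute[of "r lo"])
  have all: "j \<le> hi \<Longrightarrow> \<exists>m n. y = m *\<^sub>R q j + n *\<^sub>R r j" if "lo \<le> j" for j
    using that
  proof (induction j rule: int_ge_induct)
    case base
    show ?case using y_def by blast
  next
    case (step j)
    then obtain m n where y: "y = m *\<^sub>R q j + n *\<^sub>R r j" by auto
    have "j < hi" using step.prems by simp
  from step_refl[OF step.hyps(1) this] obtain z c d where z: "z = v \<or> z = w" "c \<noteq> 0" "d \<noteq> 0" "q (j + 1) = c *\<^sub>R reflect z (q j)" "r (j + 1) = d *\<^sub>R reflect z (r j)"
    by blast
    have "lor y z = 0" using perp z(1) by auto
    then have "y = reflect z y" by (simp add: reflect_def)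
    also have "\<dots> = m *\<^sub>R reflect z (q j) + n *\<^sub>R reflect z (r j)" unfolding y by (rule reflect_linear)
    also have "\<dots> = (m / c) *\<^sub>R q (j + 1) + (n / d) *\<^sub>R r (j + 1)" using z(2-5) by simp
    finally show ?case by blast
  qed
  have "dual j (bar y)" if j: "j \<in> {lo..hi}" for j
  proof -
    obtain m n where "y = m *\<^sub>R q j + n *\<^sub>R r j" using all[of j] j by auto
    then have "bar y = m *\<^sub>R bar (q j) + n *\<^sub>R bar (r j)" by simp
    then show ?thesis unfolding dual_def by blast
  qed
  moreover have "bar y \<noteq> 0"
  proof
    assume "bar y = 0"
    then have "\<mu> *\<^sub>R bar (q lo) + \<nu> *\<^sub>R bar (r lo) = 0" by (simp add: y_def)
    then show False using bar_indep[OF lo_mem(1)] mn(1) by blast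
  qed
  ultimately show ?thesis by blast
qed

lemma degenerate_quadric: "\<exists>H. possibly_degenerate_hyperboloid H \<and> (\<forall>j\<in>{lo..hi}. L j \<subseteq> H)"
proof (cases "D = 0")
  case True
  then obtain y where y: "y \<noteq> 0" "\<And>j. j \<in> {lo..hi} \<Longrightarrow> dual j y" using common_plane by blast
  then have f: "fst y \<noteq> 0" using dual_fst[OF lo_mem(1)] lo_mem(1) by blast
  have "av y (fst y) - av y 0 = fst y \<bullet> fst y" by (simp add: av_def)
  then have "av y (fst y) \<noteq> 0 \<or> av y 0 \<noteq> 0" using f by auto
  then have "\<exists>x. av y x * av y x + av 0 x * av 0 x \<noteq> 0" by auto
  from possibly_degenerate_quadric[OF this] have "possibly_degenerate_hyperboloid {x. av y x * av y x + av 0 x * av 0 x = 0}" .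
  moreover have "L j \<subseteq> {x. av y x * av y x + av 0 x * av 0 x = 0}" if "j \<in> {lo..hi}" for j
    using dual_line[OF that y(2)[OF that]] by auto
  ultimately show ?thesis by blast
next
  case False
  from possibly_degenerate_quadric[OF quadric_proper[OF this]] quadric_lines show ?thesis by blast
qed

text \<open>Reflections in \<open>v\<close> and \<open>w\<close> add multiples of these vectors and
  are isometries, so the product of \<open>q j\<close> and \<open>r j\<close> scales with the
  coefficients of \<open>q lo\<close> and \<open>r lo\<close>.\<close>

lemma coordinates:
  assumes "lo \<le> j"
  shows "j \<le> hi \<Longrightarrow> \<exists>\<xi> s t \<eta> s' t'. q j = \<xi> *\<^sub>R q lo + s *\<^sub>R v + t *\<^sub>R w \<and> r j = \<eta> *\<^sub>R r lo + s' *\<^sub>R v + t' *\<^sub>R w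
    \<and> lor (q j) (r j) = \<xi> * \<eta> * lor (q lo) (r lo)"
  using assms
proof (induction j rule: int_ge_induct)
  case base
  show ?case by (intro exI[of _ 1] exI[of _ 0]) simp
next
  case (step j)
  then obtain \<xi> s t \<eta> s' t' where x: "q j = \<xi> *\<^sub>R q lo + s *\<^sub>R v + t *\<^sub>R w" "r j = \<eta> *\<^sub>R r lo + s' *\<^sub>R v + t' *\<^sub>R w"
    "lor (q j) (r j) = \<xi> * \<eta> * lor (q lo) (r lo)" by auto
  have "j < hi" using step.prems by simp
  from step_refl[OF step.hyps(1) this] obtain z c d where z: "z = v \<or> z = w" "lor z z \<noteq> 0" "q (j + 1) = c *\<^sub>R reflect z (q j)" "r (j + 1) = d *\<^sub>R reflect z (r j)"
    by blast
  have "\<exists>k l. z = k *\<^sub>R v + l *\<^sub>R w"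
    using z(1)
  proof
    assume "z = v"
    then show ?thesis by (intro exI[of _ 1] exI[of _ 0]) simp
  next
    assume "z = w"
    then show ?thesis by (intro exI[of _ 0] exI[of _ 1]) simp
  qed
  then obtain k l where kl: "z = k *\<^sub>R v + l *\<^sub>R w" by blast
  define g h where "g = 2 * lor (q j) z / lor z z" and "h = 2 * lor (r j) z / lor z z"
  have "q (j + 1) = c *\<^sub>R (q j - g *\<^sub>R z)" "r (j + 1) = d *\<^sub>R (r j - h *\<^sub>R z)"
    using z(3,4) by (simp_all add: reflect_def g_def h_def)
  then have "q (j + 1) = (c * \<xi>) *\<^sub>R q lo + (c * (s - g * k)) *\<^sub>R v + (c * (t - g * l)) *\<^sub>R w"
    "r (j + 1) = (d * \<eta>) *\<^sub>R r lo + (d * (s' - h * k)) *\<^sub>R v + (d * (t' - h * l)) *\<^sub>R w"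
    unfolding kl x(1,2) by (simp_all add: algebra_simps)
  moreover have "lor (q (j + 1)) (r (j + 1)) = (c * \<xi>) * (d * \<eta>) * lor (q lo) (r lo)"
    unfolding z(3,4) by (simp add: reflect_lor[OF z(2)] x(3))
  ultimately show ?case by blast
qed

text \<open>
  The quadric is a one-sheeted hyperboloid unless it touches the plane at infinity, represented by \<open>(0, 1)\<close>.
  If it does, writing \<open>(0, 1)\<close> as a sum of planes through the lines \<open>lo\<close> and \<open>j\<close> exhibits parallel planes
  through these lines whose direction \<open>\<omega>\<close> does not depend on \<open>j\<close>.
\<close>
lemma quadric_five:
  assumes S: "lo + 4 \<le> hi" and gp: "rulings_in_general_position {lo..hi} L"
  shows "\<exists>H. good_quadric H \<and> (\<forall>j\<in>{lo..hi}. L j \<subseteq> H)"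
proof -
  have m: "lo \<in> {lo..hi}" "lo + 2 \<in> {lo..hi}" "lo + 4 \<in> {lo..hi}" using S by auto
  have D0: "D \<noteq> 0"
  proof
    assume "D = 0"
    then obtain y where "y \<noteq> 0" "dual lo y" "dual (lo + 2) y" using common_plane m by blast
    then show False using dual_disjoint[OF gp m(1,2)] by simp
  qed
  have split: "\<exists>a b c d. x = a *\<^sub>R bar (q lo) + b *\<^sub>R bar (r lo) + c *\<^sub>R bar (q j) + d *\<^sub>R bar (r j)"
    if j: "j \<in> {lo..hi}" "j \<noteq> lo" "even (lo - j)" for j x
  proof -
    have "lin_indep4 (bar (q lo)) (bar (r lo)) (bar (q j)) (bar (r j))" unfolding lin_indep4_def
    proof (intro allI impI)
      fix a b c d assume e: "a *\<^sub>R bar (q lo) + b *\<^sub>R bar (r lo) + c *\<^sub>R bar (q j) + d *\<^sub>R bar (r j) = 0"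
      define y where "y = a *\<^sub>R bar (q lo) + b *\<^sub>R bar (r lo)"
      have y2: "y = (- c) *\<^sub>R bar (q j) + (- d) *\<^sub>R bar (r j)"
        using e unfolding y_def by (simp add: algebra_simps eq_neg_iff_add_eq_0)
      have "dual lo y" "dual j y" using y_def y2 unfolding dual_def by blast+
      then have y0: "y = 0" using dual_disjoint[OF gp m(1) j(1)] j(2,3) by simp
      have "a = 0 \<and> b = 0" by (rule bar_indep[OF m(1) y0[unfolded y_def]])
      moreover have "- c = 0 \<and> - d = 0" by (rule bar_indep[OF j(1) y0[unfolded y2]])
      ultimately show "a = 0 \<and> b = 0 \<and> c = 0 \<and> d = 0" by simp
    qed
    from lin_indep4_span[OF this] show ?thesis .
  qed
  have span0: "\<exists>a b c d. x = a *\<^sub>R bar v + b *\<^sub>R bar w + c *\<^sub>R bar (q lo) + d *\<^sub>R bar (r lo)" for x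
  proof -
    have "lo + 2 \<noteq> lo" "even (lo - (lo + 2))" by simp_all
    from split[OF m(2) this] obtain a b c d
      where x: "x = a *\<^sub>R bar (q lo) + b *\<^sub>R bar (r lo) + c *\<^sub>R bar (q (lo + 2)) + d *\<^sub>R bar (r (lo + 2))"
      by blast
    obtain \<xi> s t \<eta> s' t' where y: "q (lo + 2) = \<xi> *\<^sub>R q lo + s *\<^sub>R v + t *\<^sub>R w" "r (lo + 2) = \<eta> *\<^sub>R r lo + s' *\<^sub>R v + t' *\<^sub>R w"
      using coordinates[of "lo + 2"] m(2) by auto
    have "x = (c * s + d * s') *\<^sub>R bar v + (c * t + d * t') *\<^sub>R bar w + (a + c * \<xi>) *\<^sub>R bar (q lo) + (b + d * \<eta>) *\<^sub>R bar (r lo)"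
      unfolding x y by (simp add: algebra_simps)
    then show ?thesis by blast
  qed
  have ind0: "lin_indep4 (bar v) (bar w) (bar (q lo)) (bar (r lo))" by (rule span_lin_indep4[OF span0])
  have recover: "D *\<^sub>R q lo = lor v (q lo) *\<^sub>R y1 + lor w (q lo) *\<^sub>R y2" "D *\<^sub>R r lo = lor v (r lo) *\<^sub>R y1 + lor w (r lo) *\<^sub>R y2"
    by (simp_all add: D_def y1_def y2_def algebra_simps)
  obtain s1 t1 f1 g1 where e1: "(0, 1) = s1 *\<^sub>R bar v + t1 *\<^sub>R bar w + f1 *\<^sub>R bar (q lo) + g1 *\<^sub>R bar (r lo)"
    using span0 by blast
  define e where "e = s1 *\<^sub>R v + t1 *\<^sub>R w + f1 *\<^sub>R q lo + g1 *\<^sub>R r lo"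
  \<comment> \<open>\<open>X\<close> and \<open>Y\<close> are the products of
    \<open>s1 *\<^sub>R v + t1 *\<^sub>R w\<close> with \<open>q lo\<close> and \<open>r lo\<close>.
    \<open>F\<close> is the dual form at the plane at infinity, zero when that plane is
    tangent.\<close>
  define X where "X = s1 * lor v (q lo) + t1 * lor w (q lo)"
  define Y where "Y = s1 * lor v (r lo) + t1 * lor w (r lo)"
  define F where "F = s1 * s1 * lor v v + 2 * s1 * t1 * lor v w + t1 * t1 * lor w w + 2 * f1 * X + 2 * g1 * Y"
  have in_forms: "\<exists>A B C E. s *\<^sub>R bar v + t *\<^sub>R bar w + f *\<^sub>R bar (q lo) + g *\<^sub>R bar (r lo)
      = A *\<^sub>R bar y1 + B *\<^sub>R bar z1 + C *\<^sub>R bar y2 + E *\<^sub>R bar z2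
      \<and> 4 * D * D * (A * B + C * E) = s * s * lor v v + 2 * s * t * lor v w + t * t * lor w w
        + 2 * f * (s * lor v (q lo) + t * lor w (q lo)) + 2 * g * (s * lor v (r lo) + t * lor w (r lo))" for s t f g
  proof -
    \<comment> \<open>\<open>v\<close> and \<open>w\<close> enter through \<open>z1\<close> and
      \<open>z2\<close> with the factor \<open>2 * D\<close>; \<open>A\<close> and \<open>C\<close>
      absorb the remaining part in \<open>y1\<close> and \<open>y2\<close>.\<close>
    define B E where "B = s / (2 * D)" and "E = t / (2 * D)"
    define k l where "k = (f * lor v (q lo) + g * lor v (r lo)) / D" and "l = (f * lor w (q lo) + g * lor w (r lo)) / D"
    define A C where "A = k + lor v v * B + lor v w * E" and "C = l + lor v w * B + lor w w * E"
    have st: "s = 2 * D * B" "t = 2 * D * E" using D0 by (simp_all add: B_def E_def)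
    have kl: "f * lor v (q lo) + g * lor v (r lo) = D * k" "f * lor w (q lo) + g * lor w (r lo) = D * l"
      using D0 by (simp_all add: k_def l_def)
    have "D *\<^sub>R (f *\<^sub>R q lo + g *\<^sub>R r lo) = f *\<^sub>R (D *\<^sub>R q lo) + g *\<^sub>R (D *\<^sub>R r lo)" by (simp add: algebra_simps)
    also have "\<dots> = (f * lor v (q lo) + g * lor v (r lo)) *\<^sub>R y1 + (f * lor w (q lo) + g * lor w (r lo)) *\<^sub>R y2"
      unfolding recover by (simp add: algebra_simps)
    also have "\<dots> = D *\<^sub>R (k *\<^sub>R y1 + l *\<^sub>R y2)" unfolding kl by (simp add: algebra_simps)
    finally have fg: "f *\<^sub>R q lo + g *\<^sub>R r lo = k *\<^sub>R y1 + l *\<^sub>R y2" using D0 by simp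
    have "s *\<^sub>R v + t *\<^sub>R w + (k *\<^sub>R y1 + l *\<^sub>R y2) = A *\<^sub>R y1 + B *\<^sub>R z1 + C *\<^sub>R y2 + E *\<^sub>R z2"
      unfolding A_def C_def z1_def z2_def st by (simp add: algebra_simps)
    then have "s *\<^sub>R v + t *\<^sub>R w + f *\<^sub>R q lo + g *\<^sub>R r lo = A *\<^sub>R y1 + B *\<^sub>R z1 + C *\<^sub>R y2 + E *\<^sub>R z2"
      using fg by (simp add: add.assoc)
    then have "bar (s *\<^sub>R v + t *\<^sub>R w + f *\<^sub>R q lo + g *\<^sub>R r lo) = bar (A *\<^sub>R y1 + B *\<^sub>R z1 + C *\<^sub>R y2 + E *\<^sub>R z2)" by simp
    moreover have "4 * D * D * (A * B + C * E) = s * s * lor v v + 2 * s * t * lor v w + t * t * lor w w + 2 * s * (D * k) + 2 * t * (D * l)"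
      unfolding A_def C_def st by (simp add: algebra_simps)
    moreover have "2 * s * (D * k) + 2 * t * (D * l) = 2 * f * (s * lor v (q lo) + t * lor w (q lo)) + 2 * g * (s * lor v (r lo) + t * lor w (r lo))"
      unfolding kl[symmetric] by (simp add: algebra_simps)
    ultimately show ?thesis by (intro exI[of _ A] exI[of _ B] exI[of _ C] exI[of _ E]) simp
  qed
  have ind: "lin_indep4 (bar y1) (bar z1) (bar y2) (bar z2)"
  proof (rule span_lin_indep4)
    fix x
    obtain a b c d where "x = a *\<^sub>R bar v + b *\<^sub>R bar w + c *\<^sub>R bar (q lo) + d *\<^sub>R bar (r lo)" using span0 by blast
    then show "\<exists>A B C E. x = A *\<^sub>R bar y1 + B *\<^sub>R bar z1 + C *\<^sub>R bar y2 + E *\<^sub>R bar z2"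
      using in_forms[of a b c d] by auto
  qed
  obtain A B C E where one: "(0, 1) = A *\<^sub>R bar y1 + B *\<^sub>R bar z1 + C *\<^sub>R bar y2 + E *\<^sub>R bar z2"
    and val: "4 * D * D * (A * B + C * E) = F"
    using in_forms[of s1 t1 f1 g1] unfolding e1[symmetric] X_def[symmetric] Y_def[symmetric] F_def by auto
  have "F \<noteq> 0"
  proof
    assume F0: "F = 0"
    have XY: "X \<noteq> 0 \<or> Y \<noteq> 0"
    proof (rule ccontr)
      assume "\<not> ?thesis"
      then have 0: "X = 0" "Y = 0" by auto
      have "s1 * D = X * lor w (r lo) - Y * lor w (q lo)" "t1 * D = Y * lor v (q lo) - X * lor v (r lo)"
        by (simp_all add: X_def Y_def D_def algebra_simps)
      then have "s1 = 0" "t1 = 0" using 0 D0 by simp_all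
      then have "(0, 1) = f1 *\<^sub>R bar (q lo) + g1 *\<^sub>R bar (r lo)" using e1 by simp
      then have "dual lo (0, 1)" unfolding dual_def by blast
      then show False using dual_one[OF m(1)] by blast
    qed
    define \<kappa> where "\<kappa> = lor (q lo) (r lo)"
    have null0: "lor (q lo) (q lo) = 0" "lor (r lo) (r lo) = 0" using planes[OF m(1)] oplane_null by blast+
    \<comment> \<open>Normal of the plane through the first line that turns out to be parallel to
      all lines of its ruling.\<close>
    define \<omega> where "\<omega> = Y *\<^sub>R fst (q lo) - X *\<^sub>R fst (r lo)"
    have om0: "\<omega> \<noteq> 0"
    proof
      assume "\<omega> = 0"
      then have "Y *\<^sub>R fst (q lo) + (- X) *\<^sub>R fst (r lo) = 0" by (simp add: \<omega>_def)
      from normals[OF m(1) this] show False using XY by simp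
    qed
    have perp_lo: "\<omega> \<bullet> (x - y) = 0" if "x \<in> L lo" "y \<in> L lo" for x y
    proof -
      have "fst (q lo) \<bullet> (x - y) = 0" "fst (r lo) \<bullet> (x - y) = 0"
        using that unfolding L_eq[OF m(1)] ev_def by (simp_all add: inner_diff_right)
      then show ?thesis by (simp add: \<omega>_def inner_diff_left)
    qed
    have perp: "\<omega> \<bullet> (x - y) = 0" if j: "j \<in> {lo..hi}" "j \<noteq> lo" "even (lo - j)" and xy: "x \<in> L j" "y \<in> L j" for j x y
    proof -
      obtain \<mu> \<nu> \<mu>' \<nu>' where d: "(0, 1) = \<mu> *\<^sub>R bar (q lo) + \<nu> *\<^sub>R bar (r lo) + \<mu>' *\<^sub>R bar (q j) + \<nu>' *\<^sub>R bar (r j)"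
        using split[OF j] by blast
      obtain \<xi> s t \<eta> s' t' where c: "q j = \<xi> *\<^sub>R q lo + s *\<^sub>R v + t *\<^sub>R w" "r j = \<eta> *\<^sub>R r lo + s' *\<^sub>R v + t' *\<^sub>R w"
        "lor (q j) (r j) = \<xi> * \<eta> * \<kappa>"
        using coordinates[of j] j(1) unfolding \<kappa>_def by auto
      have nullj: "lor (q j) (q j) = 0" "lor (r j) (r j) = 0" using planes[OF j(1)] oplane_null by blast+
      have "(\<mu>' * s + \<nu>' * s' - s1) *\<^sub>R bar v + (\<mu>' * t + \<nu>' * t' - t1) *\<^sub>R bar w
        + (\<mu> + \<mu>' * \<xi> - f1) *\<^sub>R bar (q lo) + (\<nu> + \<nu>' * \<eta> - g1) *\<^sub>R bar (r lo)
        = (\<mu> *\<^sub>R bar (q lo) + \<nu> *\<^sub>R bar (r lo) + \<mu>' *\<^sub>R bar (q j) + \<nu>' *\<^sub>R bar (r j))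
        - (s1 *\<^sub>R bar v + t1 *\<^sub>R bar w + f1 *\<^sub>R bar (q lo) + g1 *\<^sub>R bar (r lo))"
        unfolding c(1,2) by (simp add: algebra_simps)
      also have "\<dots> = 0" unfolding d[symmetric] e1[symmetric] by simp
      finally have "\<mu>' * s + \<nu>' * s' - s1 = 0 \<and> \<mu>' * t + \<nu>' * t' - t1 = 0 \<and> \<mu> + \<mu>' * \<xi> - f1 = 0 \<and> \<nu> + \<nu>' * \<eta> - g1 = 0"
        using ind0 unfolding lin_indep4_def by blast
      then have co: "s1 = \<mu>' * s + \<nu>' * s'" "t1 = \<mu>' * t + \<nu>' * t'" "f1 = \<mu> + \<mu>' * \<xi>" "g1 = \<nu> + \<nu>' * \<eta>" by simp_all
      define S where "S = s1 *\<^sub>R v + t1 *\<^sub>R w"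
      have S2: "S = \<mu>' *\<^sub>R (q j - \<xi> *\<^sub>R q lo) + \<nu>' *\<^sub>R (r j - \<eta> *\<^sub>R r lo)"
        unfolding S_def co c(1,2) by (simp add: algebra_simps)
      have SX: "lor S (q lo) = X" "lor S (r lo) = Y" by (simp_all add: S_def X_def Y_def)
      \<comment> \<open>The part of the plane at infinity through the line \<open>j\<close> is a
        combination of the null vectors \<open>q j\<close>, \<open>r j\<close>, and its contribution
        cancels. What remains is a pairing with the part through the first line.\<close>
      have "F = lor S S + 2 * f1 * lor S (q lo) + 2 * g1 * lor S (r lo)"
        unfolding SX F_def by (simp add: S_def lor_commute[of w v] algebra_simps)
      also have "\<dots> = (lor S S + 2 * (\<mu>' * \<xi>) * lor S (q lo) + 2 * (\<nu>' * \<eta>) * lor S (r lo)) + 2 * (\<mu> * X + \<nu> * Y)"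
        unfolding co(3,4) SX by (simp add: algebra_simps)
      also have "lor S S + 2 * (\<mu>' * \<xi>) * lor S (q lo) + 2 * (\<nu>' * \<eta>) * lor S (r lo)
        = lor (S + (\<mu>' * \<xi>) *\<^sub>R q lo + (\<nu>' * \<eta>) *\<^sub>R r lo) (S + (\<mu>' * \<xi>) *\<^sub>R q lo + (\<nu>' * \<eta>) *\<^sub>R r lo)
          - 2 * \<mu>' * \<nu>' * \<xi> * \<eta> * \<kappa>"
        by (simp add: null0 \<kappa>_def lor_commute[of "r lo" "q lo"] lor_commute[of "q lo" S] lor_commute[of "r lo" S] algebra_simps)
      also have "S + (\<mu>' * \<xi>) *\<^sub>R q lo + (\<nu>' * \<eta>) *\<^sub>R r lo = \<mu>' *\<^sub>R q j + \<nu>' *\<^sub>R r j"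
        unfolding S2 by (simp add: algebra_simps)
      also have "lor (\<mu>' *\<^sub>R q j + \<nu>' *\<^sub>R r j) (\<mu>' *\<^sub>R q j + \<nu>' *\<^sub>R r j) = 2 * \<mu>' * \<nu>' * \<xi> * \<eta> * \<kappa>"
        by (simp add: nullj c(3) lor_commute[of "r j" "q j"] algebra_simps)
      finally have pol: "\<mu> * X + \<nu> * Y = 0" using F0 by simp
      have mn: "\<mu> \<noteq> 0 \<or> \<nu> \<noteq> 0"
      proof (rule ccontr)
        assume "\<not> ?thesis"
        then have "(0, 1) = \<mu>' *\<^sub>R bar (q j) + \<nu>' *\<^sub>R bar (r j)" using d by simp
        then have "dual j (0, 1)" unfolding dual_def by blast
        then show False using dual_one[OF j(1)] by blast
      qed
      have "fst ((0, 1) :: (real^3) \<times> real) = 0" by simp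
      then have "\<mu> *\<^sub>R fst (q lo) + \<nu> *\<^sub>R fst (r lo) + (\<mu>' *\<^sub>R fst (q j) + \<nu>' *\<^sub>R fst (r j)) = 0"
        unfolding d by (simp add: add.assoc)
      then have fd: "\<mu> *\<^sub>R fst (q lo) + \<nu> *\<^sub>R fst (r lo) = - (\<mu>' *\<^sub>R fst (q j) + \<nu>' *\<^sub>R fst (r j))"
        by (simp only: eq_neg_iff_add_eq_0)
      have "fst (q j) \<bullet> (x - y) = 0" "fst (r j) \<bullet> (x - y) = 0"
        using xy unfolding L_eq[OF j(1)] ev_def by (simp_all add: inner_diff_right)
      then have 0: "(\<mu> *\<^sub>R fst (q lo) + \<nu> *\<^sub>R fst (r lo)) \<bullet> (x - y) = 0"
        unfolding fd inner_minus_left inner_add_left inner_scaleR_left by simp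
      define g h where "g = fst (q lo) \<bullet> (x - y)" and "h = fst (r lo) \<bullet> (x - y)"
      have gh: "\<mu> * g + \<nu> * h = 0" using 0 by (simp add: g_def h_def inner_add_left)
      \<comment> \<open>By \<open>pol\<close> the pair \<open>(\<mu>, \<nu>)\<close> is proportional
        to \<open>(Y, - X)\<close>, so the part through the first line has the normal direction
        \<open>\<omega>\<close>, whatever \<open>j\<close> is.\<close>
      have "\<mu> * (Y * g - X * h) = Y * (\<mu> * g + \<nu> * h) - h * (\<mu> * X + \<nu> * Y)"
        "\<nu> * (Y * g - X * h) = g * (\<mu> * X + \<nu> * Y) - X * (\<mu> * g + \<nu> * h)" by (simp_all add: algebra_simps)
      then have "Y * g - X * h = 0" using gh pol mn by auto
      then show ?thesis by (simp add: \<omega>_def inner_diff_left g_def h_def)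
    qed
    have "parallel_to_common_plane {L lo, L (lo + 2), L (lo + 4)}"
      unfolding parallel_to_common_plane_def
      using om0 perp_lo perp[OF m(2)] perp[OF m(3)] by (intro exI[of _ \<omega>]) auto
    moreover have "\<not> parallel_to_common_plane {L lo, L (lo + 2), L (lo + 4)}"
      using gp m unfolding rulings_in_general_position_def by simp
    ultimately show False by blast
  qed
  then have "A * B + C * E \<noteq> 0" using val by auto
  from good_quadric_forms[OF ind one this] quadric_lines show ?thesis by blast
qed

lemma family_on_hyperboloid: "lie_on_hyperboloid {lo..hi} L"
proof (cases "rulings_in_general_position {lo..hi} L")
  case True
  consider "hi = lo + 1" | "hi = lo + 2" | "hi = lo + 3" | "lo + 4 \<le> hi" using two by linarith
  then have "\<exists>H. good_quadric H \<and> (\<forall>j\<in>{lo..hi}. L j \<subseteq> H)"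
    using quadrilateral_two quadrilateral_three[OF _ True] quadrilateral_four[OF _ True] quadric_five[OF _ True]
    by cases blast+
  then show ?thesis unfolding lie_on_hyperboloid_def good_quadric_def by blast
next
  case False
  then show ?thesis using degenerate_quadric unfolding lie_on_hyperboloid_def by blast
qed

end

section \<open>Lines of the net as intersections of level planes\<close>

lemma parallel_of_normals:
  fixes n1 n2 d y :: "real^3"
  assumes n: "\<And>a b. a *\<^sub>R n1 + b *\<^sub>R n2 = 0 \<Longrightarrow> a = 0 \<and> b = 0"
    and d: "d \<noteq> 0" "n1 \<bullet> d = 0" "n2 \<bullet> d = 0" and y: "n1 \<bullet> y = 0" "n2 \<bullet> y = 0"
  shows "\<exists>c. y = c *\<^sub>R d"
proof -
  have "lin_indep4 (n1, 0 :: real) (n2, 0) (d, 0) (0, 1)" unfolding lin_indep4_def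
  proof (intro allI impI)
    fix a b c e assume z: "a *\<^sub>R (n1, 0 :: real) + b *\<^sub>R (n2, 0) + c *\<^sub>R (d, 0) + e *\<^sub>R (0, 1) = 0"
    have f: "a *\<^sub>R n1 + b *\<^sub>R n2 + c *\<^sub>R d = 0" using arg_cong[OF z, of fst] by simp
    have "(a *\<^sub>R n1 + b *\<^sub>R n2 + c *\<^sub>R d) \<bullet> d = 0" unfolding f by simp
    then have "c = 0" using d by (simp add: inner_add_left)
    then show "a = 0 \<and> b = 0 \<and> c = 0 \<and> e = 0" using n f arg_cong[OF z, of snd] by simp
  qed
  define c where "c = (d \<bullet> y) / (d \<bullet> d)"
  define z where "z = y - c *\<^sub>R d"
  have zd: "n1 \<bullet> z = 0" "n2 \<bullet> z = 0" "d \<bullet> z = 0"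
    using d y by (simp_all add: z_def c_def inner_diff_right)
  obtain k l m e where "(z, 0) = k *\<^sub>R (n1, 0) + l *\<^sub>R (n2, 0) + m *\<^sub>R (d, 0) + e *\<^sub>R (0, 1 :: real)"
    using lin_indep4_span[OF \<open>lin_indep4 _ _ _ _\<close>] by blast
  then have z: "z = k *\<^sub>R n1 + l *\<^sub>R n2 + m *\<^sub>R d" by simp
  have "z \<bullet> z = k * (n1 \<bullet> z) + l * (n2 \<bullet> z) + m * (d \<bullet> z)" by (subst (1) z) (simp add: inner_add_left)
  then have "z = 0" using zd by simp
  then show ?thesis unfolding z_def by auto
qed

lemma ev_affine_comb: "u + v = 1 \<Longrightarrow> ev p (u *\<^sub>R x + v *\<^sub>R y) = u * ev p x + v * ev p y"
proof -
  assume "u + v = 1"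
  then have "snd (snd p) = (u + v) * snd (snd p)" by simp
  then show ?thesis by (simp add: ev_def inner_add_right algebra_simps)
qed

lemma cube_edge_line:
  assumes c: "cube_planes P Q R \<sigma> V"
  shows "a *\<^sub>R fst (Q b) + e *\<^sub>R fst (R d) = 0 \<Longrightarrow> a = 0 \<and> e = 0"
    and "{x. ev (Q b) x = 0 \<and> ev (R d) x = 0} \<subseteq> affine hull {V False b d, V True b d}"
proof -
  note i = cube_planes_incidence[OF c]
  show n: "a = 0 \<and> e = 0" if z: "a *\<^sub>R fst (Q b) + e *\<^sub>R fst (R d) = 0" for a e
  proof -
    have e: "a * (ev (Q b) x - ev (Q b) y) + e * (ev (R d) x - ev (R d) y) = 0" for x y
    proof -
      have "a * (ev (Q b) x - ev (Q b) y) + e * (ev (R d) x - ev (R d) y) = (a *\<^sub>R fst (Q b) + e *\<^sub>R fst (R d)) \<bullet> (x - y)"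
        by (simp add: ev_def inner_add_left inner_diff_right algebra_simps)
      then show ?thesis unfolding z by simp
    qed
    show ?thesis
      using e[of "V False (\<not> b) d" "V False b d"] e[of "V False b (\<not> d)" "V False b d"]
        i(2)[of b False "\<not> b" d] i(2)[of b False b d] i(2)[of b False b "\<not> d"]
        i(3)[of d False "\<not> b" d] i(3)[of d False b d] i(3)[of d False b "\<not> d"] by auto
  qed
  have ne: "V True b d - V False b d \<noteq> 0" using i(1)[of True True b d] i(1)[of True False b d] by auto
  have perp: "fst x \<bullet> (y - z) = 0" if "ev x y = 0" "ev x z = 0" for x y z
    using that by (simp add: ev_def inner_diff_right)
  show "{x. ev (Q b) x = 0 \<and> ev (R d) x = 0} \<subseteq> affine hull {V False b d, V True b d}"
  proof clarify
    fix x assume x: "ev (Q b) x = 0" "ev (R d) x = 0"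
    obtain k where "x - V False b d = k *\<^sub>R (V True b d - V False b d)"
      using parallel_of_normals[OF n ne perp perp perp perp] i(2,3) x by blast
    then have "x = (1 - k) *\<^sub>R V False b d + k *\<^sub>R V True b d" by (simp add: algebra_simps)
    moreover have "(1 - k) + k = 1" by simp
    ultimately show "x \<in> affine hull {V False b d, V True b d}" unfolding affine_hull_2 by blast
  qed
qed

context laguerre_net
begin

text \<open>The edge of one adjacent cell already spans the intersection of the two planes, and all
  points of the line lie on both.\<close>

lemma line_l_planes:
  assumes c: "ncube 1 i j k" and b: "j' = j + of_bool b" "k' = k + of_bool d"
  shows "line_l {a1..b1} f j' k' = {x. ev (q j') x = 0 \<and> ev (r k') x = 0}"
    and "a *\<^sub>R fst (q j') + e *\<^sub>R fst (r k') = 0 \<Longrightarrow> a = 0 \<and> e = 0"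
    and "\<exists>x\<in>line_l {a1..b1} f j' k'. ev (q (j + of_bool (\<not> b))) x \<noteq> 0"
proof -
  note cp = cell_planes[OF c]
  have m: "i \<in> {a1..b1}" "i + 1 \<in> {a1..b1}" "j' \<in> {a2..b2}" "k' \<in> {a3..b3}" "j + of_bool (\<not> b) \<in> {a2..b2}"
    using c b by (auto simp: is_net_cube_def of_bool_def)
  show "a *\<^sub>R fst (q j') + e *\<^sub>R fst (r k') = 0 \<Longrightarrow> a = 0 \<and> e = 0"
    unfolding b by (rule cube_edge_line(1)[OF cp])
  have V: "net_cube f 1 i j k False b d = f i j' k'" "net_cube f 1 i j k True b d = f (i + 1) j' k'"
    by (simp_all add: net_cube_def b)
  let ?S = "{x. ev (q j') x = 0 \<and> ev (r k') x = 0}"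
  show "line_l {a1..b1} f j' k' = ?S"
  proof
    have "affine ?S"
      unfolding affine_def by (simp add: ev_affine_comb)
    moreover have "(\<lambda>i. f i j' k') ` {a1..b1} \<subseteq> ?S" using inc m by blast
    ultimately show "line_l {a1..b1} f j' k' \<subseteq> ?S" unfolding line_l_def by (rule hull_minimal[rotated])
  next
    have "?S \<subseteq> affine hull {f i j' k', f (i + 1) j' k'}"
      using cube_edge_line(2)[OF cp, of b d] unfolding V b[symmetric] .
    also have "\<dots> \<subseteq> line_l {a1..b1} f j' k'" unfolding line_l_def by (rule hull_mono) (use m in blast)
    finally show "?S \<subseteq> line_l {a1..b1} f j' k'" .
  qed
  have "f i j' k' \<in> line_l {a1..b1} f j' k'" unfolding line_l_def by (rule hull_inc) (use m in blast)
  moreover have "ev (q (j + of_bool (\<not> b))) (f i j' k') \<noteq> 0"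
    using cube_planes_incidence(2)[OF cp, of "\<not> b" False b d] unfolding V by simp
  ultimately show "\<exists>x\<in>line_l {a1..b1} f j' k'. ev (q (j + of_bool (\<not> b))) x \<noteq> 0" by blast
qed

text \<open>\<open>\<sigma>\<close> and the parity of \<open>s\<close> unite the families with odd
  \<open>j + k\<close> and with even \<open>j - k\<close>. Under this parity two consecutive lines
  carry diagonally opposite edges of a unit cell.\<close>

lemma diagonal_on_hyperboloid:
  assumes large: "a1 + 4 \<le> b1" "a2 + 4 \<le> b2" "a3 + 4 \<le> b3"
    and \<sigma>: "\<sigma> = 1 \<and> even s \<or> \<sigma> = - 1 \<and> odd s"
    and mem: "\<And>j. j \<in> {lo..hi} \<Longrightarrow> j \<in> {a2..b2} \<and> s + \<sigma> * j \<in> {a3..b3}"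
  shows "lie_on_hyperboloid {lo..hi} (\<lambda>j. line_l {a1..b1} f j (s + \<sigma> * j))"
proof (cases "lo < hi")
  case False
  have "collinear (line_l {a1..b1} f lo (s + \<sigma> * lo))" if "lo \<in> {lo..hi}"
  proof -
    have "collinear ((\<lambda>i. f i lo (s + \<sigma> * lo)) ` {a1..b1})"
      using lines(2) mem[OF that] by (simp add: on_line_in_order_def)
    then show ?thesis unfolding line_l_def by (simp add: collinear_affine_hull_collinear)
  qed
  then have "collinear (if lo \<in> {lo..hi} then line_l {a1..b1} f lo (s + \<sigma> * lo) else {})" by simp
  from collinear_in_hyperboloid[OF this] obtain H where H: "good_quadric H"
    "(if lo \<in> {lo..hi} then line_l {a1..b1} f lo (s + \<sigma> * lo) else {}) \<subseteq> H" by blast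
  have "line_l {a1..b1} f j (s + \<sigma> * j) \<subseteq> H" if "j \<in> {lo..hi}" for j
  proof -
    have "j = lo" using that False by simp
    then show ?thesis using H(2) that by simp
  qed
  then show ?thesis using H(1) unfolding lie_on_hyperboloid_def good_quadric_def by blast
next
  case True
  have odd_comm: "even (x - (y + 1)) \<longleftrightarrow> odd (x - y)" for x y :: int by presburger
  obtain v where v: "class_pencil lo v" "lor v v \<noteq> 0" using class_pencils_large[OF large, of lo] by blast
  obtain w where w: "class_pencil (lo + 1) w" "lor w w \<noteq> 0" using class_pencils_large[OF large, of "lo + 1"] by blast
  have step: "s + \<sigma> * (j + 1) = s + \<sigma> * j + \<sigma>" for j by (simp add: algebra_simps)
  have adj: "pencil x (q j) (q (j + 1)) \<and> pencil x (r (s + \<sigma> * j)) (r (s + \<sigma> * (j + 1)))"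
    if x: "class_pencil \<epsilon> x" and j: "lo \<le> j" "j < hi" "even (j - \<epsilon>)" for \<epsilon> x j
  proof -
    have jm: "j \<in> {a2..b2}" "s + \<sigma> * j \<in> {a3..b3}" "j + 1 \<in> {a2..b2}" "s + \<sigma> * j + \<sigma> \<in> {a3..b3}"
      using mem[of j] mem[of "j + 1"] j unfolding step by auto
    have Q: "pencil x (q j) (q (j + 1))" using x jm j(3) unfolding class_pencil_def by simp
    have R: "pencil x (r k) (r (k + 1))" if "even (k - \<epsilon>)" "k \<in> {a3..b3}" "k + 1 \<in> {a3..b3}" for k
      using x that unfolding class_pencil_def by simp
    show ?thesis
    proof (cases "\<sigma> = 1")
      case True
      then have "even (s + \<sigma> * j - \<epsilon>)" using \<sigma> j(3) by auto
      from R[OF this jm(2)] show ?thesis using Q True jm(4) by (simp add: add.assoc)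
    next
      case False
      then have s: "\<sigma> = - 1" "odd s" using \<sigma> by auto
      then have "even (s + \<sigma> * j + \<sigma> - \<epsilon>)" using j(3) by auto
      from R[OF this jm(4)] jm(2) have "pencil x (r (s + \<sigma> * j + \<sigma>)) (r (s + \<sigma> * j))" by (simp add: s)
      then show ?thesis using Q unfolding step by (simp add: pencil_commute)
    qed
  qed
  have cell: "\<exists>i k d. ncube 1 i j k \<and> s + \<sigma> * j = k + of_bool d \<and> s + \<sigma> * (j + 1) = k + of_bool (\<not> d)"
    if j: "lo \<le> j" "j < hi" for j
  proof -
    have jm: "j \<in> {a2..b2}" "s + \<sigma> * j \<in> {a3..b3}" "j + 1 \<in> {a2..b2}" "s + \<sigma> * j + \<sigma> \<in> {a3..b3}"
      using mem[of j] mem[of "j + 1"] j unfolding step by auto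
    define i where "i = (if even (a1 - j) then a1 else a1 + 1)"
    have i: "even i = even j" "i \<in> {a1..b1}" "i + 1 \<in> {a1..b1}" using large(1) by (auto simp: i_def)
    \<comment> \<open>On a falling diagonal the cell between the lines \<open>j\<close> and
      \<open>j + 1\<close> starts at the third index of the latter.\<close>
    define d where "d \<longleftrightarrow> \<sigma> = - 1"
    define k where "k = s + \<sigma> * j - of_bool d"
    have "ncube 1 i j k" using i jm \<sigma> unfolding is_net_cube_def k_def d_def by auto
    moreover have "s + \<sigma> * j = k + of_bool d \<and> s + \<sigma> * (j + 1) = k + of_bool (\<not> d)"
      using \<sigma> unfolding step by (auto simp: k_def d_def)
    ultimately show ?thesis by blast
  qed
  have cover: "\<exists>i j0 k b d. ncube 1 i j0 k \<and> j = j0 + of_bool b \<and> s + \<sigma> * j = k + of_bool d" if j: "j \<in> {lo..hi}" for j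
  proof (cases "j < hi")
    case True
    then obtain i k d where "ncube 1 i j k" "s + \<sigma> * j = k + of_bool d" using cell[of j] j by auto
    then show ?thesis by (intro exI[of _ i] exI[of _ j] exI[of _ k] exI[of _ False] exI[of _ d]) simp
  next
    case False
    then have "lo \<le> j - 1" "j - 1 < hi" using j True by auto
    from cell[OF this] obtain i k d where "ncube 1 i (j - 1) k" "s + \<sigma> * (j - 1 + 1) = k + of_bool (\<not> d)" by blast
    then show ?thesis by (intro exI[of _ i] exI[of _ "j - 1"] exI[of _ k] exI[of _ True] exI[of _ "\<not> d"]) simp
  qed
  interpret diagonal_family lo hi q "\<lambda>j. r (s + \<sigma> * j)" "\<lambda>j. line_l {a1..b1} f j (s + \<sigma> * j)" v w
  proof
    show "lo < hi" by (rule True)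
    show "lor v v \<noteq> 0" "lor w w \<noteq> 0" by (rule v(2) w(2))+
    fix j
    show "line_l {a1..b1} f j (s + \<sigma> * j) = {x. ev (q j) x = 0 \<and> ev (r (s + \<sigma> * j)) x = 0}" if "j \<in> {lo..hi}"
      using cover[OF that] line_l_planes(1) by blast
    show "oplane (q j) \<and> oplane (r (s + \<sigma> * j))" if "j \<in> {lo..hi}" using mem[OF that] oplanes by blast
    show "a = 0 \<and> b = 0" if j: "j \<in> {lo..hi}" and z: "a *\<^sub>R fst (q j) + b *\<^sub>R fst (r (s + \<sigma> * j)) = 0" for a b
    proof -
      obtain i j0 k b d where c: "ncube 1 i j0 k" "j = j0 + of_bool b" "s + \<sigma> * j = k + of_bool d" using cover[OF j] by blast
      show ?thesis by (rule line_l_planes(2)[OF c z])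
    qed
    show "pencil v (q j) (q (j + 1)) \<and> pencil v (r (s + \<sigma> * j)) (r (s + \<sigma> * (j + 1)))"
      if "lo \<le> j" "j < hi" "even (j - lo)" by (rule adj[OF v(1) that])
    show "pencil w (q j) (q (j + 1)) \<and> pencil w (r (s + \<sigma> * j)) (r (s + \<sigma> * (j + 1)))"
      if "lo \<le> j" "j < hi" "odd (j - lo)" by (rule adj[OF w(1) that(1,2)]) (use that(3) odd_comm in blast)
    show "\<exists>u. pencil u (q i) (q j) \<and> pencil u (r (s + \<sigma> * i)) (r (s + \<sigma> * j))"
      if ij: "i \<in> {lo..hi}" "j \<in> {lo..hi}" "odd (j - i)" for i
    proof -
      have main: "\<exists>u. pencil u (q i) (q j) \<and> pencil u (r (s + \<sigma> * i)) (r (s + \<sigma> * j))"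
        if ij: "i \<in> {lo..hi}" "j \<in> {lo..hi}" "odd (j - i)" "even i" for i j
      proof -
        obtain u where u: "net_pencil u (j - i)" using net_pencil_exists[OF large ij(3)] by blast
        have Q: "pencil u (q i) (q (i + (j - i)))"
          by (rule seq_pencilD[of a2 b2]) (use u ij mem in \<open>auto simp: net_pencil_def\<close>)
        have R: "pencil u (r k) (r (k + (j - i)))" if "even k" "k \<in> {a3..b3}" "k + (j - i) \<in> {a3..b3}" for k
          by (rule seq_pencilD[of a3 b3]) (use u that in \<open>auto simp: net_pencil_def\<close>)
        have "pencil u (r (s + \<sigma> * i)) (r (s + \<sigma> * j))"
        proof (cases "\<sigma> = 1")
          case True
          then show ?thesis using R[of "s + i"] \<sigma> ij mem[OF ij(1)] mem[OF ij(2)] by auto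
        next
          case False
          \<comment> \<open>With \<open>s\<close> and \<open>j\<close> odd, the even third index is
            the one of the line \<open>j\<close>.\<close>
          then show ?thesis using R[of "s - j"] \<sigma> ij mem[OF ij(1)] mem[OF ij(2)] by (auto simp: pencil_commute)
        qed
        moreover have "pencil u (q i) (q j)" using Q by simp
        ultimately show ?thesis by blast
      qed
      show ?thesis
      proof (cases "even i")
        case True
        then show ?thesis using main[OF ij] by blast
      next
        case False
        then have "odd (i - j)" "even j" using ij(3) by auto
        from main[OF ij(2,1) this] show ?thesis using pencil_commute by blast
      qed
    qed
    show "\<exists>x\<in>line_l {a1..b1} f lo (s + \<sigma> * lo). ev (q (lo + 1)) x \<noteq> 0"
    proof -
      obtain i k d where c: "ncube 1 i lo k" "s + \<sigma> * lo = k + of_bool d" using cell[of lo] True by auto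
      from line_l_planes(3)[OF c(1) _ c(2), of lo False] show ?thesis by simp
    qed
  qed
  show ?thesis by (rule family_on_hyperboloid)
qed

lemma diagonals_on_hyperboloids_l:
  assumes large: "a1 + 4 \<le> b1" "a2 + 4 \<le> b2" "a3 + 4 \<le> b3"
  shows "diagonals_on_hyperboloids {a2..b2} {a3..b3} (line_l {a1..b1} f)"
  unfolding diagonals_on_hyperboloids_def
proof (intro conjI allI impI)
  fix s :: int assume s: "odd s"
  have S: "{j \<in> {a2..b2}. s - j \<in> {a3..b3}} = {max a2 (s - b3)..min b2 (s - a3)}" by auto
  have "lie_on_hyperboloid {max a2 (s - b3)..min b2 (s - a3)} (\<lambda>j. line_l {a1..b1} f j (s + (- 1) * j))"
    by (rule diagonal_on_hyperboloid[OF large]) (use s in auto)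
  then show "lie_on_hyperboloid {j \<in> {a2..b2}. s - j \<in> {a3..b3}} (\<lambda>j. line_l {a1..b1} f j (s - j))"
    unfolding S by simp
next
  fix t :: int assume t: "even t"
  have S: "{j \<in> {a2..b2}. j - t \<in> {a3..b3}} = {max a2 (a3 + t)..min b2 (b3 + t)}" by auto
  have "lie_on_hyperboloid {max a2 (a3 + t)..min b2 (b3 + t)} (\<lambda>j. line_l {a1..b1} f j (- t + 1 * j))"
    by (rule diagonal_on_hyperboloid[OF large]) (use t in auto)
  then show "lie_on_hyperboloid {j \<in> {a2..b2}. j - t \<in> {a3..b3}} (\<lambda>j. line_l {a1..b1} f j (j - t))"
    unfolding S by simp
qed

lemma diagonals_on_hyperboloids_all:
  assumes large: "a1 + 4 \<le> b1" "a2 + 4 \<le> b2" "a3 + 4 \<le> b3"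
  shows "diagonals_on_hyperboloids {a2..b2} {a3..b3} (line_l {a1..b1} f)"
    "diagonals_on_hyperboloids {a1..b1} {a3..b3} (line_m {a2..b2} f)"
    "diagonals_on_hyperboloids {a1..b1} {a2..b2} (line_n {a3..b3} f)"
proof -
  show "diagonals_on_hyperboloids {a2..b2} {a3..b3} (line_l {a1..b1} f)"
    by (rule diagonals_on_hyperboloids_l[OF large])
  have "line_m {a2..b2} f = line_l {a2..b2} (\<lambda>j i k. f i j k)" by (simp add: fun_eq_iff line_m_def line_l_def)
  then show "diagonals_on_hyperboloids {a1..b1} {a3..b3} (line_m {a2..b2} f)"
    using laguerre_net.diagonals_on_hyperboloids_l[OF net12 large(2,1,3)] by simp
  have "line_n {a3..b3} f = line_l {a3..b3} (\<lambda>k i j. f i j k)" by (simp add: fun_eq_iff line_n_def line_l_def)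
  then show "diagonals_on_hyperboloids {a1..b1} {a2..b2} (line_n {a3..b3} f)"
    using laguerre_net.diagonals_on_hyperboloids_l[OF laguerre_net_swap12[OF net23] large(3,1,2)] by simp
qed

end

section \<open>From the IS-net to the five properties\<close>

lemma laguerre_net_of_checkerboard:
  assumes net: "checkerboard_IS_net {a1..b1} {a2..b2} {a3..b3} f"
    and thick: "a1 + 2 \<le> b1" "a2 + 2 \<le> b2" "a3 + 2 \<le> b3"
  shows "\<exists>p q r Z rad. laguerre_net a1 b1 a2 b2 a3 b3 f p q r Z rad"
proof -
  obtain p q r where pqr: "\<And>Z rad. (\<forall>i j k. is_net_cube {a1..b1} {a2..b2} {a3..b3} 1 i j k \<longrightarrow>
        inscribed_sphere (cube_hull (net_cube f 1 i j k)) (Z i j k) (rad i j k)) \<Longrightarrow>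
      laguerre_net a1 b1 a2 b2 a3 b3 f p q r Z rad"
    using laguerre_net_exists[OF assms] by blast
  define X where "X i j k = (SOME x. inscribed_sphere (cube_hull (net_cube f 1 i j k)) (fst x) (snd x))" for i j k
  have "inscribed_sphere (cube_hull (net_cube f 1 i j k)) (fst (X i j k)) (snd (X i j k))"
    if "is_net_cube {a1..b1} {a2..b2} {a3..b3} 1 i j k" for i j k
  proof -
    have "circumscribed (net_cube f 1 i j k)" using net that unfolding checkerboard_IS_net_def by blast
    then obtain z s where "inscribed_sphere (cube_hull (net_cube f 1 i j k)) z s" unfolding circumscribed_def by blast
    then have "\<exists>x. inscribed_sphere (cube_hull (net_cube f 1 i j k)) (fst x) (snd x)" by (intro exI[of _ "(z, s)"]) simp
    then show ?thesis unfolding X_def by (rule someI_ex)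
  qed
  then have "laguerre_net a1 b1 a2 b2 a3 b3 f p q r (\<lambda>i j k. fst (X i j k)) (\<lambda>i j k. snd (X i j k))"
    by (intro pqr) blast
  then show ?thesis by blast
qed

theorem theorem4p1:
  fixes f :: "int \<Rightarrow> int \<Rightarrow> int \<Rightarrow> real^3"
    and a1 b1 a2 b2 a3 b3 :: int
    and I J K :: "int set"
    and large :: bool
  assumes cuboid: "I = {a1..b1}" "J = {a2..b2}" "K = {a3..b3}"
    and full_dim: "a1 < b1" "a2 < b2" "a3 < b3"
    and large: "large \<longleftrightarrow> b1 - a1 \<ge> 4 \<and> b2 - a2 \<ge> 4 \<and> b3 - a3 \<ge> 4"
    and net: "checkerboard_IS_net I J K f"
  shows
    "(\<forall>c i j k. is_net_cube I J K c i j k \<longrightarrow> circumscribed (net_cube f c i j k))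
     \<and>
     (\<forall>c s i j k.
        is_net_cube I J K c i j k \<and>
        is_net_cube I J K (c + 4 * s + 2) (i - 2 * s - 1) (j - 2 * s - 1) (k - 2 * s - 1) \<and>
        (c + 4 * s + 2 = - c \<longrightarrow> large) \<longrightarrow>
        perspective (net_cube f c i j k)
          (net_cube f (c + 4 * s + 2) (i - 2 * s - 1) (j - 2 * s - 1) (k - 2 * s - 1)))
     \<and>
     (large \<longrightarrow>
        (\<forall>c i j k. is_net_cube I J K c i j k \<longrightarrow> projective_cube (net_cube f c i j k)))
     \<and>
     (large \<longrightarrow>
        diagonals_on_hyperboloids J K (line_l I f) \<and>
        diagonals_on_hyperboloids I K (line_m J f) \<and>
        diagonals_on_hyperboloids I J (line_n K f))
     \<and>
     (large \<longrightarrow>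
        (\<forall>p. (\<forall>i j k. is_net_cube I J K 1 i j k \<longrightarrow>
                (\<exists>r. inscribed_sphere (cube_hull (net_cube f 1 i j k)) (p i j k) r)) \<longrightarrow>
           proj_orthogonal_grid {i. even i \<and> i \<in> I \<and> i + 1 \<in> I}
             {j. even j \<and> j \<in> J \<and> j + 1 \<in> J} {k. even k \<and> k \<in> K \<and> k + 1 \<in> K} p \<and>
           proj_orthogonal_grid {i. odd i \<and> i \<in> I \<and> i + 1 \<in> I}
             {j. odd j \<and> j \<in> J \<and> j + 1 \<in> J} {k. odd k \<and> k \<in> K \<and> k + 1 \<in> K} p))"
proof -
  note net = net[unfolded cuboid]
  have C: "circumscribed (net_cube f 1 i j k)" if "is_net_cube {a1..b1} {a2..b2} {a3..b3} 1 i j k" for i j k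
    using net that unfolding checkerboard_IS_net_def by blast
  have bound: "odd c" "\<bar>c\<bar> \<le> b1 - a1" "\<bar>c\<bar> \<le> b2 - a2" "\<bar>c\<bar> \<le> b3 - a3"
    if "is_net_cube {a1..b1} {a2..b2} {a3..b3} c i j k" for c i j k
    using that by (auto simp: is_net_cube_def)
  have circ: "circumscribed (net_cube f c i j k)" if c: "is_net_cube {a1..b1} {a2..b2} {a3..b3} c i j k" for c i j k
  proof -
    \<comment> \<open>Cubes of size 1 are circumscribed by definition, also in nets of side 1, where
      \<open>laguerre_net\<close> does not apply; larger ones force all sides to be at least
      3.\<close>
    have "c = 1 \<or> c = - 1 \<or> \<bar>c\<bar> \<ge> 3" using bound(1)[OF c] by presburger
    then consider "c = 1" | "c = - 1" | "\<bar>c\<bar> \<ge> 3" by blast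
    then show ?thesis
    proof cases
      case 1
      then show ?thesis using C c by simp
    next
      case 2
      have "is_net_cube {a1..b1} {a2..b2} {a3..b3} 1 (i - 1) (j - 1) (k - 1)"
        using c unfolding 2 by (auto simp: is_net_cube_def)
      from circumscribed_antipodal[OF C[OF this]]
      have "circumscribed (\<lambda>a b d. net_cube f 1 (i - 1) (j - 1) (k - 1) (\<not> a) (\<not> b) (\<not> d))" .
      moreover have "(\<lambda>a b d. net_cube f 1 (i - 1) (j - 1) (k - 1) (\<not> a) (\<not> b) (\<not> d)) = net_cube f c i j k"
        unfolding 2 by (auto simp: fun_eq_iff net_cube_def of_bool_def)
      ultimately show ?thesis by simp
    next
      case 3
      then have "a1 + 2 \<le> b1" "a2 + 2 \<le> b2" "a3 + 2 \<le> b3" using bound(2-4)[OF c] by linarith+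
      from laguerre_net_of_checkerboard[OF net this] obtain p q r Z rad
        where "laguerre_net a1 b1 a2 b2 a3 b3 f p q r Z rad" by blast
      from laguerre_net.circumscribed_net_cube[OF this C c] show ?thesis .
    qed
  qed
  have persp: "perspective (net_cube f c i j k)
      (net_cube f (c + 4 * s + 2) (i - 2 * s - 1) (j - 2 * s - 1) (k - 2 * s - 1))"
    if c: "is_net_cube {a1..b1} {a2..b2} {a3..b3} c i j k"
      and c': "is_net_cube {a1..b1} {a2..b2} {a3..b3} (c + 4 * s + 2) (i - 2 * s - 1) (j - 2 * s - 1) (k - 2 * s - 1)"
      and opp: "c + 4 * s + 2 = - c \<longrightarrow> large" for c s i j k
  proof -
    define m where "m = 2 * s + 1"
    have eq: "c + 4 * s + 2 = c + 2 * m" "i - 2 * s - 1 = i - m" "j - 2 * s - 1 = j - m" "k - 2 * s - 1 = k - m"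
      by (simp_all add: m_def)
    note c' = c'[unfolded eq]
    have odd: "odd m" by (simp add: m_def)
    \<comment> \<open>In a net that is not large both sizes are odd and at most 3 in absolute value.
      As they are not opposite and \<open>m\<close> is odd, they are 1 and 3 up to order and a
      common sign.\<close>
    have l: "a1 + 4 \<le> b1 \<and> a2 + 4 \<le> b2 \<and> a3 + 4 \<le> b3 \<or> (\<bar>m\<bar> = 1 \<and> m \<noteq> - c) \<and> (\<bar>c\<bar> = 3 \<or> \<bar>c + 2 * m\<bar> = 3)"
    proof (cases large)
      case True
      then show ?thesis using large by auto
    next
      case False
      then have ne: "\<bar>c\<bar> \<le> 3" "\<bar>c + 2 * m\<bar> \<le> 3" "c + 2 * m \<noteq> - c"
        using large bound(2-4)[OF c] bound(2-4)[OF c'] opp eq(1) by auto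
      have small: "x = - 3 \<or> x = - 1 \<or> x = 1 \<or> x = 3" if "odd x" "\<bar>x\<bar> \<le> 3" for x :: int
        using that by presburger
      have "\<bar>m\<bar> \<le> 3" using ne(1,2) by linarith
      from small[OF odd this] small[OF bound(1)[OF c] ne(1)] ne(2,3) show ?thesis by auto
    qed
    have "a1 + 2 \<le> b1" "a2 + 2 \<le> b2" "a3 + 2 \<le> b3"
      using l bound(2-4)[OF c] bound(2-4)[OF c'] by linarith+
    from laguerre_net_of_checkerboard[OF net this] obtain p q r Z rad
      where L: "laguerre_net a1 b1 a2 b2 a3 b3 f p q r Z rad" by blast
    obtain u where u: "pencil u (p i) (p (i - m))" "pencil u (q j) (q (j - m))" "pencil u (r k) (r (k - m))"
      "pencil u (p (i + c)) (p (i + c + m))" "pencil u (q (j + c)) (q (j + c + m))" "pencil u (r (k + c)) (r (k + c + m))"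
      using laguerre_net.concentric_pencil[OF L c c' odd] l by blast
    show ?thesis unfolding eq by (rule laguerre_net.perspective_net_cubes[OF L c c' odd circ[OF c] u])
  qed
  have big: "\<exists>p q r. \<forall>Z rad. (\<forall>i j k. is_net_cube {a1..b1} {a2..b2} {a3..b3} 1 i j k \<longrightarrow>
        inscribed_sphere (cube_hull (net_cube f 1 i j k)) (Z i j k) (rad i j k)) \<longrightarrow>
      laguerre_net a1 b1 a2 b2 a3 b3 f p q r Z rad" if large
    by (rule laguerre_net_exists[OF net]) (use that large in auto)
  have L: "\<exists>p q r Z rad. laguerre_net a1 b1 a2 b2 a3 b3 f p q r Z rad" if large
    by (rule laguerre_net_of_checkerboard[OF net]) (use that large in auto)
  have sides: "a1 + 4 \<le> b1" "a2 + 4 \<le> b2" "a3 + 4 \<le> b3" if large using that large by auto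
  have proj: "projective_cube (net_cube f c i j k)"
    if l: large and c: "is_net_cube {a1..b1} {a2..b2} {a3..b3} c i j k" for c i j k
    using L[OF l] laguerre_net.projective_net_cube[OF _ sides[OF l] c] by blast
  have hyp: "diagonals_on_hyperboloids {a2..b2} {a3..b3} (line_l {a1..b1} f) \<and>
        diagonals_on_hyperboloids {a1..b1} {a3..b3} (line_m {a2..b2} f) \<and>
        diagonals_on_hyperboloids {a1..b1} {a2..b2} (line_n {a3..b3} f)" if l: large
    using L[OF l] laguerre_net.diagonals_on_hyperboloids_all[OF _ sides[OF l]] by blast
  have grid: "proj_orthogonal_grid {i. even i \<and> i \<in> {a1..b1} \<and> i + 1 \<in> {a1..b1}}
       {j. even j \<and> j \<in> {a2..b2} \<and> j + 1 \<in> {a2..b2}} {k. even k \<and> k \<in> {a3..b3} \<and> k + 1 \<in> {a3..b3}} p \<and>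
     proj_orthogonal_grid {i. odd i \<and> i \<in> {a1..b1} \<and> i + 1 \<in> {a1..b1}}
       {j. odd j \<and> j \<in> {a2..b2} \<and> j + 1 \<in> {a2..b2}} {k. odd k \<and> k \<in> {a3..b3} \<and> k + 1 \<in> {a3..b3}} p"
    if l: large and p: "\<forall>i j k. is_net_cube {a1..b1} {a2..b2} {a3..b3} 1 i j k \<longrightarrow>
                (\<exists>r. inscribed_sphere (cube_hull (net_cube f 1 i j k)) (p i j k) r)" for p
  proof -
    \<comment> \<open>The centres are prescribed, so the radii are chosen to fit them.\<close>
    define rad where "rad i j k = (SOME r. inscribed_sphere (cube_hull (net_cube f 1 i j k)) (p i j k) r)" for i j k
    have "\<forall>i j k. is_net_cube {a1..b1} {a2..b2} {a3..b3} 1 i j k \<longrightarrow>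
        inscribed_sphere (cube_hull (net_cube f 1 i j k)) (p i j k) (rad i j k)"
      unfolding rad_def using p by (blast intro: someI_ex)
    then obtain x y z where N: "laguerre_net a1 b1 a2 b2 a3 b3 f x y z p rad" using big[OF l] by blast
    have o: "even (i - 1) \<longleftrightarrow> odd i" for i :: int by presburger
    show ?thesis
      using laguerre_net.centre_grid_large[OF N sides[OF l], of 0] laguerre_net.centre_grid_large[OF N sides[OF l], of 1]
      unfolding o by simp
  qed
  show ?thesis unfolding cuboid using circ persp proj hyp grid by blast
qed

end
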